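(* Let $\Omega\subset\mathbb{R}^3$ be open and bounded with continuous boundary, and let $m$ be the number of connected components of $\mathbb{R}^3\setminus\overline{\Omega}$. Let $$\mathcal{H}:=\ker(\mathring{\operatorname{symCurl}}_{\mathbb{T}})\cap\ker(\operatorname{Div}_{\mathbb{T}})\subset L^{2,3\times3}_{\mathbb{T}}(\Omega).$$ Then $\dim\mathcal{H}=4(m-1)$, and a basis of $\mathcal{H}$ is given by $$\big\{\operatorname{devGrad}v_{\ell,j}:\ell\in\{1,\dots,m-1\},\ j\in\{0,\dots,3\}\big\},$$ where $v_{\ell,j}=\xi_{\ell,j}-\psi_{\ell,j}\in H^{1,3}(\Omega)$ are the vector fields constructed in the context.
   Context: All function spaces are real. $L^{2,3}(\Omega)$, $H^{1,3}(\Omega)$, $H^{1,3}_0(\Omega)$: vector fields with components in $L^2$, $H^1$, $H^1_0$. $L^{2,3\times3}_{\mathbb{S}}(\Omega)$, $L^{2,3\times3}_{\mathbb{T}}(\Omega)$: symmetric, trace-free $3\times3$ tensor fields with $L^2$ entries. $\operatorname{Grad}v$ is the Jacobian matrix; $\operatorname{Curl}$, $\operatorname{Div}$ act row-wise; $\operatorname{sym}M=\frac12(M+M^\top)$, $\operatorname{dev}M=M-\frac13(\operatorname{tr}M)\operatorname{Id}$; $\operatorname{devGrad}v=\operatorname{dev}\operatorname{Grad}v$, $\operatorname{symCurl}T=\operatorname{sym}\operatorname{Curl}T$. $\mathring{\operatorname{devGrad}}$ is the closure of $\operatorname{devGrad}$ on smooth compactly supported vector fields, $L^{2,3}(\Omega)\to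 L^{2,3\times3}_{\mathbb{T}}(\Omega)$ (its domain is $H^{1,3}_0(\Omega)$ and its range is closed); $\operatorname{Div}_{\mathbb{T}}:=-(\mathring{\operatorname{devGrad}})^*$; $\mathring{\operatorname{symCurl}}_{\mathbb{T}}$ is the closure of $\operatorname{symCurl}$ on smooth compactly supported trace-free fields, $L^{2,3\times3}_{\mathbb{T}}(\Omega)\to L^{2,3\times3}_{\mathbb{S}}(\Omega)$. Continuous boundary: the boundary is locally the graph of a continuous function (equivalently, $\Omega$ has the segment property). Construction. Let $\Xi_0$ be the unbounded and $\Xi_1,\dots,\Xi_{m-1}$ the remaining connected components of $\mathbb{R}^3\setminus\overline{\Omega}$. Let $\xi_\ell\in C^\infty_c(\mathbb{R}^3)$, $\ell\in\{1,\dots,m-1\}$, have pairwise disjoint supports with $\xi_\ell=1$ in a neighbourhood of $\Xi_\ell$ and $\xi_\ell=0$ in a neighbourhood of $\Xi_k$ for all $k\in\{0,\dots,m-1\}\setminus\{\ell\}$. Let $\widehat{r}_0(x):=x$, $\widehat{r}_j(x):=e^j$ (unit vectors) for $j\in\{1,2,3\}$, and $\xi_{\ell,j}:=\xi_\ell\widehat{r}_j$. Let $\pi$ be the orthogonal projector in $L^{2,3\times3}_{\mathbb{T}}(\Omega)=\operatorname{ran}(\mathring{\operatorname{devGrad}})\oplus\ker(\operatorname{Div}_{\mathbb{T}})$ onto $\ker(\operatorname{Div}_{\mathbb{T}})$. Then $\psi_{\ell,j}\in H^{1,3}_0(\Omega)$ is the unique vector field with $\pi\operatorname{devGrad}\xi_{\ell,j}=\operatorname{devGrad}(\xi_{\ell,j}-\psi_{\ell,j})$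 in $\Omega$. *)

theory Defs
  imports "HOL-Analysis.Analysis"
begin

section \<open>The Hilbert space of square-integrable fields on three-space\<close>

definition sq_int :: "(real^3 \<Rightarrow> 'b::euclidean_space) \<Rightarrow> bool" where
  "sq_int f \<longleftrightarrow> f \<in> borel_measurable lebesgue \<and> integrable lebesgue (\<lambda>x. (norm (f x))\<^sup>2)"

lemma sq_int_zero: "sq_int (\<lambda>x. 0)"
  by (simp add: sq_int_def)

lemma sq_int_bounded_linear:
  assumes f: "sq_int f" and h: "bounded_linear h"
  shows "sq_int (\<lambda>x. h (f x))"
proof -
  have m: "f \<in> borel_measurable lebesgue" and i: "integrable lebesgue (\<lambda>x. (norm (f x))\<^sup>2)"
    using f by (auto simp: sq_int_def)
  obtain K where K: "\<And>x. norm (h x) \<le> norm x * K"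
    using bounded_linear.bounded[OF h] by blast
  have hm: "(\<lambda>x. h (f x)) \<in> borel_measurable lebesgue"
    using m borel_measurable_continuous_onI[OF linear_continuous_on[OF h]]
    by (rule measurable_compose)
  have b: "(norm (h y))\<^sup>2 \<le> K\<^sup>2 * (norm y)\<^sup>2" for y
    using power_mono[OF K[of y] norm_ge_zero, of 2] by (simp add: power_mult_distrib mult.commute)
  have "integrable lebesgue (\<lambda>x. (norm (h (f x)))\<^sup>2)"
  proof (rule Bochner_Integration.integrable_bound)
    show "integrable lebesgue (\<lambda>x. K\<^sup>2 * (norm (f x))\<^sup>2)" using i by simp
    show "(\<lambda>x. (norm (h (f x)))\<^sup>2) \<in> borel_measurable lebesgue" using hm by measurable
    show "AE x in lebesgue. norm ((norm (h (f x)))\<^sup>2) \<le> norm (K\<^sup>2 * (norm (f x))\<^sup>2)"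
      using b by (intro AE_I2) simp
  qed
  with hm show ?thesis by (simp add: sq_int_def)
qed

lemma sq_int_scaleR: "sq_int f \<Longrightarrow> sq_int (\<lambda>x. c *\<^sub>R f x)"
  by (rule sq_int_bounded_linear[OF _ bounded_linear_scaleR_right])

lemma sq_int_uminus: "sq_int f \<Longrightarrow> sq_int (\<lambda>x. - f x)"
  using sq_int_scaleR[of f "-1"] by simp

lemma sq_int_add:
  assumes f: "sq_int f" and g: "sq_int g"
  shows "sq_int (\<lambda>x. f x + g x)"
proof -
  have m: "f \<in> borel_measurable lebesgue" "g \<in> borel_measurable lebesgue"
    and i: "integrable lebesgue (\<lambda>x. (norm (f x))\<^sup>2)" "integrable lebesgue (\<lambda>x. (norm (g x))\<^sup>2)"
    using f g by (auto simp: sq_int_def)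
  have b: "(norm (a + b))\<^sup>2 \<le> 2 * (norm a)\<^sup>2 + 2 * (norm b)\<^sup>2" for a b :: 'a
  proof -
    have "(norm (a + b))\<^sup>2 \<le> (norm a + norm b)\<^sup>2"
      by (intro power_mono norm_triangle_ineq norm_ge_zero)
    also have "\<dots> \<le> 2 * (norm a)\<^sup>2 + 2 * (norm b)\<^sup>2"
      using sum_squares_bound[of "norm a" "norm b"] by (simp add: power2_sum)
    finally show ?thesis .
  qed
  have s: "(\<lambda>x. f x + g x) \<in> borel_measurable lebesgue" using m by measurable
  have "integrable lebesgue (\<lambda>x. (norm (f x + g x))\<^sup>2)"
  proof (rule Bochner_Integration.integrable_bound)
    show "integrable lebesgue (\<lambda>x. 2 * (norm (f x))\<^sup>2 + 2 * (norm (g x))\<^sup>2)" using i by simp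
    show "(\<lambda>x. (norm (f x + g x))\<^sup>2) \<in> borel_measurable lebesgue" using s by measurable
    show "AE x in lebesgue. norm ((norm (f x + g x))\<^sup>2)
        \<le> norm (2 * (norm (f x))\<^sup>2 + 2 * (norm (g x))\<^sup>2)"
      using b by (intro AE_I2) simp
  qed
  with s show ?thesis by (simp add: sq_int_def)
qed

lemma sq_int_diff: "sq_int f \<Longrightarrow> sq_int g \<Longrightarrow> sq_int (\<lambda>x. f x - g x)"
  using sq_int_add[OF _ sq_int_uminus, of f g] by simp

lemma sq_int_inner_integrable:
  assumes f: "sq_int f" and g: "sq_int g"
  shows "integrable lebesgue (\<lambda>x. inner (f x) (g x))"
proof (rule Bochner_Integration.integrable_bound)
  show "integrable lebesgue (\<lambda>x. (norm (f x))\<^sup>2 + (norm (g x))\<^sup>2)"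
    using f g by (simp add: sq_int_def)
  show "(\<lambda>x. inner (f x) (g x)) \<in> borel_measurable lebesgue"
    using f g by (simp add: sq_int_def borel_measurable_inner)
  have "\<bar>inner a b\<bar> \<le> (norm a)\<^sup>2 + (norm b)\<^sup>2" for a b :: 'a
  proof -
    have "\<bar>inner a b\<bar> \<le> norm a * norm b" by (rule Cauchy_Schwarz_ineq2)
    also have "\<dots> \<le> (norm a)\<^sup>2 + (norm b)\<^sup>2"
      using sum_squares_bound[of "norm a" "norm b"] mult_nonneg_nonneg[OF norm_ge_zero norm_ge_zero, of a b] by linarith
    finally show ?thesis .
  qed
  then show "AE x in lebesgue. norm (inner (f x) (g x)) \<le> norm ((norm (f x))\<^sup>2 + (norm (g x))\<^sup>2)"
    by (intro AE_I2) simp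
qed

quotient_type (overloaded) 'b L2 = "real^3 \<Rightarrow> 'b::euclidean_space" /
  partial: "\<lambda>f g. sq_int f \<and> sq_int g \<and> (AE x in lebesgue. f x = g x)"
proof (rule part_equivpI)
  show "\<exists>f::real^3 \<Rightarrow> 'b. sq_int f \<and> sq_int f \<and> (AE x in lebesgue. f x = f x)"
    using sq_int_zero by auto
  show "symp (\<lambda>(f::real^3 \<Rightarrow> 'b) g. sq_int f \<and> sq_int g \<and> (AE x in lebesgue. f x = g x))"
    by (auto intro!: sympI elim: AE_mp)
  show "transp (\<lambda>(f::real^3 \<Rightarrow> 'b) g. sq_int f \<and> sq_int g \<and> (AE x in lebesgue. f x = g x))"
    by (rule transpI) (auto elim: AE_mp)
qed

instantiation L2 :: (euclidean_space) real_vector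
begin

lift_definition zero_L2 :: "'a L2" is "\<lambda>x. 0"
  by (simp add: sq_int_zero)

lift_definition plus_L2 :: "'a L2 \<Rightarrow> 'a L2 \<Rightarrow> 'a L2" is "\<lambda>f g x. f x + g x"
  by (auto intro: sq_int_add)

lift_definition uminus_L2 :: "'a L2 \<Rightarrow> 'a L2" is "\<lambda>f x. - f x"
  by (auto intro: sq_int_uminus)

lift_definition minus_L2 :: "'a L2 \<Rightarrow> 'a L2 \<Rightarrow> 'a L2" is "\<lambda>f g x. f x - g x"
  by (auto intro: sq_int_diff)

lift_definition scaleR_L2 :: "real \<Rightarrow> 'a L2 \<Rightarrow> 'a L2" is "\<lambda>c f x. c *\<^sub>R f x"
  by (auto intro: sq_int_scaleR)

instance
proof
  fix a b c :: "'a L2" and r s :: real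
  show "a + b + c = a + (b + c)"
    by transfer (auto intro!: sq_int_add simp: add.assoc)
  show "a + b = b + a"
    by transfer (auto intro!: sq_int_add simp: add.commute)
  show "0 + a = a"
    by transfer auto
  show "- a + a = 0"
    by transfer (auto simp: sq_int_zero)
  show "a - b = a + - b"
    by transfer (auto intro: sq_int_diff)
  show "r *\<^sub>R (a + b) = r *\<^sub>R a + r *\<^sub>R b"
    by transfer (auto intro!: sq_int_scaleR sq_int_add simp: scaleR_right_distrib)
  show "(r + s) *\<^sub>R a = r *\<^sub>R a + s *\<^sub>R a"
    by transfer (auto intro!: sq_int_scaleR sq_int_add simp: scaleR_left_distrib)
  show "r *\<^sub>R s *\<^sub>R a = (r * s) *\<^sub>R a"
    by transfer (auto intro!: sq_int_scaleR)
  show "1 *\<^sub>R a = a"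
    by transfer auto
qed

end

instantiation L2 :: (euclidean_space) real_inner
begin

lift_definition inner_L2 :: "'a L2 \<Rightarrow> 'a L2 \<Rightarrow> real"
  is "\<lambda>f g. integral\<^sup>L lebesgue (\<lambda>x. inner (f x) (g x))"
proof -
  fix f f' g g' :: "real^3 \<Rightarrow> 'a"
  assume *: "sq_int f \<and> sq_int f' \<and> (AE x in lebesgue. f x = f' x)"
    "sq_int g \<and> sq_int g' \<and> (AE x in lebesgue. g x = g' x)"
  show "integral\<^sup>L lebesgue (\<lambda>x. inner (f x) (g x)) = integral\<^sup>L lebesgue (\<lambda>x. inner (f' x) (g' x))"
  proof (rule integral_cong_AE)
    show "(\<lambda>x. inner (f x) (g x)) \<in> borel_measurable lebesgue"
      "(\<lambda>x. inner (f' x) (g' x)) \<in> borel_measurable lebesgue"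
      using * by (auto intro: borel_measurable_integrable sq_int_inner_integrable)
    show "AE x in lebesgue. inner (f x) (g x) = inner (f' x) (g' x)"
      using * by auto
  qed
qed

definition norm_L2 :: "'a L2 \<Rightarrow> real" where "norm_L2 u = sqrt (inner u u)"
definition sgn_L2 :: "'a L2 \<Rightarrow> 'a L2" where "sgn_L2 u = inverse (norm u) *\<^sub>R u"
definition dist_L2 :: "'a L2 \<Rightarrow> 'a L2 \<Rightarrow> real" where "dist_L2 u v = norm (u - v)"
definition uniformity_L2 :: "('a L2 \<times> 'a L2) filter"
  where "uniformity_L2 = (INF e\<in>{0 <..}. principal {(x, y). dist x y < e})"
definition open_L2 :: "'a L2 set \<Rightarrow> bool"
  where "open_L2 U = (\<forall>x\<in>U. eventually (\<lambda>(x', y). x' = x \<longrightarrow> y \<in> U) uniformity)"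

instance
proof
  fix a b c :: "'a L2" and r :: real and U :: "'a L2 set"
  show "sgn a = a /\<^sub>R norm a" by (simp add: sgn_L2_def)
  show "dist a b = norm (a - b)" by (simp add: dist_L2_def)
  show "uniformity = (INF e\<in>{0 <..}. principal {(x::'a L2, y). dist x y < e})"
    by (rule uniformity_L2_def)
  show "open U = (\<forall>x\<in>U. eventually (\<lambda>(x', y). x' = x \<longrightarrow> y \<in> U) uniformity)"
    by (rule open_L2_def)
  show "inner a b = inner b a"
    by transfer (simp add: inner_commute)
  show "inner (a + b) c = inner a c + inner b c"
    by transfer (simp add: inner_add_left sq_int_inner_integrable)
  show "inner (r *\<^sub>R a) b = r * inner a b"
    by transfer simp
  show "0 \<le> inner a a"
    by transfer simp
  show "inner a a = 0 \<longleftrightarrow> a = 0"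
  proof transfer
    fix f :: "real^3 \<Rightarrow> 'a"
    assume f: "sq_int f \<and> sq_int f \<and> (AE x in lebesgue. f x = f x)"
    then have "integrable lebesgue (\<lambda>x. inner (f x) (f x))"
      by (auto intro: sq_int_inner_integrable)
    then have "integral\<^sup>L lebesgue (\<lambda>x. inner (f x) (f x)) = 0 \<longleftrightarrow> (AE x in lebesgue. inner (f x) (f x) = 0)"
      by (rule integral_nonneg_eq_0_iff_AE) simp
    then show "integral\<^sup>L lebesgue (\<lambda>x. inner (f x) (f x)) = 0 \<longleftrightarrow>
        sq_int f \<and> sq_int (\<lambda>x. 0 :: 'a) \<and> (AE x in lebesgue. f x = 0)"
      using f by (simp add: sq_int_zero)
  qed
  show "norm a = sqrt (inner a a)" by (simp add: norm_L2_def)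
qed

end

lift_definition L2_AE :: "(real^3 \<Rightarrow> 'b \<Rightarrow> bool) \<Rightarrow> 'b::euclidean_space L2 \<Rightarrow> bool"
  is "\<lambda>P f. AE x in lebesgue. P x (f x)"
  by (auto elim: AE_mp)

text \<open>
  Fields on \<open>\<Omega>\<close> are identified with their extensions by zero: the space \<open>L2_on \<Omega>\<close> is the
  closed subspace of fields that vanish almost everywhere outside \<open>\<Omega>\<close>, and it carries the
  inner product of the usual Lebesgue space over \<open>\<Omega>\<close>.  The class \<open>restr \<Omega> f\<close> of the
  restriction of \<open>f\<close> to \<open>\<Omega>\<close> is meaningful only if that restriction is square integrable.
\<close>

definition L2_on :: "(real^3) set \<Rightarrow> 'b::euclidean_space L2 set" where
  "L2_on \<Omega> = {u. L2_AE (\<lambda>x y. x \<notin> \<Omega> \<longrightarrow> y = 0) u}"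

definition restr :: "(real^3) set \<Rightarrow> (real^3 \<Rightarrow> 'b::euclidean_space) \<Rightarrow> 'b L2" where
  "restr \<Omega> f = abs_L2 (\<lambda>x. if x \<in> \<Omega> then f x else 0)"

definition L2_T :: "(real^3) set \<Rightarrow> (real^3^3) L2 set" where
  "L2_T \<Omega> = {M \<in> L2_on \<Omega>. L2_AE (\<lambda>x A. trace A = 0) M}"

section \<open>Classical differential operators and test fields\<close>

primrec C_k :: "nat \<Rightarrow> ('a::euclidean_space \<Rightarrow> 'b::real_normed_vector) \<Rightarrow> bool" where
  "C_k 0 f \<longleftrightarrow> continuous_on UNIV f"
| "C_k (Suc k) f \<longleftrightarrow> (\<forall>x. f differentiable (at x)) \<and>
     (\<forall>d. C_k k (\<lambda>x. frechet_derivative f (at x) d))"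

definition supp :: "('a::topological_space \<Rightarrow> 'b::zero) \<Rightarrow> 'a set" where
  "supp f = closure {x. f x \<noteq> 0}"

definition test :: "'a::euclidean_space set \<Rightarrow> ('a \<Rightarrow> 'b::real_normed_vector) \<Rightarrow> bool" where
  "test \<Omega> f \<longleftrightarrow> (\<forall>k. C_k k f) \<and> compact (supp f) \<and> supp f \<subseteq> \<Omega>"

definition sym_part :: "real^3^3 \<Rightarrow> real^3^3" where
  "sym_part M = (1/2) *\<^sub>R (M + transpose M)"

definition dev :: "real^3^3 \<Rightarrow> real^3^3" where
  "dev M = M - (trace M / 3) *\<^sub>R mat 1"

definition Grad :: "(real^3 \<Rightarrow> real^3) \<Rightarrow> real^3 \<Rightarrow> real^3^3" where
  "Grad v x = jacobian v (at x)"

definition curl :: "(real^3 \<Rightarrow> real^3) \<Rightarrow> real^3 \<Rightarrow> real^3" where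
  "curl v x = (let J = Grad v x in
     vector [J $ 3 $ 2 - J $ 2 $ 3, J $ 1 $ 3 - J $ 3 $ 1, J $ 2 $ 1 - J $ 1 $ 2])"

definition Curl :: "(real^3 \<Rightarrow> real^3^3) \<Rightarrow> real^3 \<Rightarrow> real^3^3" where
  "Curl T x = (\<chi> i. curl (\<lambda>y. T y $ i) x)"

definition Div :: "(real^3 \<Rightarrow> real^3^3) \<Rightarrow> real^3 \<Rightarrow> real^3" where
  "Div T x = (\<chi> i. trace (Grad (\<lambda>y. T y $ i) x))"

section \<open>Unbounded operators, represented by their graphs\<close>

definition ker :: "('a \<times> 'b::zero) set \<Rightarrow> 'a set" where
  "ker A = {x. (x, 0) \<in> A}"

definition adjoint_on ::
    "'a::real_inner set \<Rightarrow> 'b::real_inner set \<Rightarrow> ('a \<times> 'b) set \<Rightarrow> ('b \<times> 'a) set" where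
  "adjoint_on X Y A = {(y, z). y \<in> Y \<and> z \<in> X \<and> (\<forall>(x, a)\<in>A. inner a y = inner x z)}"

definition neg_op :: "('a \<times> 'b::uminus) set \<Rightarrow> ('a \<times> 'b) set" where
  "neg_op A = {(x, - y) | x y. (x, y) \<in> A}"

definition orth_proj :: "'a::real_inner set \<Rightarrow> 'a \<Rightarrow> 'a" where
  "orth_proj N x = (THE p. p \<in> N \<and> (\<forall>q\<in>N. inner (x - p) q = 0))"

text \<open>The suffix \<open>0\<close> marks closures of operators on compactly supported fields.\<close>

definition devGrad0 :: "(real^3) set \<Rightarrow> ((real^3) L2 \<times> (real^3^3) L2) set" where
  "devGrad0 \<Omega> = closure {(restr \<Omega> \<phi>, restr \<Omega> (\<lambda>x. dev (Grad \<phi> x))) | \<phi>. test \<Omega> \<phi>}"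

definition Div_T :: "(real^3) set \<Rightarrow> ((real^3^3) L2 \<times> (real^3) L2) set" where
  "Div_T \<Omega> = neg_op (adjoint_on (L2_on \<Omega>) (L2_T \<Omega>) (devGrad0 \<Omega>))"

definition symCurl_T0 :: "(real^3) set \<Rightarrow> ((real^3^3) L2 \<times> (real^3^3) L2) set" where
  "symCurl_T0 \<Omega> = closure {(restr \<Omega> \<Phi>, restr \<Omega> (\<lambda>x. sym_part (Curl \<Phi> x))) | \<Phi>.
     test \<Omega> \<Phi> \<and> (\<forall>x. trace (\<Phi> x) = 0)}"

definition Dirichlet_fields :: "(real^3) set \<Rightarrow> (real^3^3) L2 set" where
  "Dirichlet_fields \<Omega> = ker (symCurl_T0 \<Omega>) \<inter> ker (Div_T \<Omega>)"

section \<open>Sobolev spaces\<close>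

text \<open>The graph of the weak Jacobian; its domain is \<open>H1 \<Omega>\<close>.\<close>

definition weak_Grad :: "(real^3) set \<Rightarrow> ((real^3) L2 \<times> (real^3^3) L2) set" where
  "weak_Grad \<Omega> = {(v, G). v \<in> L2_on \<Omega> \<and> G \<in> L2_on \<Omega> \<and>
     (\<forall>\<Phi>. test \<Omega> \<Phi> \<longrightarrow> inner v (restr \<Omega> (Div \<Phi>)) = - inner G (restr \<Omega> \<Phi>))}"

definition H1 :: "(real^3) set \<Rightarrow> (real^3) L2 set" where
  "H1 \<Omega> = Domain (weak_Grad \<Omega>)"

text \<open>The closure of the test fields with respect to the norm of \<open>H1 \<Omega>\<close>, that is, the graph norm.\<close>

definition H1_0 :: "(real^3) set \<Rightarrow> (real^3) L2 set" where
  "H1_0 \<Omega> = Domain (closure {(restr \<Omega> \<phi>, restr \<Omega> (Grad \<phi>)) | \<phi>. test \<Omega> \<phi>})"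

lemma bounded_linear_dev: "bounded_linear dev"
  unfolding linear_conv_bounded_linear[symmetric]
  by (rule linearI)
    (simp_all add: dev_def trace_def sum.distrib sum_distrib_left[symmetric] add_divide_distrib
      scaleR_left_distrib scaleR_right_diff_distrib)

lift_definition dev_L2 :: "(real^3^3) L2 \<Rightarrow> (real^3^3) L2" is "\<lambda>M x. dev (M x)"
  by (auto intro: sq_int_bounded_linear[OF _ bounded_linear_dev])

definition devGrad :: "(real^3) set \<Rightarrow> (real^3) L2 \<Rightarrow> (real^3^3) L2" where
  "devGrad \<Omega> v = dev_L2 (THE G. (v, G) \<in> weak_Grad \<Omega>)"

section \<open>Domains with continuous boundary and the fields spanning the Dirichlet fields\<close>

text \<open>
  In suitable Cartesian coordinates near each boundary point, the boundary is the graph of a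
  continuous function and \<open>\<Omega>\<close> lies on one side of it, as in the segment property.
\<close>

definition continuous_boundary :: "(real^3) set \<Rightarrow> bool" where
  "continuous_boundary \<Omega> \<longleftrightarrow>
     (\<forall>p\<in>frontier \<Omega>. \<exists>U (Q :: real^3 \<Rightarrow> real^3) (g :: real^2 \<Rightarrow> real). open U \<and> p \<in> U \<and>
        orthogonal_transformation Q \<and> continuous_on UNIV g \<and>
        frontier \<Omega> \<inter> U = {x \<in> U. Q x $ 3 = g (vector [Q x $ 1, Q x $ 2])} \<and>
        \<Omega> \<inter> U = {x \<in> U. Q x $ 3 < g (vector [Q x $ 1, Q x $ 2])})"

definition enumerates_components :: "(real^3) set \<Rightarrow> nat \<Rightarrow> (nat \<Rightarrow> (real^3) set) \<Rightarrow> bool" where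
  "enumerates_components \<Omega> m \<Xi> \<longleftrightarrow>
     bij_betw \<Xi> {0..<m} (components (- closure \<Omega>)) \<and> \<not> bounded (\<Xi> 0)"

text \<open>
  A neighbourhood of a set is an open superset.  When \<open>S\<close> is itself open, as for the components
  below, this is no more than equality on \<open>S\<close>; requiring more would only restrict the cutoffs.
\<close>

definition equals_near :: "('a::topological_space \<Rightarrow> 'b) \<Rightarrow> 'b \<Rightarrow> 'a set \<Rightarrow> bool" where
  "equals_near f c S \<longleftrightarrow> (\<exists>V. open V \<and> S \<subseteq> V \<and> (\<forall>x\<in>V. f x = c))"

definition cutoff_functions ::
    "nat \<Rightarrow> (nat \<Rightarrow> (real^3) set) \<Rightarrow> (nat \<Rightarrow> real^3 \<Rightarrow> real) \<Rightarrow> bool" where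
  "cutoff_functions m \<Xi> \<xi> \<longleftrightarrow>
     (\<forall>l\<in>{1..<m}. test UNIV (\<xi> l) \<and> equals_near (\<xi> l) 1 (\<Xi> l) \<and>
        (\<forall>k\<in>{0..<m} - {l}. equals_near (\<xi> l) 0 (\<Xi> k))) \<and>
     (\<forall>l\<in>{1..<m}. \<forall>k\<in>{1..<m}. l \<noteq> k \<longrightarrow> supp (\<xi> l) \<inter> supp (\<xi> k) = {})"

text \<open>
  The embedding \<open>of_nat\<close> of the naturals into the index type \<open>3\<close> maps 1, 2, 3 to its three
  distinct elements.
\<close>

definition rhat :: "nat \<Rightarrow> real^3 \<Rightarrow> real^3" where
  "rhat j x = (if j = 0 then x else axis (of_nat j) 1)"

definition xi_field :: "(nat \<Rightarrow> real^3 \<Rightarrow> real) \<Rightarrow> nat \<Rightarrow> nat \<Rightarrow> real^3 \<Rightarrow> real^3" where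
  "xi_field \<xi> l j x = \<xi> l x *\<^sub>R rhat j x"

text \<open>
  For bounded open \<open>\<Omega>\<close> the description below determines \<open>\<psi>\<close> uniquely: the range of \<open>devGrad0 \<Omega>\<close>
  is closed, its domain is \<open>H1_0 \<Omega>\<close>, and it is injective.
\<close>

definition psi :: "(real^3) set \<Rightarrow> (nat \<Rightarrow> real^3 \<Rightarrow> real) \<Rightarrow> nat \<Rightarrow> nat \<Rightarrow> (real^3) L2" where
  "psi \<Omega> \<xi> l j = (THE \<psi>. \<psi> \<in> H1_0 \<Omega> \<and>
     orth_proj (ker (Div_T \<Omega>)) (devGrad \<Omega> (restr \<Omega> (xi_field \<xi> l j))) =
     devGrad \<Omega> (restr \<Omega> (xi_field \<xi> l j) - \<psi>))"

definition v_field :: "(real^3) set \<Rightarrow> (nat \<Rightarrow> real^3 \<Rightarrow> real) \<Rightarrow> nat \<Rightarrow> nat \<Rightarrow> (real^3) L2" where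
  "v_field \<Omega> \<xi> l j = restr \<Omega> (xi_field \<xi> l j) - psi \<Omega> \<xi> l j"

end

theory Submission
  imports Defs "HOL-Computational_Algebra.Polynomial"
begin

text \<open>
  Extended by zero, a field \<open>T\<close> in the kernel of the closed \<open>symCurl\<close> stays \<open>symCurl\<close>-free on the whole
  space. After mollification \<open>Curl T\<close> is skew, given by a curl-free vector field \<open>grad f\<close>, and
  \<open>T + f Id\<close> is then curl-free, so \<open>T = dev (Grad v)\<close> with \<open>v\<close> smooth and compactly supported. Korn's inequality
  passes this to the limit with \<open>v \<in> H\<^sub>0\<^sup>1\<close> of a large ball. On every component of the exterior
  \<open>dev (Grad v) = 0\<close>, hence \<open>v = a x + b\<close> there, with \<open>v = 0\<close> on the unbounded component. Subtracting the
  corresponding combination of the \<open>\<xi>\<^sub>l r\<^sub>j\<close> leaves a field that vanishes outside \<open>closure \<Omega>\<close>; by the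
  continuity of the boundary it belongs to \<open>H\<^sub>0\<^sup>1(\<Omega>)\<close>, so it is annihilated by the projection onto the kernel of \<open>Div\<close>.
  This shows that the four fields for each bounded component span. If a combination vanishes, then the
  combined \<open>\<xi>\<^sub>l r\<^sub>j\<close> have the deviatoric gradient of some \<open>\<psi> \<in> H\<^sub>0\<^sup>1(\<Omega>)\<close>, so by Korn they equal \<open>\<psi>\<close>, which is
  zero on the components; there the \<open>r\<^sub>j\<close> are independent.
\<close>

section \<open>Smooth functions\<close>

text \<open>Extension by zero moves the construction of potentials to balls in R^3, so that they
  exist whatever the topology of \<Omega>. The topology reappears only in the affine values of the
  limit potential on the exterior, with four parameters for each bounded component.

  The vector field behind the skew \<open>Curl T\<close> is curl-free because the rows of
  \<open>Curl T\<close> are divergence-free. Korn's inequality is elementary for compactly supported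
  fields: integration by parts bounds the L2 norm of the divergence by that of the gradient. With
  Poincare's inequality it makes the range of the deviatoric gradient on H_0^1(\<Omega>) closed, and
  this gives the orthogonal splitting and the uniqueness on which \<open>orth_proj\<close> and
  \<open>psi\<close> rest.

  As the boundary is merely continuous, membership in H_0^1(\<Omega>) is obtained without traces, by
  mollifiers centred off the origin which push a field into \<Omega> while smoothing it. The same
  charts show that there are finitely many exterior components and that their closures are
  disjoint.\<close>

definition pd :: "'a::euclidean_space \<Rightarrow> ('a \<Rightarrow> 'b::real_normed_vector) \<Rightarrow> 'a \<Rightarrow> 'b" where
  "pd d f x = frechet_derivative f (at x) d"

definition smooth :: "('a::euclidean_space \<Rightarrow> 'b::real_normed_vector) \<Rightarrow> bool" where
  "smooth f \<longleftrightarrow> (\<forall>k. C_k k f)"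

lemma C_k_Suc_pd: "C_k (Suc k) f \<longleftrightarrow> (\<forall>x. f differentiable (at x)) \<and> (\<forall>d. C_k k (pd d f))"
  by (simp add: pd_def[abs_def])

declare C_k.simps(2) [simp del]

text \<open>Induction on the order \<open>k\<close>, for all members of the class at once. Families
  stable under differentiation, such as convolutions with test kernels, are seen to be smooth in
  this way without a formula for the higher derivatives.\<close>

lemma smooth_coinduct:
  assumes "P f"
    and diff: "\<And>f x. P f \<Longrightarrow> f differentiable (at x)"
    and pd: "\<And>f d. P f \<Longrightarrow> P (pd d f)"
  shows "smooth f"
proof -
  have "C_k k f" if "P f" for k f
    using that
  proof (induction k arbitrary: f)
    case 0
    then show ?case
      by (simp add: diff differentiable_imp_continuous_within continuous_at_imp_continuous_on)
  next
    case (Suc k)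
    then show ?case by (simp add: C_k_Suc_pd diff pd)
  qed
  with \<open>P f\<close> show ?thesis by (simp add: smooth_def)
qed

lemma smooth_differentiable: "smooth f \<Longrightarrow> f differentiable (at x)"
  unfolding smooth_def by (metis C_k_Suc_pd)

lemma smooth_pd: "smooth f \<Longrightarrow> smooth (pd d f)"
  unfolding smooth_def by (metis C_k_Suc_pd)

lemma smooth_continuous: "smooth f \<Longrightarrow> continuous_on S f"
  unfolding smooth_def using C_k.simps(1)[of f] continuous_on_subset by blast

lemma differentiable_has_derivative_pd:
  "f differentiable (at x) \<Longrightarrow> (f has_derivative (\<lambda>d. pd d f x)) (at x)"
  by (simp add: pd_def frechet_derivative_works)

lemma smooth_has_derivative: "smooth f \<Longrightarrow> (f has_derivative (\<lambda>d. pd d f x)) (at x)"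
  by (simp add: differentiable_has_derivative_pd smooth_differentiable)

lemma pd_eqI: "(f has_derivative f') (at x) \<Longrightarrow> pd d f x = f' d"
  unfolding pd_def using frechet_derivative_at by metis

lemma linear_pd: "f differentiable (at x) \<Longrightarrow> linear (\<lambda>d. pd d f x)"
  using differentiable_has_derivative_pd has_derivative_linear by blast

text \<open>Meant for functions known only through their gradient, such as a potential: all orders
  above the first are delegated to the given derivative \<open>f'\<close>.\<close>

lemma smooth_I:
  assumes "\<And>x. (f has_derivative f' x) (at x)" and "\<And>d. smooth (\<lambda>x. f' x d)"
  shows "smooth f"
proof -
  have "C_k k f" for k
  proof (cases k)
    case 0
    have "f differentiable at x" for x using assms(1) differentiableI by blast
    with 0 show ?thesis
      by (simp add: differentiable_imp_continuous_within continuous_at_imp_continuous_on)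
  next
    case (Suc j)
    have "pd d f = (\<lambda>x. f' x d)" for d using pd_eqI[OF assms(1)] by fastforce
    with Suc assms show ?thesis
      by (auto simp: C_k_Suc_pd smooth_def intro: differentiableI)
  qed
  then show ?thesis by (simp add: smooth_def)
qed

lemma smooth_bounded_linear_comp:
  assumes "smooth f" and h: "bounded_linear h"
  shows smooth_linear: "smooth (\<lambda>x. h (f x))"
    and pd_linear: "pd d (\<lambda>x. h (f x)) x = h (pd d f x)"
proof -
  have der: "((\<lambda>x. h (g x)) has_derivative (\<lambda>d. h (pd d g x))) (at x)" if "smooth g" for g x
    by (rule bounded_linear.has_derivative[OF h smooth_has_derivative[OF that]])
  show "pd d (\<lambda>x. h (f x)) x = h (pd d f x)" by (rule pd_eqI[OF der[OF assms(1)]])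
  show "smooth (\<lambda>x. h (f x))"
  proof (rule smooth_coinduct[where P = "\<lambda>u. \<exists>g. smooth g \<and> u = (\<lambda>x. h (g x))"])
    fix u :: "'a \<Rightarrow> 'c" and x d
    assume "\<exists>g. smooth g \<and> u = (\<lambda>x. h (g x))"
    then obtain g where g: "smooth g" "u = (\<lambda>x. h (g x))" by blast
    show "u differentiable at x" using der[OF g(1)] g(2) differentiableI by blast
    show "\<exists>g. smooth g \<and> pd d u = (\<lambda>x. h (g x))"
      using g pd_eqI[OF der[OF g(1)]] by (intro exI[of _ "pd d g"]) (auto simp: smooth_pd)
  qed (use assms in blast)
qed

lemma smooth_const: "smooth (\<lambda>x. c)"
proof (rule smooth_coinduct[where P = "\<lambda>u. \<exists>c. u = (\<lambda>x. c)"])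
  fix u :: "'a \<Rightarrow> 'b" and d x
  assume "\<exists>c. u = (\<lambda>x. c)"
  then obtain c where u: "u = (\<lambda>x. c)" by blast
  show "u differentiable at x" by (simp add: u)
  have "pd d u = (\<lambda>x. 0)" by (rule ext, rule pd_eqI) (simp add: u)
  then show "\<exists>c. pd d u = (\<lambda>x. c)" by blast
qed blast

lemma pd_const [simp]: "pd d (\<lambda>x. c) x = 0"
  by (rule pd_eqI) simp

lemma smooth_bounded_linear: "bounded_linear h \<Longrightarrow> smooth h"
  by (rule smooth_I[where f' = "\<lambda>x. h"]) (auto simp: smooth_const bounded_linear_imp_has_derivative)

lemma pd_bounded_linear: "bounded_linear h \<Longrightarrow> pd d h x = h d"
  by (rule pd_eqI) (simp add: bounded_linear_imp_has_derivative)

text \<open>The clause for \<open>Suc k\<close> mentions only differentiability and the derivatives,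
  so monotonicity in the order takes an induction. The product rule relies on it, since an
  undifferentiated factor occurs there next to a derivative of order \<open>k\<close>.\<close>

lemma C_k_SucD: "C_k (Suc k) f \<Longrightarrow> C_k k f"
proof (induction k arbitrary: f)
  case 0
  then show ?case
    by (simp add: C_k_Suc_pd differentiable_imp_continuous_within continuous_at_imp_continuous_on)
next
  case (Suc k)
  then show ?case by (meson C_k_Suc_pd)
qed

lemma pd_add: "f differentiable (at x) \<Longrightarrow> g differentiable (at x) \<Longrightarrow>
    pd d (\<lambda>x. f x + g x) x = pd d f x + pd d g x"
  by (rule pd_eqI) (intro has_derivative_add differentiable_has_derivative_pd)

lemma C_k_add: "C_k k f \<Longrightarrow> C_k k g \<Longrightarrow> C_k k (\<lambda>x. f x + g x)"
proof (induction k arbitrary: f g)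
  case 0
  then show ?case by (simp add: continuous_on_add)
next
  case (Suc k)
  then have "pd d (\<lambda>x. f x + g x) = (\<lambda>x. pd d f x + pd d g x)" for d
    by (auto simp: C_k_Suc_pd pd_add)
  with Suc show ?case by (auto simp: C_k_Suc_pd)
qed

lemma smooth_add: "smooth f \<Longrightarrow> smooth g \<Longrightarrow> smooth (\<lambda>x. f x + g x)"
  by (simp add: smooth_def C_k_add)

lemma pd_bilinear:
  assumes "bounded_bilinear bl" "f differentiable (at x)" "g differentiable (at x)"
  shows "pd d (\<lambda>x. bl (f x) (g x)) x = bl (f x) (pd d g x) + bl (pd d f x) (g x)"
  by (rule pd_eqI) (intro bounded_bilinear.FDERIV assms differentiable_has_derivative_pd)

lemma C_k_bilinear:
  assumes "bounded_bilinear bl"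
  shows "C_k k f \<Longrightarrow> C_k k g \<Longrightarrow> C_k k (\<lambda>x. bl (f x) (g x))"
proof (induction k arbitrary: f g)
  case 0
  then show ?case by (auto intro: bounded_bilinear.continuous_on[OF assms])
next
  case (Suc k)
  have df: "f differentiable at x" "g differentiable at x" for x
    using Suc.prems by (auto simp: C_k_Suc_pd)
  have "pd d (\<lambda>x. bl (f x) (g x)) = (\<lambda>x. bl (f x) (pd d g x) + bl (pd d f x) (g x))" for d
    using pd_bilinear[OF assms df] by blast
  moreover have "(\<lambda>x. bl (f x) (g x)) differentiable at x" for x
    using bounded_bilinear.FDERIV[OF assms df[THEN differentiable_has_derivative_pd]]
    by (rule differentiableI)
  ultimately show ?case
    using Suc.prems C_k_SucD[OF Suc.prems(1)] C_k_SucD[OF Suc.prems(2)]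
    by (auto simp: C_k_Suc_pd intro!: C_k_add Suc.IH)
qed

lemma smooth_bilinear:
  "bounded_bilinear bl \<Longrightarrow> smooth f \<Longrightarrow> smooth g \<Longrightarrow> smooth (\<lambda>x. bl (f x) (g x))"
  by (simp add: smooth_def C_k_bilinear)

lemma smooth_mult:
  fixes f g :: "'a::euclidean_space \<Rightarrow> 'b::real_normed_algebra"
  shows "smooth f \<Longrightarrow> smooth g \<Longrightarrow> smooth (\<lambda>x. f x * g x)"
  by (rule smooth_bilinear[OF bounded_bilinear_mult])

lemma smooth_uminus: "smooth f \<Longrightarrow> smooth (\<lambda>x. - f x)"
  by (rule smooth_linear[OF _ bounded_linear_minus[OF bounded_linear_ident]])

lemma smooth_diff: "smooth f \<Longrightarrow> smooth g \<Longrightarrow> smooth (\<lambda>x. f x - g x)"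
  using smooth_add[OF _ smooth_uminus, of f g] by simp

lemma smooth_sum: "(\<And>i. i \<in> I \<Longrightarrow> smooth (f i)) \<Longrightarrow> smooth (\<lambda>x. \<Sum>i\<in>I. f i x)"
  by (induction I rule: infinite_finite_induct) (auto simp: smooth_const smooth_add)

lemma smooth_prod:
  fixes f :: "'i \<Rightarrow> 'a::euclidean_space \<Rightarrow> real"
  shows "(\<And>i. i \<in> I \<Longrightarrow> smooth (f i)) \<Longrightarrow> smooth (\<lambda>x. \<Prod>i\<in>I. f i x)"
  by (induction I rule: infinite_finite_induct) (auto simp: smooth_const smooth_mult)

text \<open>The second difference f(x+sa+sb) - f(x+sa) - f(x+sb) + f(x) is symmetric in a and b. Two
  applications of the mean value theorem make it s^2 times either mixed derivative at points that
  tend to x with s, and continuity of these derivatives gives equality at x.\<close>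

lemma pd_commute_real:
  fixes f :: "'a::euclidean_space \<Rightarrow> real"
  assumes f: "smooth f"
  shows "pd a (pd b f) x = pd b (pd a f) x"
proof -
  have line: "((\<lambda>t. g (y + t *\<^sub>R d)) has_real_derivative pd d g (y + t *\<^sub>R d)) (at t)"
    if "smooth g" for g :: "'a \<Rightarrow> real" and y d t
  proof -
    have "((\<lambda>t. y + t *\<^sub>R d) has_derivative (\<lambda>h. h *\<^sub>R d)) (at t)"
      by (auto intro!: derivative_eq_intros)
    then have "((\<lambda>t. g (y + t *\<^sub>R d)) has_derivative (\<lambda>h. pd (h *\<^sub>R d) g (y + t *\<^sub>R d))) (at t)"
      by (rule has_derivative_compose[OF _ smooth_has_derivative[OF that]])
    moreover have "pd (h *\<^sub>R d) g (y + t *\<^sub>R d) = pd d g (y + t *\<^sub>R d) * h" for h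
      using linear_scale[OF linear_pd[OF smooth_differentiable[OF that]]] by (simp add: mult.commute)
    ultimately show ?thesis by (simp add: has_field_derivative_def)
  qed
  have mv: "\<exists>p. norm (p - x) \<le> s * (norm a + norm b) \<and>
      f (x + s *\<^sub>R a + s *\<^sub>R b) - f (x + s *\<^sub>R a) - f (x + s *\<^sub>R b) + f x = s\<^sup>2 * pd b (pd a f) p"
    if s: "s > 0" for s and a b :: 'a
  proof -
    \<comment> \<open>The increment in direction \<open>b\<close> as a function of the step in
      direction \<open>a\<close>: the mean value theorem in \<open>a\<close> leaves a difference of
      values of \<open>pd a f\<close>, to which it is then applied in \<open>b\<close>.\<close>
    define \<phi> where "\<phi> t = f ((x + s *\<^sub>R b) + t *\<^sub>R a) - f (x + t *\<^sub>R a)" for t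
    have "(\<phi> has_real_derivative pd a f ((x + s *\<^sub>R b) + t *\<^sub>R a) - pd a f (x + t *\<^sub>R a)) (at t)" for t
      unfolding \<phi>_def by (intro DERIV_diff line f)
    then have "\<exists>u>0. u < s \<and> \<phi> s - \<phi> 0
        = (s - 0) * (pd a f ((x + s *\<^sub>R b) + u *\<^sub>R a) - pd a f (x + u *\<^sub>R a))"
      by (rule MVT2[OF s])
    then obtain u where u: "0 < u" "u < s" and 1: "\<phi> s - \<phi> 0
        = (s - 0) * (pd a f ((x + s *\<^sub>R b) + u *\<^sub>R a) - pd a f (x + u *\<^sub>R a))"
      by blast
    have "((\<lambda>t. pd a f ((x + u *\<^sub>R a) + t *\<^sub>R b)) has_real_derivative
        pd b (pd a f) ((x + u *\<^sub>R a) + t *\<^sub>R b)) (at t)" for t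
      by (intro line smooth_pd f)
    then have "\<exists>w>0. w < s \<and>
      pd a f ((x + u *\<^sub>R a) + s *\<^sub>R b) - pd a f ((x + u *\<^sub>R a) + 0 *\<^sub>R b)
        = (s - 0) * pd b (pd a f) ((x + u *\<^sub>R a) + w *\<^sub>R b)"
      by (rule MVT2[OF s])
    then obtain w where w: "0 < w" "w < s" and 2:
      "pd a f ((x + u *\<^sub>R a) + s *\<^sub>R b) - pd a f ((x + u *\<^sub>R a) + 0 *\<^sub>R b)
        = (s - 0) * pd b (pd a f) ((x + u *\<^sub>R a) + w *\<^sub>R b)"
      by blast
    show ?thesis
    proof (intro exI[of _ "x + u *\<^sub>R a + w *\<^sub>R b"] conjI)
      have "norm (u *\<^sub>R a + w *\<^sub>R b) \<le> u * norm a + w * norm b"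
        using norm_triangle_ineq[of "u *\<^sub>R a" "w *\<^sub>R b"] u w by simp
      also have "\<dots> \<le> s * norm a + s * norm b"
        using u w by (intro add_mono mult_right_mono) auto
      finally show "norm (x + u *\<^sub>R a + w *\<^sub>R b - x) \<le> s * (norm a + norm b)"
        by (simp add: algebra_simps)
      show "f (x + s *\<^sub>R a + s *\<^sub>R b) - f (x + s *\<^sub>R a) - f (x + s *\<^sub>R b) + f x
          = s\<^sup>2 * pd b (pd a f) (x + u *\<^sub>R a + w *\<^sub>R b)"
        using 1 2 by (simp add: \<phi>_def power2_eq_square add_ac)
    qed
  qed
  define s where "s n = inverse (real (Suc n))" for n
  have s: "s n > 0" for n by (simp add: s_def)
  have s0: "s \<longlonglongrightarrow> 0" unfolding s_def by (rule LIMSEQ_inverse_real_of_nat)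
  have "\<forall>n. \<exists>p. norm (p - x) \<le> s n * (norm a + norm b) \<and>
      f (x + s n *\<^sub>R a + s n *\<^sub>R b) - f (x + s n *\<^sub>R a) - f (x + s n *\<^sub>R b) + f x = (s n)\<^sup>2 * pd b (pd a f) p"
    using mv[OF s, of _ a b] by blast
  from choice[OF this] obtain p where p: "\<And>n. norm (p n - x) \<le> s n * (norm a + norm b)"
    and p': "\<And>n. f (x + s n *\<^sub>R a + s n *\<^sub>R b) - f (x + s n *\<^sub>R a) - f (x + s n *\<^sub>R b) + f x = (s n)\<^sup>2 * pd b (pd a f) (p n)"
    by blast
  have "\<forall>n. \<exists>q. norm (q - x) \<le> s n * (norm b + norm a) \<and>
      f (x + s n *\<^sub>R b + s n *\<^sub>R a) - f (x + s n *\<^sub>R b) - f (x + s n *\<^sub>R a) + f x = (s n)\<^sup>2 * pd a (pd b f) q"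
    using mv[OF s, of _ b a] by blast
  from choice[OF this] obtain q where q: "\<And>n. norm (q n - x) \<le> s n * (norm b + norm a)"
    and q': "\<And>n. f (x + s n *\<^sub>R b + s n *\<^sub>R a) - f (x + s n *\<^sub>R b) - f (x + s n *\<^sub>R a) + f x = (s n)\<^sup>2 * pd a (pd b f) (q n)"
    by blast
  note pq = p' q'
  have eq: "pd b (pd a f) (p n) = pd a (pd b f) (q n)" for n
  proof -
    have "(s n)\<^sup>2 * pd b (pd a f) (p n) = (s n)\<^sup>2 * pd a (pd b f) (q n)"
      using pq[of n] by (simp add: algebra_simps)
    then show ?thesis using s[of n] by simp
  qed
  have "p \<longlonglongrightarrow> x"
  proof (rule Lim_transform_bound[where g = "\<lambda>n. s n *\<^sub>R (norm a + norm b)", THEN LIM_zero_cancel])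
    show "\<forall>\<^sub>F n in sequentially. norm (p n - x) \<le> norm (s n *\<^sub>R (norm a + norm b))"
      using p s by (intro always_eventually allI) (simp add: less_imp_le)
    show "(\<lambda>n. s n *\<^sub>R (norm a + norm b)) \<longlonglongrightarrow> 0" using tendsto_mult_right[OF s0] by simp
  qed
  moreover have "q \<longlonglongrightarrow> x"
  proof (rule Lim_transform_bound[where g = "\<lambda>n. s n *\<^sub>R (norm b + norm a)", THEN LIM_zero_cancel])
    show "\<forall>\<^sub>F n in sequentially. norm (q n - x) \<le> norm (s n *\<^sub>R (norm b + norm a))"
      using q s by (intro always_eventually allI) (simp add: less_imp_le)
    show "(\<lambda>n. s n *\<^sub>R (norm b + norm a)) \<longlonglongrightarrow> 0" using tendsto_mult_right[OF s0] by simp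
  qed
  moreover have "isCont (pd b (pd a f)) x" "isCont (pd a (pd b f)) x"
    using smooth_continuous[OF smooth_pd[OF smooth_pd[OF f]], of UNIV]
    by (simp_all add: continuous_on_eq_continuous_at)
  ultimately have "(\<lambda>n. pd b (pd a f) (p n)) \<longlonglongrightarrow> pd b (pd a f) x"
    "(\<lambda>n. pd a (pd b f) (q n)) \<longlonglongrightarrow> pd a (pd b f) x"
    by (auto intro: isCont_tendsto_compose)
  then show ?thesis using eq LIMSEQ_unique by simp
qed

section \<open>Bump functions and test fields\<close>

text \<open>With s = 1/t these are the functions P(s) exp(-s), continued by zero. The polynomial
  makes the family closed under differentiation; the usual bump profile exp(-1/t) is
  \<open>ebump 1\<close>.\<close>

definition ebump :: "real poly \<Rightarrow> real \<Rightarrow> real" where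
  "ebump p t = (if t > 0 then poly p (inverse t) * exp (- inverse t) else 0)"

lemma poly_mult_exp_tendsto_0: "((\<lambda>s::real. poly p s * exp (- s)) \<longlongrightarrow> 0) at_top"
proof -
  have "((\<lambda>s::real. \<Sum>i\<le>degree p. coeff p i * (s ^ i / exp s)) \<longlongrightarrow> (\<Sum>i\<le>degree p. coeff p i * 0)) at_top"
    by (intro tendsto_intros tendsto_power_div_exp_0)
  moreover have "(\<Sum>i\<le>degree p. coeff p i * (s ^ i / exp s)) = poly p s * exp (- s)" for s
    by (simp add: poly_altdef exp_minus divide_inverse sum_distrib_right mult.assoc)
  ultimately show ?thesis by simp
qed

text \<open>With s = 1/t, the derivative of P(s) exp(-s) in t is s^2 (P(s) - P'(s)) exp(-s), whence
  the factor \<open>[:0,0,1:]\<close>. At the origin the difference quotient from the right is s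
  P(s) exp(-s), which tends to zero.\<close>

lemma ebump_has_derivative:
  "(ebump p has_real_derivative ebump ([:0,0,1:] * (p - pderiv p)) t) (at t)"
proof -
  consider "t > 0" | "t < 0" | "t = 0" by linarith
  then show ?thesis
  proof cases
    case 1
    have inv: "(inverse has_real_derivative - (inverse t * inverse t)) (at t)"
      using DERIV_inverse[of t UNIV] 1 by (simp add: numeral_2_eq_2)
    have "((\<lambda>t. poly p (inverse t) * exp (- inverse t)) has_real_derivative
        poly (pderiv p) (inverse t) * (- (inverse t * inverse t)) * exp (- inverse t)
        + (exp (- inverse t) * (- (- (inverse t * inverse t)))) * poly p (inverse t)) (at t)"
      by (intro DERIV_mult DERIV_chain2[OF poly_DERIV inv] DERIV_chain2[OF DERIV_exp] DERIV_minus inv)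
    moreover have "poly (pderiv p) (inverse t) * (- (inverse t * inverse t)) * exp (- inverse t)
        + (exp (- inverse t) * (- (- (inverse t * inverse t)))) * poly p (inverse t)
        = ebump ([:0,0,1:] * (p - pderiv p)) t"
      using 1 by (simp add: ebump_def algebra_simps)
    ultimately have "((\<lambda>t. poly p (inverse t) * exp (- inverse t)) has_real_derivative
        ebump ([:0,0,1:] * (p - pderiv p)) t) (at t)" by simp
    then show ?thesis
      by (rule has_field_derivative_transform_within_open[where S = "{0<..}"])
        (use 1 in \<open>auto simp: ebump_def\<close>)
  next
    case 2
    have "((\<lambda>t. 0) has_real_derivative ebump ([:0,0,1:] * (p - pderiv p)) t) (at t)"
      using 2 by (auto simp: ebump_def)
    then show ?thesis
      by (rule has_field_derivative_transform_within_open[where S = "{..<0}"])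
        (use 2 in \<open>auto simp: ebump_def\<close>)
  next
    case 3
    have "((\<lambda>h. poly (pCons 0 p) (inverse h) * exp (- inverse h)) \<longlongrightarrow> 0) (at_right 0)"
      by (rule filterlim_compose[OF poly_mult_exp_tendsto_0 filterlim_inverse_at_top_right])
    then have "((\<lambda>h. ebump p h / h) \<longlongrightarrow> 0) (at_right 0)"
      by (rule Lim_transform_eventually)
         (auto simp: ebump_def eventually_at_filter divide_inverse)
    moreover have "((\<lambda>h. ebump p h / h) \<longlongrightarrow> 0) (at_left 0)"
      by (rule Lim_transform_eventually[OF tendsto_const])
         (auto simp: ebump_def eventually_at_filter)
    ultimately have "((\<lambda>h. ebump p h / h) \<longlongrightarrow> 0) (at 0)"
      by (simp add: filterlim_split_at)
    with 3 show ?thesis by (simp add: DERIV_def ebump_def)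
  qed
qed

lemma smooth_ebump_affine:
  fixes a :: "'a::euclidean_space"
  shows "smooth (\<lambda>x. ebump p (a \<bullet> x + b))"
proof -
  have der: "((\<lambda>x. c * ebump p (a \<bullet> x + b)) has_derivative
      (\<lambda>d. c * (a \<bullet> d) * ebump ([:0,0,1:] * (p - pderiv p)) (a \<bullet> x + b))) (at x)" for c p x
  proof -
    have "((\<lambda>x. ebump p (a \<bullet> x + b)) has_derivative
        (\<lambda>d. (a \<bullet> d) *\<^sub>R ebump ([:0,0,1:] * (p - pderiv p)) (a \<bullet> x + b))) (at x)"
    proof -
      have "((\<lambda>x. a \<bullet> x + b) has_derivative (\<lambda>d. a \<bullet> d)) (at x)"
        by (auto intro!: derivative_eq_intros)
      from has_derivative_compose[OF this ebump_has_derivative[unfolded has_field_derivative_def]]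
      show ?thesis by (simp add: mult.commute)
    qed
    from has_derivative_mult_right[OF this, of c] show ?thesis by (simp add: mult.assoc)
  qed
  \<comment> \<open>Each differentiation contributes a factor \<open>a \<bullet> d\<close>, which
    the constant \<open>c\<close> of the class absorbs.\<close>
  show ?thesis
  proof (rule smooth_coinduct[where P = "\<lambda>u. \<exists>c p. u = (\<lambda>x. c * ebump p (a \<bullet> x + b))"])
    show "\<exists>c pa. (\<lambda>x. ebump p (a \<bullet> x + b)) = (\<lambda>x. c * ebump pa (a \<bullet> x + b))"
      by (intro exI[of _ 1] exI[of _ p]) simp
  next
    fix u :: "'a \<Rightarrow> real" and d x
    assume "\<exists>c p. u = (\<lambda>x. c * ebump p (a \<bullet> x + b))"
    then obtain c p where u: "u = (\<lambda>x. c * ebump p (a \<bullet> x + b))" by blast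
    show "u differentiable at x" using der u differentiableI by blast
    have "pd d u = (\<lambda>x. c * (a \<bullet> d) * ebump ([:0,0,1:] * (p - pderiv p)) (a \<bullet> x + b))"
      unfolding u by (rule ext, rule pd_eqI[OF der])
    then show "\<exists>c p. pd d u = (\<lambda>x. c * ebump p (a \<bullet> x + b))" by blast
  qed
qed

lemma test_iff: "test \<Omega> f \<longleftrightarrow> smooth f \<and> compact (supp f) \<and> supp f \<subseteq> \<Omega>"
  by (simp add: test_def smooth_def)

lemma notin_supp: "x \<notin> supp f \<Longrightarrow> f x = 0"
proof (rule ccontr)
  assume "x \<notin> supp f" "f x \<noteq> 0"
  moreover from this(2) have "x \<in> closure {x. f x \<noteq> 0}" using closure_subset[of "{x. f x \<noteq> 0}"] by blast
  ultimately show False by (simp add: supp_def)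
qed

lemma supp_subset_iff: "closed S \<Longrightarrow> supp f \<subseteq> S \<longleftrightarrow> (\<forall>x. x \<notin> S \<longrightarrow> f x = 0)"
proof
  assume "closed S" "supp f \<subseteq> S"
  then show "\<forall>x. x \<notin> S \<longrightarrow> f x = 0" using notin_supp by blast
next
  assume "closed S" "\<forall>x. x \<notin> S \<longrightarrow> f x = 0"
  then show "supp f \<subseteq> S" unfolding supp_def by (intro closure_minimal) auto
qed

lemma closed_supp: "closed (supp f)" by (simp add: supp_def)

lemma testI:
  assumes "smooth f" "compact K" "K \<subseteq> \<Omega>" "\<And>x. x \<notin> K \<Longrightarrow> f x = 0"
  shows "test \<Omega> f"
proof -
  have "supp f \<subseteq> K" using assms by (subst supp_subset_iff) (auto intro: compact_imp_closed)
  with assms show ?thesis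
    unfolding test_iff using compact_Int_closed[OF assms(2) closed_supp, of f]
    by (metis inf.absorb_iff2 subset_trans)
qed

lemma test_smooth: "test \<Omega> f \<Longrightarrow> smooth f" by (simp add: test_iff)

lemma test_mono: "test A f \<Longrightarrow> A \<subseteq> B \<Longrightarrow> test B f" by (auto simp: test_iff)

lemma test_supp: "test UNIV f \<Longrightarrow> supp f \<subseteq> S \<Longrightarrow> test S f" by (auto simp: test_iff)

lemma test_zero_outside: "test \<Omega> f \<Longrightarrow> x \<notin> \<Omega> \<Longrightarrow> f x = 0"
  unfolding test_iff using notin_supp by blast

lemma test_bounded_supp: "test \<Omega> f \<Longrightarrow> bounded (supp f)"
  by (simp add: test_iff compact_imp_bounded)

lemma bounded_linear_zero: "bounded_linear h \<Longrightarrow> h 0 = 0"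
  by (simp add: linear_simps)

lemma test_linear: "test \<Omega> f \<Longrightarrow> bounded_linear h \<Longrightarrow> test \<Omega> (\<lambda>x. h (f x))"
  by (rule testI[of _ "supp f"]) (auto simp: test_iff smooth_linear notin_supp bounded_linear_zero)

lemma test_scaleR: "test \<Omega> f \<Longrightarrow> test \<Omega> (\<lambda>x. c *\<^sub>R f x)"
  by (rule test_linear[OF _ bounded_linear_scaleR_right])

lemma test_add: "test \<Omega> f \<Longrightarrow> test \<Omega> g \<Longrightarrow> test \<Omega> (\<lambda>x. f x + g x)"
  by (rule testI[of _ "supp f \<union> supp g"]) (auto simp: test_iff smooth_add notin_supp)

lemma test_zero: "test \<Omega> (\<lambda>x. 0)"
  by (rule testI[of _ "{}"]) (auto simp: smooth_const)

lemma test_sum: "(\<And>i. i \<in> I \<Longrightarrow> test \<Omega> (f i)) \<Longrightarrow> test \<Omega> (\<lambda>x. \<Sum>i\<in>I. f i x)"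
  by (induction I rule: infinite_finite_induct) (auto simp: test_zero test_add)

lemma test_uminus: "test \<Omega> f \<Longrightarrow> test \<Omega> (\<lambda>x. - f x)"
  using test_scaleR[of \<Omega> f "-1"] by simp

lemma test_diff: "test \<Omega> f \<Longrightarrow> test \<Omega> g \<Longrightarrow> test \<Omega> (\<lambda>x. f x - g x)"
  using test_add[OF _ test_uminus, of \<Omega> f g] by simp

lemma test_bilinear_left:
  assumes "bounded_bilinear bl" "test \<Omega> f" "smooth g"
  shows "test \<Omega> (\<lambda>x. bl (f x) (g x))"
  using assms by (intro testI[of _ "supp f"])
    (auto simp: test_iff smooth_bilinear notin_supp bounded_bilinear.zero_left)

lemma test_bilinear_right:
  assumes "bounded_bilinear bl" "smooth f" "test \<Omega> g"
  shows "test \<Omega> (\<lambda>x. bl (f x) (g x))"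
  using assms by (intro testI[of _ "supp g"])
    (auto simp: test_iff smooth_bilinear notin_supp bounded_bilinear.zero_right)

lemma pd_eq_0_open:
  assumes "open U" "x \<in> U" "\<And>y. y \<in> U \<Longrightarrow> f y = c"
  shows "pd d f x = 0"
proof -
  have "((\<lambda>y. c) has_derivative (\<lambda>_. 0)) (at x)" by simp
  then have "(f has_derivative (\<lambda>_. 0)) (at x)"
    by (rule has_derivative_transform_within_open[OF _ assms(1,2)]) (use assms in auto)
  from pd_eqI[OF this] show ?thesis by simp
qed

lemma pd_notin_supp: "x \<notin> supp f \<Longrightarrow> pd d f x = 0"
  by (rule pd_eq_0_open[of "- supp f" _ _ 0]) (auto simp: closed_supp open_Compl notin_supp)

lemma test_pd: "test \<Omega> f \<Longrightarrow> test \<Omega> (pd d f)"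
  by (rule testI[of _ "supp f"]) (auto simp: test_iff smooth_pd pd_notin_supp)

text \<open>A product over the coordinates of one-dimensional bumps, which lives on the box of
  half-width \<open>s\<close> around \<open>c\<close>.\<close>

lemma ex_bump:
  fixes c :: "'a::euclidean_space"
  assumes "r > 0"
  shows "\<exists>k :: 'a \<Rightarrow> real. test (ball c r) k \<and> (\<forall>x. k x \<ge> 0) \<and> k c > 0"
proof -
  \<comment> \<open>Outside the ball of radius \<open>r / 2\<close> some coordinate of
    \<open>x - c\<close> exceeds \<open>s\<close>, since the norm is at most the sum of the absolute
    values of the coordinates.\<close>
  define s where "s = r / (2 * DIM('a))"
  have s: "s > 0" using assms by (simp add: s_def)
  define k where "k x = (\<Prod>i\<in>Basis. ebump 1 (i \<bullet> x + (s - i \<bullet> c)) * ebump 1 ((- i) \<bullet> x + (s + i \<bullet> c)))" for x :: 'a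
  have sm: "smooth k" unfolding k_def by (intro smooth_prod smooth_mult smooth_ebump_affine)
  have pos: "k c > 0" unfolding k_def using s by (intro prod_pos) (auto simp: ebump_def)
  have nn: "k x \<ge> 0" for x unfolding k_def by (intro prod_nonneg) (auto simp: ebump_def)
  have "k x = 0" if x: "x \<notin> cball c (r/2)" for x
  proof -
    have "r / 2 < norm (x - c)" using x by (simp add: dist_norm norm_minus_commute)
    also have "\<dots> \<le> (\<Sum>i\<in>Basis. \<bar>(x - c) \<bullet> i\<bar>)" by (rule norm_le_l1)
    finally have "\<exists>i\<in>Basis. s < \<bar>(x - c) \<bullet> i\<bar>"
      using sum_bounded_above[of "Basis::'a set" "\<lambda>i. \<bar>(x - c) \<bullet> i\<bar>" s]
      by (force simp: s_def not_less)
    then obtain i where i: "i \<in> Basis" "s < \<bar>(x - c) \<bullet> i\<bar>" by blast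
    have "ebump 1 (i \<bullet> x + (s - i \<bullet> c)) * ebump 1 ((- i) \<bullet> x + (s + i \<bullet> c)) = 0"
      using i(2) by (auto simp: ebump_def inner_diff_left inner_diff_right inner_commute)
    then show ?thesis unfolding k_def using i(1) by (meson finite_Basis prod_zero_iff)
  qed
  then have "test (ball c r) k"
    using assms by (intro testI[of _ "cball c (r/2)"] sm) auto
  with pos nn show ?thesis by blast
qed

section \<open>Integration\<close>

lemma lebesgue_translation:
  shows distr_lebesgue_plus: "distr lebesgue lebesgue (\<lambda>x. a + x) = (lebesgue :: 'a::euclidean_space measure)"
    and measurable_lebesgue_plus: "(\<lambda>x. a + x) \<in> lebesgue \<rightarrow>\<^sub>M (lebesgue :: 'a measure)"
  using lebesgue_affine_euclidean[of "\<lambda>_. 1" a] lebesgue_affine_measurable[of "\<lambda>_. 1" a]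
  by (simp_all add: euclidean_representation density_1)

lemma lebesgue_reflection:
  shows distr_lebesgue_minus: "distr lebesgue lebesgue (\<lambda>x. a - x) = (lebesgue :: 'a::euclidean_space measure)"
    and measurable_lebesgue_minus: "(\<lambda>x. a - x) \<in> lebesgue \<rightarrow>\<^sub>M (lebesgue :: 'a measure)"
  using lebesgue_affine_euclidean[of "\<lambda>_. -1" a] lebesgue_affine_measurable[of "\<lambda>_. -1" a]
  by (simp_all add: euclidean_representation density_1 sum_negf)

lemma integral_translate:
  fixes f :: "'a::euclidean_space \<Rightarrow> 'b::{banach,second_countable_topology}"
  assumes "f \<in> borel_measurable lebesgue"
  shows "integral\<^sup>L lebesgue (\<lambda>x. f (a + x)) = integral\<^sup>L lebesgue f"
  using integral_distr[OF measurable_lebesgue_plus assms, of a] by (simp add: distr_lebesgue_plus)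

lemma integrable_translate:
  fixes f :: "'a::euclidean_space \<Rightarrow> 'b::{banach,second_countable_topology}"
  assumes "integrable lebesgue f"
  shows "integrable lebesgue (\<lambda>x. f (a + x))"
  using integrable_distr[OF measurable_lebesgue_plus, of a f] assms by (simp add: distr_lebesgue_plus)

lemma integral_reflect:
  fixes f :: "'a::euclidean_space \<Rightarrow> 'b::{banach,second_countable_topology}"
  assumes "f \<in> borel_measurable lebesgue"
  shows "integral\<^sup>L lebesgue (\<lambda>x. f (a - x)) = integral\<^sup>L lebesgue f"
  using integral_distr[OF measurable_lebesgue_minus assms, of a] by (simp add: distr_lebesgue_minus)

lemma integrable_reflect:
  fixes f :: "'a::euclidean_space \<Rightarrow> 'b::{banach,second_countable_topology}"
  assumes "integrable lebesgue f"
  shows "integrable lebesgue (\<lambda>x. f (a - x))"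
  using integrable_distr[OF measurable_lebesgue_minus, of a f] assms by (simp add: distr_lebesgue_minus)

lemma continuous_borel_lebesgue:
  "continuous_on UNIV f \<Longrightarrow> f \<in> borel_measurable lebesgue"
  using measurable_completion[of f lborel borel] borel_measurable_continuous_onI[of f] by simp

lemma integrable_compact_support:
  fixes f :: "'a::euclidean_space \<Rightarrow> 'b::{banach,second_countable_topology}"
  assumes "continuous_on UNIV f" "compact K" "\<And>x. x \<notin> K \<Longrightarrow> f x = 0"
  shows "integrable lebesgue f"
proof -
  have "integrable lborel (\<lambda>x. indicator K x *\<^sub>R f x)"
    by (rule borel_integrable_compact[OF assms(2)]) (use assms(1) continuous_on_subset in blast)
  moreover have "(\<lambda>x. indicator K x *\<^sub>R f x) = f" using assms(3) by (auto simp: indicator_def)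
  ultimately show ?thesis
    using borel_measurable_continuous_onI[OF assms(1)] by (simp add: integrable_completion)
qed

lemma integrable_indicator_compact: "compact K \<Longrightarrow> integrable lebesgue (indicator K :: 'a::euclidean_space \<Rightarrow> real)"
  using emeasure_lborel_cbox_finite emeasure_compact_finite[of K]
  by (intro integrable_real_indicator) (auto simp: borel_compact)

lemma bounded_compact_support:
  fixes f :: "'a::topological_space \<Rightarrow> 'b::real_normed_vector"
  assumes "continuous_on UNIV f" "compact K" "\<And>x. x \<notin> K \<Longrightarrow> f x = 0"
  obtains C where "C > 0" "\<And>x. norm (f x) \<le> C"
proof -
  have "bounded (f ` K)"
    by (intro compact_imp_bounded compact_continuous_image assms(2)) (use assms(1) continuous_on_subset in blast)
  then obtain C where C: "C > 0" "\<And>y. y \<in> f ` K \<Longrightarrow> norm y \<le> C" by (auto simp: bounded_pos)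
  show thesis
  proof
    show "norm (f x) \<le> C" for x using C assms(3)[of x] by (cases "x \<in> K") auto
  qed fact
qed

lemma test_bounded:
  fixes f :: "'a::euclidean_space \<Rightarrow> 'b::euclidean_space"
  assumes "test \<Omega> f"
  obtains C where "C > 0" "\<And>x. norm (f x) \<le> C"
  using bounded_compact_support[of f "supp f"] assms notin_supp
  by (metis smooth_continuous test_iff)

lemma test_integrable:
  fixes f :: "'a::euclidean_space \<Rightarrow> 'b::euclidean_space"
  shows "test \<Omega> f \<Longrightarrow> integrable lebesgue f"
  by (rule integrable_compact_support[of f "supp f"]) (auto simp: test_iff smooth_continuous notin_supp)

lemma smooth_measurable: "smooth f \<Longrightarrow> f \<in> borel_measurable lebesgue"
  by (simp add: continuous_borel_lebesgue smooth_continuous)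

lemma test_difference_bound:
  fixes f :: "'a::euclidean_space \<Rightarrow> 'b::euclidean_space"
  assumes "smooth f" "\<And>x. norm (pd d f x) \<le> C"
  shows "norm (f (x + t *\<^sub>R d) - f x) \<le> C * \<bar>t\<bar>"
proof -
  have "norm ((\<lambda>s. f (x + s *\<^sub>R d)) t - (\<lambda>s. f (x + s *\<^sub>R d)) 0) \<le> C * norm (t - 0)"
  proof (rule differentiable_bound[of UNIV])
    fix s :: real
    have "((\<lambda>s. x + s *\<^sub>R d) has_derivative (\<lambda>h. h *\<^sub>R d)) (at s)"
      by (auto intro!: derivative_eq_intros)
    then have "((\<lambda>s. f (x + s *\<^sub>R d)) has_derivative (\<lambda>h. pd (h *\<^sub>R d) f (x + s *\<^sub>R d))) (at s)"
      by (rule has_derivative_compose[OF _ smooth_has_derivative[OF assms(1)]])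
    moreover have "pd (h *\<^sub>R d) f y = h *\<^sub>R pd d f y" for h y
      using linear_scale[OF linear_pd[OF smooth_differentiable[OF assms(1)]]] by blast
    ultimately show "((\<lambda>s. f (x + s *\<^sub>R d)) has_derivative (\<lambda>h. h *\<^sub>R pd d f (x + s *\<^sub>R d))) (at s within UNIV)"
      by simp
    show "onorm (\<lambda>h. h *\<^sub>R pd d f (x + s *\<^sub>R d)) \<le> C"
    proof (rule onorm_le)
      show "norm (h *\<^sub>R pd d f (x + s *\<^sub>R d)) \<le> C * norm h" for h
        using mult_right_mono[OF assms(2), of "\<bar>h\<bar>" "x + s *\<^sub>R d"] by (simp add: mult.commute)
    qed
  qed auto
  then show ?thesis by simp
qed

text \<open>Difference quotients of \<open>f\<close> have integral zero by translation invariance.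
  They are bounded by a bound for the derivative and live on one compact set, so dominated
  convergence passes to the derivative.\<close>

lemma integral_pd_test:
  fixes f :: "'a::euclidean_space \<Rightarrow> 'b::euclidean_space"
  assumes f: "test \<Omega> f"
  shows "integral\<^sup>L lebesgue (pd d f) = 0"
proof -
  have sf: "smooth f" using f by (simp add: test_iff)
  obtain C where C: "C > 0" "\<And>x. norm (pd d f x) \<le> C" using test_bounded[OF test_pd[OF f]] by blast
  define h where "h n = inverse (real (Suc n))" for n
  have h: "h n > 0" "h n \<le> 1" for n by (auto simp: h_def field_simps)
  \<comment> \<open>Contains the supports of all quotients below, since \<open>h n\<close> lies
    between 0 and 1: \<open>t = 0\<close> accounts for \<open>f x\<close> and \<open>t = h n\<close>
    for the shifted value.\<close>
  define K where "K = (\<lambda>(y, t). y - t *\<^sub>R d) ` (supp f \<times> {0..1::real})"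
  have K: "compact K" unfolding K_def
    by (intro compact_continuous_image compact_Times) (use f in \<open>auto simp: test_iff case_prod_unfold intro!: continuous_intros\<close>)
  define q where "q n x = inverse (h n) *\<^sub>R (f (h n *\<^sub>R d + x) - f x)" for n x
  have cq: "continuous_on UNIV (q n)" for n
    unfolding q_def by (intro continuous_intros continuous_on_compose2[OF smooth_continuous[OF sf]]) auto
  have q0: "integral\<^sup>L lebesgue (q n) = 0" for n
    unfolding q_def
    using integrable_translate[OF test_integrable[OF f]] test_integrable[OF f]
      integral_translate[OF smooth_measurable[OF sf]] by simp
  have "(\<lambda>n. integral\<^sup>L lebesgue (q n)) \<longlonglongrightarrow> integral\<^sup>L lebesgue (pd d f)"
  proof (rule integral_dominated_convergence)
    show "pd d f \<in> borel_measurable lebesgue" by (intro smooth_measurable smooth_pd sf)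
    show "q n \<in> borel_measurable lebesgue" for n by (rule continuous_borel_lebesgue[OF cq])
    show "integrable lebesgue (\<lambda>x. C * indicator K x)"
      using integrable_indicator_compact[OF K] by simp
    show "AE x in lebesgue. norm (q n x) \<le> C * indicator K x" for n
    proof (rule AE_I2)
      fix x
      show "norm (q n x) \<le> C * indicator K x"
      proof (cases "x \<in> K")
        case True
        have "norm (f (x + h n *\<^sub>R d) - f x) \<le> C * \<bar>h n\<bar>" by (rule test_difference_bound[OF sf C(2)])
        then have "inverse (h n) * norm (f (x + h n *\<^sub>R d) - f x) \<le> inverse (h n) * (C * h n)"
          using h[of n] by (intro mult_left_mono) auto
        moreover have "norm (q n x) = inverse (h n) * norm (f (x + h n *\<^sub>R d) - f x)"
          using h[of n] by (simp add: q_def add.commute)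
        moreover have "inverse (h n) * (C * h n) = C" using h[of n] by simp
        ultimately show ?thesis using True by simp
      next
        case False
        have "f (h n *\<^sub>R d + x) = 0"
        proof (rule notin_supp[of _ f], rule notI)
          assume "h n *\<^sub>R d + x \<in> supp f"
          then have "(\<lambda>(y, t). y - t *\<^sub>R d) (h n *\<^sub>R d + x, h n) \<in> K"
            unfolding K_def using h[of n] by (intro imageI) (auto simp: less_imp_le)
          with False show False by simp
        qed
        moreover have "f x = 0"
        proof (rule notin_supp[of _ f], rule notI)
          assume "x \<in> supp f"
          then have "(\<lambda>(y, t). y - t *\<^sub>R d) (x, 0) \<in> K"
            unfolding K_def by (intro imageI) auto
          with False show False by simp
        qed
        ultimately show ?thesis by (simp add: q_def False)
      qed
    qed
    show "AE x in lebesgue. (\<lambda>n. q n x) \<longlonglongrightarrow> pd d f x"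
    proof (rule AE_I2)
      fix x
      have "((\<lambda>s. x + s *\<^sub>R d) has_derivative (\<lambda>h. h *\<^sub>R d)) (at 0)"
        by (auto intro!: derivative_eq_intros)
      then have "((\<lambda>s. f (x + s *\<^sub>R d)) has_derivative (\<lambda>h. pd (h *\<^sub>R d) f x)) (at 0)"
        using has_derivative_compose[of "\<lambda>s. x + s *\<^sub>R d" "\<lambda>h. h *\<^sub>R d" 0 UNIV f "\<lambda>e. pd e f x"]
          smooth_has_derivative[OF sf, of x] by simp
      moreover have "pd (h *\<^sub>R d) f x = h *\<^sub>R pd d f x" for h
        using linear_scale[OF linear_pd[OF smooth_differentiable[OF sf]]] by blast
      ultimately have vd: "((\<lambda>s. f (x + s *\<^sub>R d)) has_vector_derivative pd d f x) (at 0)"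
        by (simp add: has_vector_derivative_def)
      have "((\<lambda>s. inverse s *\<^sub>R (f (x + s *\<^sub>R d) - f x)) \<longlongrightarrow> pd d f x) (at 0)"
      proof -
        have "((\<lambda>s. norm (f (x + s *\<^sub>R d) - f x - s *\<^sub>R pd d f x) / norm s) \<longlongrightarrow> 0) (at 0)"
          using vd by (simp add: has_vector_derivative_def has_derivative_at)
        then have "((\<lambda>s. norm (inverse s *\<^sub>R (f (x + s *\<^sub>R d) - f x) - pd d f x)) \<longlongrightarrow> 0) (at 0)"
        proof (rule Lim_transform_eventually)
          have "norm (f (x + s *\<^sub>R d) - f x - s *\<^sub>R pd d f x) / norm s =
              norm (inverse s *\<^sub>R (f (x + s *\<^sub>R d) - f x) - pd d f x)" if "s \<noteq> 0" for s
          proof -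
            have "inverse s *\<^sub>R (f (x + s *\<^sub>R d) - f x) - pd d f x =
                inverse s *\<^sub>R (f (x + s *\<^sub>R d) - f x - s *\<^sub>R pd d f x)"
              using that by (simp add: scaleR_diff_right)
            then show ?thesis by (simp add: divide_inverse mult.commute)
          qed
          then show "\<forall>\<^sub>F s in at 0. norm (f (x + s *\<^sub>R d) - f x - s *\<^sub>R pd d f x) / norm s =
              norm (inverse s *\<^sub>R (f (x + s *\<^sub>R d) - f x) - pd d f x)"
            by (simp add: eventually_at_filter)
        qed
        then show ?thesis by (rule LIM_zero_cancel[OF tendsto_norm_zero_cancel])
      qed
      moreover have "filterlim h (at 0) sequentially"
        unfolding filterlim_at using LIMSEQ_inverse_real_of_nat h(1)
        by (auto simp: h_def[abs_def])
      ultimately have "(\<lambda>n. inverse (h n) *\<^sub>R (f (x + h n *\<^sub>R d) - f x)) \<longlonglongrightarrow> pd d f x"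
        by (rule filterlim_compose)
      then show "(\<lambda>n. q n x) \<longlonglongrightarrow> pd d f x" by (simp add: q_def add.commute)
    qed
  qed
  then show ?thesis using q0 by (simp add: LIMSEQ_const_iff)
qed

text \<open>The derivative of the product integrates to zero. The product is a general bilinear one,
  so that inner products, scalar multiples and products of reals are all covered.\<close>

lemma integral_by_parts:
  fixes f :: "'a::euclidean_space \<Rightarrow> 'b::euclidean_space" and g :: "'a \<Rightarrow> 'c::euclidean_space"
    and bl :: "'b \<Rightarrow> 'c \<Rightarrow> 'd::euclidean_space"
  assumes bl: "bounded_bilinear bl" and f: "test \<Omega> f" and g: "smooth g"
  shows "integral\<^sup>L lebesgue (\<lambda>x. bl (pd d f x) (g x)) = - integral\<^sup>L lebesgue (\<lambda>x. bl (f x) (pd d g x))"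
proof -
  have "pd d (\<lambda>x. bl (f x) (g x)) = (\<lambda>x. bl (f x) (pd d g x) + bl (pd d f x) (g x))"
    using pd_bilinear[OF bl smooth_differentiable smooth_differentiable] f g by (intro ext) (auto simp: test_iff)
  then have "0 = integral\<^sup>L lebesgue (\<lambda>x. bl (f x) (pd d g x) + bl (pd d f x) (g x))"
    using integral_pd_test[OF test_bilinear_left[OF bl f g], of d] by simp
  also have "\<dots> = integral\<^sup>L lebesgue (\<lambda>x. bl (f x) (pd d g x)) + integral\<^sup>L lebesgue (\<lambda>x. bl (pd d f x) (g x))"
    by (intro Bochner_Integration.integral_add test_integrable[of UNIV] test_bilinear_left[OF bl] test_pd smooth_pd g test_mono[OF f]) auto
  finally show ?thesis by (simp add: eq_neg_iff_add_eq_0 add.commute)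
qed

section \<open>Square-integrable fields\<close>

lemma sq_int_measurable: "sq_int f \<Longrightarrow> f \<in> borel_measurable lebesgue"
  by (simp add: sq_int_def)

lemma sq_int_norm_integrable: "sq_int f \<Longrightarrow> integrable lebesgue (\<lambda>x. (norm (f x))\<^sup>2)"
  by (simp add: sq_int_def)

lemma sq_int_dominated:
  assumes "f \<in> borel_measurable lebesgue" "integrable lebesgue (\<lambda>x. (w x)\<^sup>2)"
    and "AE x in lebesgue. norm (f x) \<le> w x"
  shows "sq_int f"
  unfolding sq_int_def
proof (intro conjI assms(1))
  show "integrable lebesgue (\<lambda>x. (norm (f x))\<^sup>2)"
  proof (rule Bochner_Integration.integrable_bound[OF assms(2)])
    show "(\<lambda>x. (norm (f x))\<^sup>2) \<in> borel_measurable lebesgue" using assms(1) by measurable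
    show "AE x in lebesgue. norm ((norm (f x))\<^sup>2) \<le> norm ((w x)\<^sup>2)"
      using assms(3) by eventually_elim (auto intro: power_mono)
  qed
qed

lemma sq_int_compact_support:
  fixes f :: "real^3 \<Rightarrow> 'b::euclidean_space"
  assumes "continuous_on UNIV f" "compact K" "\<And>x. x \<notin> K \<Longrightarrow> f x = 0"
  shows "sq_int f"
  unfolding sq_int_def
  by (intro conjI continuous_borel_lebesgue assms(1) integrable_compact_support[OF _ assms(2)] continuous_intros)
    (simp add: assms(3))

lemma test_sq_int: "test \<Omega> f \<Longrightarrow> sq_int f"
  by (rule sq_int_compact_support[of f "supp f"]) (auto simp: test_iff smooth_continuous notin_supp)

lemma sq_int_restrict:
  assumes f: "sq_int f" and A: "A \<in> sets lebesgue"
  shows "sq_int (\<lambda>x. if x \<in> A then f x else 0)"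
proof (rule sq_int_dominated[OF _ sq_int_norm_integrable[OF f]])
  have "{x \<in> space lebesgue. x \<in> A} \<in> sets lebesgue" using A by simp
  then show "(\<lambda>x. if x \<in> A then f x else 0) \<in> borel_measurable lebesgue"
    using sq_int_measurable[OF f] by (intro measurable_If) auto
qed auto

lemma abs_L2_cases:
  obtains f where "sq_int f" "u = abs_L2 f"
  using Quotient_rep_reflp[OF Quotient_L2, of u] Quotient_abs_rep[OF Quotient_L2, of u] by metis

lemma abs_L2_add: "sq_int f \<Longrightarrow> sq_int g \<Longrightarrow> abs_L2 (\<lambda>x. f x + g x) = abs_L2 f + abs_L2 g"
  by (subst plus_L2.abs_eq) auto

lemma abs_L2_diff: "sq_int f \<Longrightarrow> sq_int g \<Longrightarrow> abs_L2 (\<lambda>x. f x - g x) = abs_L2 f - abs_L2 g"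
  by (subst minus_L2.abs_eq) auto

lemma abs_L2_scaleR: "sq_int f \<Longrightarrow> abs_L2 (\<lambda>x. c *\<^sub>R f x) = c *\<^sub>R abs_L2 f"
  by (subst scaleR_L2.abs_eq) auto

lemma abs_L2_zero: "abs_L2 (\<lambda>x. 0) = 0" by (simp add: zero_L2_def)

lemma abs_L2_inner: "sq_int f \<Longrightarrow> sq_int g \<Longrightarrow> abs_L2 f \<bullet> abs_L2 g = integral\<^sup>L lebesgue (\<lambda>x. f x \<bullet> g x)"
  by (subst inner_L2.abs_eq) auto

lemma abs_L2_norm: "sq_int f \<Longrightarrow> (norm (abs_L2 f))\<^sup>2 = integral\<^sup>L lebesgue (\<lambda>x. (norm (f x))\<^sup>2)"
  by (simp add: power2_norm_eq_inner abs_L2_inner)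

lemma abs_L2_AE: "sq_int f \<Longrightarrow> L2_AE P (abs_L2 f) \<longleftrightarrow> (AE x in lebesgue. P x (f x))"
  by (subst L2_AE.abs_eq) auto

lemma abs_L2_dev: "sq_int f \<Longrightarrow> dev_L2 (abs_L2 f) = abs_L2 (\<lambda>x. dev (f x))"
  by (subst dev_L2.abs_eq) auto

lemma sq_int_sum: "(\<And>i. i \<in> I \<Longrightarrow> sq_int (f i)) \<Longrightarrow> sq_int (\<lambda>x. \<Sum>i\<in>I. f i x)"
  by (induction I rule: infinite_finite_induct) (auto simp: sq_int_zero sq_int_add)

lemma abs_L2_sum: "(\<And>i. i \<in> I \<Longrightarrow> sq_int (f i)) \<Longrightarrow> abs_L2 (\<lambda>x. \<Sum>i\<in>I. f i x) = (\<Sum>i\<in>I. abs_L2 (f i))"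
  by (induction I rule: infinite_finite_induct) (auto simp: abs_L2_zero abs_L2_add sq_int_sum)

lemma abs_L2_norm_nn: "sq_int f \<Longrightarrow> (\<integral>\<^sup>+x. ennreal ((norm (f x))\<^sup>2) \<partial>lebesgue) = ennreal ((norm (abs_L2 f))\<^sup>2)"
  by (simp add: abs_L2_norm nn_integral_eq_integral sq_int_norm_integrable)

lemma abs_L2_norm_le:
  assumes "sq_int f" "sq_int g" "AE x in lebesgue. norm (f x) \<le> norm (g x)"
  shows "norm (abs_L2 f) \<le> norm (abs_L2 g)"
proof -
  have "(norm (abs_L2 f))\<^sup>2 \<le> (norm (abs_L2 g))\<^sup>2"
    unfolding abs_L2_norm[OF assms(1)] abs_L2_norm[OF assms(2)]
    by (intro integral_mono_AE sq_int_norm_integrable assms) (use assms(3) in \<open>eventually_elim, simp add: power_mono\<close>)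
  then show ?thesis using norm_ge_zero power2_le_imp_le by blast
qed

text \<open>Fatou's lemma for the squared norms. Square integrability of the limit is part of the
  conclusion because in the completeness proof the limit is at first only a pointwise one.\<close>

lemma sq_int_Fatou:
  assumes f: "\<And>n. sq_int (f n)" and g: "g \<in> borel_measurable lebesgue"
    and lim: "AE x in lebesgue. (\<lambda>n. f n x) \<longlonglongrightarrow> g x" and b: "\<And>n. norm (abs_L2 (f n)) \<le> e"
  shows "sq_int g \<and> norm (abs_L2 g) \<le> e"
proof -
  have e: "e \<ge> 0" using b[of 0] norm_ge_zero order_trans by blast
  have "(\<integral>\<^sup>+x. ennreal ((norm (g x))\<^sup>2) \<partial>lebesgue) = (\<integral>\<^sup>+x. liminf (\<lambda>n. ennreal ((norm (f n x))\<^sup>2)) \<partial>lebesgue)"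
  proof (rule nn_integral_cong_AE, use lim in eventually_elim)
    case (elim x)
    have "(\<lambda>n. ennreal ((norm (f n x))\<^sup>2)) \<longlonglongrightarrow> ennreal ((norm (g x))\<^sup>2)"
      by (intro tendsto_ennrealI tendsto_intros elim)
    from lim_imp_Liminf[OF sequentially_bot this] show ?case by simp
  qed
  also have "\<dots> \<le> liminf (\<lambda>n. \<integral>\<^sup>+x. ennreal ((norm (f n x))\<^sup>2) \<partial>lebesgue)"
    by (intro nn_integral_liminf) (use sq_int_measurable[OF f] in measurable)
  also have "\<dots> \<le> liminf (\<lambda>n. ennreal (e\<^sup>2))"
    using b by (intro Liminf_mono always_eventually allI) (simp add: abs_L2_norm_nn[OF f] ennreal_leI power_mono)
  finally have *: "(\<integral>\<^sup>+x. ennreal ((norm (g x))\<^sup>2) \<partial>lebesgue) \<le> ennreal (e\<^sup>2)" by (simp add: Liminf_const)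
  then have "integrable lebesgue (\<lambda>x. (norm (g x))\<^sup>2)"
    by (intro integrableI_nonneg) (use g in \<open>auto simp: less_top[symmetric] top_unique\<close>)
  then have s: "sq_int g" using g by (simp add: sq_int_def)
  with * have "(norm (abs_L2 g))\<^sup>2 \<le> e\<^sup>2" by (simp add: abs_L2_norm_nn)
  then show ?thesis using s e power2_le_imp_le by blast
qed

section \<open>Convergence in the mean, convergence almost everywhere, and completeness\<close>

lemma tendsto_norm_power2_zero_cancel:
  assumes "((\<lambda>n. (norm (f n))\<^sup>2) \<longlongrightarrow> 0) F"
  shows "(f \<longlongrightarrow> 0) F"
  using tendsto_real_sqrt[OF assms] tendsto_norm_zero_cancel[of f F] by simp

lemma L2_dominated_convergence:
  assumes f: "\<And>n. f n \<in> borel_measurable lebesgue" and g: "g \<in> borel_measurable lebesgue"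
    and w: "integrable lebesgue (\<lambda>x. (w x)\<^sup>2)" and b: "\<And>n. AE x in lebesgue. norm (f n x) \<le> w x"
    and lim: "AE x in lebesgue. (\<lambda>n. f n x) \<longlonglongrightarrow> g x"
  shows "sq_int (f n)" and "sq_int g" and "(\<lambda>n. abs_L2 (f n)) \<longlonglongrightarrow> abs_L2 g"
proof -
  show sf: "sq_int (f n)" for n by (rule sq_int_dominated[OF f w b])
  have b': "AE x in lebesgue. \<forall>n. norm (f n x) \<le> w x" using b by (simp add: AE_all_countable)
  have gb: "AE x in lebesgue. norm (g x) \<le> w x"
    using b' lim
  proof eventually_elim
    case (elim x)
    show ?case by (rule LIMSEQ_le_const2[OF tendsto_norm[OF elim(2)]]) (use elim(1) in auto)
  qed
  then show sg: "sq_int g" by (rule sq_int_dominated[OF g w])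
  have "(\<lambda>n. integral\<^sup>L lebesgue (\<lambda>x. (norm (f n x - g x))\<^sup>2)) \<longlonglongrightarrow> integral\<^sup>L lebesgue (\<lambda>x::real^3. 0::real)"
  proof (rule integral_dominated_convergence)
    \<comment> \<open>The limit inherits the bound \<open>w\<close>, so the differences are at most
      \<open>2 * w\<close>.\<close>
    show "integrable lebesgue (\<lambda>x. 4 * (w x)\<^sup>2)" using w by simp
    show "(\<lambda>x. (norm (f n x - g x))\<^sup>2) \<in> borel_measurable lebesgue" for n using f g by measurable
    show "AE x in lebesgue. (\<lambda>n. (norm (f n x - g x))\<^sup>2) \<longlonglongrightarrow> 0"
      using lim by eventually_elim (auto intro!: tendsto_eq_intros simp: LIM_zero_iff)
    show "AE x in lebesgue. norm ((norm (f n x - g x))\<^sup>2) \<le> 4 * (w x)\<^sup>2" for n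
      using b[of n] gb
    proof eventually_elim
      case (elim x)
      have "norm (f n x - g x) \<le> 2 * w x" using elim norm_triangle_ineq4[of "f n x" "g x"] by linarith
      from power_mono[OF this norm_ge_zero, of 2] show ?case by (simp add: power_mult_distrib)
    qed
  qed simp
  then have "(\<lambda>n. (norm (abs_L2 (f n) - abs_L2 g))\<^sup>2) \<longlonglongrightarrow> 0"
    by (simp add: abs_L2_norm[OF sq_int_diff[OF sf sg]] flip: abs_L2_diff[OF sf sg])
  then show "(\<lambda>n. abs_L2 (f n)) \<longlonglongrightarrow> abs_L2 g"
    by (rule LIM_zero_cancel[OF tendsto_norm_power2_zero_cancel])
qed

lemma L2_AE_subsequence:
  assumes f: "\<And>n. sq_int (f n)" and g: "sq_int g" and lim: "(\<lambda>n. abs_L2 (f n)) \<longlonglongrightarrow> abs_L2 g"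
  shows "\<exists>r::nat\<Rightarrow>nat. strict_mono r \<and> (AE x in lebesgue. (\<lambda>n. f (r n) x) \<longlonglongrightarrow> g x)"
proof -
  have "(\<lambda>n. (norm (abs_L2 (f n) - abs_L2 g))\<^sup>2) \<longlonglongrightarrow> 0"
    using lim by (auto intro!: tendsto_eq_intros simp: LIM_zero_iff)
  then have "(\<lambda>n. integral\<^sup>L lebesgue (\<lambda>x. norm ((norm (f n x - g x))\<^sup>2))) \<longlonglongrightarrow> 0"
    by (simp add: abs_L2_norm[OF sq_int_diff[OF f g]] flip: abs_L2_diff[OF f g])
  from tendsto_L1_AE_subseq[OF _ this] obtain r :: "nat \<Rightarrow> nat" where r: "strict_mono r"
    "AE x in lebesgue. (\<lambda>n. (norm (f (r n) x - g x))\<^sup>2) \<longlonglongrightarrow> 0"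
    using sq_int_norm_integrable[OF sq_int_diff[OF f g]] by blast
  from r(2) have "AE x in lebesgue. (\<lambda>n. f (r n) x) \<longlonglongrightarrow> g x"
  proof eventually_elim
    case (elim x)
    then show ?case by (rule LIM_zero_cancel[OF tendsto_norm_power2_zero_cancel])
  qed
  with r(1) show ?thesis by blast
qed

text \<open>The weight 4^n turns the rate 8^(-n) into the summable 2^(-n), so the sum of the
  weighted squared increments is finite almost everywhere. At such a point the increments are at
  most a constant times 2^(-n).\<close>

lemma L2_fast_Cauchy_AE:
  assumes f: "\<And>n. sq_int (f n)" and fast: "\<And>n. (norm (abs_L2 (f (Suc n)) - abs_L2 (f n)))\<^sup>2 \<le> (1/8) ^ n"
  shows "AE x in lebesgue. convergent (\<lambda>n. f n x)"
proof -
  define d where "d n x = 4 ^ n * (norm (f (Suc n) x - f n x))\<^sup>2" for n x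
  have m [measurable]: "d n \<in> borel_measurable lebesgue" for n
    unfolding d_def using sq_int_measurable[OF f] by measurable
  have int: "(\<integral>\<^sup>+x. ennreal (d n x) \<partial>lebesgue) \<le> ennreal ((1/2) ^ n)" for n
  proof -
    have "(\<integral>\<^sup>+x. ennreal (d n x) \<partial>lebesgue) = ennreal (4 ^ n) * (\<integral>\<^sup>+x. ennreal ((norm (f (Suc n) x - f n x))\<^sup>2) \<partial>lebesgue)"
      unfolding d_def using sq_int_measurable[OF f]
      by (subst nn_integral_cmult[symmetric]) (auto simp: ennreal_mult)
    also have "\<dots> = ennreal (4 ^ n * (norm (abs_L2 (f (Suc n)) - abs_L2 (f n)))\<^sup>2)"
      by (simp add: abs_L2_norm_nn[OF sq_int_diff[OF f f]] abs_L2_diff[OF f f] ennreal_mult)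
    also have "\<dots> \<le> ennreal (4 ^ n * (1/8) ^ n)" by (intro ennreal_leI mult_left_mono fast) auto
    also have "(4::real) ^ n * (1/8) ^ n = (1/2) ^ n" by (simp flip: power_mult_distrib)
    finally show ?thesis .
  qed
  have "(\<integral>\<^sup>+x. (\<Sum>n. ennreal (d n x)) \<partial>lebesgue) = (\<Sum>n. \<integral>\<^sup>+x. ennreal (d n x) \<partial>lebesgue)"
    by (rule nn_integral_suminf) measurable
  also have "\<dots> \<le> (\<Sum>n. ennreal ((1/2) ^ n))" by (intro suminf_le int) auto
  also have "\<dots> = ennreal (\<Sum>n. (1/2) ^ n)" by (rule suminf_ennreal2) (auto simp: summable_geometric)
  finally have fin: "(\<integral>\<^sup>+x. (\<Sum>n. ennreal (d n x)) \<partial>lebesgue) \<noteq> \<infinity>" by (auto simp: top_unique)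
  have "AE x in lebesgue. (\<Sum>n. ennreal (d n x)) \<noteq> \<infinity>"
    by (rule nn_integral_noteq_infinite[OF _ fin]) measurable
  then show ?thesis
  proof eventually_elim
    case (elim x)
    obtain s where s: "s \<ge> 0" "(\<Sum>n. ennreal (d n x)) = ennreal s"
      using elim by (cases "\<Sum>n. ennreal (d n x)") auto
    have ds: "d n x \<le> s" for n
    proof -
      have "(\<Sum>i\<in>{n}. ennreal (d i x)) \<le> (\<Sum>n. ennreal (d n x))" by (rule sum_le_suminf) auto
      then show ?thesis using s by (simp add: ennreal_le_iff)
    qed
    have "norm (f (Suc n) x - f n x) \<le> sqrt s * (1/2) ^ n" for n
    proof (rule power2_le_imp_le)
      have "4 ^ n * (norm (f (Suc n) x - f n x))\<^sup>2 \<le> s" using ds[of n] by (simp add: d_def)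
      moreover have "((1/2::real) ^ n)\<^sup>2 = (1/4) ^ n" by (simp add: power2_eq_square flip: power_mult_distrib)
      then have "(sqrt s * (1/2) ^ n)\<^sup>2 = s * (1/4) ^ n" using s by (simp add: power_mult_distrib)
      moreover have "(1/4::real) ^ n * 4 ^ n = 1" by (simp flip: power_mult_distrib)
      then have "s * (1/4) ^ n * 4 ^ n = s" by (simp add: mult.assoc)
      ultimately have "4 ^ n * (norm (f (Suc n) x - f n x))\<^sup>2 \<le> 4 ^ n * (sqrt s * (1/2) ^ n)\<^sup>2"
        by (metis mult.commute)
      then show "(norm (f (Suc n) x - f n x))\<^sup>2 \<le> (sqrt s * (1/2) ^ n)\<^sup>2" by simp
    qed (use s in simp)
    moreover have "summable (\<lambda>n. sqrt s * (1/2) ^ n)" by (intro summable_mult summable_geometric) simp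
    ultimately have "summable (\<lambda>n. f (Suc n) x - f n x)"
      by (meson summable_comparison_test')
    then have "convergent (\<lambda>n. f n x - f 0 x)"
      using sum_lessThan_telescope[of "\<lambda>n. f n x"] by (simp add: summable_iff_convergent)
    from convergent_add[OF this convergent_const[of "f 0 x"]] show ?case by simp
  qed
qed

text \<open>The Riesz-Fischer argument: a rapidly convergent subsequence has a pointwise limit, and
  Fatou's lemma shows that it is also the limit in the mean.\<close>

instance L2 :: (euclidean_space) complete_space
proof
  fix X :: "nat \<Rightarrow> 'a L2"
  assume X: "Cauchy X"
  have ex: "\<exists>N. \<forall>m\<ge>N. \<forall>k\<ge>N. (norm (X m - X k))\<^sup>2 \<le> (1/8) ^ n" for n
  proof -
    have "sqrt ((1/8) ^ n) > 0" by simp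
    from CauchyD[OF X this] obtain N where N: "\<And>m k. m \<ge> N \<Longrightarrow> k \<ge> N \<Longrightarrow> norm (X m - X k) < sqrt ((1/8) ^ n)" by blast
    have "(norm (X m - X k))\<^sup>2 \<le> (1/8) ^ n" if "m \<ge> N" "k \<ge> N" for m k
      using power_mono[OF less_imp_le[OF N[OF that]] norm_ge_zero, of 2] by simp
    then show ?thesis by blast
  qed
  then obtain N where N: "\<And>n m k. m \<ge> N n \<Longrightarrow> k \<ge> N n \<Longrightarrow> (norm (X m - X k))\<^sup>2 \<le> (1/8) ^ n" by metis
  \<comment> \<open>The sum dominates \<open>N n\<close>, and the extra \<open>n\<close> makes the
    index sequence strictly increasing.\<close>
  define r where "r n = n + (\<Sum>i\<le>n. N i)" for n
  have r: "strict_mono r" by (rule strict_monoI_Suc) (simp add: r_def)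
  have rN: "r n \<ge> N n" for n
    unfolding r_def using member_le_sum[of n "{..n}" N] by simp
  have "\<forall>n. \<exists>f. sq_int f \<and> X (r n) = abs_L2 f" using abs_L2_cases by metis
  then obtain f where f: "\<And>n. sq_int (f n)" "\<And>n. X (r n) = abs_L2 (f n)" by metis
  have "AE x in lebesgue. convergent (\<lambda>n. f n x)"
  proof (rule L2_fast_Cauchy_AE[OF f(1)])
    fix n
    have "r (Suc n) \<ge> N n" using rN[of n] strict_monoD[OF r, of n "Suc n"] by simp
    then show "(norm (abs_L2 (f (Suc n)) - abs_L2 (f n)))\<^sup>2 \<le> (1/8) ^ n"
      using N[of n "r (Suc n)" "r n"] rN[of n] f(2) by simp
  qed
  then have lim: "AE x in lebesgue. (\<lambda>n. f n x) \<longlonglongrightarrow> lim (\<lambda>n. f n x)"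
    by eventually_elim (simp add: convergent_LIMSEQ_iff)
  define g where "g x = lim (\<lambda>n. f n x)" for x
  have g: "g \<in> borel_measurable lebesgue"
    unfolding g_def using sq_int_measurable[OF f(1)] by measurable
  \<comment> \<open>Stated for the differences, since \<open>g\<close> itself is not yet known to be
    square integrable.\<close>
  have tail: "\<exists>M. \<forall>n\<ge>M. sq_int (\<lambda>x. g x - f n x) \<and> norm (abs_L2 (\<lambda>x. g x - f n x)) \<le> e" if "e > 0" for e
  proof -
    from CauchyD[OF X that] obtain M where M: "\<And>m k. m \<ge> M \<Longrightarrow> k \<ge> M \<Longrightarrow> norm (X m - X k) < e" by blast
    have "sq_int (\<lambda>x. g x - f n x) \<and> norm (abs_L2 (\<lambda>x. g x - f n x)) \<le> e" if n: "n \<ge> M" for n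
    proof (rule sq_int_Fatou)
      show "sq_int (\<lambda>x. f (k + M) x - f n x)" for k by (intro sq_int_diff f)
      show "(\<lambda>x. g x - f n x) \<in> borel_measurable lebesgue"
        using g sq_int_measurable[OF f(1), of n] by measurable
      show "AE x in lebesgue. (\<lambda>k. f (k + M) x - f n x) \<longlonglongrightarrow> g x - f n x"
        using lim
      proof eventually_elim
        case (elim x)
        show ?case unfolding g_def
          by (rule tendsto_diff[OF LIMSEQ_ignore_initial_segment[OF elim] tendsto_const])
      qed
      show "norm (abs_L2 (\<lambda>x. f (k + M) x - f n x)) \<le> e" for k
        using M[of "r (k + M)" "r n"] n seq_suble[OF r, of n] seq_suble[OF r, of "k + M"]
        by (simp add: abs_L2_diff[OF f(1) f(1)] f(2))
    qed
    then show ?thesis by blast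
  qed
  obtain n where "sq_int (\<lambda>x. g x - f n x)" using tail[of 1] by auto
  from sq_int_add[OF this f(1)[of n]] have sg: "sq_int g" by simp
  have "(\<lambda>n. X (r n)) \<longlonglongrightarrow> abs_L2 g"
  proof (rule LIMSEQ_I)
    fix e :: real assume "e > 0"
    then obtain M where M: "\<And>n. n \<ge> M \<Longrightarrow> norm (abs_L2 (\<lambda>x. g x - f n x)) \<le> e / 2" using tail[of "e/2"] by auto
    have "norm (X (r n) - abs_L2 g) < e" if "n \<ge> M" for n
      using M[OF that] \<open>e > 0\<close> by (simp add: abs_L2_diff[OF sg f(1)] f(2) norm_minus_commute)
    then show "\<exists>no. \<forall>n\<ge>no. norm (X (r n) - abs_L2 g) < e" by blast
  qed
  moreover have "((X \<circ> r) \<longlonglongrightarrow> abs_L2 g) \<Longrightarrow> X \<longlonglongrightarrow> abs_L2 g"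
    using Cauchy_converges_subseq[OF X r] by simp
  ultimately show "convergent X" by (auto simp: convergent_def comp_def)
qed

text \<open>A closure argument in two stages: bounded fields with bounded support are limits of
  continuous ones, and truncation reduces a general field to these.\<close>

lemma L2_dense_continuous:
  fixes u :: "real^3 \<Rightarrow> 'b::euclidean_space"
  assumes u: "sq_int u" and e: "e > 0"
  shows "\<exists>g. continuous_on UNIV g \<and> (\<exists>R. \<forall>x. norm x > R \<longrightarrow> g x = 0) \<and> norm (abs_L2 u - abs_L2 g) < e"
proof -
  let ?S = "closure {abs_L2 g | g :: real^3 \<Rightarrow> 'b. continuous_on UNIV g \<and> (\<exists>R. \<forall>x. norm x > R \<longrightarrow> g x = 0)}"
  have bdd: "abs_L2 f \<in> ?S"
    if f: "f \<in> borel_measurable lebesgue" and b: "\<And>x. norm (f x) \<le> M" "M > 0" and R: "\<And>x. norm x > R \<Longrightarrow> f x = 0" for f :: "real^3 \<Rightarrow> 'b" and M R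
  proof -
    have "f measurable_on UNIV" using f by (simp add: measurable_on_iff_borel_measurable lebesgue_on_UNIV_eq)
    then obtain N g where N: "negligible N" and g: "\<And>n. continuous_on UNIV (g n)"
      and lim: "\<And>x. x \<notin> N \<Longrightarrow> (\<lambda>n. g n x) \<longlonglongrightarrow> f x"
      by (auto simp: measurable_on_def)
    \<comment> \<open>The continuous approximants obtained from measurability carry no bounds. The
      retraction onto the ball of radius \<open>M\<close> and the factor \<open>ch\<close>, which is
      1 up to radius \<open>R\<close> and 0 beyond \<open>R + 1\<close>, put them under a
      square-integrable bound without changing the limit.\<close>
    define ch where "ch x = max 0 (min 1 (R + 1 - norm x))" for x :: "real^3"
    define h where "h n x = ch x *\<^sub>R closest_point (cball 0 M) (g n x)" for n x
    have hc: "continuous_on UNIV (h n)" for n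
      unfolding h_def ch_def using b(2)
      by (intro continuous_intros continuous_on_compose2[OF continuous_on_closest_point] g) auto
    have cp: "norm (closest_point (cball 0 M) y) \<le> M" for y :: 'b
      using closest_point_in_set[of "cball (0::'b) M" y] b(2) by (simp add: dist_norm)
    have h0: "h n x = 0" if "norm x > R + 1" for n x using that by (simp add: h_def ch_def)
    have hb: "norm (h n x) \<le> M * indicator (cball 0 (R+1)) x" for n x
    proof (cases "norm x \<le> R + 1")
      case True
      have "\<bar>ch x\<bar> \<le> 1" by (simp add: ch_def)
      with cp[of "g n x"] have "\<bar>ch x\<bar> * norm (closest_point (cball 0 M) (g n x)) \<le> 1 * M"
        by (intro mult_mono) auto
      with True show ?thesis by (simp add: h_def)
    qed (use h0 in auto)
    have "(\<lambda>n. abs_L2 (h n)) \<longlonglongrightarrow> abs_L2 f"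
    proof (rule L2_dominated_convergence(3))
      show "h n \<in> borel_measurable lebesgue" for n by (rule continuous_borel_lebesgue[OF hc])
      have "(\<lambda>x. (M * indicator (cball 0 (R+1)) x)\<^sup>2) = (\<lambda>x::real^3. M\<^sup>2 * indicator (cball 0 (R+1)) x)"
        by (auto simp: indicator_def)
      then show "integrable lebesgue (\<lambda>x::real^3. (M * indicator (cball 0 (R+1)) x)\<^sup>2)"
        using integrable_indicator_compact[of "cball (0::real^3) (R+1)"] by simp
      have "N \<in> null_sets lebesgue" using N by (simp add: negligible_iff_null_sets)
      then have "AE x in lebesgue. x \<notin> N" by (rule AE_not_in)
      then show "AE x in lebesgue. (\<lambda>n. h n x) \<longlonglongrightarrow> f x"
      proof eventually_elim
        case (elim x)
        have "isCont (closest_point (cball 0 M)) (f x)"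
          using continuous_on_closest_point[of "cball (0::'b) M" UNIV] b(2) by (simp add: continuous_on_eq_continuous_at)
        from isCont_tendsto_compose[OF this lim[OF elim]]
        have "(\<lambda>n. closest_point (cball 0 M) (g n x)) \<longlonglongrightarrow> f x"
          using closest_point_self[of "f x" "cball 0 M"] b(1)[of x] by simp
        then have "(\<lambda>n. h n x) \<longlonglongrightarrow> ch x *\<^sub>R f x" unfolding h_def by (intro tendsto_intros)
        moreover have "ch x *\<^sub>R f x = f x" using R[of x] by (cases "norm x > R") (auto simp: ch_def)
        ultimately show ?case by simp
      qed
    qed (use f hb in auto)
    then show ?thesis
      unfolding closure_sequential
      by (intro exI[of _ "\<lambda>n. abs_L2 (h n)"] conjI allI) (use hc h0 in blast)+
  qed
  \<comment> \<open>Truncation in space and in value at once; at each point it is inactive for large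
    \<open>n\<close>.\<close>
  define f where "f n x = (if x \<in> {x. norm x \<le> real n \<and> norm (u x) \<le> real n} then u x else 0)" for n x
  have "(\<lambda>n. abs_L2 (f n)) \<longlonglongrightarrow> abs_L2 u"
  proof (rule L2_dominated_convergence(3)[OF _ _ sq_int_norm_integrable[OF u]])
    show "f n \<in> borel_measurable lebesgue" for n
    proof -
      have "(\<lambda>x. norm x) \<in> borel_measurable lebesgue"
        by (rule continuous_borel_lebesgue) (intro continuous_intros)
      then have "{x \<in> space lebesgue. norm x \<le> real n \<and> norm (u x) \<le> real n} \<in> sets lebesgue"
        using sq_int_measurable[OF u] by measurable
      then show ?thesis unfolding f_def using sq_int_measurable[OF u] by (intro measurable_If) auto
    qed
    show "u \<in> borel_measurable lebesgue" by (rule sq_int_measurable[OF u])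
    show "AE x in lebesgue. norm (f n x) \<le> norm (u x)" for n by (simp add: f_def)
    show "AE x in lebesgue. (\<lambda>n. f n x) \<longlonglongrightarrow> u x"
    proof (rule AE_I2)
      fix x
      obtain n0 where n0: "real n0 \<ge> max (norm x) (norm (u x))" using real_arch_simple by blast
      have "\<forall>\<^sub>F n in sequentially. f n x = u x"
        by (rule eventually_mono[OF eventually_ge_at_top[of n0]]) (use n0 in \<open>auto simp: f_def\<close>)
      then show "(\<lambda>n. f n x) \<longlonglongrightarrow> u x" by (simp add: tendsto_eventually)
    qed
  qed
  moreover have "abs_L2 (f n) \<in> ?S" for n
  proof (rule bdd)
    show "f n \<in> borel_measurable lebesgue"
    proof -
      have "(\<lambda>x. norm x) \<in> borel_measurable lebesgue"
        by (rule continuous_borel_lebesgue) (intro continuous_intros)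
      then have "{x \<in> space lebesgue. norm x \<le> real n \<and> norm (u x) \<le> real n} \<in> sets lebesgue"
        using sq_int_measurable[OF u] by measurable
      then show ?thesis unfolding f_def using sq_int_measurable[OF u] by (intro measurable_If) auto
    qed
    show "norm (f n x) \<le> real n + 1" for x by (auto simp: f_def)
    show "norm x > real n \<Longrightarrow> f n x = 0" for x by (auto simp: f_def)
  qed simp
  ultimately have "abs_L2 u \<in> ?S" by (metis (no_types, lifting) closed_closure closed_sequentially)
  then obtain y where "y \<in> {abs_L2 g | g :: real^3 \<Rightarrow> 'b. continuous_on UNIV g \<and> (\<exists>R. \<forall>x. norm x > R \<longrightarrow> g x = 0)}"
    "dist y (abs_L2 u) < e" using e unfolding closure_approachable by blast
  then show ?thesis by (auto simp: dist_norm norm_minus_commute)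
qed

section \<open>Mollification\<close>

definition conv :: "(real^3 \<Rightarrow> real) \<Rightarrow> (real^3 \<Rightarrow> 'b::euclidean_space) \<Rightarrow> real^3 \<Rightarrow> 'b" where
  "conv k f x = integral\<^sup>L lebesgue (\<lambda>y. k (x - y) *\<^sub>R f y)"

lemma sq_int_norm: "sq_int f \<Longrightarrow> sq_int (\<lambda>x. norm (f x))"
  unfolding sq_int_def by (auto intro: borel_measurable_norm)

lemma sq_int_reflect:
  assumes "sq_int f"
  shows "sq_int (\<lambda>y. f (x - y))"
  unfolding sq_int_def
proof
  show "(\<lambda>y. f (x - y)) \<in> borel_measurable lebesgue"
    by (rule measurable_compose[OF measurable_lebesgue_minus sq_int_measurable[OF assms]])
  show "integrable lebesgue (\<lambda>y. (norm (f (x - y)))\<^sup>2)"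
    by (rule integrable_reflect[OF sq_int_norm_integrable[OF assms]])
qed

lemma sq_int_scaleR_integrable:
  assumes f: "sq_int (f :: real^3 \<Rightarrow> real)" and g: "sq_int g"
  shows "integrable lebesgue (\<lambda>x. f x *\<^sub>R g x)"
proof (rule Bochner_Integration.integrable_bound)
  show "integrable lebesgue (\<lambda>x. norm (f x) \<bullet> norm (g x))"
    by (intro sq_int_inner_integrable sq_int_norm f g)
  show "(\<lambda>x. f x *\<^sub>R g x) \<in> borel_measurable lebesgue"
    using f g by (simp add: sq_int_def borel_measurable_scaleR)
qed simp

lemma conv_integrable: "sq_int k \<Longrightarrow> sq_int f \<Longrightarrow> integrable lebesgue (\<lambda>y. k (x - y) *\<^sub>R f y)"
  by (intro sq_int_scaleR_integrable sq_int_reflect)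

text \<open>The Cauchy-Schwarz inequality at a fixed point. As the bound is pointwise, convergence
  of fields in the mean already gives convergence of their convolutions at every point.\<close>

lemma norm_conv_le:
  assumes k: "sq_int k" and f: "sq_int f"
  shows "norm (conv k f x) \<le> norm (abs_L2 k) * norm (abs_L2 f)"
proof -
  let ?k = "\<lambda>y. norm (k (x - y))" and ?f = "\<lambda>y. norm (f y)"
  have s: "sq_int ?k" "sq_int ?f" by (intro sq_int_norm sq_int_reflect k f)+
  have "norm (conv k f x) \<le> integral\<^sup>L lebesgue (\<lambda>y. norm (k (x - y) *\<^sub>R f y))"
    unfolding conv_def by (rule integral_norm_bound)
  also have "\<dots> = abs_L2 ?k \<bullet> abs_L2 ?f" using abs_L2_inner[OF s] by simp
  also have "\<dots> \<le> norm (abs_L2 ?k) * norm (abs_L2 ?f)" by (rule norm_cauchy_schwarz)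
  also have "norm (abs_L2 ?f) = norm (abs_L2 f)"
    by (rule power2_eq_imp_eq) (simp_all add: abs_L2_norm s f)
  also have "norm (abs_L2 ?k) = norm (abs_L2 k)"
  proof (rule power2_eq_imp_eq)
    have "(\<lambda>x. (norm (k x))\<^sup>2) \<in> borel_measurable lebesgue" using sq_int_norm_integrable[OF k] by blast
    from integral_reflect[OF this, of x] show "(norm (abs_L2 ?k))\<^sup>2 = (norm (abs_L2 k))\<^sup>2"
      unfolding abs_L2_norm[OF s(1)] abs_L2_norm[OF k] by simp
  qed auto
  finally show ?thesis .
qed

lemma conv_add: "sq_int k \<Longrightarrow> sq_int f \<Longrightarrow> sq_int g \<Longrightarrow> conv k (\<lambda>y. f y + g y) x = conv k f x + conv k g x"
  by (simp add: conv_def scaleR_add_right conv_integrable)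

lemma conv_diff: "sq_int k \<Longrightarrow> sq_int f \<Longrightarrow> sq_int g \<Longrightarrow> conv k (\<lambda>y. f y - g y) x = conv k f x - conv k g x"
  by (simp add: conv_def scaleR_diff_right conv_integrable)

lemma conv_add_kernel: "sq_int k \<Longrightarrow> sq_int l \<Longrightarrow> sq_int f \<Longrightarrow> conv (\<lambda>y. k y + l y) f x = conv k f x + conv l f x"
  by (simp add: conv_def scaleR_add_left conv_integrable)

lemma conv_diff_kernel: "sq_int k \<Longrightarrow> sq_int l \<Longrightarrow> sq_int f \<Longrightarrow> conv (\<lambda>y. k y - l y) f x = conv k f x - conv l f x"
  by (simp add: conv_def scaleR_diff_left conv_integrable)

lemma conv_scaleR_kernel: "conv (\<lambda>y. c * k y) f x = c *\<^sub>R conv k f x"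
  by (simp add: conv_def flip: scaleR_scaleR)

lemma conv_linear:
  assumes "sq_int k" "sq_int f" "bounded_linear h"
  shows "conv k (\<lambda>y. h (f y)) x = h (conv k f x)"
proof -
  interpret bounded_linear h by fact
  show ?thesis
    unfolding conv_def
    using integral_bounded_linear[OF assms(3) conv_integrable[OF assms(1,2)], of x] by (simp add: scaleR)
qed

lemma conv_sum:
  assumes "sq_int k" "\<And>i. i \<in> I \<Longrightarrow> sq_int (f i)"
  shows "conv k (\<lambda>y. \<Sum>i\<in>I. f i y) x = (\<Sum>i\<in>I. conv k (f i) x)"
  using assms(2)
  by (induction I rule: infinite_finite_induct) (auto simp: conv_add assms(1) sq_int_sum conv_def[of k "\<lambda>_. 0"])

lemma tendsto_conv:
  assumes k: "sq_int k" and f: "\<And>n. sq_int (f n)" and g: "sq_int g" and lim: "(\<lambda>n. abs_L2 (f n)) \<longlonglongrightarrow> abs_L2 g"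
  shows "(\<lambda>n. conv k (f n) x) \<longlonglongrightarrow> conv k g x"
proof (rule LIM_zero_cancel, rule Lim_null_comparison)
  show "\<forall>\<^sub>F n in sequentially. norm (conv k (f n) x - conv k g x) \<le> norm (abs_L2 k) * norm (abs_L2 (f n) - abs_L2 g)"
    using norm_conv_le[OF k sq_int_diff[OF f g], where x = x]
    by (intro always_eventually allI) (simp add: conv_diff[OF k f g] abs_L2_diff[OF f g])
  have "(\<lambda>n. norm (abs_L2 k) * norm (abs_L2 (f n) - abs_L2 g)) \<longlonglongrightarrow> norm (abs_L2 k) * 0"
    by (intro tendsto_mult tendsto_const tendsto_norm_zero LIM_zero lim)
  then show "(\<lambda>n. norm (abs_L2 k) * norm (abs_L2 (f n) - abs_L2 g)) \<longlonglongrightarrow> 0" by simp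
qed

section \<open>Differentiation of convolutions\<close>

lemma pd_sum_Basis:
  assumes "smooth f"
  shows "pd d f x = (\<Sum>i\<in>Basis. (d \<bullet> i) *\<^sub>R pd i f x)"
proof -
  interpret linear "\<lambda>d. pd d f x" by (rule linear_pd[OF smooth_differentiable[OF assms]])
  have "pd (\<Sum>i\<in>Basis. (d \<bullet> i) *\<^sub>R i) f x = (\<Sum>i\<in>Basis. (d \<bullet> i) *\<^sub>R pd i f x)"
    by (simp add: sum scale)
  then show ?thesis by (simp add: euclidean_representation)
qed

lemma test_pd_bound:
  fixes f :: "'a::euclidean_space \<Rightarrow> 'b::euclidean_space"
  assumes f: "test \<Omega> f"
  shows "\<exists>C>0. \<forall>d x. norm (pd d f x) \<le> C * norm d"
proof -
  have "\<forall>i. \<exists>C>0. \<forall>x. norm (pd i f x) \<le> C" using test_bounded[OF test_pd[OF f]] by metis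
  then obtain C where C: "\<And>i. C i > 0" "\<And>i x. norm (pd i f x) \<le> C i" by metis
  have "norm (pd d f x) \<le> (\<Sum>i\<in>Basis. C i) * norm d" for d x
  proof -
    have "norm (pd d f x) \<le> (\<Sum>i\<in>Basis. norm ((d \<bullet> i) *\<^sub>R pd i f x))"
      unfolding pd_sum_Basis[OF test_smooth[OF f], of d x] by (rule norm_sum)
    also have "\<dots> \<le> (\<Sum>i\<in>Basis. C i * norm d)"
    proof (rule sum_mono)
      fix i :: 'a assume "i \<in> Basis"
      then have "\<bar>d \<bullet> i\<bar> * norm (pd i f x) \<le> norm d * C i"
        using C(2)[of i x] by (intro mult_mono) (auto intro: Basis_le_norm)
      then show "norm ((d \<bullet> i) *\<^sub>R pd i f x) \<le> C i * norm d" by (simp add: mult.commute)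
    qed
    finally show ?thesis by (simp add: sum_distrib_right)
  qed
  moreover have "(\<Sum>i\<in>(Basis::'a set). C i) > 0" using C(1) by (intro sum_pos) auto
  ultimately show ?thesis by blast
qed

text \<open>The second derivatives of a test function are bounded on the whole space, so the
  remainder is uniform in \<open>x\<close>, as differentiation under the convolution integral
  requires.\<close>

lemma test_taylor:
  fixes f :: "'a::euclidean_space \<Rightarrow> 'b::euclidean_space"
  assumes f: "test \<Omega> f"
  shows "\<exists>C>0. \<forall>h x. norm (f (x + h) - f x - pd h f x) \<le> C * (norm h)\<^sup>2"
proof -
  have sf: "smooth f" by (rule test_smooth[OF f])
  have "\<forall>i. \<exists>C>0. \<forall>d x. norm (pd d (pd i f) x) \<le> C * norm d" using test_pd_bound[OF test_pd[OF f]] by blast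
  then obtain C where C: "\<And>i. C i > 0" "\<And>i d x. norm (pd d (pd i f) x) \<le> C i * norm d" by metis
  define D where "D = (\<Sum>i\<in>(Basis::'a set). C i)"
  have D: "D > 0" unfolding D_def using C(1) by (intro sum_pos) auto
  have b2: "norm (pd h (pd h f) x) \<le> D * (norm h)\<^sup>2" for h x
  proof -
    have "pd h (pd h f) x = pd h (\<lambda>x. \<Sum>i\<in>Basis. (h \<bullet> i) *\<^sub>R pd i f x) x"
      using pd_sum_Basis[OF sf, of h] by presburger
    also have "\<dots> = (\<Sum>i\<in>Basis. (h \<bullet> i) *\<^sub>R pd h (pd i f) x)"
      by (rule pd_eqI) (intro has_derivative_sum has_derivative_scaleR_right smooth_has_derivative smooth_pd sf)
    finally have "norm (pd h (pd h f) x) \<le> (\<Sum>i\<in>Basis. norm ((h \<bullet> i) *\<^sub>R pd h (pd i f) x))"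
      using norm_sum by metis
    also have "\<dots> \<le> (\<Sum>i\<in>Basis. C i * (norm h)\<^sup>2)"
    proof (rule sum_mono)
      fix i :: 'a assume "i \<in> Basis"
      then have "\<bar>h \<bullet> i\<bar> * norm (pd h (pd i f) x) \<le> norm h * (C i * norm h)"
        using C(2)[of h i x] by (intro mult_mono) (auto intro: Basis_le_norm)
      then show "norm ((h \<bullet> i) *\<^sub>R pd h (pd i f) x) \<le> C i * (norm h)\<^sup>2" by (simp add: power2_eq_square mult_ac)
    qed
    finally show ?thesis by (simp add: D_def sum_distrib_right)
  qed
  have "norm (f (x + h) - f x - pd h f x) \<le> D * (norm h)\<^sup>2" for h x
  proof -
    let ?r = "\<lambda>t. f (x + t *\<^sub>R h) - t *\<^sub>R pd h f x"
    have "norm (?r 1 - ?r 0) \<le> D * (norm h)\<^sup>2 * norm (1 - 0 :: real)"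
    proof (rule differentiable_bound[of "{0..1}"])
      fix t :: real assume t: "t \<in> {0..1}"
      have "((\<lambda>s. x + s *\<^sub>R h) has_derivative (\<lambda>s. s *\<^sub>R h)) (at t)"
        by (auto intro!: derivative_eq_intros)
      then have "((\<lambda>s. f (x + s *\<^sub>R h)) has_derivative (\<lambda>s. pd (s *\<^sub>R h) f (x + t *\<^sub>R h))) (at t)"
        by (rule has_derivative_compose[OF _ smooth_has_derivative[OF sf]])
      moreover have "pd (s *\<^sub>R h) f y = s *\<^sub>R pd h f y" for s y
        using linear_scale[OF linear_pd[OF smooth_differentiable[OF sf]]] by blast
      ultimately have "(?r has_derivative (\<lambda>s. s *\<^sub>R pd h f (x + t *\<^sub>R h) - s *\<^sub>R pd h f x)) (at t)"
        by (auto intro!: derivative_eq_intros)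
      then show "(?r has_derivative (\<lambda>s. s *\<^sub>R (pd h f (x + t *\<^sub>R h) - pd h f x))) (at t within {0..1})"
        by (simp add: scaleR_diff_right has_derivative_at_withinI)
      have "norm (pd h f (x + t *\<^sub>R h) - pd h f x) \<le> D * (norm h)\<^sup>2 * \<bar>t\<bar>"
        by (rule test_difference_bound[OF smooth_pd[OF sf] b2])
      also have "\<dots> \<le> D * (norm h)\<^sup>2 * 1" using t D by (intro mult_left_mono) auto
      finally show "onorm (\<lambda>s. s *\<^sub>R (pd h f (x + t *\<^sub>R h) - pd h f x)) \<le> D * (norm h)\<^sup>2"
        by (intro onorm_le) (simp add: mult.commute mult_left_mono)
    qed auto
    then show ?thesis by (simp add: algebra_simps)
  qed
  with D show ?thesis by blast
qed

lemma test_translate: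
  fixes f :: "'a::euclidean_space \<Rightarrow> 'b::real_normed_vector"
  assumes f: "test UNIV f"
  shows "test UNIV (\<lambda>x. f (x + h))"
proof (rule testI[of _ "(\<lambda>x. x - h) ` supp f"])
  show "smooth (\<lambda>x. f (x + h))"
  proof (rule smooth_coinduct[where P = "\<lambda>u. \<exists>g. smooth g \<and> u = (\<lambda>x. g (x + h))"])
    fix u :: "'a \<Rightarrow> 'b" and d x
    assume "\<exists>g. smooth g \<and> u = (\<lambda>x. g (x + h))"
    then obtain g where g: "smooth g" "u = (\<lambda>x. g (x + h))" by blast
    have "((\<lambda>x. x + h) has_derivative (\<lambda>d. d)) (at x)" for x by (auto intro!: derivative_eq_intros)
    from has_derivative_compose[OF this smooth_has_derivative[OF g(1)]]
    have der: "(u has_derivative (\<lambda>d. pd d g (x + h))) (at x)" for x by (simp add: g(2))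
    then show "u differentiable at x" using differentiableI by blast
    have "pd d u = (\<lambda>x. pd d g (x + h))" using pd_eqI[OF der] by blast
    then show "\<exists>g. smooth g \<and> pd d u = (\<lambda>x. g (x + h))" using smooth_pd[OF g(1)] by blast
  qed (use f test_smooth in blast)
  show "compact ((\<lambda>x. x - h) ` supp f)"
    using f by (intro compact_continuous_image continuous_intros) (auto simp: test_iff)
  show "f (x + h) = 0" if "x \<notin> (\<lambda>x. x - h) ` supp f" for x
  proof (rule notin_supp[of _ f], rule notI)
    assume "x + h \<in> supp f"
    then have "x + h - h \<in> (\<lambda>x. x - h) ` supp f" by (rule imageI)
    with that show False by simp
  qed
qed auto

text \<open>The Taylor remainder of \<open>k\<close> is of size |h|^2 and vanishes outside one fixed
  ball, so its L2 norm is O(|h|^2); \<open>norm_conv_le\<close> carries this over to the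
  convolution.\<close>

lemma conv_has_derivative:
  assumes k: "test UNIV k" and f: "sq_int f"
  shows "(conv k f has_derivative (\<lambda>d. conv (pd d k) f x)) (at x)"
  unfolding has_derivative_at_alt
proof (intro conjI allI impI)
  have sk: "smooth k" by (rule test_smooth[OF k])
  have skpd: "sq_int (pd d k)" for d by (rule test_sq_int[OF test_pd[OF k]])
  have "linear (\<lambda>d. conv (pd d k) f x)"
  proof (rule linearI)
    interpret linear "\<lambda>d. pd d k y" for y by (rule linear_pd[OF smooth_differentiable[OF sk]])
    have "pd (a + b) k = (\<lambda>y. pd a k y + pd b k y)" for a b by (auto simp: add)
    then show "conv (pd (a + b) k) f x = conv (pd a k) f x + conv (pd b k) f x" for a b
      by (simp add: conv_add_kernel skpd f)
    have "pd (c *\<^sub>R a) k = (\<lambda>y. c *\<^sub>R pd a k y)" for a c by (auto simp: scale)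
    then show "conv (pd (c *\<^sub>R a) k) f x = c *\<^sub>R conv (pd a k) f x" for a c
      by (simp add: conv_scaleR_kernel)
  qed
  then show "bounded_linear (\<lambda>d. conv (pd d k) f x)" by (simp add: linear_conv_bounded_linear)
  fix e :: real assume e: "e > 0"
  obtain C where C: "C > 0" "\<And>h u. norm (k (u + h) - k u - pd h k u) \<le> C * (norm h)\<^sup>2"
    using test_taylor[OF k] by blast
  obtain R where R: "\<And>y. y \<in> supp k \<Longrightarrow> norm y \<le> R" using test_bounded_supp[OF k] by (auto simp: bounded_iff)
  \<comment> \<open>For |h| < 1 both \<open>k\<close> and its translate by \<open>h\<close> vanish
    outside this ball.\<close>
  define I :: "real^3 \<Rightarrow> real" where "I = indicator (cball 0 (R + 1))"
  have sI: "sq_int I"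
  proof (rule sq_int_dominated[where w = I])
    have i: "integrable lebesgue I" unfolding I_def by (rule integrable_indicator_compact) simp
    then show "I \<in> borel_measurable lebesgue" by auto
    have "(\<lambda>x. (I x)\<^sup>2) = I" by (auto simp: I_def indicator_def)
    with i show "integrable lebesgue (\<lambda>x. (I x)\<^sup>2)" by simp
  qed (auto simp: I_def)
  \<comment> \<open>The summand 1 keeps \<open>M\<close> positive even when the norms
    vanish.\<close>
  define M where "M = C * norm (abs_L2 I) * norm (abs_L2 f) + 1"
  have M: "M > 0" unfolding M_def using C(1) by (intro add_nonneg_pos mult_nonneg_nonneg) auto
  show "\<exists>d>0. \<forall>y. norm (y - x) < d \<longrightarrow> norm (conv k f y - conv k f x - conv (pd (y - x) k) f x) \<le> e * norm (y - x)"
  proof (intro exI[of _ "min 1 (e / M)"] conjI allI impI)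
    show "0 < min 1 (e / M)" using e M by simp
    fix y :: "real^3" assume y: "norm (y - x) < min 1 (e / M)"
    define h where "h = y - x"
    have h: "norm h < 1" "norm h * M < e" using y M by (auto simp: h_def field_simps)
    define \<rho> where "\<rho> u = k (u + h) - k u - pd h k u" for u
    have skh: "sq_int (\<lambda>u. k (u + h))" by (rule test_sq_int[OF test_translate[OF k]])
    have s1: "sq_int (\<lambda>u. k (u + h) - k u)" by (intro sq_int_diff skh test_sq_int[OF k])
    have s\<rho>: "sq_int \<rho>" unfolding \<rho>_def by (intro sq_int_diff skh test_sq_int[OF k] skpd)
    have "conv k f y = conv (\<lambda>u. k (u + h)) f x" by (simp add: conv_def h_def algebra_simps)
    then have eq: "conv k f y - conv k f x - conv (pd h k) f x = conv \<rho> f x"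
      unfolding \<rho>_def by (simp add: conv_diff_kernel s1 skh skpd f test_sq_int[OF k])
    have "norm (\<rho> u) \<le> norm ((C * (norm h)\<^sup>2) *\<^sub>R I u)" for u
    proof (cases "norm u \<le> R + 1")
      case True
      then show ?thesis using C(2)[of u h] C(1) by (simp add: \<rho>_def I_def)
    next
      case False
      have "u \<notin> supp k" using False R by force
      moreover have "u + h \<notin> supp k"
      proof
        assume "u + h \<in> supp k"
        then have "norm (u + h) \<le> R" by (rule R)
        with False h norm_triangle_ineq4[of "u + h" h] show False by simp
      qed
      ultimately have "\<rho> u = 0" by (simp add: \<rho>_def notin_supp pd_notin_supp)
      then show ?thesis by simp
    qed
    then have "norm (abs_L2 \<rho>) \<le> norm (abs_L2 (\<lambda>u. (C * (norm h)\<^sup>2) *\<^sub>R I u))"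
      by (intro abs_L2_norm_le s\<rho> sq_int_scaleR sI) auto
    also have "\<dots> = C * (norm h)\<^sup>2 * norm (abs_L2 I)" using C(1) by (subst abs_L2_scaleR[OF sI]) simp
    finally have "norm (conv \<rho> f x) \<le> C * (norm h)\<^sup>2 * norm (abs_L2 I) * norm (abs_L2 f)"
      using norm_conv_le[OF s\<rho> f, of x] mult_right_mono[of "norm (abs_L2 \<rho>)" _ "norm (abs_L2 f)"] by force
    also have "\<dots> = (norm h)\<^sup>2 * (M - 1)" by (simp add: M_def)
    also have "\<dots> \<le> (norm h)\<^sup>2 * M" by (intro mult_left_mono) auto
    also have "\<dots> = norm h * (norm h * M)" by (simp add: power2_eq_square)
    also have "\<dots> \<le> norm h * e" using h by (intro mult_left_mono) auto
    finally show "norm (conv k f y - conv k f x - conv (pd (y - x) k) f x) \<le> e * norm (y - x)"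
      using eq by (simp add: h_def mult.commute)
  qed
qed

lemma conv_smooth:
  assumes "test UNIV k" "sq_int f"
  shows smooth_conv: "smooth (conv k f)" and pd_conv: "pd d (conv k f) x = conv (pd d k) f x"
proof -
  show "pd d (conv k f) x = conv (pd d k) f x" by (rule pd_eqI[OF conv_has_derivative[OF assms]])
  show "smooth (conv k f)"
  proof (rule smooth_coinduct[where P = "\<lambda>u. \<exists>k. test UNIV k \<and> u = conv k f"])
    fix u :: "real^3 \<Rightarrow> 'a" and d x
    assume "\<exists>k. test UNIV k \<and> u = conv k f"
    then obtain k where k: "test UNIV k" "u = conv k f" by blast
    note der = conv_has_derivative[OF k(1) assms(2), folded k(2)]
    show "u differentiable at x" using der differentiableI by blast
    have "pd d u = conv (pd d k) f" by (rule ext) (rule pd_eqI[OF der])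
    then show "\<exists>k. test UNIV k \<and> pd d u = conv k f" using test_pd[OF k(1)] by blast
  qed (use assms in blast)
qed

lemma conv_eq_0:
  assumes "AE y in lebesgue. y \<notin> S \<longrightarrow> f y = 0" "\<And>y. y \<in> S \<Longrightarrow> k (x - y) = 0"
  shows "conv k f x = 0"
  unfolding conv_def by (rule integral_eq_zero_AE) (use assms(1) in \<open>eventually_elim, use assms(2) in auto\<close>)

lemma test_reflect:
  fixes f :: "'a::euclidean_space \<Rightarrow> 'b::real_normed_vector"
  assumes f: "test UNIV f"
  shows test_reflection: "test UNIV (\<lambda>y. f (x - y))" and pd_reflect: "pd d (\<lambda>y. f (x - y)) y = - pd d f (x - y)"
proof -
  have der: "((\<lambda>y. g (x - y)) has_derivative (\<lambda>d. - pd d g (x - y))) (at y)" if "smooth g" for g :: "'a \<Rightarrow> 'b" and y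
  proof -
    have "((\<lambda>y. x - y) has_derivative (\<lambda>d. - d)) (at y)" by (auto intro!: derivative_eq_intros)
    from has_derivative_compose[OF this smooth_has_derivative[OF that]]
    show ?thesis using linear_neg[OF linear_pd[OF smooth_differentiable[OF that]]] by simp
  qed
  show "pd d (\<lambda>y. f (x - y)) y = - pd d f (x - y)" by (rule pd_eqI[OF der[OF test_smooth[OF f]]])
  show "test UNIV (\<lambda>y. f (x - y))"
  proof (rule testI[of _ "(\<lambda>y. x - y) ` supp f"])
    show "smooth (\<lambda>y. f (x - y))"
    proof (rule smooth_coinduct[where P = "\<lambda>u. \<exists>g. smooth g \<and> u = (\<lambda>y. g (x - y))"])
      fix u :: "'a \<Rightarrow> 'b" and d y
      assume "\<exists>g. smooth g \<and> u = (\<lambda>y. g (x - y))"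
      then obtain g where g: "smooth g" "u = (\<lambda>y. g (x - y))" by blast
      show "u differentiable at y" using der[OF g(1)] g(2) differentiableI by blast
      have "pd d u = (\<lambda>y. (\<lambda>z. - pd d g z) (x - y))" using pd_eqI[OF der[OF g(1)]] g(2) by blast
      then show "\<exists>g. smooth g \<and> pd d u = (\<lambda>y. g (x - y))" using smooth_uminus[OF smooth_pd[OF g(1)]] by blast
    qed (use f test_smooth in blast)
    show "compact ((\<lambda>y. x - y) ` supp f)"
      using f by (intro compact_continuous_image continuous_intros) (auto simp: test_iff)
    show "f (x - y) = 0" if "y \<notin> (\<lambda>y. x - y) ` supp f" for y
    proof (rule notin_supp[of _ f], rule notI)
      assume "x - y \<in> supp f"
      then have "x - (x - y) \<in> (\<lambda>y. x - y) ` supp f" by (rule imageI)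
      with that show False by simp
    qed
  qed auto
qed

text \<open>Integration by parts and the reflection of the kernel each contribute a sign, and the
  two cancel.\<close>

lemma conv_pd_swap:
  assumes k: "test UNIV k" and f: "test UNIV f"
  shows "conv (pd d k) f x = conv k (pd d f) x"
  using integral_by_parts[OF bounded_bilinear_scaleR test_reflection[OF k, of x] test_smooth[OF f], of d]
  by (simp add: conv_def pd_reflect[OF k])

text \<open>A kernel centred at \<open>c\<close> smooths a field and at the same time translates it
  by roughly \<open>c\<close>. Centres off the origin serve at the boundary of \<Omega>, to move
  supports inside.\<close>

definition mollifier :: "real^3 \<Rightarrow> real \<Rightarrow> (real^3 \<Rightarrow> real) \<Rightarrow> bool" where
  "mollifier c r k \<longleftrightarrow> test (ball c r) k \<and> (\<forall>x. k x \<ge> 0) \<and> integral\<^sup>L lebesgue k = 1"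

lemma ex_mollifier:
  assumes "r > 0"
  shows "\<exists>k. mollifier c r k"
proof -
  obtain k :: "real^3 \<Rightarrow> real" where k: "test (ball c r) k" "\<And>x. k x \<ge> 0" "k c > 0"
    using ex_bump[OF assms] by blast
  have i: "integrable lebesgue k" by (rule test_integrable[OF k(1)])
  have "integral\<^sup>L lebesgue k \<noteq> 0"
  proof
    assume "integral\<^sup>L lebesgue k = 0"
    then have "AE x in lebesgue. x \<in> {x. k x = 0}"
      using integral_nonneg_eq_0_iff_AE[OF i] k(2) by simp
    moreover have "closed {x. k x = 0}"
      by (intro closed_Collect_eq smooth_continuous test_smooth[OF k(1)] continuous_intros)
    ultimately have "c \<in> {x. k x = 0}" using mem_closed_if_AE_lebesgue by blast
    with k(3) show False by simp
  qed
  moreover have "integral\<^sup>L lebesgue k \<ge> 0" by (rule integral_nonneg_AE) (use k(2) in auto)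
  ultimately have pos: "integral\<^sup>L lebesgue k > 0" by simp
  have "mollifier c r (\<lambda>x. inverse (integral\<^sup>L lebesgue k) *\<^sub>R k x)"
    unfolding mollifier_def using test_scaleR[OF k(1), of "inverse (integral\<^sup>L lebesgue k)"] pos k(2) by auto
  then show ?thesis by blast
qed

lemma mollifier_test: "mollifier c r k \<Longrightarrow> test UNIV k"
  unfolding mollifier_def using test_mono by blast

lemma mollifier_sq_int: "mollifier c r k \<Longrightarrow> sq_int k"
  using mollifier_test test_sq_int by blast

lemma mollifier_eq_0: "mollifier c r k \<Longrightarrow> x \<notin> ball c r \<Longrightarrow> k x = 0"
  unfolding mollifier_def using test_zero_outside by blast

lemma mollifier_reflect:
  assumes "mollifier c r k"
  shows "integrable lebesgue (\<lambda>y. k (x - y))" "integral\<^sup>L lebesgue (\<lambda>y. k (x - y)) = 1"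
  using integrable_reflect[of k x] integral_reflect[of k x] test_integrable[of UNIV k] smooth_measurable[of k]
    mollifier_test[OF assms] test_smooth assms by (auto simp: mollifier_def)

text \<open>Convexity of the square in the form of a variance: the weighted integral of |f(y) - z|^2
  is nonnegative, and for \<open>z = conv k f x\<close> it equals the difference of the two sides,
  as the weight has total mass 1.\<close>

lemma conv_Jensen:
  assumes m: "mollifier c r k" and f: "sq_int f"
  shows "integrable lebesgue (\<lambda>y. k (x - y) * (norm (f y))\<^sup>2)"
    and "(norm (conv k f x))\<^sup>2 \<le> integral\<^sup>L lebesgue (\<lambda>y. k (x - y) * (norm (f y))\<^sup>2)"
proof -
  have k: "test UNIV k" by (rule mollifier_test[OF m])
  obtain C where C: "C > 0" "\<And>x. norm (k x) \<le> C" using test_bounded[OF k] by blast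
  have mk: "(\<lambda>y. k (x - y)) \<in> borel_measurable lebesgue"
    by (rule measurable_compose[OF measurable_lebesgue_minus smooth_measurable[OF test_smooth[OF k]]])
  show i: "integrable lebesgue (\<lambda>y. k (x - y) * (norm (f y))\<^sup>2)"
  proof (rule Bochner_Integration.integrable_bound)
    show "integrable lebesgue (\<lambda>y. C * (norm (f y))\<^sup>2)" using sq_int_norm_integrable[OF f] by simp
    show "(\<lambda>y. k (x - y) * (norm (f y))\<^sup>2) \<in> borel_measurable lebesgue"
      using mk sq_int_measurable[OF f] by measurable
    show "AE y in lebesgue. norm (k (x - y) * (norm (f y))\<^sup>2) \<le> norm (C * (norm (f y))\<^sup>2)"
      using C by (intro AE_I2) (auto simp: abs_mult intro!: mult_right_mono)
  qed
  define z where "z = conv k f x"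
  have ik: "integrable lebesgue (\<lambda>y. k (x - y) *\<^sub>R f y)" by (rule conv_integrable[OF mollifier_sq_int[OF m] f])
  have "0 \<le> integral\<^sup>L lebesgue (\<lambda>y. k (x - y) * (norm (f y - z))\<^sup>2)"
    by (rule integral_nonneg_AE) (use m in \<open>auto simp: mollifier_def\<close>)
  also have "(\<lambda>y. k (x - y) * (norm (f y - z))\<^sup>2) =
      (\<lambda>y. k (x - y) * (norm (f y))\<^sup>2 - 2 * ((k (x - y) *\<^sub>R f y) \<bullet> z) + k (x - y) * (norm z)\<^sup>2)"
    by (auto simp: power2_norm_eq_inner inner_diff_left inner_diff_right inner_commute algebra_simps)
  also have "integral\<^sup>L lebesgue \<dots> = integral\<^sup>L lebesgue (\<lambda>y. k (x - y) * (norm (f y))\<^sup>2)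
      - 2 * (integral\<^sup>L lebesgue (\<lambda>y. k (x - y) *\<^sub>R f y) \<bullet> z) + (norm z)\<^sup>2"
  proof -
    have "integrable lebesgue (\<lambda>y. (k (x - y) *\<^sub>R f y) \<bullet> z)" by (rule integrable_inner_left[OF ik])
    moreover have "integral\<^sup>L lebesgue (\<lambda>y. (k (x - y) *\<^sub>R f y) \<bullet> z) = integral\<^sup>L lebesgue (\<lambda>y. k (x - y) *\<^sub>R f y) \<bullet> z"
      by (rule integral_inner_left) (use ik in simp)
    ultimately show ?thesis using i mollifier_reflect[OF m, of x] by simp
  qed
  finally show "(norm (conv k f x))\<^sup>2 \<le> integral\<^sup>L lebesgue (\<lambda>y. k (x - y) * (norm (f y))\<^sup>2)"
    by (simp add: z_def conv_def power2_norm_eq_inner)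
qed

text \<open>Integrate the Jensen bound over \<open>x\<close> and exchange the integrals; the kernel
  has total mass 1 in either variable.\<close>

lemma conv_Young:
  assumes m: "mollifier c r k" and f: "sq_int f"
  shows sq_int_conv: "sq_int (conv k f)" and norm_conv_L2_le: "norm (abs_L2 (conv k f)) \<le> norm (abs_L2 f)"
proof -
  have k: "test UNIV k" by (rule mollifier_test[OF m])
  have k0: "k x \<ge> 0" for x using m by (simp add: mollifier_def)
  have kb: "k \<in> borel_measurable borel"
    by (intro borel_measurable_continuous_onI smooth_continuous test_smooth[OF k])
  \<comment> \<open>The exchange of integrals needs joint Borel measurability, so the Lebesgue
    measurable |f|^2 is replaced by a Borel function \<open>h\<close> that equals it almost
    everywhere.\<close>
  have "(\<lambda>y. ennreal ((norm (f y))\<^sup>2)) \<in> borel_measurable (completion lborel)"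
    using sq_int_measurable[OF f] by measurable
  from completion_ex_borel_measurable[OF this] obtain h where h: "h \<in> borel_measurable lborel"
    and fh: "AE y in lborel. ennreal ((norm (f y))\<^sup>2) = h y" by blast
  have h' [measurable]: "h \<in> borel_measurable borel" using h by simp
  have fh': "AE y in lebesgue. ennreal ((norm (f y))\<^sup>2) = h y" using AE_completion[OF fh] .
  have cm: "conv k f \<in> borel_measurable lebesgue" by (rule smooth_measurable[OF smooth_conv[OF k f]])
  have pt: "ennreal ((norm (conv k f x))\<^sup>2) \<le> (\<integral>\<^sup>+y. ennreal (k (x - y)) * h y \<partial>lborel)" for x
  proof -
    have "ennreal ((norm (conv k f x))\<^sup>2) \<le> ennreal (integral\<^sup>L lebesgue (\<lambda>y. k (x - y) * (norm (f y))\<^sup>2))"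
      by (rule ennreal_leI[OF conv_Jensen(2)[OF m f]])
    also have "\<dots> = (\<integral>\<^sup>+y. ennreal (k (x - y) * (norm (f y))\<^sup>2) \<partial>lebesgue)"
      by (rule nn_integral_eq_integral[symmetric, OF conv_Jensen(1)[OF m f]]) (simp add: k0)
    also have "\<dots> = (\<integral>\<^sup>+y. ennreal (k (x - y)) * h y \<partial>lebesgue)"
      by (rule nn_integral_cong_AE) (use fh' in \<open>eventually_elim, simp add: ennreal_mult k0\<close>)
    finally show ?thesis by (simp add: nn_integral_completion)
  qed
  have kshift: "(\<integral>\<^sup>+x. ennreal (k (x - y)) \<partial>lborel) = 1" for y
  proof -
    have i: "integrable lebesgue k" by (rule test_integrable[OF k])
    have "integral\<^sup>L lebesgue (\<lambda>x. k (- y + x)) = 1" "integrable lebesgue (\<lambda>x. k (- y + x))"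
      using integral_translate[of k "- y"] integrable_translate[OF i, of "- y"] i m by (auto simp: mollifier_def)
    then have "(\<integral>\<^sup>+x. ennreal (k (x - y)) \<partial>lebesgue) = 1"
      using nn_integral_eq_integral[of lebesgue "\<lambda>x. k (- y + x)"] k0 by simp
    then show ?thesis by (simp add: nn_integral_completion)
  qed
  have "(\<integral>\<^sup>+x. ennreal ((norm (conv k f x))\<^sup>2) \<partial>lebesgue) = (\<integral>\<^sup>+x. ennreal ((norm (conv k f x))\<^sup>2) \<partial>lborel)"
    by (simp add: nn_integral_completion)
  also have "\<dots> \<le> (\<integral>\<^sup>+x. (\<integral>\<^sup>+y. ennreal (k (x - y)) * h y \<partial>lborel) \<partial>lborel)"
    by (rule nn_integral_mono) (rule pt)
  also have "\<dots> = (\<integral>\<^sup>+y. (\<integral>\<^sup>+x. ennreal (k (x - y)) * h y \<partial>lborel) \<partial>lborel)"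
  proof (rule lborel_pair.Fubini'[symmetric])
    have "(\<lambda>p. fst p - snd p) \<in> borel_measurable (borel :: ((real^3) \<times> (real^3)) measure)"
      by (intro borel_measurable_continuous_onI continuous_intros)
    then have "(\<lambda>p. k (fst p - snd p)) \<in> borel_measurable (borel :: ((real^3) \<times> (real^3)) measure)"
      by (rule measurable_compose[OF _ kb])
    moreover have "(\<lambda>p. h (snd p)) \<in> borel_measurable (borel :: ((real^3) \<times> (real^3)) measure)"
      by (rule measurable_compose[OF _ h']) (intro borel_measurable_continuous_onI continuous_intros)
    ultimately have "(\<lambda>p. ennreal (k (fst p - snd p)) * h (snd p)) \<in> borel_measurable (borel :: ((real^3) \<times> (real^3)) measure)"
      by measurable
    then show "(\<lambda>(x, y). ennreal (k (x - y)) * h y) \<in> borel_measurable (lborel \<Otimes>\<^sub>M lborel)"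
      by (simp add: case_prod_unfold lborel_prod)
  qed
  also have "\<dots> = (\<integral>\<^sup>+y. h y \<partial>lborel)"
  proof (rule nn_integral_cong)
    fix y :: "real^3"
    have "(\<lambda>x. ennreal (k (x - y))) \<in> borel_measurable lborel" using kb by measurable
    then show "(\<integral>\<^sup>+x. ennreal (k (x - y)) * h y \<partial>lborel) = h y"
      by (simp add: nn_integral_multc kshift)
  qed
  also have "\<dots> = (\<integral>\<^sup>+y. h y \<partial>lebesgue)" by (simp add: nn_integral_completion)
  also have "\<dots> = (\<integral>\<^sup>+y. ennreal ((norm (f y))\<^sup>2) \<partial>lebesgue)"
    by (rule nn_integral_cong_AE) (use fh' in \<open>eventually_elim, simp\<close>)
  also have "\<dots> = ennreal ((norm (abs_L2 f))\<^sup>2)" by (rule abs_L2_norm_nn[OF f])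
  finally have *: "(\<integral>\<^sup>+x. ennreal ((norm (conv k f x))\<^sup>2) \<partial>lebesgue) \<le> ennreal ((norm (abs_L2 f))\<^sup>2)" .
  then have "integrable lebesgue (\<lambda>x. (norm (conv k f x))\<^sup>2)"
    by (intro integrableI_nonneg) (use cm in \<open>auto simp: less_top[symmetric] top_unique\<close>)
  then show s: "sq_int (conv k f)" using cm by (simp add: sq_int_def)
  with * have "(norm (abs_L2 (conv k f)))\<^sup>2 \<le> (norm (abs_L2 f))\<^sup>2" by (simp add: abs_L2_norm_nn)
  then show "norm (abs_L2 (conv k f)) \<le> norm (abs_L2 f)" using norm_ge_zero power2_le_imp_le by blast
qed

text \<open>Approximate \<open>f\<close> by a continuous compactly supported \<open>g\<close>. For
  \<open>g\<close> uniform continuity gives a \<delta> that serves all kernels at once, and Young's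
  inequality controls the convolution of \<open>f - g\<close>.\<close>

lemma conv_approx:
  fixes f :: "real^3 \<Rightarrow> 'b::euclidean_space"
  assumes f: "sq_int f" and e: "e > 0"
  shows "\<exists>\<delta>>0. \<forall>c r k. mollifier c r k \<and> ball c r \<subseteq> ball 0 \<delta> \<longrightarrow> norm (abs_L2 (conv k f) - abs_L2 f) < e"
proof -
  obtain g R where g: "continuous_on UNIV g" "\<And>x. norm x > R \<Longrightarrow> g x = 0" "norm (abs_L2 f - abs_L2 g) < e / 3"
    using L2_dense_continuous[OF f, of "e/3"] e by auto
  have sg: "sq_int g" by (rule sq_int_compact_support[OF g(1), of "cball 0 R"]) (use g(2) in auto)
  define I :: "real^3 \<Rightarrow> real" where "I = indicator (cball 0 (R + 1))"
  have sI: "sq_int I"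
  proof (rule sq_int_dominated[where w = I])
    have i: "integrable lebesgue I" unfolding I_def by (rule integrable_indicator_compact) simp
    then show "I \<in> borel_measurable lebesgue" by auto
    have "(\<lambda>x. (I x)\<^sup>2) = I" by (auto simp: I_def indicator_def)
    with i show "integrable lebesgue (\<lambda>x. (I x)\<^sup>2)" by simp
  qed (auto simp: I_def)
  \<comment> \<open>Mollifying \<open>g\<close> changes it by at most \<eta> on the ball of radius
    \<open>R + 1\<close> and nowhere else, which costs \<eta> times the norm of
    \<open>I\<close>.\<close>
  define \<eta> where "\<eta> = e / (3 * (norm (abs_L2 I) + 1))"
  have \<eta>: "\<eta> > 0" unfolding \<eta>_def using e by (intro divide_pos_pos mult_pos_pos add_nonneg_pos) auto
  have \<eta>I: "\<eta> * norm (abs_L2 I) < e / 3"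
  proof -
    have "\<eta> * (norm (abs_L2 I) + 1) = e / 3"
      unfolding \<eta>_def using norm_ge_zero[of "abs_L2 I"] by (simp add: field_simps add_nonneg_eq_0_iff)
    with \<eta> show ?thesis by (simp add: distrib_left)
  qed
  have "uniformly_continuous_on (cball 0 (R + 2)) g"
    by (rule compact_uniformly_continuous[OF continuous_on_subset[OF g(1)]]) auto
  then obtain d where d: "d > 0" "\<And>x y. x \<in> cball 0 (R + 2) \<Longrightarrow> y \<in> cball 0 (R + 2) \<Longrightarrow> dist x y < d \<Longrightarrow> dist (g x) (g y) < \<eta>"
    unfolding uniformly_continuous_on_def using \<eta> by metis
  show ?thesis
  proof (intro exI[of _ "min d 1"] conjI allI impI, goal_cases)
    case 1
    show ?case using d(1) by simp
  next
    case (2 c r k)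
    then have m: "mollifier c r k" and b: "ball c r \<subseteq> ball 0 (min d 1)" by auto
    have k0: "k u \<ge> 0" for u using m by (simp add: mollifier_def)
    have cg: "sq_int (conv k g)" "sq_int (conv k f)" by (intro sq_int_conv[OF m] sg f)+
    have kz: "k u = 0" if "norm u \<ge> min d 1" for u
      by (rule mollifier_eq_0[OF m]) (use that b in \<open>auto simp: subset_iff\<close>)
    have gd: "norm (g y - g x) \<le> \<eta> * I x" if u: "norm (x - y) < min d 1" for x y
    proof (cases "norm x \<le> R + 1")
      case True
      have "norm y \<le> norm x + norm (x - y)" by (metis norm_minus_commute norm_triangle_sub)
      with True u d(2)[of y x] show ?thesis by (simp add: I_def dist_norm norm_minus_commute)
    next
      case False
      have "norm x \<le> norm y + norm (x - y)" by (metis norm_triangle_sub)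
      with False u have "norm y > R" by simp
      with False show ?thesis using g(2)[of x] g(2)[of y] by (simp add: I_def)
    qed
    have "norm (conv k g x - g x) \<le> norm (\<eta> *\<^sub>R I x)" for x
    proof -
      have i: "integrable lebesgue (\<lambda>y. k (x - y) *\<^sub>R g y)" by (rule conv_integrable[OF mollifier_sq_int[OF m] sg])
      have i': "integrable lebesgue (\<lambda>y. k (x - y) *\<^sub>R (g y - g x))"
        using i mollifier_reflect(1)[OF m, of x] by (simp add: scaleR_diff_right)
      have "conv k g x - g x = integral\<^sup>L lebesgue (\<lambda>y. k (x - y) *\<^sub>R (g y - g x))"
        using i mollifier_reflect[OF m, of x] by (simp add: scaleR_diff_right conv_def)
      also have "norm \<dots> \<le> integral\<^sup>L lebesgue (\<lambda>y. k (x - y) * (\<eta> * I x))"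
      proof (rule order_trans[OF integral_norm_bound integral_mono[OF integrable_norm[OF i']]])
        show "integrable lebesgue (\<lambda>y. k (x - y) * (\<eta> * I x))" using mollifier_reflect(1)[OF m, of x] by simp
        fix y
        show "norm (k (x - y) *\<^sub>R (g y - g x)) \<le> k (x - y) * (\<eta> * I x)"
          using gd[of x y] kz[of "x - y"] k0[of "x - y"]
          by (cases "norm (x - y) < min d 1") (auto intro: mult_left_mono)
      qed
      also have "\<dots> = \<eta> * I x" using mollifier_reflect[OF m, of x] by simp
      finally show ?thesis using \<eta> by (simp add: I_def)
    qed
    then have "norm (abs_L2 (\<lambda>x. conv k g x - g x)) \<le> norm (abs_L2 (\<lambda>x. \<eta> *\<^sub>R I x))"
      by (intro abs_L2_norm_le sq_int_diff sq_int_scaleR cg sg sI) auto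
    then have 1: "norm (abs_L2 (conv k g) - abs_L2 g) < e / 3"
      using \<eta>I \<eta> abs_L2_scaleR[OF sI, of \<eta>] by (simp add: abs_L2_diff[OF cg(1) sg])
    have "norm (abs_L2 (conv k f) - abs_L2 (conv k g)) = norm (abs_L2 (conv k (\<lambda>x. f x - g x)))"
      using conv_diff[OF mollifier_sq_int[OF m] f sg] abs_L2_diff[OF cg(2,1)] by presburger
    also have "\<dots> \<le> norm (abs_L2 f - abs_L2 g)"
      using norm_conv_L2_le[OF m sq_int_diff[OF f sg]] by (simp add: abs_L2_diff[OF f sg])
    finally have 2: "norm (abs_L2 (conv k f) - abs_L2 (conv k g)) < e / 3" using g(3) by simp
    have "dist (abs_L2 (conv k f)) (abs_L2 f) \<le> dist (abs_L2 (conv k f)) (abs_L2 (conv k g))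
        + (dist (abs_L2 (conv k g)) (abs_L2 g) + dist (abs_L2 g) (abs_L2 f))"
      by (meson add_left_mono dist_triangle order_trans)
    with 1 2 g(3) show ?case by (simp add: dist_norm norm_minus_commute[of "abs_L2 g"])
  qed
qed

lemma conv_tendsto:
  fixes f :: "real^3 \<Rightarrow> 'b::euclidean_space"
  assumes f: "sq_int f" and m: "\<And>n. mollifier (c n) (r n) (k n)"
    and b: "\<And>n. ball (c n) (r n) \<subseteq> ball 0 (inverse (Suc n))"
  shows "(\<lambda>n. abs_L2 (conv (k n) f)) \<longlonglongrightarrow> abs_L2 f"
proof (rule LIMSEQ_I)
  fix e :: real assume "e > 0"
  from conv_approx[OF f this] obtain \<delta> where \<delta>: "\<delta> > 0"
    "\<And>c r k. mollifier c r k \<Longrightarrow> ball c r \<subseteq> ball 0 \<delta> \<Longrightarrow> norm (abs_L2 (conv k f) - abs_L2 f) < e" by blast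
  obtain N where N: "inverse (real (Suc N)) < \<delta>" using reals_Archimedean[OF \<delta>(1)] by blast
  have "norm (abs_L2 (conv (k n) f) - abs_L2 f) < e" if "n \<ge> N" for n
  proof (rule \<delta>(2)[OF m])
    have "inverse (real (Suc n)) \<le> inverse (real (Suc N))" using that by (simp add: field_simps)
    with N have "inverse (real (Suc n)) \<le> \<delta>" by linarith
    then show "ball (c n) (r n) \<subseteq> ball 0 \<delta>" by (rule order_trans[OF b subset_ball])
  qed
  then show "\<exists>no. \<forall>n\<ge>no. norm (abs_L2 (conv (k n) f) - abs_L2 f) < e" by blast
qed

section \<open>Test fields and cutoffs obtained by mollification\<close>

lemma conv_test:
  fixes f :: "real^3 \<Rightarrow> 'b::euclidean_space"
  assumes f: "sq_int f" and S: "compact S" "AE y in lebesgue. y \<notin> S \<longrightarrow> f y = 0"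
    and m: "mollifier c r k" and sub: "\<And>y u. y \<in> S \<Longrightarrow> u \<in> cball c r \<Longrightarrow> y + u \<in> \<Omega>"
  shows "test \<Omega> (conv k f)"
proof (rule testI[where K = "{y + u | y u. y \<in> S \<and> u \<in> cball c r}"])
  show "smooth (conv k f)" by (rule smooth_conv[OF mollifier_test[OF m] f])
  show "compact {y + u | y u. y \<in> S \<and> u \<in> cball c r}" by (rule compact_sums[OF S(1)]) simp
  show "{y + u | y u. y \<in> S \<and> u \<in> cball c r} \<subseteq> \<Omega>" using sub by blast
  fix x assume x: "x \<notin> {y + u | y u. y \<in> S \<and> u \<in> cball c r}"
  show "conv k f x = 0"
  proof (rule conv_eq_0[OF S(2)])
    fix y assume "y \<in> S"
    then have "x - y \<notin> cball c r" using x by force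
    then show "k (x - y) = 0" by (intro mollifier_eq_0[OF m]) auto
  qed
qed

text \<open>Exhaust \<Omega> by compact sets, cut the field off there, and mollify with radii below
  the distance to the complement.\<close>

lemma test_dense_L2:
  fixes f :: "real^3 \<Rightarrow> 'b::euclidean_space"
  assumes f: "sq_int f" and \<Omega>: "open \<Omega>" and out: "AE x in lebesgue. x \<notin> \<Omega> \<longrightarrow> f x = 0"
  shows "abs_L2 f \<in> closure {abs_L2 \<phi> | \<phi>. test \<Omega> \<phi>}"
proof -
  define K where "K n = cball 0 (real n) - (\<Union>y\<in>-\<Omega>. ball y (inverse (Suc n)))" for n
  have K: "compact (K n)" for n unfolding K_def by (intro compact_diff) auto
  define g where "g n x = (if x \<in> K n then f x else 0)" for n x
  have sg: "sq_int (g n)" for n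
    unfolding g_def by (rule sq_int_restrict[OF f]) (simp add: K borel_compact)
  have "(\<lambda>n. abs_L2 (g n)) \<longlonglongrightarrow> abs_L2 f"
  proof (rule L2_dominated_convergence(3)[OF sq_int_measurable[OF sg] sq_int_measurable[OF f] sq_int_norm_integrable[OF f]])
    show "AE x in lebesgue. norm (g n x) \<le> norm (f x)" for n by (simp add: g_def)
    show "AE x in lebesgue. (\<lambda>n. g n x) \<longlonglongrightarrow> f x"
      using out
    proof eventually_elim
      case (elim x)
      show ?case
      proof (cases "x \<in> \<Omega>")
        case True
        obtain e where e: "e > 0" "ball x e \<subseteq> \<Omega>" using \<Omega> True open_contains_ball by blast
        obtain N where N: "inverse (real (Suc N)) < e" using reals_Archimedean[OF e(1)] by blast
        obtain M where M: "norm x \<le> real M" using real_arch_simple by blast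
        have "x \<in> K n" if n: "n \<ge> max M N" for n
        proof -
          have "inverse (real (Suc n)) \<le> inverse (real (Suc N))" using n by (simp add: field_simps)
          with N have le: "inverse (real (Suc n)) < e" by linarith
          have "dist y x \<ge> inverse (real (Suc n))" if "y \<notin> \<Omega>" for y
          proof (rule ccontr)
            assume "\<not> ?thesis"
            with le have "y \<in> ball x e" by (simp add: dist_commute)
            with e(2) that show False by blast
          qed
          moreover have "norm x \<le> real n" using M n by simp
          ultimately show ?thesis by (force simp: K_def)
        qed
        then have "\<forall>\<^sub>F n in sequentially. g n x = f x"
          unfolding eventually_sequentially by (intro exI[of _ "max M N"]) (simp add: g_def)
        then show ?thesis by (rule tendsto_eventually)
      next
        case False
        with elim have "g n x = f x" for n by (simp add: g_def)
        then show ?thesis by simp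
      qed
    qed
  qed
  moreover have "abs_L2 (g n) \<in> closure {abs_L2 \<phi> | \<phi>. test \<Omega> \<phi>}" for n
  proof -
    \<comment> \<open>Strictly below 1/(n+1), a lower bound for the distance from \<open>K n\<close>
      to the complement of \<Omega>, and tending to 0 with \<open>j\<close>.\<close>
    let ?r = "\<lambda>j. inverse (real (Suc (Suc (n + j))))"
    have "\<forall>j. \<exists>k. mollifier 0 (?r j) k" by (intro allI ex_mollifier) simp
    then obtain k where m: "\<And>j. mollifier 0 (?r j) (k j)" by metis
    have "(\<lambda>j. abs_L2 (conv (k j) (g n))) \<longlonglongrightarrow> abs_L2 (g n)"
      by (rule conv_tendsto[OF sg m]) (intro subset_ball, simp add: field_simps)
    moreover have "test \<Omega> (conv (k j) (g n))" for j
    proof (rule conv_test[OF sg K _ m])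
      show "AE y in lebesgue. y \<notin> K n \<longrightarrow> g n y = 0" by (simp add: g_def)
      fix y u :: "real^3" assume y: "y \<in> K n" and u: "u \<in> cball 0 (?r j)"
      have "dist (y + u) y < inverse (real (Suc n))"
      proof -
        have "?r j < inverse (real (Suc n))" by (simp add: field_simps)
        moreover have "norm u \<le> ?r j" using u by (simp del: of_nat_Suc)
        ultimately have "norm u < inverse (real (Suc n))" by linarith
        then show ?thesis by (simp add: dist_norm)
      qed
      with y show "y + u \<in> \<Omega>" by (auto simp: K_def)
    qed
    ultimately show ?thesis
      unfolding closure_sequential by (intro exI[of _ "\<lambda>j. abs_L2 (conv (k j) (g n))"]) blast
  qed
  ultimately show ?thesis by (metis (no_types, lifting) closed_closure closed_sequentially)
qed

text \<open>Mollify the indicator of the closed \<open>e / 2\<close>-neighbourhood of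
  \<open>K\<close> with radius \<open>e / 4\<close>: the support stays within distance
  \<open>e\<close> of \<open>K\<close>, and the value is 1 up to distance
  \<open>e / 4\<close>.\<close>

lemma ex_cutoff:
  fixes K U :: "(real^3) set"
  assumes K: "compact K" and U: "open U" "K \<subseteq> U"
  shows "\<exists>\<phi> :: real^3 \<Rightarrow> real. test U \<phi> \<and> (\<exists>V. open V \<and> K \<subseteq> V \<and> (\<forall>x\<in>V. \<phi> x = 1))"
proof (cases "K = {}")
  case True
  then show ?thesis by (intro exI[of _ "\<lambda>_. 0"] conjI exI[of _ "{}"]) (auto simp: test_zero)
next
  case False
  obtain e where e: "e > 0" "{x. infdist x K \<le> e} \<subseteq> U"
    using compact_in_open_separated[OF False K U] by blast
  define L where "L = {x. infdist x K \<le> e / 2}"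
  have L: "compact L" unfolding L_def using e by (intro compact_infdist_le False K) auto
  define f :: "real^3 \<Rightarrow> real" where "f x = (if x \<in> L then 1 else 0)" for x
  have sf: "sq_int f"
  proof (rule sq_int_dominated[where w = "indicator L"])
    have i: "integrable lebesgue (indicator L :: real^3 \<Rightarrow> real)" by (rule integrable_indicator_compact[OF L])
    have "f = indicator L" by (auto simp: f_def)
    then show "f \<in> borel_measurable lebesgue" using i by auto
    have "(\<lambda>x. (indicator L x)\<^sup>2) = (indicator L :: real^3 \<Rightarrow> real)" by (auto simp: indicator_def)
    with i show "integrable lebesgue (\<lambda>x. (indicator L x :: real)\<^sup>2)" by simp
    show "AE x in lebesgue. norm (f x) \<le> indicator L x" by (simp add: f_def)
  qed
  obtain k where m: "mollifier 0 (e / 4) k" using ex_mollifier[of "e/4"] e by auto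
  have "test U (conv k f)"
  proof (rule conv_test[OF sf L _ m])
    show "AE y in lebesgue. y \<notin> L \<longrightarrow> f y = 0" by (simp add: f_def)
    fix y u :: "real^3" assume y: "y \<in> L" and u: "u \<in> cball 0 (e / 4)"
    have "infdist (y + u) K \<le> infdist y K + dist (y + u) y" by (rule infdist_triangle)
    with y u e(1) have "infdist (y + u) K \<le> e" by (simp add: L_def dist_norm)
    then show "y + u \<in> U" using e(2) by blast
  qed
  moreover have "conv k f x = 1" if x: "x \<in> (\<Union>z\<in>K. ball z (e / 4))" for x
  proof -
    obtain z where z: "z \<in> K" "dist x z < e / 4" using x by (auto simp: dist_commute)
    have "conv k f x = integral\<^sup>L lebesgue (\<lambda>y. k (x - y))"
      unfolding conv_def
    proof (rule Bochner_Integration.integral_cong[OF refl])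
      fix y
      show "k (x - y) *\<^sub>R f y = k (x - y)"
      proof (cases "y \<in> L")
        case False
        have "infdist y K \<le> dist y z" by (rule infdist_le[OF z(1)])
        also have "\<dots> \<le> dist x y + dist x z" by (metis dist_commute dist_triangle)
        finally have "dist x y > e / 4" using False z(2) by (simp add: L_def)
        then have "k (x - y) = 0" by (intro mollifier_eq_0[OF m]) (simp add: dist_norm norm_minus_commute)
        then show ?thesis by simp
      qed (simp add: f_def)
    qed
    also have "\<dots> = 1" by (rule mollifier_reflect(2)[OF m])
    finally show ?thesis .
  qed
  ultimately show ?thesis
    using e by (intro exI[of _ "conv k f"] conjI exI[of _ "\<Union>z\<in>K. ball z (e / 4)"]) auto
qed

text \<open>A homogeneous first-order operator with constant coefficients, given by its symbol:
  \<open>A i\<close> acts on the derivative in direction \<open>i\<close>. Gradient, curl and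
  symmetric curl are instances, so that one commutation rule with convolution serves all of
  them.\<close>

definition dop :: "('a::euclidean_space \<Rightarrow> 'b \<Rightarrow> 'c) \<Rightarrow> ('a \<Rightarrow> 'b::real_normed_vector) \<Rightarrow> 'a \<Rightarrow> 'c::real_normed_vector" where
  "dop A f x = (\<Sum>i\<in>Basis. A i (pd i f x))"

lemma test_dop:
  "test \<Omega> f \<Longrightarrow> (\<And>i. bounded_linear (A i)) \<Longrightarrow> test \<Omega> (dop A f)"
  unfolding dop_def[abs_def] by (rule test_sum, rule test_linear[OF test_pd]) simp_all

lemma conv_dop_test:
  fixes f :: "real^3 \<Rightarrow> 'b::euclidean_space" and A :: "real^3 \<Rightarrow> 'b \<Rightarrow> 'c::euclidean_space"
  assumes k: "test UNIV k" and f: "test UNIV f" and A: "\<And>i. bounded_linear (A i)"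
  shows "dop A (conv k f) x = conv k (dop A f) x"
proof -
  have sk: "sq_int k" and sf: "\<And>i. sq_int (pd i f)" by (rule test_sq_int[OF k], rule test_sq_int[OF test_pd[OF f]])
  have "conv k (dop A f) x = (\<Sum>i\<in>Basis. conv k (\<lambda>y. A i (pd i f y)) x)"
    unfolding dop_def[abs_def] by (rule conv_sum[OF sk]) (rule sq_int_bounded_linear[OF sf A])
  also have "\<dots> = (\<Sum>i\<in>Basis. A i (conv k (pd i f) x))"
    by (simp add: conv_linear[OF sk sf A])
  also have "\<dots> = dop A (conv k f) x"
    by (simp add: dop_def pd_conv[OF k test_sq_int[OF f]] conv_pd_swap[OF k f])
  finally show ?thesis by simp
qed

text \<open>At a fixed point both sides depend continuously on the pair of fields, so the identity
  passes from test fields to the closure of the graph. Mollifying a field in the domain of a closed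
  operator thus gives smooth fields on which the operator acts classically.\<close>

lemma conv_dop:
  fixes f :: "real^3 \<Rightarrow> 'b::euclidean_space" and A :: "real^3 \<Rightarrow> 'b \<Rightarrow> 'c::euclidean_space"
  assumes k: "test UNIV k" and A: "\<And>i. bounded_linear (A i)"
    and f: "sq_int f" and g: "sq_int g"
    and cl: "(abs_L2 f, abs_L2 g) \<in> closure {(abs_L2 \<phi>, abs_L2 (dop A \<phi>)) | \<phi>. test UNIV \<phi>}"
  shows "dop A (conv k f) x = conv k g x"
proof -
  from cl obtain X where X: "\<And>n. X n \<in> {(abs_L2 \<phi>, abs_L2 (dop A \<phi>)) | \<phi>. test UNIV \<phi>}"
    and lim: "X \<longlonglongrightarrow> (abs_L2 f, abs_L2 g)" unfolding closure_sequential by blast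
  have "\<forall>n. \<exists>\<phi>. test UNIV \<phi> \<and> X n = (abs_L2 \<phi>, abs_L2 (dop A \<phi>))" using X by blast
  then obtain \<phi> where \<phi>: "\<And>n. test UNIV (\<phi> n)" "\<And>n. X n = (abs_L2 (\<phi> n), abs_L2 (dop A (\<phi> n)))" by metis
  have l1: "(\<lambda>n. abs_L2 (\<phi> n)) \<longlonglongrightarrow> abs_L2 f" and l2: "(\<lambda>n. abs_L2 (dop A (\<phi> n))) \<longlonglongrightarrow> abs_L2 g"
    using tendsto_fst[OF lim] tendsto_snd[OF lim] by (simp_all add: \<phi>(2))
  have s1: "sq_int (\<phi> n)" and s2: "sq_int (dop A (\<phi> n))" for n
    using test_sq_int[OF \<phi>(1)] test_sq_int[OF test_dop[OF \<phi>(1) A]] by auto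
  have "(\<lambda>n. conv k (dop A (\<phi> n)) x) \<longlonglongrightarrow> conv k g x"
    by (rule tendsto_conv[OF test_sq_int[OF k] s2 g l2])
  moreover have "(\<lambda>n. dop A (conv k (\<phi> n)) x) \<longlonglongrightarrow> dop A (conv k f) x"
    unfolding dop_def
  proof (rule tendsto_sum)
    fix i :: "real^3"
    have "(\<lambda>n. A i (conv (pd i k) (\<phi> n) x)) \<longlonglongrightarrow> A i (conv (pd i k) f x)"
      by (rule bounded_linear.tendsto[OF A tendsto_conv[OF test_sq_int[OF test_pd[OF k]] s1 f l1]])
    then show "(\<lambda>n. A i (pd i (conv k (\<phi> n)) x)) \<longlonglongrightarrow> A i (pd i (conv k f) x)"
      by (simp add: pd_conv[OF k s1] pd_conv[OF k f])
  qed
  ultimately show ?thesis using LIMSEQ_unique conv_dop_test[OF k \<phi>(1) A] by simp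
qed

section \<open>Compactly supported potentials\<close>

lemma pd_diff: "f differentiable (at x) \<Longrightarrow> g differentiable (at x) \<Longrightarrow>
    pd d (\<lambda>x. f x - g x) x = pd d f x - pd d g x"
  by (rule pd_eqI) (intro has_derivative_diff differentiable_has_derivative_pd)

lemma pd_uminus: "f differentiable (at x) \<Longrightarrow> pd d (\<lambda>x. - f x) x = - pd d f x"
  by (rule pd_eqI) (intro has_derivative_minus differentiable_has_derivative_pd)

abbreviation D :: "3 \<Rightarrow> (real^3 \<Rightarrow> 'b::real_normed_vector) \<Rightarrow> real^3 \<Rightarrow> 'b" where
  "D i \<equiv> pd (axis i 1)"

lemma pd_nth: "smooth v \<Longrightarrow> pd d (\<lambda>x. v x $ i) = (\<lambda>x. pd d v x $ i)"
  by (rule ext) (rule pd_linear[OF _ bounded_linear_vec_nth])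

lemma smooth_nth: "smooth v \<Longrightarrow> smooth (\<lambda>x. v x $ i)"
  by (rule smooth_linear[OF _ bounded_linear_vec_nth])

lemma test_nth: "test \<Omega> v \<Longrightarrow> test \<Omega> (\<lambda>x. v x $ i)"
  by (rule test_linear[OF _ bounded_linear_vec_nth])

lemma bounded_linear_axis: "bounded_linear (\<lambda>c::'b::euclidean_space. axis i c :: 'b^'n)"
  unfolding linear_conv_bounded_linear[symmetric]
  by (rule linearI) (auto simp: vec_eq_iff axis_def)

lemma vec_eq_sum_axis: "v = (\<Sum>i\<in>UNIV. axis i (v $ i))"
  by (auto simp: vec_eq_iff axis_def if_distrib sum.delta cong: if_cong)

lemma smooth_vec:
  fixes v :: "'a::euclidean_space \<Rightarrow> 'b::euclidean_space^'n"
  assumes "\<And>i. smooth (\<lambda>x. v x $ i)"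
  shows "smooth v"
proof -
  have "smooth (\<lambda>x. \<Sum>i\<in>UNIV. axis i (v x $ i))"
    by (rule smooth_sum, rule smooth_linear[OF assms bounded_linear_axis])
  then show ?thesis by (simp flip: vec_eq_sum_axis)
qed

lemma test_vec:
  fixes v :: "'a::euclidean_space \<Rightarrow> 'b::euclidean_space^'n"
  assumes "\<And>i. test \<Omega> (\<lambda>x. v x $ i)"
  shows "test \<Omega> v"
proof -
  have "test \<Omega> (\<lambda>x. \<Sum>i\<in>UNIV. axis i (v x $ i))"
    by (rule test_sum, rule test_linear[OF assms bounded_linear_axis])
  then show ?thesis by (simp flip: vec_eq_sum_axis)
qed

lemma Grad_nth: "Grad v x $ i $ j = D j v x $ i"
  by (simp add: Grad_def jacobian_def matrix_def pd_def)

lemma curl_nth: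
  "curl v x $ 1 = D 2 v x $ 3 - D 3 v x $ 2"
  "curl v x $ 2 = D 3 v x $ 1 - D 1 v x $ 3"
  "curl v x $ 3 = D 1 v x $ 2 - D 2 v x $ 1"
  by (simp_all add: curl_def Let_def Grad_nth)

lemma Basis_vec3: "Basis = (\<lambda>i. axis i (1::real)) ` (UNIV :: 3 set)"
  by (auto simp: Basis_vec_def)

lemma sum_Basis3: "(\<Sum>b\<in>Basis. F b) = F (axis 1 1) + F (axis 2 1) + F (axis 3 (1::real) :: real^3)"
proof -
  have "inj_on (\<lambda>i. axis i (1::real)) (UNIV :: 3 set)" by (auto simp: inj_on_def axis_eq_axis)
  then show ?thesis unfolding Basis_vec3 by (simp add: sum.reindex sum_3)
qed

lemma pd_expand:
  fixes f :: "real^3 \<Rightarrow> 'b::real_normed_vector"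
  shows "smooth f \<Longrightarrow> pd d f x = d $ 1 *\<^sub>R D 1 f x + d $ 2 *\<^sub>R D 2 f x + d $ 3 *\<^sub>R D 3 f x"
  by (subst pd_sum_Basis) (auto simp: sum_Basis3 inner_axis)

lemma curl_free_symmetric:
  assumes "smooth u" "curl u x = 0"
  shows "pd a u x \<bullet> b = pd b u x \<bullet> a"
proof -
  have "D 2 u x $ 3 = D 3 u x $ 2" "D 3 u x $ 1 = D 1 u x $ 3" "D 1 u x $ 2 = D 2 u x $ 1"
    using assms(2) curl_nth[of u x] by (simp_all add: vec_eq_iff forall_3)
  then show ?thesis
    by (simp add: pd_expand[OF assms(1), of a] pd_expand[OF assms(1), of b] inner_vec_def sum_3 algebra_simps)
qed

text \<open>The Poincare lemma along rays from the origin. Outside the ball \<open>u\<close>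
  vanishes and the complement is connected, so the potential is constant there; subtracting the
  constant makes its support compact.\<close>

lemma curl_free_potential:
  assumes u: "test (cball 0 R) u" and curl: "\<And>x. curl u x = 0"
  shows "\<exists>f. test (cball 0 R) f \<and> (\<forall>x d. pd d f x = u x \<bullet> d)"
proof -
  have su: "smooth u" by (rule test_smooth[OF u])
  \<comment> \<open>The derivative of t u(t x) in t. As the Jacobian of \<open>u\<close> is
    symmetric, it is also the gradient in x of the integrand u(t x) \<bullet> x; integrating over t
    from 0 to 1 therefore gives u(x).\<close>
  define G where "G x t = t *\<^sub>R pd x u (t *\<^sub>R x) + u (t *\<^sub>R x)" for x t
  define f0 where "f0 x = integral {0..1} (\<lambda>t. u (t *\<^sub>R x) \<bullet> x)" for x
  have cG: "continuous_on UNIV (\<lambda>p. G (fst p) (snd p))"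
  proof -
    have c: "continuous_on UNIV (\<lambda>p. h (snd p *\<^sub>R fst p))" if "smooth h" for h :: "real^3 \<Rightarrow> real^3"
      by (rule continuous_on_compose2[OF smooth_continuous[OF that, of UNIV]]) (auto intro!: continuous_intros)
    have eq: "(\<lambda>p. G (fst p) (snd p)) = (\<lambda>p. snd p *\<^sub>R (fst p $ 1 *\<^sub>R D 1 u (snd p *\<^sub>R fst p)
        + fst p $ 2 *\<^sub>R D 2 u (snd p *\<^sub>R fst p) + fst p $ 3 *\<^sub>R D 3 u (snd p *\<^sub>R fst p)) + u (snd p *\<^sub>R fst p))"
      unfolding G_def by (rule ext) (subst pd_expand[OF su], rule refl)
    show ?thesis
      unfolding eq
      by (intro continuous_on_add continuous_on_scaleR continuous_on_component continuous_on_fst continuous_on_snd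
          continuous_on_id c[OF smooth_pd[OF su]] c[OF su])
  qed
  have der: "(f0 has_derivative (\<lambda>d. u x \<bullet> d)) (at x)" for x
  proof -
    have "((\<lambda>x. integral (cbox 0 1) (\<lambda>t. u (t *\<^sub>R x) \<bullet> x)) has_derivative
        blinfun_apply (integral (cbox 0 1) (\<lambda>t. blinfun_inner_right (G x t)))) (at x within UNIV)"
    proof (rule leibniz_rule)
      fix y :: "real^3" and t :: real
      have "((\<lambda>y. t *\<^sub>R y) has_derivative (\<lambda>d. t *\<^sub>R d)) (at y)" by (auto intro!: derivative_eq_intros)
      from has_derivative_compose[OF this smooth_has_derivative[OF su]]
      have "((\<lambda>y. u (t *\<^sub>R y)) has_derivative (\<lambda>d. pd (t *\<^sub>R d) u (t *\<^sub>R y))) (at y)" .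
      from has_derivative_inner[OF this has_derivative_ident]
      have "((\<lambda>y. u (t *\<^sub>R y) \<bullet> y) has_derivative (\<lambda>d. u (t *\<^sub>R y) \<bullet> d + pd (t *\<^sub>R d) u (t *\<^sub>R y) \<bullet> y)) (at y)" .
      moreover have "u (t *\<^sub>R y) \<bullet> d + pd (t *\<^sub>R d) u (t *\<^sub>R y) \<bullet> y = G y t \<bullet> d" for d
        using linear_scale[OF linear_pd[OF smooth_differentiable[OF su]], of t d "t *\<^sub>R y"]
          curl_free_symmetric[OF su curl, of d "t *\<^sub>R y" y]
        by (simp add: G_def inner_add_left)
      ultimately show "((\<lambda>y. u (t *\<^sub>R y) \<bullet> y) has_derivative blinfun_apply (blinfun_inner_right (G y t))) (at y within UNIV)"
        by simp
    next
      fix y :: "real^3"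
      show "(\<lambda>t. u (t *\<^sub>R y) \<bullet> y) integrable_on cbox 0 (1::real)"
        by (intro integrable_continuous continuous_intros continuous_on_compose2[OF smooth_continuous[OF su, of UNIV]]) auto
    next
      show "continuous_on (UNIV \<times> cbox 0 (1::real)) (\<lambda>(y, t). blinfun_inner_right (G y t))"
        unfolding case_prod_unfold
        by (intro bounded_linear.continuous_on[OF bounded_linear_blinfun_inner_right] continuous_on_subset[OF cG]) auto
    qed auto
    moreover have "integral (cbox 0 1) (\<lambda>t. blinfun_inner_right (G x t)) = blinfun_inner_right (u x)"
    proof -
      have "((\<lambda>t. G x t) has_integral (1 *\<^sub>R u (1 *\<^sub>R x) - 0 *\<^sub>R u (0 *\<^sub>R x))) {0..1}"
      proof (rule fundamental_theorem_of_calculus)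
        fix t :: real
        have "((\<lambda>t. t *\<^sub>R x) has_derivative (\<lambda>s. s *\<^sub>R x)) (at t)" by (auto intro!: derivative_eq_intros)
        from has_derivative_compose[OF this smooth_has_derivative[OF su]]
        have "((\<lambda>t. u (t *\<^sub>R x)) has_derivative (\<lambda>s. pd (s *\<^sub>R x) u (t *\<^sub>R x))) (at t)" .
        from has_derivative_scaleR[OF has_derivative_ident this]
        have "((\<lambda>t. t *\<^sub>R u (t *\<^sub>R x)) has_derivative (\<lambda>s. t *\<^sub>R pd (s *\<^sub>R x) u (t *\<^sub>R x) + s *\<^sub>R u (t *\<^sub>R x))) (at t)" .
        moreover have "t *\<^sub>R pd (s *\<^sub>R x) u (t *\<^sub>R x) + s *\<^sub>R u (t *\<^sub>R x) = s *\<^sub>R G x t" for s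
          using linear_scale[OF linear_pd[OF smooth_differentiable[OF su]], of s x "t *\<^sub>R x"]
          by (simp add: G_def scaleR_add_right mult.commute)
        ultimately show "((\<lambda>t. t *\<^sub>R u (t *\<^sub>R x)) has_vector_derivative G x t) (at t within {0..1})"
          by (simp add: has_vector_derivative_def has_derivative_at_withinI)
      qed simp
      then have "((\<lambda>t. blinfun_inner_right (G x t)) has_integral blinfun_inner_right (u x)) {0..1}"
        using has_integral_linear[OF _ bounded_linear_blinfun_inner_right, of "G x" "u x" "{0..1}"] by (simp add: o_def)
      then show ?thesis by (simp add: integral_unique)
    qed
    ultimately show ?thesis by (simp add: f0_def[abs_def])
  qed
  have u0: "u x = 0" if "x \<notin> cball 0 R" for x by (rule test_zero_outside[OF u that])
  have con: "connected (- cball (0::real^3) R)" by (rule connected_complement_bounded_convex) auto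
  have const: "f0 x = f0 y" if "x \<in> - cball 0 R" "y \<in> - cball 0 R" for x y
  proof (rule has_derivative_zero_unique_connected[OF _ con _ that])
    show "(f0 has_derivative (\<lambda>x. 0)) (at x)" if "x \<in> - cball 0 R" for x
      using der[of x] u0[of x] that by simp
  qed auto
  \<comment> \<open>Evaluated at a point outside the ball, whatever the sign of
    \<open>R\<close>.\<close>
  define c where "c = f0 (axis 1 (\<bar>R\<bar> + 1))"
  have c: "f0 x = c" if "x \<notin> cball 0 R" for x
    unfolding c_def by (rule const) (use that in \<open>auto simp: norm_eq_sqrt_inner inner_axis_axis\<close>)
  have der': "((\<lambda>x. f0 x - c) has_derivative (\<lambda>d. u x \<bullet> d)) (at x)" for x
    using has_derivative_diff[OF der has_derivative_const] by simp
  have "test (cball 0 R) (\<lambda>x. f0 x - c)"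
  proof (rule testI[of _ "cball 0 R"])
    show "smooth (\<lambda>x. f0 x - c)"
      by (rule smooth_I[OF der']) (rule smooth_linear[OF su bounded_linear_inner_left])
  qed (use c in auto)
  moreover have "pd d (\<lambda>x. f0 x - c) x = u x \<bullet> d" for x d by (rule pd_eqI[OF der'])
  ultimately show ?thesis by blast
qed

lemma Curl_nth:
  assumes "smooth T"
  shows "Curl T x $ i $ 1 = D 2 (\<lambda>x. T x $ i $ 3) x - D 3 (\<lambda>x. T x $ i $ 2) x"
    "Curl T x $ i $ 2 = D 3 (\<lambda>x. T x $ i $ 1) x - D 1 (\<lambda>x. T x $ i $ 3) x"
    "Curl T x $ i $ 3 = D 1 (\<lambda>x. T x $ i $ 2) x - D 2 (\<lambda>x. T x $ i $ 1) x"
  by (simp_all add: Curl_def curl_nth pd_nth smooth_nth assms)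

text \<open>The symbol of the row-wise curl, from the formula curl u = \<Sum> e_i \<times> D_i
  u.\<close>

definition curl_coeff :: "real^3 \<Rightarrow> real^3^3 \<Rightarrow> real^3^3" where
  "curl_coeff b M = (\<chi> i. cross3 b (M $ i))"

lemma bounded_linear_curl_coeff: "bounded_linear (curl_coeff b)"
  unfolding linear_conv_bounded_linear[symmetric]
  by (rule linearI) (simp_all add: curl_coeff_def vec_eq_iff cross_add_right cross_mult_right)

lemma bounded_linear_sym_part: "bounded_linear sym_part"
  unfolding linear_conv_bounded_linear[symmetric]
  by (rule linearI) (simp_all add: sym_part_def vec_eq_iff transpose_def algebra_simps)

lemma Curl_eq_dop: "smooth T \<Longrightarrow> Curl T x = dop curl_coeff T x"
  by (simp add: vec_eq_iff forall_3 Curl_nth pd_nth smooth_nth dop_def sum_Basis3 curl_coeff_def cross3_def axis_def)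

lemma test_Curl:
  assumes "test \<Omega> T" shows "test \<Omega> (Curl T)"
proof -
  have "Curl T = dop curl_coeff T" using Curl_eq_dop[OF test_smooth[OF assms]] by blast
  then show ?thesis by (simp add: test_dop[OF assms bounded_linear_curl_coeff])
qed

lemma div_Curl:
  assumes T: "smooth T"
  shows "D 1 (\<lambda>x. Curl T x $ i $ 1) x + D 2 (\<lambda>x. Curl T x $ i $ 2) x + D 3 (\<lambda>x. Curl T x $ i $ 3) x = 0"
proof -
  have s: "smooth (\<lambda>x. T x $ i $ j)" for j by (intro smooth_nth T)
  have d: "D a (\<lambda>x. D b (\<lambda>x. T x $ i $ j) x - D c (\<lambda>x. T x $ i $ k) x) x =
      D a (D b (\<lambda>x. T x $ i $ j)) x - D a (D c (\<lambda>x. T x $ i $ k)) x" for a b c j k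
    by (rule pd_diff) (intro smooth_differentiable smooth_pd s)+
  show ?thesis
    unfolding Curl_nth[OF T] d
    using pd_commute_real[OF s, of "axis 1 1" "axis 2 1"] pd_commute_real[OF s, of "axis 1 1" "axis 3 1"]
      pd_commute_real[OF s, of "axis 2 1" "axis 3 1"] by simp
qed

text \<open>The divergences of the rows of \<open>Curl T\<close> vanish, and for a skew matrix they
  are, up to sign, the components of the curl of the associated vector field; so that field has a
  potential \<open>f\<close>. The curl of f Id then cancels \<open>Curl T\<close>, and the rows of T
  + f Id have potentials as well. Since each potential has compact support, so does
  \<open>v\<close>.\<close>

lemma symCurl_free_potential:
  assumes T: "test (cball 0 R) T" and tr: "\<And>x. trace (T x) = 0" and sc: "\<And>x. sym_part (Curl T x) = 0"
  shows "\<exists>v. test (cball 0 R) v \<and> (\<forall>x. T x = dev (Grad v x))"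
proof -
  have sT: "smooth T" by (rule test_smooth[OF T])
  have tC: "test (cball 0 R) (\<lambda>x. Curl T x $ i $ j)" for i j by (intro test_nth test_Curl T)
  have sC: "smooth (\<lambda>x. Curl T x $ i $ j)" for i j by (rule test_smooth[OF tC])
  have skew: "Curl T x $ j $ i = - Curl T x $ i $ j" for i j x
  proof -
    have "sym_part (Curl T x) $ i $ j = 0" using sc by simp
    then show ?thesis by (simp add: sym_part_def transpose_def)
  qed
  have diag: "Curl T x $ i $ i = 0" for i x using skew[of x i i] by simp
  have pm: "D k (\<lambda>x. - Curl T x $ i $ j) x = - D k (\<lambda>x. Curl T x $ i $ j) x" for i j k x
    by (rule pd_uminus[OF smooth_differentiable[OF sC]])
  \<comment> \<open>The signs are those for which f Id has curl \<open>- Curl T\<close> whenever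
    \<open>f\<close> has gradient \<open>u\<close>: the first row of the curl of f Id is (0, D_3 f,
    - D_2 f), and the others follow cyclically.\<close>
  define u where "u x = (vector [- Curl T x $ 2 $ 3, Curl T x $ 1 $ 3, - Curl T x $ 1 $ 2] :: real^3)" for x
  have tu: "test (cball 0 R) u"
  proof (rule test_vec)
    fix i
    show "test (cball 0 R) (\<lambda>x. u x $ i)"
      using exhaust_3[of i] by (auto simp: u_def intro: tC test_uminus[OF tC])
  qed
  have su: "smooth u" by (rule test_smooth[OF tu])
  have "curl u x = 0" for x
  proof -
    have 1: "D k u x $ 1 = - D k (\<lambda>x. Curl T x $ 2 $ 3) x"
      "D k u x $ 2 = D k (\<lambda>x. Curl T x $ 1 $ 3) x"
      "D k u x $ 3 = - D k (\<lambda>x. Curl T x $ 1 $ 2) x" for k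
      using fun_cong[OF pd_nth[OF su, of "axis k 1"], of 1 x] fun_cong[OF pd_nth[OF su, of "axis k 1"], of 2 x]
        fun_cong[OF pd_nth[OF su, of "axis k 1"], of 3 x]
      by (simp_all add: u_def pm)
    have sk: "(\<lambda>x. Curl T x $ 2 $ 1) = (\<lambda>x. - Curl T x $ 1 $ 2)"
      "(\<lambda>x. Curl T x $ 3 $ 1) = (\<lambda>x. - Curl T x $ 1 $ 3)"
      "(\<lambda>x. Curl T x $ 3 $ 2) = (\<lambda>x. - Curl T x $ 2 $ 3)"
      by (rule ext, rule skew)+
    have 2: "D k (\<lambda>x. Curl T x $ 2 $ 1) x = - D k (\<lambda>x. Curl T x $ 1 $ 2) x"
      "D k (\<lambda>x. Curl T x $ 3 $ 1) x = - D k (\<lambda>x. Curl T x $ 1 $ 3) x"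
      "D k (\<lambda>x. Curl T x $ 3 $ 2) x = - D k (\<lambda>x. Curl T x $ 2 $ 3) x" for k
      by (simp_all add: sk pm)
    show ?thesis
      using div_Curl[OF sT, of 1 x] div_Curl[OF sT, of 2 x] div_Curl[OF sT, of 3 x]
      by (simp add: vec_eq_iff forall_3 curl_nth 1 2 diag)
  qed
  from curl_free_potential[OF tu this] obtain f where f: "test (cball 0 R) f" "\<And>x d. pd d f x = u x \<bullet> d" by blast
  have sf: "smooth f" by (rule test_smooth[OF f(1)])
  have Df: "D k f x = u x $ k" for k x using f(2) by (simp add: inner_axis)
  define r where "r i x = T x $ i + f x *\<^sub>R axis i 1" for i x
  have tr': "test (cball 0 R) (r i)" for i
    unfolding r_def[abs_def] by (intro test_add test_nth T test_bilinear_left[OF bounded_bilinear_scaleR f(1)] smooth_const)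
  have Dr: "D k (r i) x $ j = D k (\<lambda>x. T x $ i $ j) x + (if i = j then u x $ k else 0)" for k i j x
  proof -
    have "((\<lambda>x. r i x $ j) has_derivative (\<lambda>d. pd d (\<lambda>x. T x $ i $ j) x + pd d f x * axis i 1 $ j)) (at x)"
      unfolding r_def by (auto intro!: derivative_eq_intros smooth_has_derivative smooth_nth sT sf)
    moreover have "axis i 1 $ j = (if i = j then 1 else 0::real)" by (simp add: axis_def)
    ultimately show ?thesis
      using fun_cong[OF pd_nth[OF test_smooth[OF tr'], of "axis k 1" i j], of x] pd_eqI[of "\<lambda>x. r i x $ j" _ x "axis k 1"]
      by (force simp: Df)
  qed
  have "curl (r i) x = 0" for i x
    using exhaust_3[of i] Curl_nth[OF sT, of x 1] Curl_nth[OF sT, of x 2] Curl_nth[OF sT, of x 3]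
      diag[of x 1] diag[of x 2] diag[of x 3] skew[of x 1 2] skew[of x 1 3] skew[of x 2 3]
    by (auto simp: vec_eq_iff forall_3 curl_nth Dr u_def)
  from curl_free_potential[OF tr' this]
  have "\<forall>i. \<exists>g. test (cball 0 R) g \<and> (\<forall>x d. pd d g x = r i x \<bullet> d)" by blast
  then obtain g where g: "\<And>i. test (cball 0 R) (g i)" "\<And>i x d. pd d (g i) x = r i x \<bullet> d" by metis
  define v where "v x = (\<chi> i. g i x)" for x
  have tv: "test (cball 0 R) v" by (rule test_vec) (simp add: v_def g(1))
  have Gv: "Grad v x = T x + f x *\<^sub>R mat 1" for x
  proof -
    have "D j v x $ i = T x $ i $ j + f x * (if i = j then 1 else 0)" for i j
    proof -
      have "r i x $ j = T x $ i $ j + f x * (if i = j then 1 else 0)" by (simp add: r_def axis_def)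
      then show ?thesis
        using fun_cong[OF pd_nth[OF test_smooth[OF tv], of "axis j 1" i], of x] g(2)[of "axis j 1" i x]
        by (simp add: v_def inner_axis)
    qed
    then show ?thesis by (simp add: vec_eq_iff Grad_nth mat_def)
  qed
  \<comment> \<open>As \<open>T\<close> is trace-free, \<open>f\<close> is one third of the trace of
    \<open>Grad v\<close>, and \<open>dev\<close> removes exactly f Id.\<close>
  have "dev (Grad v x) = T x" for x
  proof -
    have "trace (Grad v x) = 3 * f x" unfolding Gv using tr[of x] by (simp add: trace_def sum_3 mat_def)
    then show ?thesis by (simp add: dev_def Gv)
  qed
  with tv show ?thesis by metis
qed

text \<open>The curl kills gradients row by row, by the symmetry of second derivatives, and the curl
  of a multiple of the identity is skew.\<close>

lemma symCurl_devGrad: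
  assumes v: "smooth v"
  shows "sym_part (Curl (\<lambda>x. dev (Grad v x)) x) = 0"
proof -
  define g where "g = (\<lambda>x. (D 1 (\<lambda>x. v x $ 1) x + D 2 (\<lambda>x. v x $ 2) x + D 3 (\<lambda>x. v x $ 3) x) / 3)"
  have sv: "smooth (D j (\<lambda>x. v x $ i))" for i j by (intro smooth_pd smooth_nth v)
  have sg: "smooth g" unfolding g_def
    by (rule smooth_linear[OF _ bounded_linear_divide]) (intro smooth_add sv)
  have comp: "dev (Grad v x) $ i $ j = (if i = j then D j (\<lambda>x. v x $ i) x - g x else D j (\<lambda>x. v x $ i) x)" for i j x
    by (simp add: dev_def Grad_nth trace_def sum_3 mat_def g_def pd_nth[OF v])
  have sT: "smooth (\<lambda>x. dev (Grad v x))"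
  proof (intro smooth_vec)
    show "smooth (\<lambda>x. dev (Grad v x) $ i $ j)" for i j
      by (cases "i = j") (simp_all add: comp sv sg smooth_diff)
  qed
  have dd: "D k (\<lambda>x. D j (\<lambda>x. v x $ i) x - g x) x = D k (D j (\<lambda>x. v x $ i)) x - D k g x" for i j k x
    by (rule pd_diff) (intro smooth_differentiable sv sg)+
  have com: "D 2 (D 1 (\<lambda>x. v x $ i)) x = D 1 (D 2 (\<lambda>x. v x $ i)) x"
    "D 3 (D 1 (\<lambda>x. v x $ i)) x = D 1 (D 3 (\<lambda>x. v x $ i)) x"
    "D 3 (D 2 (\<lambda>x. v x $ i)) x = D 2 (D 3 (\<lambda>x. v x $ i)) x" for i x
    by (intro pd_commute_real smooth_nth v)+
  show ?thesis
    by (simp add: sym_part_def transpose_def vec_eq_iff forall_3 Curl_nth[OF sT] comp dd com)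
qed

section \<open>The inequalities of Korn and Poincare\<close>

lemma norm_matrix_power2: "(norm (M :: real^3^3))\<^sup>2 = (\<Sum>i\<in>UNIV. \<Sum>j\<in>UNIV. (M $ i $ j)\<^sup>2)"
  unfolding power2_norm_eq_inner by (simp add: inner_vec_def power2_eq_square)

text \<open>Pythagoras: the part (tr M / 3) Id is orthogonal to the trace-free part and has squared
  norm (tr M)^2 / 3.\<close>

lemma norm_dev_power2: "(norm (dev M))\<^sup>2 = (norm M)\<^sup>2 - (trace M)\<^sup>2 / 3"
  unfolding norm_matrix_power2 by (simp add: dev_def trace_def mat_def sum_3 power2_eq_square algebra_simps)

lemma norm_dev_le: "norm (dev M) \<le> norm M"
  by (rule power2_le_imp_le) (simp_all add: norm_dev_power2)

lemma Grad_nth_smooth: "smooth v \<Longrightarrow> Grad v x $ i $ j = D j (\<lambda>x. v x $ i) x"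
  by (simp add: Grad_nth pd_nth)

definition grad_coeff :: "real^3 \<Rightarrow> real^3 \<Rightarrow> real^3^3" where
  "grad_coeff b u = (\<chi> i j. u $ i * b $ j)"

lemma bounded_linear_grad_coeff: "bounded_linear (grad_coeff b)"
  unfolding linear_conv_bounded_linear[symmetric]
  by (rule linearI) (simp_all add: grad_coeff_def vec_eq_iff algebra_simps)

lemma Grad_eq_dop: "Grad v = dop grad_coeff v"
  by (rule ext) (simp add: vec_eq_iff forall_3 Grad_nth dop_def sum_Basis3 grad_coeff_def axis_def)

lemma test_Grad: "test \<Omega> v \<Longrightarrow> test \<Omega> (Grad v)"
  unfolding Grad_eq_dop by (rule test_dop[OF _ bounded_linear_grad_coeff])

lemma test_dev: "test \<Omega> M \<Longrightarrow> test \<Omega> (\<lambda>x. dev (M x))"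
  by (rule test_linear[OF _ bounded_linear_dev])

lemma Grad_add: "smooth u \<Longrightarrow> smooth v \<Longrightarrow> Grad (\<lambda>x. u x + v x) x = Grad u x + Grad v x"
  by (simp add: vec_eq_iff Grad_nth pd_add smooth_differentiable)

lemma Grad_scaleR: "smooth v \<Longrightarrow> Grad (\<lambda>x. c *\<^sub>R v x) x = c *\<^sub>R Grad v x"
  by (simp add: vec_eq_iff Grad_nth pd_linear[OF _ bounded_linear_scaleR_right])

text \<open>Both sides equal minus the integral of \<open>f\<close> times the mixed second
  derivative of \<open>g\<close>.\<close>

lemma integral_pd_swap:
  fixes f g :: "real^3 \<Rightarrow> real"
  assumes f: "test UNIV f" and g: "test UNIV g"
  shows "integral\<^sup>L lebesgue (\<lambda>x. D i f x * D j g x) = integral\<^sup>L lebesgue (\<lambda>x. D j f x * D i g x)"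
proof -
  have "D i (D j g) = D j (D i g)" using pd_commute_real[OF test_smooth[OF g]] by blast
  then show ?thesis
    using integral_by_parts[OF bounded_bilinear_mult f smooth_pd[OF test_smooth[OF g]], of "axis i 1" "axis j 1"]
      integral_by_parts[OF bounded_bilinear_mult f smooth_pd[OF test_smooth[OF g]], of "axis j 1" "axis i 1"]
    by simp
qed

text \<open>Exchanging derivatives turns the integral of (div v)^2 into that of the sum of D_j v_i
  D_i v_j, which is at most the integral of |Grad v|^2. Removing the trace therefore costs at most a
  third of the latter, and 2 is a convenient upper bound for the square root of 3/2.\<close>

lemma Korn_test:
  assumes v: "test UNIV v"
  shows "norm (abs_L2 (Grad v)) \<le> 2 * norm (abs_L2 (\<lambda>x. dev (Grad v x)))"
proof -
  let ?I = "integral\<^sup>L lebesgue"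
  have sv: "smooth v" by (rule test_smooth[OF v])
  have tc: "test UNIV (\<lambda>x. v x $ i)" for i by (rule test_nth[OF v])
  have tp: "test UNIV (\<lambda>x. D a (\<lambda>x. v x $ i) x * D b (\<lambda>x. v x $ j) x)" for a b i j
    by (rule test_bilinear_left[OF bounded_bilinear_mult test_pd[OF tc] smooth_pd[OF test_smooth[OF tc]]])
  have ip: "integrable lebesgue (\<lambda>x. D a (\<lambda>x. v x $ i) x * D b (\<lambda>x. v x $ j) x)" for a b i j
    by (rule test_integrable[OF tp])
  have sG: "sq_int (Grad v)" and sdG: "sq_int (\<lambda>x. dev (Grad v x))"
    by (intro test_sq_int[of UNIV] test_dev test_Grad v)+
  have tr: "(trace (Grad v x))\<^sup>2 = (\<Sum>i\<in>UNIV. \<Sum>j\<in>UNIV. D i (\<lambda>x. v x $ i) x * D j (\<lambda>x. v x $ j) x)" for x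
    by (simp add: trace_def Grad_nth_smooth[OF sv] power2_eq_square sum_product)
  have itr: "integrable lebesgue (\<lambda>x. (trace (Grad v x))\<^sup>2)"
    unfolding tr by (intro Bochner_Integration.integrable_sum ip)
  have "?I (\<lambda>x. (trace (Grad v x))\<^sup>2) = (\<Sum>i\<in>UNIV. \<Sum>j\<in>UNIV. ?I (\<lambda>x. D i (\<lambda>x. v x $ i) x * D j (\<lambda>x. v x $ j) x))"
    unfolding tr by (simp add: Bochner_Integration.integral_sum ip)
  also have "\<dots> = (\<Sum>i\<in>UNIV. \<Sum>j\<in>UNIV. ?I (\<lambda>x. D j (\<lambda>x. v x $ i) x * D i (\<lambda>x. v x $ j) x))"
    by (intro sum.cong refl integral_pd_swap tc)
  also have "\<dots> = ?I (\<lambda>x. \<Sum>i\<in>UNIV. \<Sum>j\<in>UNIV. D j (\<lambda>x. v x $ i) x * D i (\<lambda>x. v x $ j) x)"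
    by (simp add: Bochner_Integration.integral_sum ip)
  also have "\<dots> \<le> ?I (\<lambda>x. (norm (Grad v x))\<^sup>2)"
  proof (rule integral_mono)
    show "integrable lebesgue (\<lambda>x. \<Sum>i\<in>UNIV. \<Sum>j\<in>UNIV. D j (\<lambda>x. v x $ i) x * D i (\<lambda>x. v x $ j) x)"
      by (intro Bochner_Integration.integrable_sum ip)
    show "integrable lebesgue (\<lambda>x. (norm (Grad v x))\<^sup>2)" by (rule sq_int_norm_integrable[OF sG])
    fix x
    define m where "m i j = D j (\<lambda>x. v x $ i) x" for i j
    have "(\<Sum>i\<in>UNIV. \<Sum>j\<in>UNIV. m i j * m j i) \<le> (\<Sum>i\<in>UNIV. \<Sum>j\<in>UNIV. (m i j)\<^sup>2)"
      using sum_squares_bound[of "m 1 2" "m 2 1"] sum_squares_bound[of "m 1 3" "m 3 1"] sum_squares_bound[of "m 2 3" "m 3 2"]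
      by (simp add: sum_3 power2_eq_square algebra_simps)
    then show "(\<Sum>i\<in>UNIV. \<Sum>j\<in>UNIV. D j (\<lambda>x. v x $ i) x * D i (\<lambda>x. v x $ j) x) \<le> (norm (Grad v x))\<^sup>2"
      by (simp add: m_def norm_matrix_power2 Grad_nth_smooth[OF sv])
  qed
  finally have le: "?I (\<lambda>x. (trace (Grad v x))\<^sup>2) \<le> ?I (\<lambda>x. (norm (Grad v x))\<^sup>2)" .
  have "?I (\<lambda>x. (norm (dev (Grad v x)))\<^sup>2) = ?I (\<lambda>x. (norm (Grad v x))\<^sup>2) - ?I (\<lambda>x. (trace (Grad v x))\<^sup>2) / 3"
    unfolding norm_dev_power2 using itr sq_int_norm_integrable[OF sG] by simp
  moreover have "0 \<le> ?I (\<lambda>x. (norm (Grad v x))\<^sup>2)" by (rule integral_nonneg_AE) auto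
  ultimately have "(norm (abs_L2 (Grad v)))\<^sup>2 \<le> 4 * (norm (abs_L2 (\<lambda>x. dev (Grad v x))))\<^sup>2"
    using le unfolding abs_L2_norm[OF sG] abs_L2_norm[OF sdG] by linarith
  then have "(norm (abs_L2 (Grad v)))\<^sup>2 \<le> (2 * norm (abs_L2 (\<lambda>x. dev (Grad v x))))\<^sup>2" by (simp add: power_mult_distrib)
  then show ?thesis by (rule power2_le_imp_le) simp
qed

text \<open>Integration by parts against the coordinate x_1, whose derivative is 1: the integral of
  |v|^2 is -2 times that of x_1 v \<bullet> D_1 v, and |x_1| \<le> R on the support. Cauchy-Schwarz
  then gives the factor \<open>2 * R\<close>.\<close>

lemma Poincare_test:
  assumes v: "test (cball 0 R) v"
  shows "norm (abs_L2 v) \<le> 2 * R * norm (abs_L2 (Grad v))"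
proof (cases "R < 0")
  case True
  then have "v x = 0" for x by (intro test_zero_outside[OF v]) auto
  then have v0: "v = (\<lambda>x. 0)" by auto
  then have "Grad v = (\<lambda>x. 0)" by (auto simp: vec_eq_iff Grad_nth)
  then show ?thesis by (simp add: v0 abs_L2_zero)
next
  case False
  let ?I = "integral\<^sup>L lebesgue"
  have v': "test UNIV v" by (rule test_mono[OF v]) simp
  have sv: "smooth v" by (rule test_smooth[OF v])
  have sq: "sq_int v" "sq_int (D 1 v)" by (intro test_sq_int[of UNIV] test_pd v')+
  have s1: "smooth (\<lambda>x::real^3. x $ 1)" by (rule smooth_bounded_linear[OF bounded_linear_vec_nth])
  have t: "test UNIV (\<lambda>x. x $ 1 *\<^sub>R v x)" by (rule test_bilinear_right[OF bounded_bilinear_scaleR s1 v'])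
  have "D 1 (\<lambda>x. x $ 1 *\<^sub>R v x) x = x $ 1 *\<^sub>R D 1 v x + v x" for x
    using pd_bilinear[OF bounded_bilinear_scaleR smooth_differentiable[OF s1] smooth_differentiable[OF sv], of "axis 1 1" x]
    by (simp add: pd_bounded_linear[OF bounded_linear_vec_nth])
  moreover have "(x $ 1 *\<^sub>R D 1 v x + v x) \<bullet> v x = x $ 1 * (v x \<bullet> D 1 v x) + v x \<bullet> v x" for x
    by (simp add: inner_add_left inner_commute[of "D 1 v x" "v x"])
  ultimately have "?I (\<lambda>x. x $ 1 * (v x \<bullet> D 1 v x) + v x \<bullet> v x) = - ?I (\<lambda>x. (x $ 1 *\<^sub>R v x) \<bullet> D 1 v x)"
    using integral_by_parts[OF bounded_bilinear_inner t sv, of "axis 1 1"] by simp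
  moreover have ia: "integrable lebesgue (\<lambda>x. x $ 1 * (v x \<bullet> D 1 v x))"
    by (rule test_integrable[of UNIV], rule test_bilinear_right[OF bounded_bilinear_mult s1],
        rule test_bilinear_left[OF bounded_bilinear_inner v' smooth_pd[OF sv]])
  moreover have "integrable lebesgue (\<lambda>x. v x \<bullet> v x)" by (rule sq_int_inner_integrable[OF sq(1,1)])
  ultimately have "?I (\<lambda>x. v x \<bullet> v x) = - 2 * ?I (\<lambda>x. x $ 1 * (v x \<bullet> D 1 v x))"
    by simp
  also have "\<dots> \<le> 2 * \<bar>?I (\<lambda>x. x $ 1 * (v x \<bullet> D 1 v x))\<bar>" by simp
  also have "\<dots> \<le> 2 * ?I (\<lambda>x. R * (norm (v x) * norm (D 1 v x)))"
  proof -
    have "\<bar>?I (\<lambda>x. x $ 1 * (v x \<bullet> D 1 v x))\<bar> \<le> ?I (\<lambda>x. norm (x $ 1 * (v x \<bullet> D 1 v x)))"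
      using integral_norm_bound[of lebesgue "\<lambda>x. x $ 1 * (v x \<bullet> D 1 v x)"] by simp
    also have "\<dots> \<le> ?I (\<lambda>x. R * (norm (v x) * norm (D 1 v x)))"
    proof (rule integral_mono[OF integrable_norm[OF ia]])
      show "integrable lebesgue (\<lambda>x. R * (norm (v x) * norm (D 1 v x)))"
        using sq_int_inner_integrable[OF sq_int_norm[OF sq(1)] sq_int_norm[OF sq(2)]] by simp
      fix x
      show "norm (x $ 1 * (v x \<bullet> D 1 v x)) \<le> R * (norm (v x) * norm (D 1 v x))"
      proof (cases "x \<in> cball 0 R")
        case True
        then have "\<bar>x $ 1\<bar> \<le> R" using component_le_norm_cart[of x 1] by simp
        then show ?thesis
          using Cauchy_Schwarz_ineq2[of "v x" "D 1 v x"] False by (auto simp: abs_mult intro!: mult_mono)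
      qed (use test_zero_outside[OF v] in simp)
    qed
    finally show ?thesis by simp
  qed
  also have "\<dots> = 2 * R * (abs_L2 (\<lambda>x. norm (v x)) \<bullet> abs_L2 (\<lambda>x. norm (D 1 v x)))"
    using abs_L2_inner[OF sq_int_norm[OF sq(1)] sq_int_norm[OF sq(2)]] by simp
  also have "\<dots> \<le> 2 * R * (norm (abs_L2 (\<lambda>x. norm (v x))) * norm (abs_L2 (\<lambda>x. norm (D 1 v x))))"
    using False by (intro mult_left_mono norm_cauchy_schwarz) auto
  also have "\<dots> \<le> 2 * R * (norm (abs_L2 v) * norm (abs_L2 (Grad v)))"
  proof (intro mult_left_mono mult_mono)
    show "norm (abs_L2 (\<lambda>x. norm (v x))) \<le> norm (abs_L2 v)"
      by (intro abs_L2_norm_le sq_int_norm sq) auto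
    have "norm (D 1 v x) \<le> norm (Grad v x)" for x
    proof (rule power2_le_imp_le)
      have "(norm (D 1 v x))\<^sup>2 = (\<Sum>i\<in>UNIV. (D 1 v x $ i)\<^sup>2)"
        unfolding power2_norm_eq_inner by (simp add: inner_vec_def power2_eq_square)
      then show "(norm (D 1 v x))\<^sup>2 \<le> (norm (Grad v x))\<^sup>2"
        unfolding norm_matrix_power2 Grad_nth by (simp add: sum_3)
    qed simp
    then show "norm (abs_L2 (\<lambda>x. norm (D 1 v x))) \<le> norm (abs_L2 (Grad v))"
      by (intro abs_L2_norm_le sq_int_norm sq test_sq_int[OF test_Grad[OF v]]) auto
  qed (use False in auto)
  finally have "norm (abs_L2 v) * norm (abs_L2 v) \<le> norm (abs_L2 v) * (2 * R * norm (abs_L2 (Grad v)))"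
    using abs_L2_inner[OF sq(1,1)] by (simp add: norm_eq_sqrt_inner mult_ac)
  then show ?thesis
  proof (cases "norm (abs_L2 v) = 0")
    case True
    then show ?thesis using \<open>\<not> R < 0\<close> by simp
  next
    case False
    with \<open>norm (abs_L2 v) * norm (abs_L2 v) \<le> _\<close> show ?thesis
      by (metis mult_le_cancel_left_pos norm_ge_zero order_le_less)
  qed
qed

section \<open>Closures of differential operators\<close>

lemma subspace_closure:
  fixes S :: "'a::real_normed_vector set"
  assumes S: "subspace S"
  shows "subspace (closure S)"
proof (rule subspaceI)
  show "0 \<in> closure S" using closure_subset subspace_0[OF S] by blast
next
  fix x y assume "x \<in> closure S" "y \<in> closure S"
  then obtain f g where f: "\<And>n. f n \<in> S" "f \<longlonglongrightarrow> x" and g: "\<And>n. g n \<in> S" "g \<longlonglongrightarrow> y"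
    unfolding closure_sequential by blast
  have "(\<lambda>n. f n + g n) \<longlonglongrightarrow> x + y" by (rule tendsto_add[OF f(2) g(2)])
  then show "x + y \<in> closure S"
    unfolding closure_sequential using subspace_add[OF S f(1) g(1)] by (intro exI[of _ "\<lambda>n. f n + g n"]) blast
next
  fix c :: real and x assume "x \<in> closure S"
  then obtain f where f: "\<And>n. f n \<in> S" "f \<longlonglongrightarrow> x" unfolding closure_sequential by blast
  have "(\<lambda>n. c *\<^sub>R f n) \<longlonglongrightarrow> c *\<^sub>R x" by (intro tendsto_intros f)
  then show "c *\<^sub>R x \<in> closure S"
    unfolding closure_sequential using subspace_scale[OF S f(1)] by (intro exI[of _ "\<lambda>n. c *\<^sub>R f n"]) blast
qed

text \<open>A minimizing sequence for the distance to \<open>R\<close> is Cauchy by the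
  parallelogram identity, and at the minimizer the squared distance is stationary in every direction
  of \<open>R\<close>.\<close>

lemma ex_orthogonal_projection:
  fixes R :: "'a::{real_inner, complete_space} set"
  assumes R: "subspace R" "closed R"
  shows "\<exists>r\<in>R. \<forall>q\<in>R. (x - r) \<bullet> q = 0"
proof -
  define d where "d = Inf ((\<lambda>r. (norm (x - r))\<^sup>2) ` R)"
  have R0: "0 \<in> R" by (rule subspace_0[OF R(1)])
  have bdd: "bdd_below ((\<lambda>r. (norm (x - r))\<^sup>2) ` R)" by (rule bdd_belowI[of _ 0]) auto
  have dle: "d \<le> (norm (x - r))\<^sup>2" if "r \<in> R" for r
    unfolding d_def using that by (intro cInf_lower bdd) auto
  have "\<exists>r\<in>R. (norm (x - r))\<^sup>2 < d + inverse (real (Suc n))" for n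
  proof -
    have "Inf ((\<lambda>r. (norm (x - r))\<^sup>2) ` R) < d + inverse (real (Suc n))" by (simp add: d_def)
    from cInf_lessD[OF _ this] show ?thesis using R0 by blast
  qed
  then obtain f where f: "\<And>n. f n \<in> R" "\<And>n. (norm (x - f n))\<^sup>2 < d + inverse (real (Suc n))" by metis
  \<comment> \<open>The midpoint of \<open>f m\<close> and \<open>f n\<close> lies in
    \<open>R\<close>, so its squared distance from \<open>x\<close> is at least
    \<open>d\<close>.\<close>
  have par: "(norm (f m - f n))\<^sup>2 \<le> 2 * inverse (real (Suc m)) + 2 * inverse (real (Suc n))" for m n
  proof -
    have "(1/2) *\<^sub>R (f m + f n) \<in> R" by (intro subspace_scale subspace_add R f)
    from dle[OF this] have "4 * d \<le> 4 * (norm (x - (1/2) *\<^sub>R (f m + f n)))\<^sup>2" by simp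
    also have "\<dots> = (norm (2 *\<^sub>R (x - (1/2) *\<^sub>R (f m + f n))))\<^sup>2" by (simp add: power_mult_distrib)
    also have "2 *\<^sub>R (x - (1/2) *\<^sub>R (f m + f n)) = (x - f m) + (x - f n)"
      by (simp add: scaleR_diff_right scaleR_2)
    finally have "4 * d \<le> (norm ((x - f m) + (x - f n)))\<^sup>2" .
    moreover have "(norm ((x - f m) + (x - f n)))\<^sup>2 + (norm ((x - f m) - (x - f n)))\<^sup>2
        = 2 * (norm (x - f m))\<^sup>2 + 2 * (norm (x - f n))\<^sup>2"
      unfolding power2_norm_eq_inner by (simp only: inner_add_left inner_add_right inner_diff_left inner_diff_right inner_commute) simp
    moreover have "norm ((x - f m) - (x - f n)) = norm (f m - f n)" by (simp add: norm_minus_commute)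
    ultimately show ?thesis using f(2)[of m] f(2)[of n] by simp
  qed
  have "Cauchy f"
  proof (rule CauchyI)
    fix e :: real assume e: "e > 0"
    then obtain N where N: "inverse (real (Suc N)) < e\<^sup>2 / 4" using reals_Archimedean[of "e\<^sup>2/4"] by auto
    have "norm (f m - f n) < e" if "m \<ge> N" "n \<ge> N" for m n
    proof -
      have "inverse (real (Suc m)) \<le> inverse (real (Suc N))" "inverse (real (Suc n)) \<le> inverse (real (Suc N))"
        using that by (simp_all add: field_simps)
      with par[of m n] N have "(norm (f m - f n))\<^sup>2 < e\<^sup>2" by linarith
      then show ?thesis using e by (simp add: power_less_imp_less_base)
    qed
    then show "\<exists>M. \<forall>m\<ge>M. \<forall>n\<ge>M. norm (f m - f n) < e" by blast
  qed
  then obtain r where r: "f \<longlonglongrightarrow> r" using Cauchy_convergent convergent_def by blast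
  have rR: "r \<in> R" using closed_sequentially[OF R(2)] f(1) r by blast
  have "(\<lambda>n. (norm (x - f n))\<^sup>2) \<longlonglongrightarrow> (norm (x - r))\<^sup>2" by (intro tendsto_intros r)
  moreover have "(\<lambda>n. d + inverse (real (Suc n))) \<longlonglongrightarrow> d + 0" by (intro tendsto_add tendsto_const LIMSEQ_inverse_real_of_nat)
  moreover have "\<exists>N. \<forall>n\<ge>N. (norm (x - f n))\<^sup>2 \<le> d + inverse (real (Suc n))" using f(2) less_imp_le by blast
  ultimately have rd: "(norm (x - r))\<^sup>2 \<le> d" using LIMSEQ_le by fastforce
  have "(x - r) \<bullet> q = 0" if q: "q \<in> R" for q
  proof (rule ccontr)
    assume nz: "(x - r) \<bullet> q \<noteq> 0"
    then have qq: "q \<bullet> q > 0" by auto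
    \<comment> \<open>The minimizer of the quadratic polynomial in \<open>t\<close> given by the
      squared distance from \<open>x\<close> to \<open>r + t *\<^sub>R q\<close>.\<close>
    define t where "t = ((x - r) \<bullet> q) / (q \<bullet> q)"
    have "r + t *\<^sub>R q \<in> R" by (intro subspace_add subspace_scale R rR q)
    from order_trans[OF rd dle[OF this]] have "(norm (x - r))\<^sup>2 \<le> (norm (x - (r + t *\<^sub>R q)))\<^sup>2" .
    also have "x - (r + t *\<^sub>R q) = (x - r) - t *\<^sub>R q" by simp
    also have "(norm ((x - r) - t *\<^sub>R q))\<^sup>2 = (norm (x - r))\<^sup>2 - 2 * t * ((x - r) \<bullet> q) + t\<^sup>2 * (q \<bullet> q)"
    proof -
      have "(norm (a - t *\<^sub>R q))\<^sup>2 = (norm a)\<^sup>2 - 2 * t * (a \<bullet> q) + t\<^sup>2 * (q \<bullet> q)" for a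
        unfolding power2_norm_eq_inner
        by (simp add: inner_diff_left inner_diff_right inner_commute[of q a] power2_eq_square algebra_simps)
      then show ?thesis .
    qed
    also have "t\<^sup>2 * (q \<bullet> q) = t * ((x - r) \<bullet> q)" using qq by (simp add: t_def power2_eq_square)
    finally have "t * ((x - r) \<bullet> q) \<le> 0" by simp
    moreover have "t * ((x - r) \<bullet> q) = ((x - r) \<bullet> q)\<^sup>2 / (q \<bullet> q)" by (simp add: t_def power2_eq_square)
    ultimately show False using nz qq by (simp add: divide_le_0_iff)
  qed
  with rR show ?thesis by blast
qed

section \<open>Graph and range of the deviatoric gradient with zero boundary values\<close>

lemma bounded_linear_dev_L2: "bounded_linear dev_L2"
proof (rule bounded_linear_intro[where K = 1])
  fix u v :: "(real^3^3) L2" and c :: real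
  obtain f where f: "sq_int f" "u = abs_L2 f" by (rule abs_L2_cases)
  obtain g where g: "sq_int g" "v = abs_L2 g" by (rule abs_L2_cases)
  have s: "sq_int (\<lambda>x. dev (f x))" "sq_int (\<lambda>x. dev (g x))"
    by (intro sq_int_bounded_linear[OF _ bounded_linear_dev] f g)+
  show "dev_L2 (u + v) = dev_L2 u + dev_L2 v"
    by (simp add: f g s abs_L2_dev linear_add[OF bounded_linear.linear[OF bounded_linear_dev]] sq_int_add flip: abs_L2_add)
  show "dev_L2 (c *\<^sub>R u) = c *\<^sub>R dev_L2 u"
    by (simp add: f s abs_L2_dev linear_cmul[OF bounded_linear.linear[OF bounded_linear_dev]] sq_int_scaleR flip: abs_L2_scaleR)
  show "norm (dev_L2 u) \<le> norm u * 1"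
    using abs_L2_norm_le[OF s(1) f(1)] norm_dev_le by (simp add: f abs_L2_dev)
qed

text \<open>The closed graph of the gradient on H_0^1(\<Omega>): the gradient is carried along with
  the field, so that limits of both are taken at once. Test fields vanish outside \<Omega>, which is
  why \<open>abs_L2\<close> can stand for \<open>restr \<Omega>\<close>.\<close>

definition H10 :: "(real^3) set \<Rightarrow> ((real^3) L2 \<times> (real^3^3) L2) set" where
  "H10 \<Omega> = closure {(abs_L2 \<phi>, abs_L2 (Grad \<phi>)) | \<phi>. test \<Omega> \<phi>}"

lemma restr_test:
  assumes "test \<Omega> \<phi>" shows "restr \<Omega> \<phi> = abs_L2 \<phi>"
proof -
  have "(\<lambda>x. if x \<in> \<Omega> then \<phi> x else 0) = \<phi>" using test_zero_outside[OF assms] by auto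
  then show ?thesis by (simp add: restr_def)
qed

lemma H1_0_eq: "H1_0 \<Omega> = Domain (H10 \<Omega>)"
proof -
  have "{(restr \<Omega> \<phi>, restr \<Omega> (Grad \<phi>)) | \<phi>. test \<Omega> \<phi>} = {(abs_L2 \<phi>, abs_L2 (Grad \<phi>)) | \<phi>. test \<Omega> \<phi>}"
    by (auto simp: restr_test test_Grad) (metis restr_test test_Grad)
  then show ?thesis by (simp add: H1_0_def H10_def)
qed

lemma subspace_H10: "subspace (H10 \<Omega>)"
  unfolding H10_def
proof (rule subspace_closure, rule subspaceI)
  show "0 \<in> {(abs_L2 \<phi>, abs_L2 (Grad \<phi>)) | \<phi>. test \<Omega> \<phi>}"
  proof -
    have "Grad (\<lambda>x. 0) = (\<lambda>x. 0)" by (auto simp: vec_eq_iff Grad_nth)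
    then show ?thesis by (auto simp: zero_prod_def abs_L2_zero intro!: exI[of _ "\<lambda>x. 0"] test_zero)
  qed
next
  fix x y assume "x \<in> {(abs_L2 \<phi>, abs_L2 (Grad \<phi>)) | \<phi>. test \<Omega> \<phi>}" "y \<in> {(abs_L2 \<phi>, abs_L2 (Grad \<phi>)) | \<phi>. test \<Omega> \<phi>}"
  then obtain f g where f: "test \<Omega> f" "x = (abs_L2 f, abs_L2 (Grad f))" and g: "test \<Omega> g" "y = (abs_L2 g, abs_L2 (Grad g))" by blast
  have "Grad (\<lambda>x. f x + g x) = (\<lambda>x. Grad f x + Grad g x)"
    using Grad_add test_smooth f(1) g(1) by blast
  then have "x + y = (abs_L2 (\<lambda>x. f x + g x), abs_L2 (Grad (\<lambda>x. f x + g x)))"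
    by (simp add: f g abs_L2_add test_sq_int[OF f(1)] test_sq_int[OF g(1)] test_sq_int[OF test_Grad[OF f(1)]] test_sq_int[OF test_Grad[OF g(1)]])
  then show "x + y \<in> {(abs_L2 \<phi>, abs_L2 (Grad \<phi>)) | \<phi>. test \<Omega> \<phi>}" using test_add[OF f(1) g(1)] by blast
next
  fix c :: real and x assume "x \<in> {(abs_L2 \<phi>, abs_L2 (Grad \<phi>)) | \<phi>. test \<Omega> \<phi>}"
  then obtain f where f: "test \<Omega> f" "x = (abs_L2 f, abs_L2 (Grad f))" by blast
  have "Grad (\<lambda>x. c *\<^sub>R f x) = (\<lambda>x. c *\<^sub>R Grad f x)"
    using Grad_scaleR test_smooth f(1) by blast
  then have "c *\<^sub>R x = (abs_L2 (\<lambda>x. c *\<^sub>R f x), abs_L2 (Grad (\<lambda>x. c *\<^sub>R f x)))"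
    by (simp add: f abs_L2_scaleR test_sq_int[OF f(1)] test_sq_int[OF test_Grad[OF f(1)]])
  then show "c *\<^sub>R x \<in> {(abs_L2 \<phi>, abs_L2 (Grad \<phi>)) | \<phi>. test \<Omega> \<phi>}" using test_scaleR[OF f(1)] by blast
qed

lemma H10_test: "test \<Omega> \<phi> \<Longrightarrow> (abs_L2 \<phi>, abs_L2 (Grad \<phi>)) \<in> H10 \<Omega>"
  unfolding H10_def using closure_subset by fastforce

lemma H10_mono: "A \<subseteq> B \<Longrightarrow> H10 A \<subseteq> H10 B"
  unfolding H10_def by (intro closure_mono) (use test_mono in blast)

lemma closed_H10: "closed (H10 \<Omega>)" by (simp add: H10_def)

lemma H10_sequence:
  assumes "(v, G) \<in> H10 \<Omega>"
  obtains \<phi> where "\<And>n. test \<Omega> (\<phi> n)" "(\<lambda>n. abs_L2 (\<phi> n)) \<longlonglongrightarrow> v" "(\<lambda>n. abs_L2 (Grad (\<phi> n))) \<longlonglongrightarrow> G"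
proof -
  from assms obtain X where X: "\<And>n. X n \<in> {(abs_L2 \<phi>, abs_L2 (Grad \<phi>)) | \<phi>. test \<Omega> \<phi>}" and lim: "X \<longlonglongrightarrow> (v, G)"
    unfolding H10_def closure_sequential by blast
  have "\<forall>n. \<exists>\<phi>. test \<Omega> \<phi> \<and> X n = (abs_L2 \<phi>, abs_L2 (Grad \<phi>))" using X by blast
  then obtain \<phi> where \<phi>: "\<And>n. test \<Omega> (\<phi> n)" "\<And>n. X n = (abs_L2 (\<phi> n), abs_L2 (Grad (\<phi> n)))" by metis
  show thesis using that[OF \<phi>(1)] tendsto_fst[OF lim] tendsto_snd[OF lim] by (simp add: \<phi>(2))
qed

lemma Korn:
  assumes "(v, G) \<in> H10 \<Omega>"
  shows "norm G \<le> 2 * norm (dev_L2 G)"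
proof -
  obtain \<phi> where \<phi>: "\<And>n. test \<Omega> (\<phi> n)" "(\<lambda>n. abs_L2 (Grad (\<phi> n))) \<longlonglongrightarrow> G"
    using H10_sequence[OF assms] by metis
  have "norm (abs_L2 (Grad (\<phi> n))) \<le> 2 * norm (dev_L2 (abs_L2 (Grad (\<phi> n))))" for n
    using Korn_test[OF test_mono[OF \<phi>(1)]] by (simp add: abs_L2_dev[OF test_sq_int[OF test_Grad[OF \<phi>(1)]]])
  moreover have "(\<lambda>n. norm (abs_L2 (Grad (\<phi> n)))) \<longlonglongrightarrow> norm G" by (intro tendsto_norm \<phi>)
  moreover have "(\<lambda>n. 2 * norm (dev_L2 (abs_L2 (Grad (\<phi> n))))) \<longlonglongrightarrow> 2 * norm (dev_L2 G)"
    by (intro tendsto_mult tendsto_const tendsto_norm bounded_linear.tendsto[OF bounded_linear_dev_L2] \<phi>)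
  ultimately show ?thesis by (meson LIMSEQ_le)
qed

lemma Poincare:
  assumes "(v, G) \<in> H10 \<Omega>" "\<Omega> \<subseteq> cball 0 R"
  shows "norm v \<le> 2 * R * norm G"
proof -
  obtain \<phi> where \<phi>: "\<And>n. test \<Omega> (\<phi> n)" "(\<lambda>n. abs_L2 (\<phi> n)) \<longlonglongrightarrow> v" "(\<lambda>n. abs_L2 (Grad (\<phi> n))) \<longlonglongrightarrow> G"
    using H10_sequence[OF assms(1)] by metis
  have "norm (abs_L2 (\<phi> n)) \<le> 2 * R * norm (abs_L2 (Grad (\<phi> n)))" for n
    by (rule Poincare_test[OF test_mono[OF \<phi>(1) assms(2)]])
  moreover have "(\<lambda>n. norm (abs_L2 (\<phi> n))) \<longlonglongrightarrow> norm v" by (intro tendsto_norm \<phi>)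
  moreover have "(\<lambda>n. 2 * R * norm (abs_L2 (Grad (\<phi> n)))) \<longlonglongrightarrow> 2 * R * norm G"
    by (intro tendsto_mult tendsto_const tendsto_norm \<phi>)
  ultimately show ?thesis by (meson LIMSEQ_le)
qed

text \<open>By Korn and Poincare, Cauchy deviatoric gradients force the gradients and the fields to
  be Cauchy. From this come both the closedness of the range and the description of the closed
  operator on H_0^1(\<Omega>).\<close>

lemma H10_complete:
  assumes X: "\<And>n. (v n, G n) \<in> H10 \<Omega>" and R: "\<Omega> \<subseteq> cball 0 R" and lim: "(\<lambda>n. dev_L2 (G n)) \<longlonglongrightarrow> T"
  shows "\<exists>w F. (w, F) \<in> H10 \<Omega> \<and> v \<longlonglongrightarrow> w \<and> G \<longlonglongrightarrow> F \<and> T = dev_L2 F"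
proof -
  have diff: "(v m - v n, G m - G n) \<in> H10 \<Omega>" for m n
    using subspace_diff[OF subspace_H10 X[of m] X[of n]] by simp
  have C: "Cauchy (\<lambda>n. dev_L2 (G n))" using lim LIMSEQ_imp_Cauchy by blast
  have k: "norm (G m - G n) \<le> 2 * norm (dev_L2 (G m) - dev_L2 (G n))" for m n
    using Korn[OF diff, of m n] by (simp add: linear_diff[OF bounded_linear.linear[OF bounded_linear_dev_L2]])
  have "Cauchy G"
  proof (rule CauchyI)
    fix e :: real assume "e > 0"
    then obtain M where M: "\<forall>m\<ge>M. \<forall>n\<ge>M. norm (dev_L2 (G m) - dev_L2 (G n)) < e / 2" using CauchyD[OF C, of "e/2"] by auto
    have "norm (G m - G n) < e" if "m \<ge> M" "n \<ge> M" for m n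
    proof -
      have "norm (dev_L2 (G m) - dev_L2 (G n)) < e / 2" using M that by blast
      with k[of m n] show ?thesis by linarith
    qed
    then show "\<exists>M. \<forall>m\<ge>M. \<forall>n\<ge>M. norm (G m - G n) < e" by blast
  qed
  then obtain F where F: "G \<longlonglongrightarrow> F" using Cauchy_convergent convergent_def by blast
  \<comment> \<open>\<open>R\<close> may be negative when \<Omega> is empty; the enlarged constant
    is positive and can be divided by.\<close>
  have p: "norm (v m - v n) \<le> (2 * \<bar>R\<bar> + 1) * norm (G m - G n)" for m n
  proof -
    have "norm (v m - v n) \<le> 2 * R * norm (G m - G n)" by (rule Poincare[OF diff R])
    also have "\<dots> \<le> (2 * \<bar>R\<bar> + 1) * norm (G m - G n)" by (intro mult_right_mono) auto
    finally show ?thesis .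
  qed
  have "Cauchy v"
  proof (rule CauchyI)
    fix e :: real assume e: "e > 0"
    have "2 * \<bar>R\<bar> + 1 > 0" by linarith
    with e obtain M where M: "\<forall>m\<ge>M. \<forall>n\<ge>M. norm (G m - G n) < e / (2 * \<bar>R\<bar> + 1)"
      using CauchyD[OF \<open>Cauchy G\<close>, of "e / (2 * \<bar>R\<bar> + 1)"] by auto
    have "norm (v m - v n) < e" if "m \<ge> M" "n \<ge> M" for m n
    proof -
      have "norm (G m - G n) < e / (2 * \<bar>R\<bar> + 1)" using M that by blast
      then have "(2 * \<bar>R\<bar> + 1) * norm (G m - G n) < e" using \<open>2 * \<bar>R\<bar> + 1 > 0\<close> by (simp add: pos_less_divide_eq mult.commute)
      with p[of m n] show ?thesis by linarith
    qed
    then show "\<exists>M. \<forall>m\<ge>M. \<forall>n\<ge>M. norm (v m - v n) < e" by blast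
  qed
  then obtain w where w: "v \<longlonglongrightarrow> w" using Cauchy_convergent convergent_def by blast
  have "(\<lambda>n. (v n, G n)) \<longlonglongrightarrow> (w, F)" by (rule tendsto_Pair[OF w F])
  from closed_sequentially[OF closed_H10 X this] have "(w, F) \<in> H10 \<Omega>" .
  moreover have "T = dev_L2 F"
    using LIMSEQ_unique[OF lim bounded_linear.tendsto[OF bounded_linear_dev_L2 F]] .
  ultimately show ?thesis using w F by blast
qed

text \<open>Closing the graph of the deviatoric gradient produces nothing beyond H_0^1(\<Omega>),
  because convergence of the deviatoric gradients already entails convergence of the full
  gradients.\<close>

lemma devGrad0_eq:
  assumes R: "\<Omega> \<subseteq> cball 0 R"
  shows "devGrad0 \<Omega> = {(v, dev_L2 G) | v G. (v, G) \<in> H10 \<Omega>}"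
proof -
  have eq: "{(restr \<Omega> \<phi>, restr \<Omega> (\<lambda>x. dev (Grad \<phi> x))) | \<phi>. test \<Omega> \<phi>} =
      {(abs_L2 \<phi>, dev_L2 (abs_L2 (Grad \<phi>))) | \<phi>. test \<Omega> \<phi>}"
  proof -
    have e: "restr \<Omega> (\<lambda>x. dev (Grad \<phi> x)) = dev_L2 (abs_L2 (Grad \<phi>))" "restr \<Omega> \<phi> = abs_L2 \<phi>" if "test \<Omega> \<phi>" for \<phi>
      using that by (simp_all add: restr_test test_dev test_Grad abs_L2_dev[OF test_sq_int[OF test_Grad[OF that]]])
    show ?thesis
    proof (intro subset_antisym subsetI)
      fix u assume "u \<in> {(restr \<Omega> \<phi>, restr \<Omega> (\<lambda>x. dev (Grad \<phi> x))) | \<phi>. test \<Omega> \<phi>}"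
      then obtain \<phi> where \<phi>: "test \<Omega> \<phi>" "u = (restr \<Omega> \<phi>, restr \<Omega> (\<lambda>x. dev (Grad \<phi> x)))" by blast
      then show "u \<in> {(abs_L2 \<phi>, dev_L2 (abs_L2 (Grad \<phi>))) | \<phi>. test \<Omega> \<phi>}"
        unfolding \<phi>(2) e[OF \<phi>(1)] by blast
    next
      fix u assume "u \<in> {(abs_L2 \<phi>, dev_L2 (abs_L2 (Grad \<phi>))) | \<phi>. test \<Omega> \<phi>}"
      then obtain \<phi> where \<phi>: "test \<Omega> \<phi>" "u = (abs_L2 \<phi>, dev_L2 (abs_L2 (Grad \<phi>)))" by blast
      then show "u \<in> {(restr \<Omega> \<phi>, restr \<Omega> (\<lambda>x. dev (Grad \<phi> x))) | \<phi>. test \<Omega> \<phi>}"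
        unfolding \<phi>(2) e[OF \<phi>(1), symmetric] by blast
    qed
  qed
  show ?thesis
  proof
    show "devGrad0 \<Omega> \<subseteq> {(v, dev_L2 G) | v G. (v, G) \<in> H10 \<Omega>}"
      unfolding devGrad0_def eq
    proof (rule closure_minimal)
      show "{(abs_L2 \<phi>, dev_L2 (abs_L2 (Grad \<phi>))) | \<phi>. test \<Omega> \<phi>} \<subseteq> {(v, dev_L2 G) | v G. (v, G) \<in> H10 \<Omega>}"
        using H10_test by blast
      show "closed {(v, dev_L2 G) | v G. (v, G) \<in> H10 \<Omega>}"
        unfolding closed_sequential_limits
      proof (intro allI impI, elim conjE)
        fix X l assume X: "\<forall>n. X n \<in> {(v, dev_L2 G) | v G. (v, G) \<in> H10 \<Omega>}" and lim: "X \<longlonglongrightarrow> l"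
        have "\<forall>n. \<exists>v G. (v, G) \<in> H10 \<Omega> \<and> X n = (v, dev_L2 G)" using X by blast
        then obtain v G where vG: "\<And>n. (v n, G n) \<in> H10 \<Omega>" "\<And>n. X n = (v n, dev_L2 (G n))" by metis
        have l1: "v \<longlonglongrightarrow> fst l" and l2: "(\<lambda>n. dev_L2 (G n)) \<longlonglongrightarrow> snd l"
          using tendsto_fst[OF lim] tendsto_snd[OF lim] by (simp_all add: vG(2))
        from H10_complete[OF vG(1) R l2] obtain w F where "(w, F) \<in> H10 \<Omega>" "v \<longlonglongrightarrow> w" "snd l = dev_L2 F" by blast
        moreover from this(2) l1 have "w = fst l" by (rule LIMSEQ_unique)
        ultimately show "l \<in> {(v, dev_L2 G) | v G. (v, G) \<in> H10 \<Omega>}" by (cases l) auto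
      qed
    qed
  next
    show "{(v, dev_L2 G) | v G. (v, G) \<in> H10 \<Omega>} \<subseteq> devGrad0 \<Omega>"
    proof safe
      fix v G assume "(v, G) \<in> H10 \<Omega>"
      then obtain \<phi> where \<phi>: "\<And>n. test \<Omega> (\<phi> n)" "(\<lambda>n. abs_L2 (\<phi> n)) \<longlonglongrightarrow> v" "(\<lambda>n. abs_L2 (Grad (\<phi> n))) \<longlonglongrightarrow> G"
        by (rule H10_sequence) blast
      have "(\<lambda>n. (abs_L2 (\<phi> n), dev_L2 (abs_L2 (Grad (\<phi> n))))) \<longlonglongrightarrow> (v, dev_L2 G)"
        by (intro tendsto_Pair \<phi> bounded_linear.tendsto[OF bounded_linear_dev_L2])
      then show "(v, dev_L2 G) \<in> devGrad0 \<Omega>"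
        unfolding devGrad0_def eq closure_sequential using \<phi>(1)
        by (intro exI[of _ "\<lambda>n. (abs_L2 (\<phi> n), dev_L2 (abs_L2 (Grad (\<phi> n))))"]) blast
    qed
  qed
qed

lemma devGrad_range:
  assumes R: "\<Omega> \<subseteq> cball 0 R"
  shows subspace_devGrad_range: "subspace (dev_L2 ` Range (H10 \<Omega>))" and closed_devGrad_range: "closed (dev_L2 ` Range (H10 \<Omega>))"
proof -
  have "Range (H10 \<Omega>) = snd ` H10 \<Omega>" by force
  then have "subspace (Range (H10 \<Omega>))"
    using linear_subspace_image[OF linear_snd subspace_H10] by simp
  then show "subspace (dev_L2 ` Range (H10 \<Omega>))"
    by (rule linear_subspace_image[OF bounded_linear.linear[OF bounded_linear_dev_L2]])
  show "closed (dev_L2 ` Range (H10 \<Omega>))"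
    unfolding closed_sequential_limits
  proof (intro allI impI, elim conjE)
    fix X T assume X: "\<forall>n. X n \<in> dev_L2 ` Range (H10 \<Omega>)" and lim: "X \<longlonglongrightarrow> T"
    have "\<forall>n. \<exists>v G. (v, G) \<in> H10 \<Omega> \<and> X n = dev_L2 G" using X by blast
    then obtain v G where vG: "\<And>n. (v n, G n) \<in> H10 \<Omega>" "\<And>n. X n = dev_L2 (G n)" by metis
    have "(\<lambda>n. dev_L2 (G n)) \<longlonglongrightarrow> T" using lim by (simp add: vG(2)[symmetric])
    from H10_complete[OF vG(1) R this] show "T \<in> dev_L2 ` Range (H10 \<Omega>)" by blast
  qed
qed

text \<open>A sequence that converges in the mean has a subsequence that converges almost
  everywhere, and closed pointwise conditions survive such limits.\<close>

lemma closed_L2_AE: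
  assumes P: "\<And>x. closed {y. P x y}"
  shows "closed {u :: 'b::euclidean_space L2. L2_AE P u}"
  unfolding closed_sequential_limits
proof (intro allI impI, elim conjE)
  fix X and l :: "'b L2" assume X: "\<forall>n. X n \<in> {u. L2_AE P u}" and lim: "X \<longlonglongrightarrow> l"
  obtain g where g: "sq_int g" "l = abs_L2 g" by (rule abs_L2_cases)
  have "\<forall>n. \<exists>f. sq_int f \<and> X n = abs_L2 f" using abs_L2_cases by metis
  then obtain f where f: "\<And>n. sq_int (f n)" "\<And>n. X n = abs_L2 (f n)" by metis
  have "(\<lambda>n. abs_L2 (f n)) \<longlonglongrightarrow> abs_L2 g" using lim by (simp add: g flip: f(2))
  from L2_AE_subsequence[OF f(1) g(1) this] obtain r :: "nat \<Rightarrow> nat" where r: "AE x in lebesgue. (\<lambda>n. f (r n) x) \<longlonglongrightarrow> g x" by blast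
  have "AE x in lebesgue. \<forall>n. P x (f n x)" using X by (simp add: AE_all_countable f(2) abs_L2_AE[OF f(1)])
  with r have "AE x in lebesgue. P x (g x)"
  proof eventually_elim
    case (elim x)
    have "g x \<in> {y. P x y}" by (rule closed_sequentially[OF P _ elim(1)]) (use elim(2) in simp)
    then show ?case by simp
  qed
  then show "l \<in> {u. L2_AE P u}" by (simp add: g abs_L2_AE)
qed

lemma closed_L2_on: "closed (L2_on \<Omega>)"
  unfolding L2_on_def
proof (rule closed_L2_AE)
  show "closed {y :: 'a. x \<notin> \<Omega> \<longrightarrow> y = 0}" for x by (cases "x \<in> \<Omega>") auto
qed

lemma L2_on_abs: "sq_int f \<Longrightarrow> abs_L2 f \<in> L2_on \<Omega> \<longleftrightarrow> (AE x in lebesgue. x \<notin> \<Omega> \<longrightarrow> f x = 0)"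
  by (simp add: L2_on_def abs_L2_AE)

lemma L2_T_abs: "sq_int f \<Longrightarrow> abs_L2 f \<in> L2_T \<Omega> \<longleftrightarrow> (AE x in lebesgue. x \<notin> \<Omega> \<longrightarrow> f x = 0) \<and> (AE x in lebesgue. trace (f x) = 0)"
  by (simp add: L2_T_def L2_on_abs abs_L2_AE)

lemma bounded_linear_trace: "bounded_linear (trace :: real^3^3 \<Rightarrow> real)"
  unfolding linear_conv_bounded_linear[symmetric]
  by (rule linearI) (simp_all add: trace_def sum.distrib sum_distrib_left)

lemma closed_L2_T: "closed (L2_T \<Omega>)"
proof -
  have "closed {A. trace (A::real^3^3) = 0}"
    by (intro closed_Collect_eq linear_continuous_on[OF bounded_linear_trace] continuous_on_const)
  then have "closed {u. L2_AE (\<lambda>x A. trace (A::real^3^3) = 0) u}" by (rule closed_L2_AE)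
  moreover have "L2_T \<Omega> = L2_on \<Omega> \<inter> {u. L2_AE (\<lambda>x A. trace (A::real^3^3) = 0) u}" by (auto simp: L2_T_def)
  ultimately show ?thesis using closed_L2_on by auto
qed

lemma subspace_L2_AE:
  assumes "\<And>x. P x 0" "\<And>x y z. P x y \<Longrightarrow> P x z \<Longrightarrow> P x (y + z)" "\<And>x y c. P x y \<Longrightarrow> P x (c *\<^sub>R y)"
  shows "subspace {u :: 'b::euclidean_space L2. L2_AE P u}"
proof (rule subspaceI)
  show "0 \<in> {u :: 'b L2. L2_AE P u}" using assms(1) by (simp add: abs_L2_AE sq_int_zero flip: abs_L2_zero)
next
  fix u v :: "'b L2" and c
  obtain f where f: "sq_int f" "u = abs_L2 f" by (rule abs_L2_cases)
  obtain g where g: "sq_int g" "v = abs_L2 g" by (rule abs_L2_cases)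
  show "u + v \<in> {u. L2_AE P u}" if "u \<in> {u. L2_AE P u}" "v \<in> {u. L2_AE P u}"
  proof -
    have "AE x in lebesgue. P x (f x)" "AE x in lebesgue. P x (g x)" using that f g by (simp_all add: abs_L2_AE)
    then have "AE x in lebesgue. P x (f x + g x)" by eventually_elim (rule assms(2))
    then show ?thesis by (simp add: f g abs_L2_AE sq_int_add flip: abs_L2_add)
  qed
  show "c *\<^sub>R u \<in> {u. L2_AE P u}" if "u \<in> {u. L2_AE P u}"
  proof -
    have "AE x in lebesgue. P x (f x)" using that f by (simp add: abs_L2_AE)
    then have "AE x in lebesgue. P x (c *\<^sub>R f x)" by eventually_elim (rule assms(3))
    then show ?thesis by (simp add: f abs_L2_AE sq_int_scaleR flip: abs_L2_scaleR)
  qed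
qed

lemma subspace_L2_on: "subspace (L2_on \<Omega>)"
  unfolding L2_on_def by (rule subspace_L2_AE) auto

lemma subspace_L2_T: "subspace (L2_T \<Omega>)"
proof -
  interpret linear "trace :: real^3^3 \<Rightarrow> real" by (rule bounded_linear.linear[OF bounded_linear_trace])
  have "subspace {u. L2_AE (\<lambda>x A. trace (A::real^3^3) = 0) u}"
    by (rule subspace_L2_AE) (simp_all add: add scale zero)
  from subspace_inter[OF subspace_L2_on this] show ?thesis
    by (simp add: L2_T_def Int_def)
qed

lemma test_in_L2_on: "test \<Omega> f \<Longrightarrow> abs_L2 f \<in> L2_on \<Omega>"
  by (simp add: L2_on_abs[OF test_sq_int] test_zero_outside)

section \<open>Weak gradients\<close>

lemma Div_nth: "smooth \<Phi> \<Longrightarrow> Div \<Phi> x $ i = (\<Sum>j\<in>UNIV. D j (\<lambda>x. \<Phi> x $ i $ j) x)"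
  by (simp add: Div_def trace_def Grad_nth_smooth smooth_nth)

lemma test_Div:
  assumes "test \<Omega> \<Phi>" shows "test \<Omega> (Div \<Phi>)"
proof (rule test_vec)
  fix i
  have "(\<lambda>x. Div \<Phi> x $ i) = (\<lambda>x. \<Sum>j\<in>UNIV. D j (\<lambda>x. \<Phi> x $ i $ j) x)"
    using Div_nth[OF test_smooth[OF assms]] by blast
  then show "test \<Omega> (\<lambda>x. Div \<Phi> x $ i)"
    by (simp add: test_sum test_pd test_nth assms)
qed

lemma integral_Grad_Div:
  assumes v: "smooth v" and \<Phi>: "test UNIV \<Phi>"
  shows "integral\<^sup>L lebesgue (\<lambda>x. v x \<bullet> Div \<Phi> x) = - integral\<^sup>L lebesgue (\<lambda>x. Grad v x \<bullet> \<Phi> x)"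
proof -
  have t: "test UNIV (\<lambda>x. \<Phi> x $ i $ j)" for i j by (intro test_nth \<Phi>)
  have i1: "integrable lebesgue (\<lambda>x. v x $ i * D j (\<lambda>x. \<Phi> x $ i $ j) x)" for i j
    by (rule test_integrable[OF test_bilinear_right[OF bounded_bilinear_mult smooth_nth[OF v] test_pd[OF t]]])
  have i2: "integrable lebesgue (\<lambda>x. D j (\<lambda>x. v x $ i) x * \<Phi> x $ i $ j)" for i j
    by (rule test_integrable[OF test_bilinear_right[OF bounded_bilinear_mult smooth_pd[OF smooth_nth[OF v]] t]])
  have p: "integral\<^sup>L lebesgue (\<lambda>x. v x $ i * D j (\<lambda>x. \<Phi> x $ i $ j) x)
      = - integral\<^sup>L lebesgue (\<lambda>x. D j (\<lambda>x. v x $ i) x * \<Phi> x $ i $ j)" for i j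
    using integral_by_parts[OF bounded_bilinear_mult t smooth_nth[OF v], of "axis j 1" i j i] by (simp add: mult.commute)
  have "integral\<^sup>L lebesgue (\<lambda>x. v x \<bullet> Div \<Phi> x)
      = integral\<^sup>L lebesgue (\<lambda>x. \<Sum>i\<in>UNIV. \<Sum>j\<in>UNIV. v x $ i * D j (\<lambda>x. \<Phi> x $ i $ j) x)"
    by (simp add: inner_vec_def[of "v _"] Div_nth[OF test_smooth[OF \<Phi>]] sum_distrib_left)
  also have "\<dots> = (\<Sum>i\<in>UNIV. \<Sum>j\<in>UNIV. integral\<^sup>L lebesgue (\<lambda>x. v x $ i * D j (\<lambda>x. \<Phi> x $ i $ j) x))"
    by (simp add: Bochner_Integration.integral_sum i1)
  also have "\<dots> = - (\<Sum>i\<in>UNIV. \<Sum>j\<in>UNIV. integral\<^sup>L lebesgue (\<lambda>x. D j (\<lambda>x. v x $ i) x * \<Phi> x $ i $ j))"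
    by (simp add: p sum_negf)
  also have "\<dots> = - integral\<^sup>L lebesgue (\<lambda>x. \<Sum>i\<in>UNIV. \<Sum>j\<in>UNIV. D j (\<lambda>x. v x $ i) x * \<Phi> x $ i $ j)"
    by (simp add: Bochner_Integration.integral_sum i2)
  also have "\<dots> = - integral\<^sup>L lebesgue (\<lambda>x. Grad v x \<bullet> \<Phi> x)"
    by (simp add: inner_vec_def Grad_nth_smooth[OF v])
  finally show ?thesis .
qed

lemma restr_eq_abs: "restr \<Omega> f = abs_L2 (\<lambda>x. if x \<in> \<Omega> then f x else 0)"
  by (simp add: restr_def)

lemma sq_int_restr_test: "test UNIV f \<Longrightarrow> open \<Omega> \<Longrightarrow> sq_int (\<lambda>x. if x \<in> \<Omega> then f x else 0)"
  by (intro sq_int_restrict test_sq_int) auto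

text \<open>The support of \<Phi> is compact in \<Omega>, so the restrictions disappear under the
  integrals and classical integration by parts applies without a boundary term.\<close>

lemma weak_Grad_restr:
  assumes \<Omega>: "open \<Omega>" and v: "test UNIV v"
  shows "(restr \<Omega> v, restr \<Omega> (Grad v)) \<in> weak_Grad \<Omega>"
  unfolding weak_Grad_def mem_Collect_eq case_prod_conv
proof (intro conjI allI impI)
  note s = sq_int_restr_test[OF v \<Omega>] sq_int_restr_test[OF test_Grad[OF v] \<Omega>]
  show "restr \<Omega> v \<in> L2_on \<Omega>" "restr \<Omega> (Grad v) \<in> L2_on \<Omega>"
    using s by (simp_all add: restr_eq_abs L2_on_abs)
  fix \<Phi> :: "real^3 \<Rightarrow> real^3^3" assume \<Phi>: "test \<Omega> \<Phi>"
  have "restr \<Omega> v \<bullet> restr \<Omega> (Div \<Phi>) = integral\<^sup>L lebesgue (\<lambda>x. (if x \<in> \<Omega> then v x else 0) \<bullet> Div \<Phi> x)"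
    by (simp add: restr_test[OF test_Div[OF \<Phi>]] restr_eq_abs[of \<Omega> v] abs_L2_inner[OF s(1) test_sq_int[OF test_Div[OF \<Phi>]]])
  also have "(\<lambda>x. (if x \<in> \<Omega> then v x else 0) \<bullet> Div \<Phi> x) = (\<lambda>x. v x \<bullet> Div \<Phi> x)"
    using test_zero_outside[OF test_Div[OF \<Phi>]] by auto
  also have "integral\<^sup>L lebesgue \<dots> = - integral\<^sup>L lebesgue (\<lambda>x. Grad v x \<bullet> \<Phi> x)"
    by (rule integral_Grad_Div[OF test_smooth[OF v] test_mono[OF \<Phi>]]) simp
  also have "(\<lambda>x. Grad v x \<bullet> \<Phi> x) = (\<lambda>x. (if x \<in> \<Omega> then Grad v x else 0) \<bullet> \<Phi> x)"
    using test_zero_outside[OF \<Phi>] by auto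
  also have "integral\<^sup>L lebesgue \<dots> = restr \<Omega> (Grad v) \<bullet> restr \<Omega> \<Phi>"
    by (simp add: restr_test[OF \<Phi>] restr_eq_abs[of \<Omega> "Grad v"] abs_L2_inner[OF s(2) test_sq_int[OF \<Phi>]])
  finally show "restr \<Omega> v \<bullet> restr \<Omega> (Div \<Phi>) = - (restr \<Omega> (Grad v) \<bullet> restr \<Omega> \<Phi>)" .
qed

lemma H10_weak_Grad:
  assumes \<Omega>: "open \<Omega>" and v: "(v, G) \<in> H10 \<Omega>"
  shows "(v, G) \<in> weak_Grad \<Omega>"
  unfolding weak_Grad_def mem_Collect_eq case_prod_conv
proof (intro conjI allI impI)
  obtain \<phi> where \<phi>: "\<And>n. test \<Omega> (\<phi> n)" and l1: "(\<lambda>n. abs_L2 (\<phi> n)) \<longlonglongrightarrow> v" and l2: "(\<lambda>n. abs_L2 (Grad (\<phi> n))) \<longlonglongrightarrow> G"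
    using H10_sequence[OF v] by metis
  show "v \<in> L2_on \<Omega>" by (rule closed_sequentially[OF closed_L2_on _ l1]) (rule test_in_L2_on[OF \<phi>])
  show "G \<in> L2_on \<Omega>" by (rule closed_sequentially[OF closed_L2_on _ l2]) (rule test_in_L2_on[OF test_Grad[OF \<phi>]])
  fix \<Phi> :: "real^3 \<Rightarrow> real^3^3" assume \<Phi>: "test \<Omega> \<Phi>"
  have "(\<lambda>n. abs_L2 (\<phi> n) \<bullet> restr \<Omega> (Div \<Phi>)) \<longlonglongrightarrow> v \<bullet> restr \<Omega> (Div \<Phi>)" by (intro tendsto_intros l1)
  moreover have "(\<lambda>n. - (abs_L2 (Grad (\<phi> n)) \<bullet> restr \<Omega> \<Phi>)) \<longlonglongrightarrow> - (G \<bullet> restr \<Omega> \<Phi>)" by (intro tendsto_intros l2)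
  moreover have "abs_L2 (\<phi> n) \<bullet> restr \<Omega> (Div \<Phi>) = - (abs_L2 (Grad (\<phi> n)) \<bullet> restr \<Omega> \<Phi>)" for n
    using weak_Grad_restr[OF \<Omega> test_mono[OF \<phi>[of n]]] \<Phi> restr_test[OF \<phi>[of n]] restr_test[OF test_Grad[OF \<phi>[of n]]]
    by (simp add: weak_Grad_def)
  ultimately show "v \<bullet> restr \<Omega> (Div \<Phi>) = - (G \<bullet> restr \<Omega> \<Phi>)" using LIMSEQ_unique by simp
qed

lemma weak_Grad_diff: "(v, G) \<in> weak_Grad \<Omega> \<Longrightarrow> (w, F) \<in> weak_Grad \<Omega> \<Longrightarrow> (v - w, G - F) \<in> weak_Grad \<Omega>"
  by (simp add: weak_Grad_def subspace_diff[OF subspace_L2_on] inner_diff_left)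

text \<open>The difference of two weak gradients is orthogonal to all test fields, which are dense,
  so it vanishes. This justifies the description operator in \<open>devGrad\<close>.\<close>

lemma weak_Grad_unique:
  assumes \<Omega>: "open \<Omega>" and "(v, G) \<in> weak_Grad \<Omega>" "(v, F) \<in> weak_Grad \<Omega>"
  shows "G = F"
proof -
  have d: "(0, G - F) \<in> weak_Grad \<Omega>" using weak_Grad_diff[OF assms(2,3)] by simp
  obtain h where h: "sq_int h" "G - F = abs_L2 h" by (rule abs_L2_cases)
  have "AE x in lebesgue. x \<notin> \<Omega> \<longrightarrow> h x = 0" using d h by (simp add: weak_Grad_def L2_on_abs)
  from test_dense_L2[OF h(1) \<Omega> this] obtain X where X: "\<And>n. X n \<in> {abs_L2 \<phi> | \<phi>. test \<Omega> \<phi>}" and lim: "X \<longlonglongrightarrow> G - F"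
    unfolding closure_sequential h(2) by blast
  have "(G - F) \<bullet> X n = 0" for n
  proof -
    obtain \<phi> where "test \<Omega> \<phi>" "X n = abs_L2 \<phi>" using X[of n] by blast
    then show ?thesis using d by (simp add: weak_Grad_def restr_test)
  qed
  moreover have "(\<lambda>n. (G - F) \<bullet> X n) \<longlonglongrightarrow> (G - F) \<bullet> (G - F)" by (intro tendsto_intros lim)
  ultimately have "(G - F) \<bullet> (G - F) = 0" by (simp add: LIMSEQ_const_iff)
  then show ?thesis by simp
qed

lemma devGrad_eq:
  assumes "open \<Omega>" "(v, G) \<in> weak_Grad \<Omega>"
  shows "devGrad \<Omega> v = dev_L2 G"
proof -
  have "(THE G. (v, G) \<in> weak_Grad \<Omega>) = G" using assms weak_Grad_unique by blast
  then show ?thesis by (simp add: devGrad_def)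
qed

text \<open>The kernel of an adjoint is the orthogonal complement of the range, here taken inside
  \<open>L2_T \<Omega>\<close>. This is the form in which \<open>Div_T\<close> is used from here
  on.\<close>

lemma ker_Div_T_iff:
  assumes R: "\<Omega> \<subseteq> cball 0 R"
  shows "T \<in> ker (Div_T \<Omega>) \<longleftrightarrow> T \<in> L2_T \<Omega> \<and> (\<forall>q\<in>dev_L2 ` Range (H10 \<Omega>). T \<bullet> q = 0)"
proof -
  have "T \<in> ker (Div_T \<Omega>) \<longleftrightarrow> T \<in> L2_T \<Omega> \<and> (\<forall>(x, a)\<in>devGrad0 \<Omega>. a \<bullet> T = 0)"
    using subspace_0[OF subspace_L2_on] by (auto simp: ker_def Div_T_def neg_op_def adjoint_on_def)
  also have "(\<forall>(x, a)\<in>devGrad0 \<Omega>. a \<bullet> T = 0) \<longleftrightarrow> (\<forall>q\<in>dev_L2 ` Range (H10 \<Omega>). T \<bullet> q = 0)"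
    unfolding devGrad0_eq[OF R] inner_commute[of T] by blast
  finally show ?thesis .
qed

section \<open>Localization\<close>

lemma tendsto_abs_L2_multiplier:
  fixes h :: "real^3 \<Rightarrow> 'b::euclidean_space \<Rightarrow> 'c::euclidean_space"
  assumes f: "\<And>n. sq_int (f n)" and g: "sq_int g" and lim: "(\<lambda>n. abs_L2 (f n)) \<longlonglongrightarrow> abs_L2 g"
    and h: "\<And>u. sq_int u \<Longrightarrow> sq_int (\<lambda>x. h x (u x))"
    and hd: "\<And>x a b. h x (a - b) = h x a - h x b" and hb: "\<And>x a. norm (h x a) \<le> C * norm a"
  shows "(\<lambda>n. abs_L2 (\<lambda>x. h x (f n x))) \<longlonglongrightarrow> abs_L2 (\<lambda>x. h x (g x))"
proof (rule LIM_zero_cancel, rule Lim_null_comparison)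
  have "norm (abs_L2 (\<lambda>x. h x (f n x)) - abs_L2 (\<lambda>x. h x (g x))) \<le> \<bar>C\<bar> * norm (abs_L2 (f n) - abs_L2 g)" for n
  proof -
    have "norm (abs_L2 (\<lambda>x. h x (f n x)) - abs_L2 (\<lambda>x. h x (g x))) = norm (abs_L2 (\<lambda>x. h x (f n x - g x)))"
      using abs_L2_diff[OF h[OF f] h[OF g], of n] by (simp add: hd)
    also have "\<dots> \<le> norm (abs_L2 (\<lambda>x. \<bar>C\<bar> *\<^sub>R (f n x - g x)))"
    proof (rule abs_L2_norm_le)
      show "sq_int (\<lambda>x. h x (f n x - g x))" by (intro h sq_int_diff f g)
      show "sq_int (\<lambda>x. \<bar>C\<bar> *\<^sub>R (f n x - g x))" by (intro sq_int_scaleR sq_int_diff f g)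
      show "AE x in lebesgue. norm (h x (f n x - g x)) \<le> norm (\<bar>C\<bar> *\<^sub>R (f n x - g x))"
      proof (rule AE_I2)
        fix x
        have "norm (h x (f n x - g x)) \<le> C * norm (f n x - g x)" by (rule hb)
        also have "\<dots> \<le> \<bar>C\<bar> * norm (f n x - g x)" by (intro mult_right_mono) auto
        finally show "norm (h x (f n x - g x)) \<le> norm (\<bar>C\<bar> *\<^sub>R (f n x - g x))" by simp
      qed
    qed
    also have "\<dots> = \<bar>C\<bar> * norm (abs_L2 (f n) - abs_L2 g)"
      by (simp add: abs_L2_scaleR[OF sq_int_diff[OF f g]] abs_L2_diff[OF f g])
    finally show ?thesis .
  qed
  then show "\<forall>\<^sub>F n in sequentially. norm (abs_L2 (\<lambda>x. h x (f n x)) - abs_L2 (\<lambda>x. h x (g x))) \<le> \<bar>C\<bar> * norm (abs_L2 (f n) - abs_L2 g)"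
    by (intro always_eventually allI)
  have "(\<lambda>n. \<bar>C\<bar> * norm (abs_L2 (f n) - abs_L2 g)) \<longlonglongrightarrow> \<bar>C\<bar> * 0"
    by (intro tendsto_mult tendsto_const tendsto_norm_zero LIM_zero lim)
  then show "(\<lambda>n. \<bar>C\<bar> * norm (abs_L2 (f n) - abs_L2 g)) \<longlonglongrightarrow> 0" by simp
qed

definition outer :: "real^3 \<Rightarrow> real^3 \<Rightarrow> real^3^3" where
  "outer u w = (\<chi> i j. u $ i * w $ j)"

lemma norm_outer: "norm (outer u w) = norm u * norm w"
proof -
  have "(norm (outer u w))\<^sup>2 = (norm u)\<^sup>2 * (norm w)\<^sup>2"
    unfolding power2_norm_eq_inner
    by (simp add: inner_vec_def outer_def sum_3 algebra_simps)
  then have "(norm (outer u w))\<^sup>2 = (norm u * norm w)\<^sup>2" by (simp add: power_mult_distrib)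
  then show ?thesis by (simp add: power2_eq_iff_nonneg)
qed

lemma bounded_bilinear_outer: "bounded_bilinear outer"
proof (rule bounded_bilinear.intro)
  show "\<exists>K. \<forall>a b. norm (outer a b) \<le> norm a * norm b * K" by (intro exI[of _ 1]) (simp add: norm_outer)
qed (simp_all add: outer_def vec_eq_iff algebra_simps)

lemma sq_int_mult_test:
  fixes bl :: "'a::euclidean_space \<Rightarrow> 'b::euclidean_space \<Rightarrow> 'c::euclidean_space"
  assumes bl: "bounded_bilinear bl" and t: "test \<Omega> c" and u: "sq_int u"
  shows "sq_int (\<lambda>x. bl (c x) (u x))"
proof -
  interpret bounded_bilinear bl by fact
  obtain K where K: "K > 0" "\<And>a b. norm (bl a b) \<le> norm a * norm b * K" using pos_bounded by blast
  obtain C where C: "C > 0" "\<And>x. norm (c x) \<le> C" using test_bounded[OF t] by blast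
  show ?thesis
  proof (rule sq_int_dominated[where w = "\<lambda>x. norm ((C * K) *\<^sub>R u x)"])
    have "(\<lambda>p. bl (fst p) (snd p)) \<in> borel_measurable borel"
      by (intro borel_measurable_continuous_onI continuous_on continuous_intros)
    moreover have "(\<lambda>x. (c x, u x)) \<in> borel_measurable lebesgue"
      using smooth_measurable[OF test_smooth[OF t]] sq_int_measurable[OF u] by (rule borel_measurable_Pair)
    ultimately show "(\<lambda>x. bl (c x) (u x)) \<in> borel_measurable lebesgue"
      using measurable_compose[of "\<lambda>x. (c x, u x)" lebesgue borel "\<lambda>p. bl (fst p) (snd p)" borel] by simp
    show "integrable lebesgue (\<lambda>x. (norm ((C * K) *\<^sub>R u x))\<^sup>2)" by (rule sq_int_norm_integrable[OF sq_int_scaleR[OF u]])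
    show "AE x in lebesgue. norm (bl (c x) (u x)) \<le> norm ((C * K) *\<^sub>R u x)"
    proof (rule AE_I2)
      fix x
      have "norm (bl (c x) (u x)) \<le> norm (c x) * norm (u x) * K" by (rule K(2))
      also have "\<dots> \<le> C * norm (u x) * K" using C K(1) by (intro mult_right_mono) auto
      finally show "norm (bl (c x) (u x)) \<le> norm ((C * K) *\<^sub>R u x)" using C(1) K(1) by (simp add: mult_ac)
    qed
  qed
qed

lemma Grad_mult:
  assumes "smooth c" "smooth v"
  shows "Grad (\<lambda>x. c x *\<^sub>R v x) x = c x *\<^sub>R Grad v x + outer (v x) (\<chi> j. D j c x)"
  by (simp add: vec_eq_iff Grad_nth outer_def pd_bilinear[OF bounded_bilinear_scaleR] assms smooth_differentiable)

text \<open>The product rule holds along the approximating test fields. Each of its terms is a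
  bounded multiplier applied to \<open>\<phi> n\<close> or to its gradient, so the graph limit
  exists.\<close>

lemma H10_mult:
  assumes z: "sq_int z" and zG: "(abs_L2 z, G) \<in> H10 A" and c: "test UNIV c"
  shows "\<exists>F. (abs_L2 (\<lambda>x. c x *\<^sub>R z x), F) \<in> H10 A"
proof -
  obtain g where g: "sq_int g" "G = abs_L2 g" by (rule abs_L2_cases)
  obtain \<phi> where \<phi>: "\<And>n. test A (\<phi> n)" and l1: "(\<lambda>n. abs_L2 (\<phi> n)) \<longlonglongrightarrow> abs_L2 z" and l2: "(\<lambda>n. abs_L2 (Grad (\<phi> n))) \<longlonglongrightarrow> abs_L2 g"
    using H10_sequence[OF zG] g(2) by metis
  have s\<phi>: "sq_int (\<phi> n)" "sq_int (Grad (\<phi> n))" for n by (intro test_sq_int[of A] test_Grad \<phi>)+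
  have td: "test UNIV (\<lambda>x. (\<chi> j. D j c x) :: real^3)" by (rule test_vec) (simp add: test_pd[OF c])
  obtain C where C: "C > 0" "\<And>x. norm (c x) \<le> C" using test_bounded[OF c] by blast
  obtain C' where C': "C' > 0" "\<And>x. norm ((\<chi> j. D j c x) :: real^3) \<le> C'" using test_bounded[OF td] by blast
  have s1: "sq_int (\<lambda>x. c x *\<^sub>R u x)" if "sq_int u" for u :: "real^3 \<Rightarrow> real^3"
    by (rule sq_int_mult_test[OF bounded_bilinear_scaleR c that])
  have s2: "sq_int (\<lambda>x. c x *\<^sub>R u x)" if "sq_int u" for u :: "real^3 \<Rightarrow> real^3^3"
    by (rule sq_int_mult_test[OF bounded_bilinear_scaleR c that])
  have s3: "sq_int (\<lambda>x. outer (u x) (\<chi> j. D j c x))" if "sq_int u" for u :: "real^3 \<Rightarrow> real^3"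
    using sq_int_mult_test[OF bounded_bilinear.flip[OF bounded_bilinear_outer] td that] by simp
  have "(\<lambda>n. abs_L2 (\<lambda>x. c x *\<^sub>R \<phi> n x)) \<longlonglongrightarrow> abs_L2 (\<lambda>x. c x *\<^sub>R z x)"
    by (rule tendsto_abs_L2_multiplier[where h = "\<lambda>x y. c x *\<^sub>R y" and C = C, OF s\<phi>(1) z l1 s1])
      (use C(2) in \<open>auto simp: scaleR_diff_right intro: mult_right_mono\<close>)
  moreover have "(\<lambda>n. abs_L2 (\<lambda>x. c x *\<^sub>R Grad (\<phi> n) x)) \<longlonglongrightarrow> abs_L2 (\<lambda>x. c x *\<^sub>R g x)"
    by (rule tendsto_abs_L2_multiplier[where h = "\<lambda>x y. c x *\<^sub>R y" and C = C, OF s\<phi>(2) g(1) l2 s2])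
      (use C(2) in \<open>auto simp: scaleR_diff_right intro: mult_right_mono\<close>)
  moreover have "(\<lambda>n. abs_L2 (\<lambda>x. outer (\<phi> n x) (\<chi> j. D j c x))) \<longlonglongrightarrow> abs_L2 (\<lambda>x. outer (z x) (\<chi> j. D j c x))"
  proof (rule tendsto_abs_L2_multiplier[where h = "\<lambda>x y. outer y (\<chi> j. D j c x)" and C = C', OF s\<phi>(1) z l1 s3])
    show "norm (outer a (\<chi> j. D j c x)) \<le> C' * norm a" for x a
      using mult_right_mono[OF C'(2)[of x] norm_ge_zero[of a]] by (simp add: norm_outer mult.commute)
  qed (assumption | rule bounded_bilinear.diff_left[OF bounded_bilinear_outer])+
  ultimately have "(\<lambda>n. (abs_L2 (\<lambda>x. c x *\<^sub>R \<phi> n x), abs_L2 (\<lambda>x. c x *\<^sub>R Grad (\<phi> n) x) + abs_L2 (\<lambda>x. outer (\<phi> n x) (\<chi> j. D j c x))))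
      \<longlonglongrightarrow> (abs_L2 (\<lambda>x. c x *\<^sub>R z x), abs_L2 (\<lambda>x. c x *\<^sub>R g x) + abs_L2 (\<lambda>x. outer (z x) (\<chi> j. D j c x)))"
    by (intro tendsto_Pair tendsto_add)
  moreover have "(abs_L2 (\<lambda>x. c x *\<^sub>R \<phi> n x), abs_L2 (\<lambda>x. c x *\<^sub>R Grad (\<phi> n) x) + abs_L2 (\<lambda>x. outer (\<phi> n x) (\<chi> j. D j c x))) \<in> H10 A" for n
  proof -
    have "test A (\<lambda>x. c x *\<^sub>R \<phi> n x)"
      by (rule test_bilinear_right[OF bounded_bilinear_scaleR test_smooth[OF c] \<phi>])
    moreover have "Grad (\<lambda>x. c x *\<^sub>R \<phi> n x) = (\<lambda>x. c x *\<^sub>R Grad (\<phi> n) x + outer (\<phi> n x) (\<chi> j. D j c x))"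
      using Grad_mult[OF test_smooth[OF c] test_smooth[OF \<phi>]] by blast
    ultimately show ?thesis
      using H10_test[of A "\<lambda>x. c x *\<^sub>R \<phi> n x"] by (simp add: abs_L2_add[OF s2[OF s\<phi>(2)] s3[OF s\<phi>(1)]])
  qed
  ultimately have "(abs_L2 (\<lambda>x. c x *\<^sub>R z x), abs_L2 (\<lambda>x. c x *\<^sub>R g x) + abs_L2 (\<lambda>x. outer (z x) (\<chi> j. D j c x))) \<in> H10 A"
    using closed_sequentially[OF closed_H10] by fast
  then show ?thesis by blast
qed

text \<open>The segment property in quantitative form for a single set: arbitrarily small
  translations move \<open>S\<close> into \<Omega>, with room for a ball. The ball around
  \<open>c\<close> is to carry the support of a mollifier.\<close>

definition shiftable :: "(real^3) set \<Rightarrow> (real^3) set \<Rightarrow> bool" where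
  "shiftable S \<Omega> \<longleftrightarrow> (\<forall>\<delta>>0. \<exists>c r. r > 0 \<and> ball c r \<subseteq> ball 0 \<delta> \<and> (\<forall>y\<in>S. \<forall>u\<in>cball c r. y + u \<in> \<Omega>))"

text \<open>Mollifiers centred off the origin translate the support into \<Omega> while smoothing.
  As \<open>z\<close> has its gradient on the whole space, convolution commutes with the gradient,
  and the mollified pairs converge.\<close>

lemma H10_shiftable:
  assumes z: "sq_int z" and zG: "(abs_L2 z, G) \<in> H10 UNIV" and S: "compact S" "AE x in lebesgue. x \<notin> S \<longrightarrow> z x = 0"
    and sh: "shiftable S \<Omega>"
  shows "(abs_L2 z, G) \<in> H10 \<Omega>"
proof -
  obtain g where g: "sq_int g" "G = abs_L2 g" by (rule abs_L2_cases)
  have "\<forall>n. \<exists>c r. r > 0 \<and> ball c r \<subseteq> ball 0 (inverse (real (Suc n))) \<and> (\<forall>y\<in>S. \<forall>u\<in>cball c r. y + u \<in> \<Omega>)"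
    using sh unfolding shiftable_def by simp
  then obtain c r where cr: "\<And>n::nat. r n > 0" "\<And>n. ball (c n) (r n) \<subseteq> ball 0 (inverse (real (Suc n)))"
    "\<And>n y u. y \<in> S \<Longrightarrow> u \<in> cball (c n) (r n) \<Longrightarrow> y + u \<in> \<Omega>" by metis
  have "\<forall>n. \<exists>k. mollifier (c n) (r n) k" by (intro allI ex_mollifier cr(1))
  then obtain k where m: "\<And>n. mollifier (c n) (r n) (k n)" by metis
  have t: "test \<Omega> (conv (k n) z)" for n by (rule conv_test[OF z S m cr(3)])
  have cl: "(abs_L2 z, abs_L2 g) \<in> closure {(abs_L2 \<phi>, abs_L2 (dop grad_coeff \<phi>)) | \<phi>. test UNIV \<phi>}"
    using zG by (simp add: H10_def g(2) Grad_eq_dop)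
  have "Grad (conv (k n) z) = conv (k n) g" for n
    unfolding Grad_eq_dop by (rule ext, rule conv_dop[OF mollifier_test[OF m] bounded_linear_grad_coeff z g(1) cl])
  then have "(abs_L2 (conv (k n) z), abs_L2 (conv (k n) g)) \<in> H10 \<Omega>" for n using H10_test[OF t] by metis
  moreover have "(\<lambda>n. (abs_L2 (conv (k n) z), abs_L2 (conv (k n) g))) \<longlonglongrightarrow> (abs_L2 z, G)"
    unfolding g(2) by (intro tendsto_Pair conv_tendsto[OF _ m cr(2)] z g(1))
  ultimately show ?thesis using closed_sequentially[OF closed_H10] by fast
qed

text \<open>Induction on the cover takes the place of a partition of unity: one cutoff splits off a
  part supported in \<open>U\<close>, and what remains is supported in a compact set covered by the
  other members.\<close>

lemma H10_cover:
  assumes fin: "finite \<U>" and op: "\<And>U. U \<in> \<U> \<Longrightarrow> open U"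
    and good: "\<And>U S. U \<in> \<U> \<Longrightarrow> compact S \<Longrightarrow> S \<subseteq> U \<Longrightarrow> S \<subseteq> C \<Longrightarrow> shiftable S \<Omega>"
    and z: "sq_int z" and zG: "(abs_L2 z, G) \<in> H10 UNIV"
    and S: "compact S" "S \<subseteq> C" "S \<subseteq> \<Union>\<U>" "AE x in lebesgue. x \<notin> S \<longrightarrow> z x = 0"
  shows "(abs_L2 z, G) \<in> H10 \<Omega>"
  using fin op good z zG S
proof (induction \<U> arbitrary: z G S rule: finite_induct)
  case empty
  have "shiftable S \<Omega>" unfolding shiftable_def
  proof (intro allI impI)
    fix \<delta> :: real assume "\<delta> > 0"
    then show "\<exists>c r. r > 0 \<and> ball c r \<subseteq> ball 0 \<delta> \<and> (\<forall>y\<in>S. \<forall>u\<in>cball c r. y + u \<in> \<Omega>)"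
      using empty.prems(7) by (intro exI[of _ 0] exI[of _ \<delta>]) auto
  qed
  then show ?case using H10_shiftable empty.prems by blast
next
  case (insert U \<U>)
  \<comment> \<open>The part of \<open>S\<close> that only \<open>U\<close> covers. The cutoff is 1
    on a neighbourhood \<open>V\<close> of it, so the remainder lives on \<open>S - V\<close>,
    inside the union of the others.\<close>
  have K: "compact (S - \<Union>\<U>)" "S - \<Union>\<U> \<subseteq> U"
    using insert.prems by (auto intro!: compact_diff)
  have "open U" using insert.prems by simp
  from ex_cutoff[OF K(1) this K(2)] obtain c :: "real^3 \<Rightarrow> real" and V where c: "test U c" and V: "open V" "S - \<Union>\<U> \<subseteq> V" "\<And>x. x \<in> V \<Longrightarrow> c x = 1"
    by blast
  have cU: "test UNIV c" by (rule test_mono[OF c]) simp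
  have s1: "sq_int (\<lambda>x. c x *\<^sub>R z x)" by (rule sq_int_mult_test[OF bounded_bilinear_scaleR cU insert.prems(3)])
  have s2: "sq_int (\<lambda>x. z x - c x *\<^sub>R z x)" by (intro sq_int_diff s1 insert.prems)
  obtain F where F: "(abs_L2 (\<lambda>x. c x *\<^sub>R z x), F) \<in> H10 UNIV" using H10_mult[OF insert.prems(3,4) cU] by blast
  have 1: "(abs_L2 (\<lambda>x. c x *\<^sub>R z x), F) \<in> H10 \<Omega>"
  proof (rule H10_shiftable[OF s1 F])
    show co: "compact (S \<inter> supp c)" using insert.prems(5) closed_supp by (rule compact_Int_closed)
    show "AE x in lebesgue. x \<notin> S \<inter> supp c \<longrightarrow> c x *\<^sub>R z x = 0"
      using insert.prems(8) by eventually_elim (auto simp: notin_supp)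
    have "supp c \<subseteq> U" using c by (simp add: test_iff)
    then show "shiftable (S \<inter> supp c) \<Omega>" using insert.prems(2)[OF insertI1 co] insert.prems(6) by blast
  qed
  have "(abs_L2 (\<lambda>x. z x - c x *\<^sub>R z x), G - F) \<in> H10 UNIV"
    using subspace_diff[OF subspace_H10 insert.prems(4) F] by (simp add: abs_L2_diff insert.prems(3) s1)
  moreover have op': "open U'" if "U' \<in> \<U>" for U' using insert.prems(1) that by blast
  moreover have good': "shiftable S' \<Omega>" if "U' \<in> \<U>" "compact S'" "S' \<subseteq> U'" "S' \<subseteq> C" for U' S'
    by (rule insert.prems(2)[OF insertI2[OF that(1)] that(2-4)])
  ultimately have 2: "(abs_L2 (\<lambda>x. z x - c x *\<^sub>R z x), G - F) \<in> H10 \<Omega>"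
  proof (intro insert.IH[OF _ _ s2])
    show "compact (S - V)" using insert.prems(5) V(1) by (rule compact_diff)
    show "S - V \<subseteq> C" "S - V \<subseteq> \<Union>\<U>" using insert.prems(6) V(2) by auto
    show "AE x in lebesgue. x \<notin> S - V \<longrightarrow> z x - c x *\<^sub>R z x = 0"
      using insert.prems(8) by eventually_elim (auto simp: V(3))
  qed
  show ?case
    using subspace_add[OF subspace_H10 1 2] by (simp add: abs_L2_diff insert.prems(3) s1)
qed

section \<open>The kernel of the symmetric curl\<close>

definition symcurl_coeff :: "real^3 \<Rightarrow> real^3^3 \<Rightarrow> real^3^3" where
  "symcurl_coeff b M = sym_part (curl_coeff b M)"

lemma bounded_linear_symcurl_coeff: "bounded_linear (symcurl_coeff b)"
  unfolding symcurl_coeff_def[abs_def]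
  by (rule bounded_linear_compose[OF bounded_linear_sym_part bounded_linear_curl_coeff])

lemma symCurl_eq_dop:
  assumes "smooth T" shows "sym_part (Curl T x) = dop symcurl_coeff T x"
  unfolding Curl_eq_dop[OF assms] dop_def symcurl_coeff_def
  by (rule linear_sum[OF bounded_linear.linear[OF bounded_linear_sym_part]])

lemma symCurl_T0_sequence:
  assumes "(T, S) \<in> symCurl_T0 \<Omega>"
  obtains \<Phi> where "\<And>n. test \<Omega> (\<Phi> n)" "\<And>n x. trace (\<Phi> n x) = 0" "(\<lambda>n. abs_L2 (\<Phi> n)) \<longlonglongrightarrow> T"
    "(\<lambda>n. abs_L2 (dop symcurl_coeff (\<Phi> n))) \<longlonglongrightarrow> S"
proof -
  from assms obtain X where X: "\<And>n. X n \<in> {(restr \<Omega> \<Phi>, restr \<Omega> (\<lambda>x. sym_part (Curl \<Phi> x))) | \<Phi>. test \<Omega> \<Phi> \<and> (\<forall>x. trace (\<Phi> x) = 0)}"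
    and lim: "X \<longlonglongrightarrow> (T, S)" unfolding symCurl_T0_def closure_sequential by blast
  have "\<forall>n. \<exists>\<Phi>. test \<Omega> \<Phi> \<and> (\<forall>x. trace (\<Phi> x) = 0) \<and> X n = (restr \<Omega> \<Phi>, restr \<Omega> (\<lambda>x. sym_part (Curl \<Phi> x)))" using X by blast
  then obtain \<Phi> where \<Phi>: "\<And>n. test \<Omega> (\<Phi> n)" "\<And>n x. trace (\<Phi> n x) = 0"
    "\<And>n. X n = (restr \<Omega> (\<Phi> n), restr \<Omega> (\<lambda>x. sym_part (Curl (\<Phi> n) x)))" by metis
  have "restr \<Omega> (\<lambda>x. sym_part (Curl (\<Phi> n) x)) = abs_L2 (dop symcurl_coeff (\<Phi> n))" for n
    using restr_test[OF test_dop[OF \<Phi>(1) bounded_linear_symcurl_coeff]] symCurl_eq_dop[OF test_smooth[OF \<Phi>(1)]] by simp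
  then have Xn: "X n = (abs_L2 (\<Phi> n), abs_L2 (dop symcurl_coeff (\<Phi> n)))" for n
    by (simp add: \<Phi>(3) restr_test[OF \<Phi>(1)])
  show thesis using that[OF \<Phi>(1,2)] tendsto_fst[OF lim] tendsto_snd[OF lim] by (simp add: Xn)
qed

text \<open>The smooth approximants \<open>v n\<close> are kept in the conclusion because their
  deviatoric gradients vanish classically where the distance to \<Omega> is at least the
  mollification radius; the affine structure is read off there. Their common support in the enlarged
  ball is what lets Korn and Poincare produce the limit.\<close>

lemma ker_symCurl_potential:
  assumes \<Omega>: "open \<Omega>" "\<Omega> \<subseteq> cball 0 R" and T: "T \<in> ker (symCurl_T0 \<Omega>)"
  shows "\<exists>v w F. (\<forall>n. test (cball 0 (R + 1)) (v n)) \<and>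
    (\<forall>n x. (\<forall>y\<in>closure \<Omega>. inverse (real (Suc n)) \<le> dist x y) \<longrightarrow> dev (Grad (v n) x) = 0) \<and>
    sq_int w \<and> (\<lambda>n. abs_L2 (v n)) \<longlonglongrightarrow> abs_L2 w \<and> (abs_L2 w, F) \<in> H10 (cball 0 (R + 1)) \<and> T = dev_L2 F"
proof -
  have T0: "(T, 0) \<in> symCurl_T0 \<Omega>" using T by (simp add: ker_def)
  obtain \<Phi> where \<Phi>: "\<And>n. test \<Omega> (\<Phi> n)" "\<And>n x. trace (\<Phi> n x) = 0" and l1: "(\<lambda>n. abs_L2 (\<Phi> n)) \<longlonglongrightarrow> T"
    and l2: "(\<lambda>n. abs_L2 (dop symcurl_coeff (\<Phi> n))) \<longlonglongrightarrow> 0"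
    using symCurl_T0_sequence[OF T0] by metis
  have "abs_L2 (\<Phi> n) \<in> L2_T \<Omega>" for n
    by (simp add: L2_T_abs[OF test_sq_int[OF \<Phi>(1)]] \<Phi>(2) test_zero_outside[OF \<Phi>(1)])
  from closed_sequentially[OF closed_L2_T this l1] have TT: "T \<in> L2_T \<Omega>" .
  obtain t where t: "sq_int t" "T = abs_L2 t" by (rule abs_L2_cases)
  have t0: "AE x in lebesgue. x \<notin> \<Omega> \<longrightarrow> t x = 0" and tr: "AE x in lebesgue. trace (t x) = 0"
    using TT by (simp_all add: t L2_T_abs)
  have t1: "AE x in lebesgue. x \<notin> closure \<Omega> \<longrightarrow> t x = 0"
    using t0 by eventually_elim (use closure_subset in blast)
  have "bounded \<Omega>" using \<Omega>(2) bounded_cball bounded_subset by blast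
  then have cO: "compact (closure \<Omega>)" by (simp add: compact_closure)
  have cR: "closure \<Omega> \<subseteq> cball 0 R" using \<Omega>(2) by (simp add: closure_minimal)
  define r where "r n = inverse (real (Suc n))" for n
  have r: "r n > 0" "r n \<le> 1" for n by (auto simp: r_def field_simps)
  have "\<forall>n. \<exists>k. mollifier 0 (r n) k" by (intro allI ex_mollifier r(1))
  then obtain k where m: "\<And>n. mollifier 0 (r n) (k n)" by metis
  define \<tau> where "\<tau> n = conv (k n) t" for n
  have tt: "test (cball 0 (R + 1)) (\<tau> n)" for n
    unfolding \<tau>_def
  proof (rule conv_test[OF t(1) cO t1 m])
    fix y u :: "real^3" assume y: "y \<in> closure \<Omega>" and u: "u \<in> cball 0 (r n)"
    have "norm (y + u) \<le> norm y + norm u" by (rule norm_triangle_ineq)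
    also have "\<dots> \<le> R + 1" using y u cR r(2)[of n] by (intro add_mono) (auto simp: subset_iff)
    finally show "y + u \<in> cball 0 (R + 1)" by simp
  qed
  have ttr: "trace (\<tau> n x) = 0" for n x
  proof -
    have "trace (\<tau> n x) = conv (k n) (\<lambda>y. trace (t y)) x"
      unfolding \<tau>_def using conv_linear[OF mollifier_sq_int[OF m] t(1) bounded_linear_trace] by simp
    also have "\<dots> = 0"
      by (rule conv_eq_0[where S = "{}"]) (use tr in auto)
    finally show ?thesis .
  qed
  \<comment> \<open>The pair (T, 0) belongs to the closure of the graph over the whole space, so
    mollification keeps the symmetric curl equal to zero.\<close>
  have cl: "(abs_L2 t, abs_L2 (\<lambda>x. 0)) \<in> closure {(abs_L2 \<phi>, abs_L2 (dop symcurl_coeff \<phi>)) | \<phi>. test UNIV \<phi>}"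
    unfolding closure_sequential
  proof (intro exI[of _ "\<lambda>n. (abs_L2 (\<Phi> n), abs_L2 (dop symcurl_coeff (\<Phi> n)))"] conjI allI)
    show "(abs_L2 (\<Phi> n), abs_L2 (dop symcurl_coeff (\<Phi> n))) \<in> {(abs_L2 \<phi>, abs_L2 (dop symcurl_coeff \<phi>)) | \<phi>. test UNIV \<phi>}" for n
      using test_mono[OF \<Phi>(1) subset_UNIV] by blast
    show "(\<lambda>n. (abs_L2 (\<Phi> n), abs_L2 (dop symcurl_coeff (\<Phi> n)))) \<longlonglongrightarrow> (abs_L2 t, abs_L2 (\<lambda>x. 0))"
      using tendsto_Pair[OF l1 l2] by (simp add: t abs_L2_zero)
  qed
  have sc: "sym_part (Curl (\<tau> n) x) = 0" for n x
  proof -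
    have "dop symcurl_coeff (\<tau> n) x = conv (k n) (\<lambda>x. 0) x"
      unfolding \<tau>_def by (rule conv_dop[OF mollifier_test[OF m] bounded_linear_symcurl_coeff t(1) sq_int_zero cl])
    then show ?thesis by (simp add: symCurl_eq_dop[OF test_smooth[OF tt]] conv_def)
  qed
  have "\<forall>n. \<exists>v. test (cball 0 (R + 1)) v \<and> (\<forall>x. \<tau> n x = dev (Grad v x))"
    using symCurl_free_potential[OF tt ttr sc] by blast
  then obtain v where v: "\<And>n. test (cball 0 (R + 1)) (v n)" "\<And>n x. \<tau> n x = dev (Grad (v n) x)" by metis
  have "(\<lambda>n. abs_L2 (\<tau> n)) \<longlonglongrightarrow> T"
    unfolding t(2) \<tau>_def by (rule conv_tendsto[OF t(1) m]) (simp add: r_def)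
  moreover have "abs_L2 (\<tau> n) = dev_L2 (abs_L2 (Grad (v n)))" for n
  proof -
    have "\<tau> n = (\<lambda>x. dev (Grad (v n) x))" using v(2) by blast
    then show ?thesis by (simp add: abs_L2_dev[OF test_sq_int[OF test_Grad[OF v(1)]]])
  qed
  ultimately have "(\<lambda>n. dev_L2 (abs_L2 (Grad (v n)))) \<longlonglongrightarrow> T" by simp
  from H10_complete[OF H10_test[OF v(1)] subset_refl this] obtain w F where
    w: "(w, F) \<in> H10 (cball 0 (R + 1))" "(\<lambda>n. abs_L2 (v n)) \<longlonglongrightarrow> w" "T = dev_L2 F" by blast
  obtain w' where w': "sq_int w'" "w = abs_L2 w'" by (rule abs_L2_cases)
  have "dev (Grad (v n) x) = 0" if far: "\<forall>y\<in>closure \<Omega>. inverse (real (Suc n)) \<le> dist x y" for n x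
    unfolding v(2)[symmetric] \<tau>_def
  proof (rule conv_eq_0[OF t1])
    fix y assume "y \<in> closure \<Omega>"
    then show "k n (x - y) = 0"
      using far by (intro mollifier_eq_0[OF m]) (auto simp: r_def dist_norm norm_minus_commute)
  qed
  with v(1) w w' show ?thesis by blast
qed

section \<open>Fields with vanishing deviatoric gradient\<close>

lemma const_on_ball:
  fixes f :: "real^3 \<Rightarrow> 'b::real_normed_vector"
  assumes f: "smooth f" and z: "\<And>x j. x \<in> ball p r \<Longrightarrow> D j f x = 0"
  shows "x \<in> ball p r \<Longrightarrow> y \<in> ball p r \<Longrightarrow> f x = f y"
proof (rule has_derivative_zero_unique_connected[of "ball p r"])
  fix x assume "x \<in> ball p r"
  then have "pd d f x = 0" for d by (simp add: pd_expand[OF f, of d] z)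
  then show "(f has_derivative (\<lambda>x. 0)) (at x)" using smooth_has_derivative[OF f, of x] by simp
qed auto

text \<open>Off-diagonal entries of the gradient vanish and the diagonal ones share a value
  \<open>q\<close>. The derivative of \<open>q\<close> in direction k is D_k D_i v_i for any i; with
  i different from k, exchanging the derivatives gives zero. So \<open>q\<close> is constant, and v
  - q x has zero gradient.\<close>

lemma dev_Grad_zero_ball:
  assumes v: "smooth v" and z: "\<And>x. x \<in> ball p r \<Longrightarrow> dev (Grad v x) = 0" and r: "r > 0"
  shows "\<exists>a b. \<forall>x\<in>ball p r. v x = a *\<^sub>R x + b"
proof -
  define q where "q = D 1 (\<lambda>x. v x $ 1)"
  have sv: "smooth (\<lambda>x. v x $ i)" for i by (rule smooth_nth[OF v])
  have sq: "smooth q" unfolding q_def by (rule smooth_pd[OF sv])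
  have e: "dev (Grad v x) $ i $ j = 0" if "x \<in> ball p r" for x i j using z[OF that] by simp
  have off: "D j (\<lambda>x. v x $ i) x = 0" if "x \<in> ball p r" "i \<noteq> j" for x i j
    using e[OF that(1), of i j] that(2) by (simp add: dev_def mat_def Grad_nth_smooth[OF v])
  have diag: "D i (\<lambda>x. v x $ i) x = q x" if "x \<in> ball p r" for x i
  proof -
    have "Grad v x $ i $ i = Grad v x $ 1 $ 1"
      using e[OF that, of i i] e[OF that, of 1 1] by (simp add: dev_def mat_def)
    then show ?thesis by (simp add: Grad_nth_smooth[OF v] q_def)
  qed
  have off2: "D k (D j (\<lambda>x. v x $ i)) x = 0" if "x \<in> ball p r" "i \<noteq> j" for x i j k
    by (rule pd_eq_0_open[OF open_ball that(1)]) (use off that(2) in blast)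
  have "D k q x = 0" if x: "x \<in> ball p r" for k x
  proof (cases "k = 1")
    case False
    then have "(1::3) \<noteq> k" by auto
    have "D k q x = D 1 (D k (\<lambda>x. v x $ 1)) x" unfolding q_def by (rule pd_commute_real[OF sv])
    then show ?thesis using off2[OF x \<open>1 \<noteq> k\<close>] by simp
  next
    case True
    \<comment> \<open>\<open>q\<close> is D_1 v_1 by definition, so in direction 1 it is first
      replaced by D_2 v_2.\<close>
    have "D 1 (\<lambda>x. q x - D 2 (\<lambda>x. v x $ 2) x) x = 0"
      by (rule pd_eq_0_open[OF open_ball x, of _ 0]) (simp add: diag)
    then have "D 1 q x = D 1 (D 2 (\<lambda>x. v x $ 2)) x"
      by (simp add: pd_diff[OF smooth_differentiable[OF sq] smooth_differentiable[OF smooth_pd[OF sv]]])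
    also have "\<dots> = D 2 (D 1 (\<lambda>x. v x $ 2)) x" by (rule pd_commute_real[OF sv])
    finally show ?thesis using off2[OF x, of 2 1 2] True by simp
  qed
  then have qc: "q x = q p" if "x \<in> ball p r" for x
    using const_on_ball[OF sq, of p r x p] that r by simp
  define w where "w x = v x - q p *\<^sub>R x" for x
  have sid: "smooth (\<lambda>x::real^3. q p *\<^sub>R x)" by (rule smooth_bounded_linear[OF bounded_linear_scaleR_right])
  have sw: "smooth w" unfolding w_def by (intro smooth_diff v sid)
  have Dw: "D j w x = 0" if x: "x \<in> ball p r" for x j
  proof -
    have "D j w x = D j v x - q p *\<^sub>R axis j 1"
      unfolding w_def by (simp add: pd_diff[OF smooth_differentiable[OF v] smooth_differentiable[OF sid]]
          pd_bounded_linear[OF bounded_linear_scaleR_right])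
    moreover have "D j v x $ i = q p * axis j 1 $ i" for i
      using fun_cong[OF pd_nth[OF v, of "axis j 1" i], of x] off[OF x, of i j] diag[OF x, of j] qc[OF x]
      by (cases "i = j") (auto simp: axis_def)
    ultimately show ?thesis by (simp add: vec_eq_iff)
  qed
  have wc: "w x = w p" if "x \<in> ball p r" for x
    by (rule const_on_ball[OF sw Dw that]) (use r in simp_all)
  have "v x = q p *\<^sub>R x + w p" if "x \<in> ball p r" for x using wc[OF that] by (simp add: w_def algebra_simps)
  then have "\<forall>x\<in>ball p r. v x = q p *\<^sub>R x + w p" by blast
  then show ?thesis by blast
qed

text \<open>A closed condition that holds almost everywhere on an open set holds throughout it; two
  points of \<open>U\<close> then determine \<open>a\<close> and \<open>b\<close>.\<close>

lemma affine_zero_AE: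
  fixes b :: "real^3"
  assumes U: "open U" "U \<noteq> {}" and z: "AE x in lebesgue. x \<in> U \<longrightarrow> a *\<^sub>R x + b = 0"
  shows "a = 0" and "b = 0"
proof -
  have "closed {x. a *\<^sub>R x + b = 0}" by (intro closed_Collect_eq continuous_intros)
  then have all: "a *\<^sub>R x + b = 0" if "x \<in> U" for x
    using mem_closed_if_AE_lebesgue_open[OF U(1), of "{x. a *\<^sub>R x + b = 0}" x] z that by simp
  obtain p e where p: "p \<in> U" "e > 0" "cball p e \<subseteq> U" using U open_contains_cball by blast
  have "p + e *\<^sub>R axis 1 1 \<in> cball p e" using p(2) by (simp add: dist_norm norm_eq_sqrt_inner inner_axis_axis)
  then have "a *\<^sub>R (p + e *\<^sub>R axis 1 1) + b = 0" "a *\<^sub>R p + b = 0" using p all by blast+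
  moreover have "a *\<^sub>R (e *\<^sub>R axis 1 1) = (a *\<^sub>R (p + e *\<^sub>R axis 1 1) + b) - (a *\<^sub>R p + b)"
    by (simp add: scaleR_add_right)
  ultimately have "a *\<^sub>R (e *\<^sub>R axis 1 1 :: real^3) = 0" by (simp only: diff_self)
  then show "a = 0" using p(2) by (auto simp: axis_eq_0_iff)
  then show "b = 0" using \<open>a *\<^sub>R p + b = 0\<close> by simp
qed

lemma AE_ex_open:
  assumes "AE x in lebesgue. P x" "open U" "U \<noteq> {}"
  shows "\<exists>x\<in>U. P (x :: 'a::euclidean_space)"
proof (rule ccontr)
  assume "\<not> ?thesis"
  with assms(1) have "AE x\<in>U in lebesgue. x \<in> {}" by auto
  with mem_closed_if_AE_lebesgue_open[OF assms(2) closed_empty this] assms(3) show False by blast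
qed

text \<open>On a small ball away from \<open>K\<close> the fields have the form a x + b for large
  indices, and such a map is determined by its values at two points. A subsequence converges almost
  everywhere, hence at two points of the ball, so the coefficients converge and the limit exists on
  the whole ball.\<close>

lemma affine_limit:
  fixes v :: "nat \<Rightarrow> real^3 \<Rightarrow> real^3"
  assumes v: "\<And>n. smooth (v n)" "\<And>n. sq_int (v n)" and w: "sq_int w" and lim: "(\<lambda>n. abs_L2 (v n)) \<longlonglongrightarrow> abs_L2 w"
    and K: "closed K" and z: "\<And>n x. \<forall>y\<in>K. inverse (real (Suc n)) \<le> dist x y \<Longrightarrow> dev (Grad (v n) x) = 0"
  shows "\<exists>W. (AE x in lebesgue. x \<notin> K \<longrightarrow> w x = W x) \<and>
    (\<forall>p. p \<notin> K \<longrightarrow> (\<exists>\<rho>>0. \<exists>a b. \<forall>x\<in>ball p \<rho>. W x = a *\<^sub>R x + b)) \<and> (\<forall>x. (\<forall>n. v n x = 0) \<longrightarrow> W x = 0)"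
proof -
  obtain r :: "nat \<Rightarrow> nat" where r: "strict_mono r" and ae: "AE x in lebesgue. (\<lambda>n. v (r n) x) \<longlonglongrightarrow> w x"
    using L2_AE_subsequence[OF v(2) w lim] by blast
  \<comment> \<open>A representative free of exceptional sets: off \<open>K\<close> the limit turns
    out to exist everywhere, and where all \<open>v n\<close> vanish it is 0.\<close>
  define W where "W x = lim (\<lambda>n. v (r n) x)" for x
  have "\<exists>\<rho>>0. \<exists>a b. \<forall>x\<in>ball p \<rho>. W x = a *\<^sub>R x + b" if p: "p \<notin> K" for p
  proof -
    have "open (- K)" "p \<in> - K" using K p by auto
    then obtain \<epsilon> where \<epsilon>: "\<epsilon> > 0" "ball p \<epsilon> \<subseteq> - K" using open_contains_ball by blast
    define \<rho> where "\<rho> = \<epsilon> / 2"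
    have \<rho>: "\<rho> > 0" using \<epsilon> by (simp add: \<rho>_def)
    have far: "\<rho> \<le> dist x y" if "x \<in> ball p \<rho>" "y \<in> K" for x y
    proof (rule ccontr)
      assume "\<not> \<rho> \<le> dist x y"
      with that(1) have "dist p y < \<epsilon>" using dist_triangle[of p y x] by (simp add: \<rho>_def)
      with \<epsilon>(2) that(2) show False by auto
    qed
    obtain N where N: "inverse (real (Suc N)) < \<rho>" using reals_Archimedean[OF \<rho>] by blast
    have "\<exists>a b. \<forall>x\<in>ball p \<rho>. v (r n) x = a *\<^sub>R x + b" if n: "n \<ge> N" for n
    proof (rule dev_Grad_zero_ball[OF v(1) z \<rho>], intro ballI)
      fix x y assume "x \<in> ball p \<rho>" "y \<in> K"
      then have "\<rho> \<le> dist x y" by (rule far)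
      moreover have "r n \<ge> N" using seq_suble[OF r, of n] n by linarith
      then have "inverse (real (Suc (r n))) \<le> inverse (real (Suc N))" by (simp add: field_simps)
      ultimately show "inverse (real (Suc (r n))) \<le> dist x y" using N by linarith
    qed
    then obtain a b where ab: "\<And>n x. n \<ge> N \<Longrightarrow> x \<in> ball p \<rho> \<Longrightarrow> v (r n) x = a n *\<^sub>R x + b n" by metis
    obtain s where s: "s \<in> ball p \<rho>" "(\<lambda>n. v (r n) s) \<longlonglongrightarrow> w s"
      using AE_ex_open[OF ae open_ball, of p \<rho>] \<rho> by auto
    have ne: "ball p \<rho> - {s} \<noteq> {}"
    proof
      assume "ball p \<rho> - {s} = {}"
      with s(1) have "ball p \<rho> = {s}" by blast
      then show False using not_open_singleton[of s] open_ball[of p \<rho>] by simp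
    qed
    obtain t where t: "t \<in> ball p \<rho>" "t \<noteq> s" "(\<lambda>n. v (r n) t) \<longlonglongrightarrow> w t"
      using AE_ex_open[OF ae open_delete[OF open_ball] ne] by blast
    \<comment> \<open>The values at s and t differ by a (s - t), and the inner product with s - t
      isolates the coefficient a.\<close>
    define A where "A = ((w s - w t) \<bullet> (s - t)) / ((s - t) \<bullet> (s - t))"
    have nz: "(s - t) \<bullet> (s - t) \<noteq> 0" using t(2) by simp
    have an: "a n = ((v (r n) s - v (r n) t) \<bullet> (s - t)) / ((s - t) \<bullet> (s - t))" if "n \<ge> N" for n
    proof -
      have "v (r n) s - v (r n) t = a n *\<^sub>R (s - t)" using ab[OF that s(1)] ab[OF that t(1)] by (simp add: scaleR_diff_right)
      then show ?thesis using nz by simp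
    qed
    have "(\<lambda>n. ((v (r n) s - v (r n) t) \<bullet> (s - t)) / ((s - t) \<bullet> (s - t))) \<longlonglongrightarrow> A"
      unfolding A_def by (intro tendsto_intros s t nz)
    then have aA: "a \<longlonglongrightarrow> A"
    proof (rule Lim_transform_eventually)
      show "\<forall>\<^sub>F n in sequentially. ((v (r n) s - v (r n) t) \<bullet> (s - t)) / ((s - t) \<bullet> (s - t)) = a n"
        using eventually_ge_at_top[of N] by eventually_elim (rule an[symmetric])
    qed
    have "(\<lambda>n. v (r n) s - a n *\<^sub>R s) \<longlonglongrightarrow> w s - A *\<^sub>R s" by (intro tendsto_intros s aA)
    then have bB: "b \<longlonglongrightarrow> w s - A *\<^sub>R s"
    proof (rule Lim_transform_eventually)
      show "\<forall>\<^sub>F n in sequentially. v (r n) s - a n *\<^sub>R s = b n"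
        using eventually_ge_at_top[of N] by eventually_elim (simp add: ab[OF _ s(1)])
    qed
    have "W x = A *\<^sub>R x + (w s - A *\<^sub>R s)" if x: "x \<in> ball p \<rho>" for x
    proof -
      have "(\<lambda>n. a n *\<^sub>R x + b n) \<longlonglongrightarrow> A *\<^sub>R x + (w s - A *\<^sub>R s)" by (intro tendsto_intros aA bB)
      then have "(\<lambda>n. v (r n) x) \<longlonglongrightarrow> A *\<^sub>R x + (w s - A *\<^sub>R s)"
      proof (rule Lim_transform_eventually)
        show "\<forall>\<^sub>F n in sequentially. a n *\<^sub>R x + b n = v (r n) x"
          using eventually_ge_at_top[of N] by eventually_elim (simp add: ab[OF _ x])
      qed
      then show ?thesis by (simp add: W_def limI)
    qed
    with \<rho> show ?thesis by blast
  qed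
  moreover have "AE x in lebesgue. x \<notin> K \<longrightarrow> w x = W x"
    using ae by eventually_elim (simp add: W_def limI)
  moreover have "W x = 0" if "\<forall>n. v n x = 0" for x using that by (simp add: W_def)
  ultimately show ?thesis by blast
qed

text \<open>Overlapping affine representations agree on a nonempty open set and so have the same
  coefficients. These are thus locally constant, hence constant on the connected set.\<close>

lemma locally_affine_imp_affine:
  fixes W :: "real^3 \<Rightarrow> real^3"
  assumes C: "connected C" "C \<noteq> {}" and loc: "\<And>p. p \<in> C \<Longrightarrow> \<exists>\<rho>>0. \<exists>a b. \<forall>x\<in>ball p \<rho>. W x = a *\<^sub>R x + b"
  shows "\<exists>a b. \<forall>p\<in>C. \<exists>\<rho>>0. \<forall>x\<in>ball p \<rho>. W x = a *\<^sub>R x + b"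
proof -
  have "\<forall>p\<in>C. \<exists>a b. \<exists>\<rho>>0. \<forall>x\<in>ball p \<rho>. W x = a *\<^sub>R x + b" using loc by blast
  then obtain a b where ab: "\<And>p. p \<in> C \<Longrightarrow> \<exists>\<rho>>0. \<forall>x\<in>ball p \<rho>. W x = a p *\<^sub>R x + b p" by metis
  define f where "f p = (a p, b p)" for p
  have "\<forall>p\<in>C. eventually (\<lambda>q. f p = f q) (at p within C)"
  proof
    fix p assume p: "p \<in> C"
    obtain \<rho> where \<rho>: "\<rho> > 0" "\<And>x. x \<in> ball p \<rho> \<Longrightarrow> W x = a p *\<^sub>R x + b p" using ab[OF p] by blast
    have "f p = f q" if q: "q \<in> C" "q \<in> ball p \<rho>" for q
    proof -
      obtain \<sigma> where \<sigma>: "\<sigma> > 0" "\<And>x. x \<in> ball q \<sigma> \<Longrightarrow> W x = a q *\<^sub>R x + b q" using ab[OF q(1)] by blast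
      let ?U = "ball p \<rho> \<inter> ball q \<sigma>"
      have U: "open ?U" "?U \<noteq> {}" using q \<sigma>(1) by (auto intro!: exI[of _ q])
      have "(a p - a q) *\<^sub>R x + (b p - b q) = 0" if "x \<in> ?U" for x
      proof -
        have "a p *\<^sub>R x + b p = a q *\<^sub>R x + b q" using \<rho>(2)[of x] \<sigma>(2)[of x] that by auto
        then show ?thesis by (simp add: scaleR_diff_left algebra_simps)
      qed
      then have "AE x in lebesgue. x \<in> ?U \<longrightarrow> (a p - a q) *\<^sub>R x + (b p - b q) = 0" by auto
      from affine_zero_AE[OF U this] show ?thesis by (simp add: f_def)
    qed
    then show "eventually (\<lambda>q. f p = f q) (at p within C)"
      unfolding eventually_at using \<rho>(1) by (intro exI[of _ \<rho>]) (auto simp: dist_commute)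
  qed
  then have const: "f p = f q" if "p \<in> C" "q \<in> C" for p q using connected_local_const[OF C(1) that] by blast
  obtain p where p: "p \<in> C" using C(2) by blast
  have "\<exists>\<rho>>0. \<forall>x\<in>ball q \<rho>. W x = a p *\<^sub>R x + b p" if "q \<in> C" for q
    using ab[OF that] const[OF that p] by (simp add: f_def)
  then show ?thesis by blast
qed

section \<open>Domains with continuous boundary\<close>

text \<open>
  In the chart at a boundary point, \<open>F\<close> is the height above the graph and \<open>\<nu>\<close> the upward direction.
\<close>

lemma continuous_boundary_chart:
  assumes \<Omega>: "open \<Omega>" and cb: "continuous_boundary \<Omega>" and p: "p \<in> frontier \<Omega>"
  obtains U F and \<nu> :: "real^3" where "open U" "p \<in> U" "continuous_on UNIV F" "norm \<nu> = 1" "\<And>x t. F (x + t *\<^sub>R \<nu>) = F x + t"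
    "\<And>x. x \<in> U \<Longrightarrow> x \<in> \<Omega> \<longleftrightarrow> F x < 0" "\<And>x. x \<in> U \<Longrightarrow> x \<in> frontier \<Omega> \<longleftrightarrow> F x = 0"
    "\<And>x. x \<in> U \<Longrightarrow> x \<in> - closure \<Omega> \<longleftrightarrow> F x > (0::real)"
proof -
  from bspec[OF cb[unfolded continuous_boundary_def] p] obtain U and Q :: "real^3 \<Rightarrow> real^3" and g :: "real^2 \<Rightarrow> real" where U: "open U" "p \<in> U" and Q: "orthogonal_transformation Q"
    and g: "continuous_on UNIV g"
    and fr: "frontier \<Omega> \<inter> U = {x \<in> U. Q x $ 3 = g (vector [Q x $ 1, Q x $ 2])}"
    and om: "\<Omega> \<inter> U = {x \<in> U. Q x $ 3 < g (vector [Q x $ 1, Q x $ 2])}"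
    by blast
  define F where "F x = Q x $ 3 - g (vector [Q x $ 1, Q x $ 2])" for x
  have lQ: "linear Q" by (rule orthogonal_transformation_linear[OF Q])
  have cQ: "continuous_on UNIV Q" by (rule linear_continuous_on[OF linear_conv_bounded_linear[THEN iffD1, OF lQ]])
  have "surj Q" by (rule orthogonal_transformation_surj[OF Q])
  then obtain \<nu> where \<nu>: "Q \<nu> = axis 3 1" by (metis surjD)
  have nn: "norm \<nu> = 1" using orthogonal_transformation_norm[OF Q, of \<nu>] \<nu> by (simp add: norm_eq_sqrt_inner inner_axis_axis)
  have shift: "F (x + t *\<^sub>R \<nu>) = F x + t" for x t
    by (simp add: F_def linear_add[OF lQ] linear_cmul[OF lQ] \<nu> axis_def)
  have cv: "continuous_on UNIV (\<lambda>x. vector [Q x $ 1, Q x $ 2] :: real^2)"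
  proof -
    have eq: "(\<lambda>x. vector [Q x $ 1, Q x $ 2] :: real^2) = (\<lambda>x. axis 1 (Q x $ 1) + axis 2 (Q x $ 2))"
      by (auto simp: vec_eq_iff forall_2 axis_def)
    show ?thesis unfolding eq
      by (intro continuous_on_add linear_continuous_on_compose[OF _ bounded_linear.linear[OF bounded_linear_axis]]
          continuous_on_component cQ)
  qed
  have cF: "continuous_on UNIV F" unfolding F_def
    by (intro continuous_intros cQ continuous_on_compose2[OF g cv]) auto
  have i: "x \<in> \<Omega> \<longleftrightarrow> F x < 0" if "x \<in> U" for x using om that by (auto simp: F_def)
  have ii: "x \<in> frontier \<Omega> \<longleftrightarrow> F x = 0" if "x \<in> U" for x using fr that by (auto simp: F_def)
  have iii: "x \<in> - closure \<Omega> \<longleftrightarrow> F x > 0" if "x \<in> U" for x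
  proof -
    have "x \<in> closure \<Omega> \<longleftrightarrow> x \<in> \<Omega> \<or> x \<in> frontier \<Omega>"
      using \<Omega> closure_subset by (auto simp: frontier_def interior_open)
    then show ?thesis using i[OF that] ii[OF that] by auto
  qed
  show thesis by (rule that[OF U cF nn shift i ii iii])
qed

text \<open>Just above a boundary point, in direction \<nu>, lies the exterior, so \<Omega> has no
  slits. Identities between continuous functions on the exterior thereby extend to the whole
  complement of \<Omega>.\<close>

lemma frontier_subset_closure_exterior:
  assumes \<Omega>: "open \<Omega>" and cb: "continuous_boundary \<Omega>"
  shows "- \<Omega> \<subseteq> closure (- closure \<Omega>)"
proof
  fix p assume p: "p \<in> - \<Omega>"
  show "p \<in> closure (- closure \<Omega>)"
  proof (cases "p \<in> closure \<Omega>")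
    case False
    then show ?thesis using closure_subset by blast
  next
    case True
    then have "p \<in> frontier \<Omega>" using p \<Omega> by (simp add: frontier_def interior_open)
    from continuous_boundary_chart[OF \<Omega> cb this] obtain U F and \<nu> :: "real^3" where U: "open U" "p \<in> U"
      and \<nu>: "norm \<nu> = 1" "\<And>x t. F (x + t *\<^sub>R \<nu>) = F x + t" and fr: "\<And>x. x \<in> U \<Longrightarrow> x \<in> frontier \<Omega> \<longleftrightarrow> F x = 0"
      and ex: "\<And>x. x \<in> U \<Longrightarrow> x \<in> - closure \<Omega> \<longleftrightarrow> F x > (0::real)" by metis
    show ?thesis unfolding closure_approachable
    proof (intro allI impI)
      fix e :: real assume e: "e > 0"
      obtain d where d: "d > 0" "ball p d \<subseteq> U" using U open_contains_ball by blast
      define t where "t = min e d / 2"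
      have t: "t > 0" "t < e" "t < d" using e d(1) by (auto simp: t_def)
      have "F p = 0" using fr[OF U(2)] \<open>p \<in> frontier \<Omega>\<close> by simp
      moreover have "p + t *\<^sub>R \<nu> \<in> U" using d t \<nu>(1) by (auto simp: dist_norm subset_iff)
      ultimately have "p + t *\<^sub>R \<nu> \<in> - closure \<Omega>" using ex \<nu>(2) t by simp
      then show "\<exists>y\<in>- closure \<Omega>. dist y p < e" using t \<nu>(1) by (intro bexI[of _ "p + t *\<^sub>R \<nu>"]) (simp add: dist_norm)
    qed
  qed
qed

text \<open>The substitution (y, s) -> y - F(y) \<nu> + s \<nu> flattens the boundary, so that the
  exterior part of a suitable neighbourhood is a continuous image of a ball times an interval. The
  exterior part of a plain ball may be disconnected over an oscillating graph.\<close>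

lemma exterior_locally_connected:
  assumes \<Omega>: "open \<Omega>" and cb: "continuous_boundary \<Omega>" and p: "p \<in> frontier \<Omega>"
  shows "\<exists>V. open V \<and> p \<in> V \<and> connected (V \<inter> - closure \<Omega>)"
proof -
  from continuous_boundary_chart[OF \<Omega> cb p] obtain U F and \<nu> :: "real^3" where U: "open U" "p \<in> U"
    and F: "continuous_on UNIV F" and \<nu>: "norm \<nu> = 1" "\<And>x t. F (x + t *\<^sub>R \<nu>) = F x + t" and fr: "\<And>x. x \<in> U \<Longrightarrow> x \<in> frontier \<Omega> \<longleftrightarrow> F x = 0"
    and ex: "\<And>x. x \<in> U \<Longrightarrow> x \<in> - closure \<Omega> \<longleftrightarrow> F x > (0::real)" by metis
  have Fp: "F p = 0" using fr[OF U(2)] p by simp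
  obtain \<epsilon> where \<epsilon>: "\<epsilon> > 0" "ball p \<epsilon> \<subseteq> U" using U open_contains_ball by blast
  have "isCont F p" using F by (simp add: continuous_on_eq_continuous_at)
  then obtain d where d: "d > 0" "\<And>y. dist y p < d \<Longrightarrow> dist (F y) (F p) < \<epsilon> / 3"
    unfolding continuous_at_eps_delta using \<epsilon>(1) by (metis divide_pos_pos zero_less_numeral)
  define \<eta> where "\<eta> = min d (\<epsilon> / 3)"
  have \<eta>: "\<eta> > 0" "\<eta> \<le> d" "\<eta> \<le> \<epsilon> / 3" using d(1) \<epsilon>(1) by (auto simp: \<eta>_def)
  define \<tau> where "\<tau> = \<epsilon> / 3"
  have \<tau>: "\<tau> > 0" using \<epsilon>(1) by (simp add: \<tau>_def)
  \<comment> \<open>A tube in direction \<nu> over the ball of radius \<eta>, cut off at height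
    \<tau> above and below the graph. The thirds of \<epsilon> bound |F y|, |F x| and |y - p|, which
    keeps the tube inside \<open>U\<close>.\<close>
  define V where "V = {x. \<bar>F x\<bar> < \<tau>} \<inter> (\<Union>t. (\<lambda>y. t *\<^sub>R \<nu> + y) ` ball p \<eta>)"
  have rep: "\<exists>y\<in>ball p \<eta>. x = y - F y *\<^sub>R \<nu> + F x *\<^sub>R \<nu>" if xV: "x \<in> V" for x
  proof -
    obtain t y where "y \<in> ball p \<eta>" "x = t *\<^sub>R \<nu> + y" using xV unfolding V_def by blast
    moreover from this(2) have "F x = F y + t" using \<nu>(2)[of y t] by (simp add: add.commute)
    ultimately show ?thesis by (intro bexI[of _ y]) (auto simp: algebra_simps)
  qed
  have inV: "y - F y *\<^sub>R \<nu> + s *\<^sub>R \<nu> \<in> V" "F (y - F y *\<^sub>R \<nu> + s *\<^sub>R \<nu>) = s" if "y \<in> ball p \<eta>" "\<bar>s\<bar> < \<tau>" for y s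
  proof -
    have eq: "y - F y *\<^sub>R \<nu> + s *\<^sub>R \<nu> = y + (s - F y) *\<^sub>R \<nu>" by (simp add: algebra_simps)
    show "F (y - F y *\<^sub>R \<nu> + s *\<^sub>R \<nu>) = s" unfolding eq \<nu>(2) by simp
    then show "y - F y *\<^sub>R \<nu> + s *\<^sub>R \<nu> \<in> V"
      unfolding V_def using that eq by (auto intro!: exI[of _ "s - F y"] image_eqI[of _ _ y] simp: add.commute)
  qed
  have VU: "V \<subseteq> U"
  proof
    fix x assume x: "x \<in> V"
    obtain y where y: "y \<in> ball p \<eta>" "x = y - F y *\<^sub>R \<nu> + F x *\<^sub>R \<nu>" using rep[OF x] by blast
    have "\<bar>F y\<bar> < \<epsilon> / 3" using d(2)[of y] y(1) \<eta>(2) Fp by (simp add: dist_commute dist_real_def)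
    moreover have "\<bar>F x\<bar> < \<epsilon> / 3" using x by (simp add: V_def \<tau>_def)
    moreover have "norm (y - p) < \<epsilon> / 3" using y(1) \<eta>(3) by (simp add: dist_norm norm_minus_commute)
    moreover have "norm (x - p) \<le> norm (y - p) + norm ((F x - F y) *\<^sub>R \<nu>)"
    proof -
      have "x - p = (y - p) + (F x - F y) *\<^sub>R \<nu>" by (subst y(2)) (simp add: algebra_simps)
      then show ?thesis by (metis norm_triangle_ineq)
    qed
    ultimately have "norm (x - p) < \<epsilon>" using \<nu>(1) by simp
    with \<epsilon>(2) show "x \<in> U" by (auto simp: dist_norm norm_minus_commute)
  qed
  have "open V" unfolding V_def
    by (intro open_Int open_Collect_less continuous_intros F open_UN ballI open_translation) auto
  moreover have "p \<in> V"
    unfolding V_def using \<eta>(1) \<tau> Fp by (auto intro!: exI[of _ 0])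
  moreover have "V \<inter> - closure \<Omega> = (\<lambda>q. fst q - F (fst q) *\<^sub>R \<nu> + snd q *\<^sub>R \<nu>) ` (ball p \<eta> \<times> {0<..<\<tau>})"
  proof
    show "V \<inter> - closure \<Omega> \<subseteq> (\<lambda>q. fst q - F (fst q) *\<^sub>R \<nu> + snd q *\<^sub>R \<nu>) ` (ball p \<eta> \<times> {0<..<\<tau>})"
    proof
      fix x assume x: "x \<in> V \<inter> - closure \<Omega>"
      then have "F x > 0" using ex VU by blast
      moreover have "\<bar>F x\<bar> < \<tau>" using x by (simp add: V_def)
      then have "F x < \<tau>" by linarith
      moreover obtain y where "y \<in> ball p \<eta>" "x = y - F y *\<^sub>R \<nu> + F x *\<^sub>R \<nu>" using rep x by blast
      ultimately show "x \<in> (\<lambda>q. fst q - F (fst q) *\<^sub>R \<nu> + snd q *\<^sub>R \<nu>) ` (ball p \<eta> \<times> {0<..<\<tau>})"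
        by (intro image_eqI[of _ _ "(y, F x)"]) auto
    qed
    show "(\<lambda>q. fst q - F (fst q) *\<^sub>R \<nu> + snd q *\<^sub>R \<nu>) ` (ball p \<eta> \<times> {0<..<\<tau>}) \<subseteq> V \<inter> - closure \<Omega>"
    proof (rule image_subsetI)
      fix q assume q: "q \<in> ball p \<eta> \<times> {0<..<\<tau>}"
      let ?x = "fst q - F (fst q) *\<^sub>R \<nu> + snd q *\<^sub>R \<nu>"
      have "?x \<in> V" "F ?x = snd q" using inV[of "fst q" "snd q"] q by auto
      moreover have "snd q > 0" using q by auto
      ultimately show "?x \<in> V \<inter> - closure \<Omega>" using ex[of ?x] VU by auto
    qed
  qed
  moreover have "connected ((\<lambda>q. fst q - F (fst q) *\<^sub>R \<nu> + snd q *\<^sub>R \<nu>) ` (ball p \<eta> \<times> {0<..<\<tau>}))"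
  proof (rule connected_continuous_image)
    show "connected (ball p \<eta> \<times> {0<..<\<tau>})" by (intro connected_Times) auto
    show "continuous_on (ball p \<eta> \<times> {0<..<\<tau>}) (\<lambda>q. fst q - F (fst q) *\<^sub>R \<nu> + snd q *\<^sub>R \<nu>)"
      by (intro continuous_intros continuous_on_compose2[OF F]) auto
  qed
  ultimately show ?thesis by metis
qed

text \<open>For compact sets inside \<Omega> a small ball around the origin serves. At the frontier
  a translation against \<nu> lowers the height \<open>F\<close>, which is at most 0 on
  \<open>closure \<Omega>\<close>, so that the translated set lies in \<Omega>.\<close>

lemma ex_good_neighbourhood:
  assumes \<Omega>: "open \<Omega>" and cb: "continuous_boundary \<Omega>" and p: "p \<in> closure \<Omega>"
  shows "\<exists>U. open U \<and> p \<in> U \<and> (\<forall>S. compact S \<longrightarrow> S \<subseteq> U \<longrightarrow> S \<subseteq> closure \<Omega> \<longrightarrow> shiftable S \<Omega>)"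
proof -
  have inner: "\<exists>r>0. \<forall>y\<in>S. \<forall>u. norm (u - c) \<le> r \<longrightarrow> y + u \<in> \<Omega>" if "compact ((\<lambda>y. y + c) ` S)" "(\<lambda>y. y + c) ` S \<subseteq> \<Omega>" for S c
  proof -
    from compact_subset_open_imp_ball_epsilon_subset[OF that(1) \<Omega> that(2)] obtain e where e: "e > 0" "(\<Union>x\<in>(\<lambda>y. y + c) ` S. ball x e) \<subseteq> \<Omega>" by blast
    have "y + u \<in> \<Omega>" if "y \<in> S" "norm (u - c) \<le> e / 2" for y u
    proof -
      have "y + u \<in> ball (y + c) e" using that(2) e(1) by (simp add: dist_norm norm_minus_commute)
      with e(2) that(1) show ?thesis by blast
    qed
    with e(1) show ?thesis by (intro exI[of _ "e/2"]) auto
  qed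
  show ?thesis
  proof (cases "p \<in> \<Omega>")
    case True
    have "shiftable S \<Omega>" if S: "compact S" "S \<subseteq> \<Omega>" for S
      unfolding shiftable_def
    proof (intro allI impI)
      fix \<delta> :: real assume \<delta>: "\<delta> > 0"
      obtain r where r: "r > 0" "\<And>y u. y \<in> S \<Longrightarrow> norm (u - 0) \<le> r \<Longrightarrow> y + u \<in> \<Omega>"
        using inner[where S = S and c = 0] S by auto
      show "\<exists>c r. r > 0 \<and> ball c r \<subseteq> ball 0 \<delta> \<and> (\<forall>y\<in>S. \<forall>u\<in>cball c r. y + u \<in> \<Omega>)"
        using r \<delta> by (intro exI[of _ 0] exI[of _ "min r \<delta>"]) auto
    qed
    with True \<Omega> show ?thesis by blast
  next
    case False
    then have "p \<in> frontier \<Omega>" using p \<Omega> by (simp add: frontier_def interior_open)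
    from continuous_boundary_chart[OF \<Omega> cb this] obtain U F and \<nu> :: "real^3" where U: "open U" "p \<in> U"
      and \<nu>: "norm \<nu> = 1" "\<And>x t. F (x + t *\<^sub>R \<nu>) = F x + t" and om: "\<And>x. x \<in> U \<Longrightarrow> x \<in> \<Omega> \<longleftrightarrow> F x < 0"
      and ex: "\<And>x. x \<in> U \<Longrightarrow> x \<in> - closure \<Omega> \<longleftrightarrow> F x > (0::real)" by metis
    have "shiftable S \<Omega>" if S: "compact S" "S \<subseteq> U" "S \<subseteq> closure \<Omega>" for S
      unfolding shiftable_def
    proof (intro allI impI)
      fix \<delta> :: real assume \<delta>: "\<delta> > 0"
      from compact_subset_open_imp_ball_epsilon_subset[OF S(1) U(1) S(2)] obtain e where e: "e > 0" "(\<Union>x\<in>S. ball x e) \<subseteq> U" by blast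
      \<comment> \<open>Below \<open>e\<close> so that the translates stay in the chart, and at most
        half of \<delta>, leaving the other half for the radius.\<close>
      define t where "t = min (e / 2) (\<delta> / 2)"
      have t: "t > 0" "t < e" "t \<le> \<delta> / 2" using e(1) \<delta> by (auto simp: t_def)
      define c where "c = (- t) *\<^sub>R \<nu>"
      have nc: "norm c = t" using t \<nu>(1) by (simp add: c_def)
      have "(\<lambda>y. y + c) ` S \<subseteq> \<Omega>"
      proof (rule image_subsetI)
        fix y assume y: "y \<in> S"
        then have "F y \<le> 0" using ex[of y] S by force
        then have "F (y + c) < 0" unfolding c_def \<nu>(2) using t by simp
        moreover have "y + c \<in> ball y e" using nc t by (simp add: dist_norm)
        then have "y + c \<in> U" using e(2) y by blast
        ultimately show "y + c \<in> \<Omega>" using om by blast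
      qed
      moreover have "compact ((\<lambda>y. y + c) ` S)" by (intro compact_continuous_image S continuous_intros)
      ultimately obtain r where r: "r > 0" "\<And>y u. y \<in> S \<Longrightarrow> norm (u - c) \<le> r \<Longrightarrow> y + u \<in> \<Omega>"
        using inner by metis
      show "\<exists>c r. r > 0 \<and> ball c r \<subseteq> ball 0 \<delta> \<and> (\<forall>y\<in>S. \<forall>u\<in>cball c r. y + u \<in> \<Omega>)"
      proof (intro exI[of _ c] exI[of _ "min r (\<delta> / 2)"] conjI ballI)
        show "ball c (min r (\<delta> / 2)) \<subseteq> ball 0 \<delta>"
        proof
          fix x assume "x \<in> ball c (min r (\<delta> / 2))"
          then have "norm (x - c) < \<delta> / 2" by (simp add: dist_norm norm_minus_commute)
          then show "x \<in> ball 0 \<delta>" using nc t norm_triangle_sub[of x c] by simp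
        qed
      qed (use r \<delta> in \<open>auto simp: dist_norm norm_minus_commute\<close>)
    qed
    with U show ?thesis by blast
  qed
qed

text \<open>The substitute for a zero trace. Compactness of \<open>closure \<Omega>\<close> reduces
  it to finitely many neighbourhoods, each of which admits the translations into \<Omega> that
  mollification requires.\<close>

lemma H10_of_vanishing:
  assumes \<Omega>: "open \<Omega>" "bounded \<Omega>" "continuous_boundary \<Omega>"
    and z: "sq_int z" "(abs_L2 z, G) \<in> H10 UNIV" "AE x in lebesgue. x \<notin> closure \<Omega> \<longrightarrow> z x = 0"
  shows "(abs_L2 z, G) \<in> H10 \<Omega>"
proof -
  have c: "compact (closure \<Omega>)" using \<Omega>(2) by (simp add: compact_closure)
  obtain U where U: "\<And>p. p \<in> closure \<Omega> \<Longrightarrow> open (U p)" "\<And>p. p \<in> closure \<Omega> \<Longrightarrow> p \<in> U p"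
    "\<And>p S. p \<in> closure \<Omega> \<Longrightarrow> compact S \<Longrightarrow> S \<subseteq> U p \<Longrightarrow> S \<subseteq> closure \<Omega> \<Longrightarrow> shiftable S \<Omega>"
    using ex_good_neighbourhood[OF \<Omega>(1,3)] by metis
  have "closure \<Omega> \<subseteq> (\<Union>p\<in>closure \<Omega>. U p)" using U(2) by blast
  from compactE_image[OF c U(1) this] obtain P where P: "P \<subseteq> closure \<Omega>" "finite P" "closure \<Omega> \<subseteq> (\<Union>p\<in>P. U p)" by metis
  show ?thesis
  proof (rule H10_cover[where \<U> = "U ` P" and C = "closure \<Omega>" and S = "closure \<Omega>", OF _ _ _ z(1,2) c _ _ z(3)])
    show "finite (U ` P)" using P by simp
    show "open V" if "V \<in> U ` P" for V using that P(1) U(1) by blast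
    show "shiftable S \<Omega>" if "V \<in> U ` P" "compact S" "S \<subseteq> V" "S \<subseteq> closure \<Omega>" for V S
      using that P(1) U(3) by blast
  qed (use P in auto)
qed

section \<open>The components of the exterior\<close>

lemma component_boundary_point:
  fixes \<Omega> :: "(real^3) set"
  assumes \<Omega>: "open \<Omega>" "\<Omega> \<noteq> {}" and C: "C \<in> components (- closure \<Omega>)"
  shows "\<exists>p\<in>frontier \<Omega>. p \<in> closure C"
proof -
  have oE: "open (- closure \<Omega>)" by (rule open_Compl[OF closed_closure])
  have oC: "open C" by (rule open_components[OF oE C])
  have "C \<noteq> {}" "C \<noteq> UNIV"
    using in_components_nonempty[OF C] in_components_subset[OF C] \<Omega>(2) closure_subset by auto
  then obtain p where p: "p \<in> frontier C" using frontier_eq_empty by blast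
  have pC: "p \<in> closure C" "p \<notin> C" using p oC by (auto simp: frontier_def interior_open)
  have "p \<in> closure \<Omega>"
  proof (rule ccontr)
    assume "p \<notin> closure \<Omega>"
    then obtain C' where C': "C' \<in> components (- closure \<Omega>)" "p \<in> C'" using Union_components[of "- closure \<Omega>"] by blast
    have "open C'" by (rule open_components[OF oE C'(1)])
    then have "C' \<inter> C \<noteq> {}" using open_Int_closure_eq_empty[of C' C] C'(2) pC(1) by blast
    then have "C' = C" using components_eq[OF C'(1) C] by blast
    with C'(2) pC(2) show False by blast
  qed
  moreover have "p \<notin> \<Omega>"
  proof
    assume "p \<in> \<Omega>"
    then have "\<Omega> \<inter> C \<noteq> {}" using open_Int_closure_eq_empty[OF \<Omega>(1), of C] pC(1) by blast
    then show False using in_components_subset[OF C] closure_subset by blast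
  qed
  ultimately show ?thesis using pC(1) \<Omega>(1) by (auto simp: frontier_def interior_open)
qed

text \<open>By maximality of components the connected set \<open>V \<inter> E\<close> lies in a
  single one.\<close>

lemma meets_unique_component:
  assumes V: "connected (V \<inter> E)" and C: "C \<in> components E" "V \<inter> C \<noteq> {}" and C': "C' \<in> components E" "V \<inter> C' \<noteq> {}"
  shows "C = C'"
proof -
  have "V \<inter> E \<subseteq> C"
    by (rule components_maximal[OF C(1) V]) (use C in_components_subset[OF C(1)] in auto)
  then have "C \<inter> C' \<noteq> {}" using C'(2) in_components_subset[OF C'(1)] by blast
  then show ?thesis using components_eq[OF C(1) C'(1)] by blast
qed

text \<open>Each component reaches the frontier, which is covered by finitely many sets whose
  exterior part is connected. Such a set meets only one component, so there are no more components
  than sets.\<close>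

lemma finite_exterior_components:
  assumes \<Omega>: "open \<Omega>" "bounded \<Omega>" "continuous_boundary \<Omega>"
  shows "finite (components (- closure \<Omega>))"
proof (cases "\<Omega> = {}")
  \<comment> \<open>Here the frontier is empty and the whole space is the only component.\<close>
  case True
  then show ?thesis using components_eq_sing_iff[of "UNIV :: (real^3) set"] by simp
next
  case False
  have "compact (frontier \<Omega>)" using \<Omega>(2) by (rule compact_frontier_bounded)
  obtain V where V: "\<And>p. p \<in> frontier \<Omega> \<Longrightarrow> open (V p)" "\<And>p. p \<in> frontier \<Omega> \<Longrightarrow> p \<in> V p"
    "\<And>p. p \<in> frontier \<Omega> \<Longrightarrow> connected (V p \<inter> - closure \<Omega>)"
    using exterior_locally_connected[OF \<Omega>(1,3)] by metis
  have "frontier \<Omega> \<subseteq> (\<Union>p\<in>frontier \<Omega>. V p)" using V(2) by blast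
  from compactE_image[OF \<open>compact (frontier \<Omega>)\<close> V(1) this] obtain P where
    P: "P \<subseteq> frontier \<Omega>" "finite P" "frontier \<Omega> \<subseteq> (\<Union>p\<in>P. V p)" by metis
  have "\<exists>p\<in>P. V p \<inter> C \<noteq> {}" if C: "C \<in> components (- closure \<Omega>)" for C
  proof -
    obtain x where x: "x \<in> frontier \<Omega>" "x \<in> closure C" using component_boundary_point[OF \<Omega>(1) False C] by blast
    then obtain p where p: "p \<in> P" "x \<in> V p" using P(3) by blast
    then have "V p \<inter> C \<noteq> {}" using open_Int_closure_eq_empty[OF V(1), of p C] P(1) x(2) by blast
    with p(1) show ?thesis by blast
  qed
  then obtain f where f: "\<And>C. C \<in> components (- closure \<Omega>) \<Longrightarrow> f C \<in> P \<and> V (f C) \<inter> C \<noteq> {}" by metis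
  have "inj_on f (components (- closure \<Omega>))"
  proof (rule inj_onI)
    fix C C' assume C: "C \<in> components (- closure \<Omega>)" and C': "C' \<in> components (- closure \<Omega>)" and eq: "f C = f C'"
    have "connected (V (f C) \<inter> - closure \<Omega>)" using V(3) f[OF C] P(1) by blast
    then show "C = C'" using f[OF C] f[OF C'] eq by (intro meets_unique_component[OF _ C _ C']) auto
  qed
  then show ?thesis by (rule inj_on_finite[OF _ _ P(2)]) (use f in blast)
qed

text \<open>A common point of the closures lies outside \<Omega>, hence has a neighbourhood whose
  exterior part is connected; that neighbourhood meets both components.\<close>

lemma closures_exterior_components_disjoint:
  assumes \<Omega>: "open \<Omega>" "continuous_boundary \<Omega>"
    and C: "C \<in> components (- closure \<Omega>)" and C': "C' \<in> components (- closure \<Omega>)" and ne: "C \<noteq> C'"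
  shows "closure C \<inter> closure C' = {}"
proof (rule ccontr)
  assume "closure C \<inter> closure C' \<noteq> {}"
  then obtain p where p: "p \<in> closure C" "p \<in> closure C'" by blast
  have "\<exists>V. open V \<and> p \<in> V \<and> connected (V \<inter> - closure \<Omega>)"
  proof (cases "p \<in> closure \<Omega>")
    case True
    have "p \<notin> \<Omega>"
    proof
      assume "p \<in> \<Omega>"
      then have "\<Omega> \<inter> C \<noteq> {}" using open_Int_closure_eq_empty[OF \<Omega>(1), of C] p(1) by blast
      then show False using in_components_subset[OF C] closure_subset by blast
    qed
    then have "p \<in> frontier \<Omega>" using True \<Omega>(1) by (simp add: frontier_def interior_open)
    then show ?thesis by (rule exterior_locally_connected[OF \<Omega>])
  next
    case False
    then have "p \<in> - closure \<Omega>" "open (- closure \<Omega>)" by auto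
    then obtain e where "e > 0" "ball p e \<subseteq> - closure \<Omega>" using open_contains_ball by blast
    then show ?thesis by (intro exI[of _ "ball p e"]) (simp add: Int_absorb2)
  qed
  then obtain V where V: "open V" "p \<in> V" "connected (V \<inter> - closure \<Omega>)" by blast
  have "V \<inter> C \<noteq> {}" "V \<inter> C' \<noteq> {}" using open_Int_closure_eq_empty[OF V(1)] V(2) p by blast+
  from meets_unique_component[OF V(3) C this(1) C' this(2)] ne show False by blast
qed

section \<open>The fields spanning the Dirichlet fields\<close>

text \<open>Stated for families, since injectivity is what turns the size of the index set into the
  dimension.\<close>

lemma finite_family_independent:
  fixes f :: "'i \<Rightarrow> 'a::real_vector"
  assumes I: "finite I" and ind: "\<And>c. (\<Sum>i\<in>I. c i *\<^sub>R f i) = 0 \<Longrightarrow> \<forall>i\<in>I. c i = 0"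
  shows "inj_on f I" and "independent (f ` I)"
proof -
  show inj: "inj_on f I"
  proof (rule inj_onI, rule ccontr)
    fix i j assume ij: "i \<in> I" "j \<in> I" "f i = f j" "i \<noteq> j"
    define c where "c k = (if k = i then 1 else 0) - (if k = j then 1 else 0::real)" for k
    have "(\<Sum>k\<in>I. c k *\<^sub>R f k) = (\<Sum>k\<in>I. if k = i then f k else 0) - (\<Sum>k\<in>I. if k = j then f k else 0)"
      unfolding sum_subtractf[symmetric] by (rule sum.cong) (auto simp: c_def)
    also have "\<dots> = 0" using ij I by (simp add: sum.delta)
    finally have "c i = 0" using ind ij(1) by blast
    then show False using ij(4) by (simp add: c_def)
  qed
  show "independent (f ` I)"
  proof
    assume "dependent (f ` I)"
    then obtain u where u: "\<exists>v\<in>f ` I. u v \<noteq> 0" "(\<Sum>v\<in>f ` I. u v *\<^sub>R v) = 0"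
      using dependent_finite[of "f ` I"] I by auto
    then have "(\<Sum>i\<in>I. u (f i) *\<^sub>R f i) = 0" by (simp add: sum.reindex[OF inj])
    then have "\<forall>i\<in>I. u (f i) = 0" by (rule ind)
    with u(1) show False by blast
  qed
qed

lemma bounded_subset_cball_0: "bounded S \<Longrightarrow> \<exists>R. S \<subseteq> cball 0 R"
  using bounded_subset_ballD[of S 0] ball_subset_cball order_trans by metis

lemma smooth_rhat: "smooth (rhat j)"
proof (cases "j = 0")
  case True
  then have "rhat j = (\<lambda>x. x)" by (auto simp: rhat_def)
  then show ?thesis by (simp add: smooth_bounded_linear bounded_linear_ident)
next
  case False
  then have "rhat j = (\<lambda>x. axis (of_nat j) 1)" by (auto simp: rhat_def)
  then show ?thesis by (simp add: smooth_const)
qed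

lemma dev_Grad_rhat: "dev (Grad (rhat j) x) = 0"
proof (cases "j = 0")
  case True
  then have "rhat j = (\<lambda>x. x)" by (auto simp: rhat_def)
  then have "Grad (rhat j) x = mat 1"
    by (simp add: vec_eq_iff Grad_nth pd_bounded_linear bounded_linear_ident mat_def axis_def)
  then show ?thesis by (simp add: dev_def trace_def sum_3 mat_def)
next
  case False
  then have "rhat j = (\<lambda>x. axis (of_nat j) 1)" by (auto simp: rhat_def)
  then have "Grad (rhat j) x = 0" by (simp add: vec_eq_iff Grad_nth)
  then show ?thesis by (simp add: dev_def trace_def)
qed

lemma test_xi_field: "test \<Omega> (\<xi> l) \<Longrightarrow> test \<Omega> (xi_field \<xi> l j)"
  unfolding xi_field_def[abs_def] by (rule test_bilinear_left[OF bounded_bilinear_scaleR _ smooth_rhat])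

lemma dev_Grad_xi_field:
  assumes s: "smooth (\<xi> l)" and V: "open V" "x \<in> V" "\<And>y. y \<in> V \<Longrightarrow> \<xi> l y = c"
  shows "dev (Grad (xi_field \<xi> l j) x) = 0"
proof -
  interpret linear dev by (rule bounded_linear.linear[OF bounded_linear_dev])
  have "D i (\<xi> l) x = 0" for i by (rule pd_eq_0_open[OF V])
  then have "Grad (xi_field \<xi> l j) x = \<xi> l x *\<^sub>R Grad (rhat j) x"
    unfolding xi_field_def[abs_def] by (simp add: Grad_mult[OF s smooth_rhat] outer_def vec_eq_iff)
  then show ?thesis by (simp add: scale dev_Grad_rhat)
qed

lemma sum_rhat: "(\<Sum>j\<in>{0..3}. c j *\<^sub>R rhat j x) = c 0 *\<^sub>R x + (\<chi> i. if i = 1 then c 1 else if i = 2 then c 2 else c 3)"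
proof -
  have "{0..3::nat} = {0, 1, 2, 3}" by auto
  then show ?thesis by (auto simp: rhat_def vec_eq_iff forall_3 axis_def)
qed

lemma cutoff_functionsD:
  assumes "cutoff_functions m Z \<xi>" "l \<in> {1..<m}"
  shows "test UNIV (\<xi> l)"
    and "k \<in> {0..<m} \<Longrightarrow> \<exists>V. open V \<and> Z k \<subseteq> V \<and> (\<forall>x\<in>V. \<xi> l x = (if l = k then 1 else 0))"
proof -
  have *: "test UNIV (\<xi> l) \<and> equals_near (\<xi> l) 1 (Z l) \<and> (\<forall>k\<in>{0..<m} - {l}. equals_near (\<xi> l) 0 (Z k))"
    using assms unfolding cutoff_functions_def by (elim conjE) (erule bspec)
  then show "test UNIV (\<xi> l)" by (elim conjE)
  show "\<exists>V. open V \<and> Z k \<subseteq> V \<and> (\<forall>x\<in>V. \<xi> l x = (if l = k then 1 else 0))" if "k \<in> {0..<m}"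
  proof (cases "l = k")
    case True
    with * have "equals_near (\<xi> l) 1 (Z k)" by simp
    with True show ?thesis by (simp add: equals_near_def)
  next
    case False
    with * that have "equals_near (\<xi> l) 0 (Z k)" by simp
    with False show ?thesis by (simp add: equals_near_def)
  qed
qed

lemma equals_near_mono: "equals_near f c T \<Longrightarrow> S \<subseteq> T \<Longrightarrow> equals_near f c S"
  unfolding equals_near_def by blast

section \<open>Kernels, ranges and the orthogonal projection\<close>

lemma subspace_ker:
  assumes "subspace A" shows "subspace (ker A)"
proof (rule subspaceI)
  show "0 \<in> ker A" using subspace_0[OF assms] by (simp add: ker_def zero_prod_def)
  show "x + y \<in> ker A" if "x \<in> ker A" "y \<in> ker A" for x y
    using subspace_add[OF assms, of "(x, 0)" "(y, 0)"] that by (simp add: ker_def)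
  show "c *\<^sub>R x \<in> ker A" if "x \<in> ker A" for c x
    using subspace_scale[OF assms, of "(x, 0)" c] that by (simp add: ker_def)
qed

lemma dop_add: "smooth f \<Longrightarrow> smooth g \<Longrightarrow> (\<And>i. bounded_linear (A i)) \<Longrightarrow> dop A (\<lambda>x. f x + g x) x = dop A f x + dop A g x"
  by (simp add: dop_def pd_add smooth_differentiable linear_add[OF bounded_linear.linear] sum.distrib)

lemma dop_scaleR: "smooth f \<Longrightarrow> (\<And>i. bounded_linear (A i)) \<Longrightarrow> dop A (\<lambda>x. c *\<^sub>R f x) x = c *\<^sub>R dop A f x"
  by (simp add: dop_def pd_linear[OF _ bounded_linear_scaleR_right] linear_cmul[OF bounded_linear.linear] scaleR_sum_right)

lemma symCurl_T0_eq:
  "symCurl_T0 \<Omega> = closure {(abs_L2 \<Phi>, abs_L2 (dop symcurl_coeff \<Phi>)) | \<Phi>. test \<Omega> \<Phi> \<and> (\<forall>x. trace (\<Phi> x) = 0)}"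
proof -
  have e: "restr \<Omega> \<Phi> = abs_L2 \<Phi>" "restr \<Omega> (\<lambda>x. sym_part (Curl \<Phi> x)) = abs_L2 (dop symcurl_coeff \<Phi>)" if "test \<Omega> \<Phi>" for \<Phi>
  proof -
    have "(\<lambda>x. sym_part (Curl \<Phi> x)) = dop symcurl_coeff \<Phi>"
      by (rule ext) (rule symCurl_eq_dop[OF test_smooth[OF that]])
    then show "restr \<Omega> \<Phi> = abs_L2 \<Phi>" "restr \<Omega> (\<lambda>x. sym_part (Curl \<Phi> x)) = abs_L2 (dop symcurl_coeff \<Phi>)"
      using restr_test[OF test_dop[OF that bounded_linear_symcurl_coeff]] restr_test[OF that] by simp_all
  qed
  have "{(restr \<Omega> \<Phi>, restr \<Omega> (\<lambda>x. sym_part (Curl \<Phi> x))) | \<Phi>. test \<Omega> \<Phi> \<and> (\<forall>x. trace (\<Phi> x) = 0)}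
      = {(abs_L2 \<Phi>, abs_L2 (dop symcurl_coeff \<Phi>)) | \<Phi>. test \<Omega> \<Phi> \<and> (\<forall>x. trace (\<Phi> x) = 0)}"
    by (intro Collect_cong ex_cong1) (auto simp: e)
  then show ?thesis by (simp add: symCurl_T0_def)
qed

lemma subspace_symCurl_T0: "subspace (symCurl_T0 \<Omega>)"
  unfolding symCurl_T0_eq
proof (rule subspace_closure, rule subspaceI)
  let ?S = "{(abs_L2 \<Phi>, abs_L2 (dop symcurl_coeff \<Phi>)) | \<Phi>. test \<Omega> \<Phi> \<and> (\<forall>x. trace (\<Phi> x) = 0)}"
  interpret tr: linear "trace :: real^3^3 \<Rightarrow> real" by (rule bounded_linear.linear[OF bounded_linear_trace])
  note bl = bounded_linear_symcurl_coeff
  have "dop symcurl_coeff (\<lambda>x. 0) = (\<lambda>x. 0)"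
    by (auto simp: dop_def bounded_linear_zero[OF bl])
  then show "0 \<in> ?S" by (auto simp: zero_prod_def abs_L2_zero tr.zero intro!: exI[of _ "\<lambda>x. 0"] test_zero)
  fix x y c
  show "x + y \<in> ?S" if xy: "x \<in> ?S" "y \<in> ?S"
  proof -
    obtain f g where f: "test \<Omega> f" "\<And>x. trace (f x) = 0" "x = (abs_L2 f, abs_L2 (dop symcurl_coeff f))"
      and g: "test \<Omega> g" "\<And>x. trace (g x) = 0" "y = (abs_L2 g, abs_L2 (dop symcurl_coeff g))" using xy by blast
    have "dop symcurl_coeff (\<lambda>x. f x + g x) = (\<lambda>x. dop symcurl_coeff f x + dop symcurl_coeff g x)"
      by (rule ext) (rule dop_add[OF test_smooth[OF f(1)] test_smooth[OF g(1)] bl])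
    then have "x + y = (abs_L2 (\<lambda>x. f x + g x), abs_L2 (dop symcurl_coeff (\<lambda>x. f x + g x)))"
      by (simp add: f(3) g(3) abs_L2_add test_sq_int[OF f(1)] test_sq_int[OF g(1)] test_sq_int[OF test_dop[OF f(1) bl]] test_sq_int[OF test_dop[OF g(1) bl]])
    moreover have "\<forall>x. trace (f x + g x) = 0" by (simp add: tr.add f g)
    ultimately show ?thesis using test_add[OF f(1) g(1)] by blast
  qed
  show "c *\<^sub>R x \<in> ?S" if x: "x \<in> ?S"
  proof -
    obtain f where f: "test \<Omega> f" "\<And>x. trace (f x) = 0" "x = (abs_L2 f, abs_L2 (dop symcurl_coeff f))" using x by blast
    have "dop symcurl_coeff (\<lambda>x. c *\<^sub>R f x) = (\<lambda>x. c *\<^sub>R dop symcurl_coeff f x)"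
      by (rule ext) (rule dop_scaleR[OF test_smooth[OF f(1)] bl])
    then have "c *\<^sub>R x = (abs_L2 (\<lambda>x. c *\<^sub>R f x), abs_L2 (dop symcurl_coeff (\<lambda>x. c *\<^sub>R f x)))"
      by (simp add: f(3) abs_L2_scaleR test_sq_int[OF f(1)] test_sq_int[OF test_dop[OF f(1) bl]])
    moreover have "\<forall>x. trace (c *\<^sub>R f x) = 0" by (simp add: tr.scale f)
    ultimately show ?thesis using test_scaleR[OF f(1)] by blast
  qed
qed

lemma trace_dev: "trace (dev M) = 0"
  by (simp add: dev_def trace_def sum_3 mat_def field_simps)

lemma devGrad_in_ker_symCurl:
  assumes v: "smooth v" and t: "test \<Omega> (\<lambda>x. dev (Grad v x))"
  shows "abs_L2 (\<lambda>x. dev (Grad v x)) \<in> ker (symCurl_T0 \<Omega>)"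
proof -
  have "dop symcurl_coeff (\<lambda>x. dev (Grad v x)) = (\<lambda>x. 0)"
    using symCurl_devGrad[OF v] symCurl_eq_dop[OF test_smooth[OF t]] by metis
  then have "(abs_L2 (\<lambda>x. dev (Grad v x)), 0) \<in> {(abs_L2 \<Phi>, abs_L2 (dop symcurl_coeff \<Phi>)) | \<Phi>. test \<Omega> \<Phi> \<and> (\<forall>x. trace (\<Phi> x) = 0)}"
    using t by (auto simp: abs_L2_zero trace_dev intro!: exI[of _ "\<lambda>x. dev (Grad v x)"])
  from subsetD[OF closure_subset this] show ?thesis unfolding ker_def symCurl_T0_eq by (rule CollectI)
qed

lemma devGrad_range_in_ker_symCurl: "dev_L2 ` Range (H10 \<Omega>) \<subseteq> ker (symCurl_T0 \<Omega>)"
proof safe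
  fix v G assume "(v, G) \<in> H10 \<Omega>"
  then obtain \<phi> where \<phi>: "\<And>n. test \<Omega> (\<phi> n)" "(\<lambda>n. abs_L2 (Grad (\<phi> n))) \<longlonglongrightarrow> G"
    by (rule H10_sequence) blast
  have lim: "(\<lambda>n. (dev_L2 (abs_L2 (Grad (\<phi> n))), 0)) \<longlonglongrightarrow> (dev_L2 G, 0 :: (real^3^3) L2)"
    by (intro tendsto_Pair tendsto_const bounded_linear.tendsto[OF bounded_linear_dev_L2 \<phi>(2)])
  have mem: "(dev_L2 (abs_L2 (Grad (\<phi> n))), 0) \<in> symCurl_T0 \<Omega>" for n
    using devGrad_in_ker_symCurl[OF test_smooth[OF \<phi>(1)] test_dev[OF test_Grad[OF \<phi>(1)]]]
    by (simp add: ker_def abs_L2_dev[OF test_sq_int[OF test_Grad[OF \<phi>(1)]]])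
  have "closed (symCurl_T0 \<Omega>)" by (simp add: symCurl_T0_def)
  from closed_sequentially[OF this mem lim] show "dev_L2 G \<in> ker (symCurl_T0 \<Omega>)" by (simp add: ker_def)
qed

lemma devGrad_range_L2_T:
  assumes \<Omega>: "open \<Omega>" shows "dev_L2 ` Range (H10 \<Omega>) \<subseteq> L2_T \<Omega>"
proof safe
  fix v G assume "(v, G) \<in> H10 \<Omega>"
  then have G: "G \<in> L2_on \<Omega>" using H10_weak_Grad[OF \<Omega>] by (auto simp: weak_Grad_def)
  obtain g where g: "sq_int g" "G = abs_L2 g" by (rule abs_L2_cases)
  have sd: "sq_int (\<lambda>x. dev (g x))" by (rule sq_int_bounded_linear[OF g(1) bounded_linear_dev])
  have "AE x in lebesgue. x \<notin> \<Omega> \<longrightarrow> dev (g x) = 0"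
    using G unfolding g(2) L2_on_abs[OF g(1)] by eventually_elim (simp add: bounded_linear_zero[OF bounded_linear_dev])
  then show "dev_L2 G \<in> L2_T \<Omega>" by (simp add: g abs_L2_dev L2_T_abs[OF sd] trace_dev)
qed

lemma subspace_ker_Div_T:
  assumes "\<Omega> \<subseteq> cball 0 R"
  shows "subspace (ker (Div_T \<Omega>))"
  by (rule subspaceI)
    (auto simp: ker_Div_T_iff[OF assms] inner_add_left subspace_0[OF subspace_L2_T] subspace_add[OF subspace_L2_T] subspace_scale[OF subspace_L2_T])

lemma subspace_Dirichlet_fields:
  assumes "\<Omega> \<subseteq> cball 0 R"
  shows "subspace (Dirichlet_fields \<Omega>)"
  unfolding Dirichlet_fields_def
  by (rule subspace_inter[OF subspace_ker[OF subspace_symCurl_T0] subspace_ker_Div_T[OF assms]])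

text \<open>Subtracting from \<open>x\<close> its projection onto the closed range leaves an element
  of the kernel of \<open>Div_T\<close>; uniqueness of orthogonal projections identifies it with
  \<open>orth_proj\<close>.\<close>

lemma orth_proj_decomposition:
  assumes \<Omega>: "open \<Omega>" "\<Omega> \<subseteq> cball 0 R" and x: "x \<in> L2_T \<Omega>"
  shows "orth_proj (ker (Div_T \<Omega>)) x \<in> ker (Div_T \<Omega>)" and "x - orth_proj (ker (Div_T \<Omega>)) x \<in> dev_L2 ` Range (H10 \<Omega>)"
proof -
  note iff = ker_Div_T_iff[OF \<Omega>(2)]
  obtain r where r: "r \<in> dev_L2 ` Range (H10 \<Omega>)" "\<And>q. q \<in> dev_L2 ` Range (H10 \<Omega>) \<Longrightarrow> (x - r) \<bullet> q = 0"
    using ex_orthogonal_projection[OF subspace_devGrad_range[OF \<Omega>(2)] closed_devGrad_range[OF \<Omega>(2)], of x] by blast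
  have k: "x - r \<in> ker (Div_T \<Omega>)"
    unfolding iff using subspace_diff[OF subspace_L2_T x] devGrad_range_L2_T[OF \<Omega>(1)] r by blast
  have "orth_proj (ker (Div_T \<Omega>)) x = x - r"
    unfolding orth_proj_def
  proof (rule the_equality, intro conjI ballI k)
    have rq: "r \<bullet> q = 0" if "q \<in> ker (Div_T \<Omega>)" for q
    proof -
      have "q \<bullet> r = 0" using that r(1) unfolding iff by blast
      then show ?thesis by (simp add: inner_commute)
    qed
    show "(x - (x - r)) \<bullet> q = 0" if "q \<in> ker (Div_T \<Omega>)" for q using rq[OF that] by simp
    fix p assume p: "p \<in> ker (Div_T \<Omega>) \<and> (\<forall>q\<in>ker (Div_T \<Omega>). (x - p) \<bullet> q = 0)"
    have d: "p - (x - r) \<in> ker (Div_T \<Omega>)" using subspace_diff[OF subspace_ker_Div_T[OF \<Omega>(2)] _ k] p by blast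
    have "(x - p) \<bullet> (p - (x - r)) = 0" using p d by blast
    moreover have "(p - (x - r)) \<bullet> (p - (x - r)) = r \<bullet> (p - (x - r)) - (x - p) \<bullet> (p - (x - r))"
      unfolding inner_diff_left[symmetric] by (simp add: algebra_simps)
    ultimately have "(p - (x - r)) \<bullet> (p - (x - r)) = 0" using rq[OF d] by simp
    then show "p = x - r" by simp
  qed
  then show "orth_proj (ker (Div_T \<Omega>)) x \<in> ker (Div_T \<Omega>)" "x - orth_proj (ker (Div_T \<Omega>)) x \<in> dev_L2 ` Range (H10 \<Omega>)"
    using k r(1) by simp_all
qed

text \<open>For existence, take a potential of the range component of \<open>dev_L2 Gu\<close>. Two
  solutions differ by an H_0^1 field with vanishing deviatoric gradient, which is zero by Korn and
  Poincare.\<close>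

lemma ex1_psi:
  assumes \<Omega>: "open \<Omega>" "\<Omega> \<subseteq> cball 0 R" and u: "(u, Gu) \<in> weak_Grad \<Omega>" and T: "dev_L2 Gu \<in> L2_T \<Omega>"
  shows "\<exists>!\<psi>. \<psi> \<in> H1_0 \<Omega> \<and> orth_proj (ker (Div_T \<Omega>)) (devGrad \<Omega> u) = devGrad \<Omega> (u - \<psi>)"
proof -
  have lin: "dev_L2 (a - b) = dev_L2 a - dev_L2 b" for a b by (rule linear_diff[OF bounded_linear.linear[OF bounded_linear_dev_L2]])
  have du: "devGrad \<Omega> u = dev_L2 Gu" by (rule devGrad_eq[OF \<Omega>(1) u])
  have d: "devGrad \<Omega> (u - \<psi>) = dev_L2 Gu - dev_L2 F" if "(\<psi>, F) \<in> H10 \<Omega>" for \<psi> F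
    using devGrad_eq[OF \<Omega>(1) weak_Grad_diff[OF u H10_weak_Grad[OF \<Omega>(1) that]]] by (simp add: lin)
  obtain \<psi> F where \<psi>: "(\<psi>, F) \<in> H10 \<Omega>" "dev_L2 Gu - orth_proj (ker (Div_T \<Omega>)) (dev_L2 Gu) = dev_L2 F"
    using orth_proj_decomposition(2)[OF \<Omega> T] by blast
  have e: "orth_proj (ker (Div_T \<Omega>)) (devGrad \<Omega> u) = dev_L2 Gu - dev_L2 F" using \<psi>(2) by (simp add: du algebra_simps)
  show ?thesis
  proof (rule ex1I[of _ \<psi>], intro conjI)
    show "\<psi> \<in> H1_0 \<Omega>" using \<psi>(1) by (auto simp: H1_0_eq)
    show "orth_proj (ker (Div_T \<Omega>)) (devGrad \<Omega> u) = devGrad \<Omega> (u - \<psi>)" by (simp add: e d[OF \<psi>(1)])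
    fix \<psi>' assume a: "\<psi>' \<in> H1_0 \<Omega> \<and> orth_proj (ker (Div_T \<Omega>)) (devGrad \<Omega> u) = devGrad \<Omega> (u - \<psi>')"
    then obtain F' where F': "(\<psi>', F') \<in> H10 \<Omega>" by (auto simp: H1_0_eq)
    have h: "(\<psi>' - \<psi>, F' - F) \<in> H10 \<Omega>" using subspace_diff[OF subspace_H10 F' \<psi>(1)] by simp
    have "dev_L2 (F' - F) = 0" using a e d[OF F'] by (simp add: lin)
    with Korn[OF h] have "F' - F = 0" by simp
    with Poincare[OF h \<Omega>(2)] show "\<psi>' = \<psi>" by simp
  qed
qed

section \<open>The cutoff fields and their projections\<close>

lemma exterior_cover:
  assumes "enumerates_components \<Omega> m \<Xi>"
  shows "- closure \<Omega> = (\<Union>k\<in>{0..<m}. \<Xi> k)" and "k < m \<Longrightarrow> \<Xi> k \<in> components (- closure \<Omega>)"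
proof -
  have "\<Xi> ` {0..<m} = components (- closure \<Omega>)" using assms by (simp add: enumerates_components_def bij_betw_def)
  then show "- closure \<Omega> = (\<Union>k\<in>{0..<m}. \<Xi> k)" "k < m \<Longrightarrow> \<Xi> k \<in> components (- closure \<Omega>)"
    using Union_components[of "- closure \<Omega>"] by auto
qed

text \<open>
  The hypothesis covers both the given cutoffs (\<open>Z = \<Xi>\<close>) and those that are constant near the
  closures of the components (\<open>Z k = closure (\<Xi> k)\<close>).
\<close>

lemma dev_Grad_xi_field_exterior:
  assumes \<xi>: "cutoff_functions m Z \<xi>" and l: "l \<in> {1..<m}"
  shows "\<exists>V. open V \<and> (\<Union>k\<in>{0..<m}. Z k) \<subseteq> V \<and> (\<forall>x\<in>V. dev (Grad (xi_field \<xi> l j) x) = 0)"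
proof -
  have s: "smooth (\<xi> l)" by (rule test_smooth[OF cutoff_functionsD(1)[OF \<xi> l]])
  have "\<exists>V c. open V \<and> Z k \<subseteq> V \<and> (\<forall>x\<in>V. \<xi> l x = c)" if "k \<in> {0..<m}" for k
    using cutoff_functionsD(2)[OF \<xi> l that] by blast
  then obtain V c where V: "\<And>k. k \<in> {0..<m} \<Longrightarrow> open (V k)" "\<And>k. k \<in> {0..<m} \<Longrightarrow> Z k \<subseteq> V k"
    "\<And>k x. k \<in> {0..<m} \<Longrightarrow> x \<in> V k \<Longrightarrow> \<xi> l x = c k" by metis
  show ?thesis
  proof (intro exI[of _ "\<Union>k\<in>{0..<m}. V k"] conjI ballI)
    show "open (\<Union>k\<in>{0..<m}. V k)" using V(1) by blast
    show "(\<Union>k\<in>{0..<m}. Z k) \<subseteq> (\<Union>k\<in>{0..<m}. V k)" using V(2) by blast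
    fix x assume "x \<in> (\<Union>k\<in>{0..<m}. V k)"
    then obtain k where "k \<in> {0..<m}" "x \<in> V k" by blast
    then show "dev (Grad (xi_field \<xi> l j) x) = 0" using dev_Grad_xi_field[where \<xi> = \<xi> and l = l and c = "c k" and V = "V k"] s V(1,3) by blast
  qed
qed

text \<open>The zero set is closed and contains the exterior, hence also its closure, which covers
  the complement of \<Omega>.\<close>

lemma dev_Grad_xi_field_outside:
  assumes \<Omega>: "open \<Omega>" "continuous_boundary \<Omega>" and \<Xi>: "enumerates_components \<Omega> m \<Xi>" and \<xi>: "cutoff_functions m \<Xi> \<xi>" and l: "l \<in> {1..<m}"
    and x: "x \<notin> \<Omega>"
  shows "dev (Grad (xi_field \<xi> l j) x) = 0"
proof -
  have t: "test UNIV (xi_field \<xi> l j)" by (rule test_xi_field[where \<xi> = \<xi> and l = l, OF cutoff_functionsD(1)[OF \<xi> l]])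
  have "closed {x. dev (Grad (xi_field \<xi> l j) x) = 0}"
    by (intro closed_Collect_eq smooth_continuous test_smooth[OF test_dev[OF test_Grad[OF t]]] continuous_on_const)
  moreover have "- closure \<Omega> \<subseteq> {x. dev (Grad (xi_field \<xi> l j) x) = 0}"
    using dev_Grad_xi_field_exterior[OF \<xi> l, of j] exterior_cover(1)[OF \<Xi>] by blast
  ultimately have "closure (- closure \<Omega>) \<subseteq> {x. dev (Grad (xi_field \<xi> l j) x) = 0}" by (intro closure_minimal)
  with frontier_subset_closure_exterior[OF \<Omega>] x show ?thesis by blast
qed

text \<open>On \<open>Z k\<close> the cutoff of index \<open>k\<close> is 1 and the others are 0,
  and there is no cutoff of index 0.\<close>

lemma sum_xi_field:
  assumes \<xi>: "cutoff_functions m Z \<xi>" and k: "k \<in> {0..<m}" "x \<in> Z k"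
  shows "(\<Sum>(l, j)\<in>{1..<m} \<times> {0..3}. c (l, j) *\<^sub>R xi_field \<xi> l j x) =
    (if k = 0 then 0 else c (k, 0) *\<^sub>R x + (\<chi> i. if i = 1 then c (k, 1) else if i = 2 then c (k, 2) else c (k, 3)))"
proof -
  have x1: "\<xi> l x = (if l = k then 1 else 0)" if "l \<in> {1..<m}" for l
    using cutoff_functionsD(2)[OF \<xi> that k(1)] k(2) by blast
  have "(\<Sum>(l, j)\<in>{1..<m} \<times> {0..3}. c (l, j) *\<^sub>R xi_field \<xi> l j x) = (\<Sum>l\<in>{1..<m}. \<Sum>j\<in>{0..3}. c (l, j) *\<^sub>R xi_field \<xi> l j x)"
    by (simp add: sum.cartesian_product)
  also have "\<dots> = (\<Sum>l\<in>{1..<m}. if l = k then (\<Sum>j\<in>{0..3}. c (k, j) *\<^sub>R rhat j x) else 0)"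
    by (rule sum.cong) (auto simp: xi_field_def x1)
  also have "\<dots> = (if k = 0 then 0 else (\<Sum>j\<in>{0..3}. c (k, j) *\<^sub>R rhat j x))" using k(1) by (auto simp: sum.delta)
  finally show ?thesis by (simp add: sum_rhat[of "\<lambda>j. c (k, j)"])
qed

lemma H10_sum_xi_field:
  assumes t: "\<And>l. l \<in> {1..<m} \<Longrightarrow> test B (\<xi> l)"
  shows "(abs_L2 (\<lambda>x. \<Sum>(l, j)\<in>{1..<m} \<times> {0..3}. c (l, j) *\<^sub>R xi_field \<xi> l j x),
      \<Sum>(l, j)\<in>{1..<m} \<times> {0..3}. c (l, j) *\<^sub>R abs_L2 (Grad (xi_field \<xi> l j))) \<in> H10 B"
proof -
  have tx: "test B (xi_field \<xi> l j)" if "l \<in> {1..<m}" for l j by (rule test_xi_field[where \<xi> = \<xi> and l = l, OF t[OF that]])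
  have "(\<Sum>(l, j)\<in>{1..<m} \<times> {0..3}. c (l, j) *\<^sub>R (abs_L2 (xi_field \<xi> l j), abs_L2 (Grad (xi_field \<xi> l j)))) \<in> H10 B"
    by (rule subspace_sum[OF subspace_H10]) (auto intro!: subspace_scale[OF subspace_H10] H10_test tx simp del: scaleR_Pair)
  moreover have "(\<Sum>(l, j)\<in>{1..<m} \<times> {0..3}. c (l, j) *\<^sub>R (abs_L2 (xi_field \<xi> l j), abs_L2 (Grad (xi_field \<xi> l j))))
      = (\<Sum>(l, j)\<in>{1..<m} \<times> {0..3}. c (l, j) *\<^sub>R abs_L2 (xi_field \<xi> l j), \<Sum>(l, j)\<in>{1..<m} \<times> {0..3}. c (l, j) *\<^sub>R abs_L2 (Grad (xi_field \<xi> l j)))"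
    by (auto simp: prod_eq_iff fst_sum snd_sum case_prod_unfold)
  moreover have "abs_L2 (\<lambda>x. \<Sum>(l, j)\<in>{1..<m} \<times> {0..3}. c (l, j) *\<^sub>R xi_field \<xi> l j x) = (\<Sum>(l, j)\<in>{1..<m} \<times> {0..3}. c (l, j) *\<^sub>R abs_L2 (xi_field \<xi> l j))"
  proof -
    have "abs_L2 (\<lambda>x. \<Sum>i\<in>{1..<m} \<times> {0..3}. c i *\<^sub>R xi_field \<xi> (fst i) (snd i) x) = (\<Sum>i\<in>{1..<m} \<times> {0..3}. abs_L2 (\<lambda>x. c i *\<^sub>R xi_field \<xi> (fst i) (snd i) x))"
      by (rule abs_L2_sum) (auto intro!: sq_int_scaleR test_sq_int[OF tx])
    also have "\<dots> = (\<Sum>i\<in>{1..<m} \<times> {0..3}. c i *\<^sub>R abs_L2 (xi_field \<xi> (fst i) (snd i)))"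
      by (rule sum.cong) (auto intro!: abs_L2_scaleR test_sq_int[OF tx])
    finally show ?thesis by (simp add: case_prod_unfold)
  qed
  ultimately show ?thesis by simp
qed

lemma dev_L2_sum_xi_field:
  assumes t: "\<And>l. l \<in> {1..<m} \<Longrightarrow> test B (\<xi> l)"
  shows "dev_L2 (\<Sum>(l, j)\<in>{1..<m} \<times> {0..3}. c (l, j) *\<^sub>R abs_L2 (Grad (xi_field \<xi> l j)))
    = (\<Sum>(l, j)\<in>{1..<m} \<times> {0..3}. c (l, j) *\<^sub>R abs_L2 (\<lambda>x. dev (Grad (xi_field \<xi> l j) x)))"
proof -
  interpret linear dev_L2 by (rule bounded_linear.linear[OF bounded_linear_dev_L2])
  have "sq_int (Grad (xi_field \<xi> l j))" if "l \<in> {1..<m}" for l j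
    by (rule test_sq_int[OF test_Grad[OF test_xi_field[where \<xi> = \<xi> and l = l, OF t[OF that]]]])
  then show ?thesis
    unfolding sum by (intro sum.cong) (auto simp: scale abs_L2_dev)
qed

text \<open>As the deviatoric gradient of the cutoff field vanishes outside \<Omega>, it coincides
  with the one of the restricted field and lies in \<open>L2_T \<Omega>\<close>. So
  \<open>ex1_psi\<close> applies and the description operator in \<open>psi\<close> can be
  unfolded.\<close>

lemma v_field_decomposition:
  assumes \<Omega>: "open \<Omega>" "\<Omega> \<subseteq> cball 0 R" "continuous_boundary \<Omega>"
    and \<Xi>: "enumerates_components \<Omega> m \<Xi>" and \<xi>: "cutoff_functions m \<Xi> \<xi>" and l: "l \<in> {1..<m}"
  shows "v_field \<Omega> \<xi> l j \<in> H1 \<Omega>"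
    and "devGrad \<Omega> (v_field \<Omega> \<xi> l j) \<in> ker (Div_T \<Omega>)"
    and "abs_L2 (\<lambda>x. dev (Grad (xi_field \<xi> l j) x)) - devGrad \<Omega> (v_field \<Omega> \<xi> l j) \<in> dev_L2 ` Range (H10 \<Omega>)"
proof -
  let ?u = "xi_field \<xi> l j" and ?N = "ker (Div_T \<Omega>)"
  have t: "test UNIV ?u" by (rule test_xi_field[where \<xi> = \<xi> and l = l, OF cutoff_functionsD(1)[OF \<xi> l]])
  note td = test_sq_int[OF test_dev[OF test_Grad[OF t]]]
  have w: "(restr \<Omega> ?u, restr \<Omega> (Grad ?u)) \<in> weak_Grad \<Omega>" by (rule weak_Grad_restr[OF \<Omega>(1) t])
  have out: "dev (Grad ?u x) = 0" if "x \<notin> \<Omega>" for x by (rule dev_Grad_xi_field_outside[OF \<Omega>(1,3) \<Xi> \<xi> l that])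
  have eq: "dev_L2 (restr \<Omega> (Grad ?u)) = abs_L2 (\<lambda>x. dev (Grad ?u x))"
  proof -
    have "(\<lambda>x. dev (if x \<in> \<Omega> then Grad ?u x else 0)) = (\<lambda>x. dev (Grad ?u x))"
      using out by (auto simp: bounded_linear_zero[OF bounded_linear_dev])
    then show ?thesis by (simp add: restr_eq_abs abs_L2_dev[OF sq_int_restr_test[OF test_Grad[OF t] \<Omega>(1)]])
  qed
  have T: "dev_L2 (restr \<Omega> (Grad ?u)) \<in> L2_T \<Omega>" unfolding eq by (simp add: L2_T_abs[OF td] out trace_dev)
  have du: "devGrad \<Omega> (restr \<Omega> ?u) = abs_L2 (\<lambda>x. dev (Grad ?u x))" by (simp add: devGrad_eq[OF \<Omega>(1) w] eq)
  from theI'[OF ex1_psi[OF \<Omega>(1,2) w T]]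
  have \<psi>: "psi \<Omega> \<xi> l j \<in> H1_0 \<Omega>" "orth_proj ?N (devGrad \<Omega> (restr \<Omega> ?u)) = devGrad \<Omega> (v_field \<Omega> \<xi> l j)"
    by (simp_all add: psi_def v_field_def)
  obtain F where "(psi \<Omega> \<xi> l j, F) \<in> H10 \<Omega>" using \<psi>(1) by (auto simp: H1_0_eq)
  from weak_Grad_diff[OF w H10_weak_Grad[OF \<Omega>(1) this]] show "v_field \<Omega> \<xi> l j \<in> H1 \<Omega>"
    by (auto simp: H1_def v_field_def)
  show "devGrad \<Omega> (v_field \<Omega> \<xi> l j) \<in> ?N"
    using orth_proj_decomposition(1)[OF \<Omega>(1,2) T] by (simp add: \<psi>(2)[symmetric] du eq)
  show "abs_L2 (\<lambda>x. dev (Grad ?u x)) - devGrad \<Omega> (v_field \<Omega> \<xi> l j) \<in> dev_L2 ` Range (H10 \<Omega>)"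
    using orth_proj_decomposition(2)[OF \<Omega>(1,2) T] by (simp add: \<psi>(2)[symmetric] du eq)
qed

section \<open>Existence of enumerations and of cutoffs that are constant near the closures\<close>

lemma ex_enumeration:
  assumes \<Omega>: "bounded \<Omega>" and fin: "finite (components (- closure \<Omega>))" and m: "m = card (components (- closure \<Omega>))"
  shows "\<exists>\<Xi>. enumerates_components \<Omega> m \<Xi>"
proof -
  have "bounded (- (- closure \<Omega>))" using bounded_closure[OF \<Omega>] by simp
  from cobounded_unbounded_components[OF this] obtain C where C: "C \<in> components (- closure \<Omega>)" "\<not> bounded C" by blast
  obtain h where h: "bij_betw h {0..<m} (components (- closure \<Omega>))" using ex_bij_betw_nat_finite[OF fin] m by blast
  then obtain i where i: "i < m" "h i = C" using C(1) by (metis atLeastLessThan_iff bij_betw_imp_surj_on imageE)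
  \<comment> \<open>Exchanging the indices 0 and \<open>i\<close> puts the unbounded component
    first.\<close>
  have "bij_betw (Transposition.transpose 0 i) {0..<m} {0..<m}"
    by (rule bij_betw_transpose_iff) (use i(1) in auto)
  from bij_betw_trans[OF this h] have "bij_betw (h \<circ> Transposition.transpose 0 i) {0..<m} (components (- closure \<Omega>))" .
  then show ?thesis unfolding enumerates_components_def using i C(2) by (intro exI[of _ "h \<circ> Transposition.transpose 0 i"]) simp
qed

text \<open>The bounded components have compact closures, which keep a positive distance from the
  closures of the other components; the supports stay within half the least such distance.\<close>

lemma ex_strong_cutoffs:
  assumes \<Omega>: "open \<Omega>" "bounded \<Omega>" "continuous_boundary \<Omega>" and \<Xi>: "enumerates_components \<Omega> m \<Xi>"
  shows "\<exists>\<xi>. cutoff_functions m (\<lambda>k. closure (\<Xi> k)) \<xi>"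
proof -
  note comp = exterior_cover(2)[OF \<Xi>]
  have inj: "\<Xi> l \<noteq> \<Xi> k" if "l < m" "k < m" "l \<noteq> k" for l k
    using \<Xi> that by (auto simp: enumerates_components_def bij_betw_def inj_on_def)
  have bC: "bounded (- (- closure \<Omega>))" using bounded_closure[OF \<Omega>(2)] by simp
  have cpt: "compact (closure (\<Xi> l))" if "l \<in> {1..<m}" for l
  proof -
    have "bounded (\<Xi> l)"
    proof (rule ccontr)
      assume "\<not> bounded (\<Xi> l)"
      then have "\<Xi> l = \<Xi> 0"
        using cobounded_unique_unbounded_components[OF bC comp[of 0] _ comp[of l]] \<Xi> that
        by (auto simp: enumerates_components_def)
      with inj[of l 0] that show False by auto
    qed
    then show ?thesis by (simp add: compact_closure)
  qed
  have "\<exists>d>0. \<forall>x\<in>closure (\<Xi> l). \<forall>y\<in>closure (\<Xi> k). d \<le> dist x y" if "l \<in> {1..<m}" "k \<in> {0..<m}" "l \<noteq> k" for l k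
  proof (rule separate_compact_closed[OF cpt[OF that(1)] closed_closure])
    show "closure (\<Xi> l) \<inter> closure (\<Xi> k) = {}"
      by (rule closures_exterior_components_disjoint[OF \<Omega>(1,3) comp comp inj]) (use that in auto)
  qed
  then obtain d where d: "\<And>l k. l \<in> {1..<m} \<Longrightarrow> k \<in> {0..<m} \<Longrightarrow> l \<noteq> k \<Longrightarrow> d l k > 0"
    "\<And>l k x y. l \<in> {1..<m} \<Longrightarrow> k \<in> {0..<m} \<Longrightarrow> l \<noteq> k \<Longrightarrow> x \<in> closure (\<Xi> l) \<Longrightarrow> y \<in> closure (\<Xi> k) \<Longrightarrow> d l k \<le> dist x y"
    by metis
  \<comment> \<open>The entry 1 makes the minimum exist and be positive when there are no
    pairs.\<close>
  define \<delta> where "\<delta> = Min (insert 1 ((\<lambda>(l, k). d l k) ` {(l, k). l \<in> {1..<m} \<and> k \<in> {0..<m} \<and> l \<noteq> k}))"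
  have finS: "finite {(l, k). l \<in> {1..<m} \<and> k \<in> {0..<m} \<and> l \<noteq> k}"
    by (rule finite_subset[of _ "{1..<m} \<times> {0..<m}"]) auto
  have \<delta>: "\<delta> > 0" "\<And>l k. l \<in> {1..<m} \<Longrightarrow> k \<in> {0..<m} \<Longrightarrow> l \<noteq> k \<Longrightarrow> \<delta> \<le> d l k"
  proof -
    show "\<delta> > 0" unfolding \<delta>_def by (subst Min_gr_iff) (use finS d(1) in auto)
    show "\<delta> \<le> d l k" if "l \<in> {1..<m}" "k \<in> {0..<m}" "l \<noteq> k" for l k
      unfolding \<delta>_def by (rule Min_le) (use finS that in \<open>auto intro!: image_eqI[of _ _ "(l, k)"]\<close>)
  qed
  define U where "U l = (\<Union>x\<in>closure (\<Xi> l). ball x (\<delta> / 2))" for l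
  have U: "open (U l)" "closure (\<Xi> l) \<subseteq> U l" for l using \<delta>(1) by (auto simp: U_def)
  have far: "\<delta> \<le> dist x y" if "l \<in> {1..<m}" "k \<in> {0..<m}" "l \<noteq> k" "x \<in> closure (\<Xi> l)" "y \<in> closure (\<Xi> k)" for l k x y
    using \<delta>(2)[OF that(1-3)] d(2)[OF that] by linarith
  have disj: "U l \<inter> U k = {}" if "l \<in> {1..<m}" "k \<in> {1..<m}" "l \<noteq> k" for l k
  proof (rule ccontr)
    assume "U l \<inter> U k \<noteq> {}"
    then obtain z x y where "x \<in> closure (\<Xi> l)" "dist x z < \<delta> / 2" "y \<in> closure (\<Xi> k)" "dist y z < \<delta> / 2"
      unfolding U_def by auto
    with far[of l k x y] that show False using dist_triangle[of x y z] by (simp add: dist_commute)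
  qed
  have disj': "U l \<inter> closure (\<Xi> k) = {}" if "l \<in> {1..<m}" "k \<in> {0..<m}" "l \<noteq> k" for l k
    using far[OF that] \<delta>(1) unfolding U_def by fastforce
  have "\<exists>\<phi>. test (U l) \<phi> \<and> (\<exists>V. open V \<and> closure (\<Xi> l) \<subseteq> V \<and> (\<forall>x\<in>V. \<phi> x = (1::real)))" if "l \<in> {1..<m}" for l
    by (rule ex_cutoff[OF cpt[OF that] U])
  then obtain \<xi> where \<xi>: "\<And>l. l \<in> {1..<m} \<Longrightarrow> test (U l) (\<xi> l)"
    "\<And>l. l \<in> {1..<m} \<Longrightarrow> \<exists>V. open V \<and> closure (\<Xi> l) \<subseteq> V \<and> (\<forall>x\<in>V. \<xi> l x = (1::real))" by metis
  have sU: "supp (\<xi> l) \<subseteq> U l" if "l \<in> {1..<m}" for l using \<xi>(1)[OF that] by (simp add: test_iff)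
  have "cutoff_functions m (\<lambda>k. closure (\<Xi> k)) \<xi>"
    unfolding cutoff_functions_def
  proof (intro conjI ballI impI)
    fix l assume l: "l \<in> {1..<m}"
    show "test UNIV (\<xi> l)" by (rule test_mono[OF \<xi>(1)[OF l]]) simp
    show "equals_near (\<xi> l) 1 (closure (\<Xi> l))" unfolding equals_near_def by (rule \<xi>(2)[OF l])
    show "equals_near (\<xi> l) 0 (closure (\<Xi> k))" if "k \<in> {0..<m} - {l}" for k
      unfolding equals_near_def
      using disj'[OF l, of k] sU[OF l] that notin_supp[of _ "\<xi> l"] closed_supp[of "\<xi> l"] by (intro exI[of _ "- supp (\<xi> l)"]) auto
    show "supp (\<xi> l) \<inter> supp (\<xi> k) = {}" if "k \<in> {1..<m}" "l \<noteq> k" for k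
      using sU[OF l] sU[OF that(1)] disj[OF l that] by blast
  qed
  then show ?thesis by blast
qed

lemma closure_UN_finite: "finite I \<Longrightarrow> closure (\<Union>i\<in>I. A i) = (\<Union>i\<in>I. closure (A i))"
  by (induction I rule: finite_induct) auto

lemma Grad_diff: "smooth u \<Longrightarrow> smooth v \<Longrightarrow> Grad (\<lambda>x. u x - v x) x = Grad u x - Grad v x"
  by (simp add: vec_eq_iff Grad_nth pd_diff smooth_differentiable)

text \<open>
  The given cutoffs need only be constant on the components themselves, so \<open>dev (Grad (xi_field \<xi> l j))\<close>
  need not be compactly supported in \<open>\<Omega>\<close>; it differs by an element of the range from one that is.
\<close>

lemma v_field_in_Dirichlet_fields:
  assumes \<Omega>: "open \<Omega>" "bounded \<Omega>" "continuous_boundary \<Omega>"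
    and \<Xi>: "enumerates_components \<Omega> m \<Xi>" and \<xi>: "cutoff_functions m \<Xi> \<xi>" and l: "l \<in> {1..<m}"
  shows "devGrad \<Omega> (v_field \<Omega> \<xi> l j) \<in> Dirichlet_fields \<Omega>"
proof -
  obtain R where R: "\<Omega> \<subseteq> cball 0 R" using \<Omega>(2) bounded_subset_cball_0 by blast
  note dec = v_field_decomposition[OF \<Omega>(1) R \<Omega>(3) \<Xi> \<xi> l, of j]
  obtain \<zeta> where \<zeta>: "cutoff_functions m (\<lambda>k. closure (\<Xi> k)) \<zeta>" using ex_strong_cutoffs[OF \<Omega> \<Xi>] by blast
  let ?u = "xi_field \<xi> l j" and ?u' = "xi_field \<zeta> l j" and ?K = "ker (symCurl_T0 \<Omega>)" and ?R = "dev_L2 ` Range (H10 \<Omega>)"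
  have t: "test UNIV ?u" by (rule test_xi_field[where \<xi> = \<xi> and l = l, OF cutoff_functionsD(1)[OF \<xi> l]])
  have t': "test UNIV ?u'" by (rule test_xi_field[where \<xi> = \<zeta> and l = l, OF cutoff_functionsD(1)[OF \<zeta> l]])
  obtain V where V: "open V" "(\<Union>k\<in>{0..<m}. closure (\<Xi> k)) \<subseteq> V" "\<And>x. x \<in> V \<Longrightarrow> dev (Grad ?u' x) = 0"
    using dev_Grad_xi_field_exterior[OF \<zeta> l, of j] by blast
  have "closure (- closure \<Omega>) = (\<Union>k\<in>{0..<m}. closure (\<Xi> k))"
    unfolding exterior_cover(1)[OF \<Xi>] by (simp add: closure_UN_finite)
  then have OV: "- V \<subseteq> \<Omega>" using frontier_subset_closure_exterior[OF \<Omega>(1,3)] V(2) by blast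
  have td: "test UNIV (\<lambda>x. dev (Grad ?u' x))" by (intro test_dev test_Grad t')
  \<comment> \<open>The complement of \<open>V\<close> is a closed subset of \<Omega>; this is where
    constancy near the closures of the components enters.\<close>
  have "supp (\<lambda>x. dev (Grad ?u' x)) \<subseteq> - V"
    using V by (subst supp_subset_iff) auto
  then have "test \<Omega> (\<lambda>x. dev (Grad ?u' x))" using OV by (intro test_supp[OF td]) blast
  then have 1: "abs_L2 (\<lambda>x. dev (Grad ?u' x)) \<in> ?K" by (rule devGrad_in_ker_symCurl[OF test_smooth[OF t']])
  have tz: "test UNIV (\<lambda>x. ?u x - ?u' x)" by (rule test_diff[OF t t'])
  \<comment> \<open>On every component both cutoffs take the same value, so the difference of the
    two fields vanishes off \<open>closure \<Omega>\<close> and lies in H_0^1(\<Omega>).\<close>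
  have z0: "?u x - ?u' x = 0" if xE: "x \<notin> closure \<Omega>" for x
  proof -
    have "x \<in> (\<Union>k\<in>{0..<m}. \<Xi> k)" using xE exterior_cover(1)[OF \<Xi>] by blast
    then obtain k where k: "k \<in> {0..<m}" "x \<in> \<Xi> k" by blast
    then have "x \<in> closure (\<Xi> k)" using closure_subset by blast
    then have "\<xi> l x = \<zeta> l x"
      using cutoff_functionsD(2)[OF \<xi> l k(1)] cutoff_functionsD(2)[OF \<zeta> l k(1)] k(2) by fastforce
    then show ?thesis by (simp add: xi_field_def)
  qed
  have "(abs_L2 (\<lambda>x. ?u x - ?u' x), abs_L2 (Grad (\<lambda>x. ?u x - ?u' x))) \<in> H10 \<Omega>"
    by (rule H10_of_vanishing[OF \<Omega> test_sq_int[OF tz] H10_test[OF tz]], rule AE_I2) (use z0 in blast)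
  then have "dev_L2 (abs_L2 (Grad (\<lambda>x. ?u x - ?u' x))) \<in> ?R" by (intro imageI RangeI)
  then have "dev_L2 (abs_L2 (Grad (\<lambda>x. ?u x - ?u' x))) \<in> ?K" by (rule subsetD[OF devGrad_range_in_ker_symCurl])
  moreover have "dev_L2 (abs_L2 (Grad (\<lambda>x. ?u x - ?u' x))) = abs_L2 (\<lambda>x. dev (Grad ?u x)) - abs_L2 (\<lambda>x. dev (Grad ?u' x))"
  proof -
    have "(\<lambda>x. dev (Grad (\<lambda>x. ?u x - ?u' x) x)) = (\<lambda>x. dev (Grad ?u x) - dev (Grad ?u' x))"
      by (simp add: Grad_diff[OF test_smooth[OF t] test_smooth[OF t']] linear_diff[OF bounded_linear.linear[OF bounded_linear_dev]])
    then show ?thesis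
      by (simp add: abs_L2_dev[OF test_sq_int[OF test_Grad[OF tz]]] abs_L2_diff[OF test_sq_int[OF test_dev[OF test_Grad[OF t]]] test_sq_int[OF td]])
  qed
  ultimately have 2: "abs_L2 (\<lambda>x. dev (Grad ?u x)) - abs_L2 (\<lambda>x. dev (Grad ?u' x)) \<in> ?K"
    by simp
  have 3: "abs_L2 (\<lambda>x. dev (Grad ?u x)) - devGrad \<Omega> (v_field \<Omega> \<xi> l j) \<in> ?K"
    using dec(3) devGrad_range_in_ker_symCurl by blast
  have sK: "subspace ?K" by (rule subspace_ker[OF subspace_symCurl_T0])
  from subspace_diff[OF sK subspace_add[OF sK 1 2] 3] have "devGrad \<Omega> (v_field \<Omega> \<xi> l j) \<in> ?K" by simp
  with dec(2) show ?thesis by (simp add: Dirichlet_fields_def)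
qed

section \<open>Linear independence and spanning\<close>

lemma v_fields_combination_zero:
  assumes \<Omega>: "open \<Omega>" "bounded \<Omega>" "continuous_boundary \<Omega>"
    and \<Xi>: "enumerates_components \<Omega> m \<Xi>" and \<xi>: "cutoff_functions m \<Xi> \<xi>"
    and zero: "(\<Sum>(l, j)\<in>{1..<m} \<times> {0..3}. c (l, j) *\<^sub>R devGrad \<Omega> (v_field \<Omega> \<xi> l j)) = 0"
    and l: "l \<in> {1..<m}" and j: "j \<in> {0..3}"
  shows "c (l, j) = 0"
proof -
  let ?I = "{1..<m} \<times> {0..3::nat}"
  define z where "z x = (\<Sum>(l, j)\<in>?I. c (l, j) *\<^sub>R xi_field \<xi> l j x)" for x
  define G where "G = (\<Sum>(l, j)\<in>?I. c (l, j) *\<^sub>R abs_L2 (Grad (xi_field \<xi> l j)))"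
  have t: "test UNIV (\<xi> l)" if "l \<in> {1..<m}" for l by (rule cutoff_functionsD(1)[OF \<xi> that])
  \<comment> \<open>One ball for \<Omega> and all cutoffs, so that the difference of the two H_0^1
    fields below is subject to Korn and Poincare.\<close>
  have "bounded (\<Omega> \<union> (\<Union>l\<in>{1..<m}. supp (\<xi> l)))" using \<Omega>(2) test_bounded_supp[OF t] by auto
  then obtain R where R: "\<Omega> \<union> (\<Union>l\<in>{1..<m}. supp (\<xi> l)) \<subseteq> cball 0 R" using bounded_subset_cball_0 by blast
  then have OR: "\<Omega> \<subseteq> cball 0 R" by blast
  have tR: "test (cball 0 R) (\<xi> l)" if "l \<in> {1..<m}" for l using R that by (intro test_supp[OF t]) blast+
  have sz: "sq_int z"
    unfolding z_def case_prod_unfold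
    by (intro sq_int_sum sq_int_scaleR test_sq_int[of UNIV] test_xi_field[where \<xi> = \<xi>] t) auto
  have zG: "(abs_L2 z, G) \<in> H10 (cball 0 R)" using H10_sum_xi_field[OF tR, where m = m and c = c] by (simp add: z_def[abs_def] G_def)
  have "dev_L2 G = (\<Sum>(l, j)\<in>?I. c (l, j) *\<^sub>R (abs_L2 (\<lambda>x. dev (Grad (xi_field \<xi> l j) x)) - devGrad \<Omega> (v_field \<Omega> \<xi> l j)))"
    using dev_L2_sum_xi_field[OF tR, where m = m and c = c] zero by (simp add: G_def case_prod_unfold scaleR_diff_right sum_subtractf)
  also have "\<dots> \<in> dev_L2 ` Range (H10 \<Omega>)"
    by (rule subspace_sum[OF subspace_devGrad_range[OF OR]])
      (auto intro!: subspace_scale[OF subspace_devGrad_range[OF OR]] v_field_decomposition(3)[OF \<Omega>(1) OR \<Omega>(3) \<Xi> \<xi>])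
  finally obtain \<psi> F where \<psi>: "(\<psi>, F) \<in> H10 \<Omega>" "dev_L2 G = dev_L2 F" by blast
  have "(\<psi>, F) \<in> H10 (cball 0 R)" using H10_mono[OF OR] \<psi>(1) by blast
  then have d: "(abs_L2 z - \<psi>, G - F) \<in> H10 (cball 0 R)" using subspace_diff[OF subspace_H10 zG] by fastforce
  have "dev_L2 (G - F) = 0" using \<psi>(2) by (simp add: linear_diff[OF bounded_linear.linear[OF bounded_linear_dev_L2]])
  with Korn[OF d] have "G - F = 0" by simp
  with Poincare[OF d subset_refl] have "abs_L2 z = \<psi>" by simp
  moreover have "\<psi> \<in> L2_on \<Omega>" using H10_weak_Grad[OF \<Omega>(1) \<psi>(1)] by (simp add: weak_Grad_def)
  ultimately have z0: "AE x in lebesgue. x \<notin> \<Omega> \<longrightarrow> z x = 0" using L2_on_abs[OF sz] by simp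
  have lm: "l \<in> {0..<m}" "l \<noteq> 0" "l < m" using l by auto
  note comp = exterior_cover(2)[OF \<Xi> lm(3)]
  have op: "open (\<Xi> l)" by (rule open_components[OF open_Compl[OF closed_closure] comp])
  have ne: "\<Xi> l \<noteq> {}" by (rule in_components_nonempty[OF comp])
  have sub: "x \<notin> \<Omega>" if "x \<in> \<Xi> l" for x using that in_components_subset[OF comp] closure_subset by blast
  have "AE x in lebesgue. x \<in> \<Xi> l \<longrightarrow> c (l, 0) *\<^sub>R x + (\<chi> i. if i = 1 then c (l, 1) else if i = 2 then c (l, 2) else c (l, 3)) = 0"
    using z0
  proof eventually_elim
    case (elim x)
    show ?case
    proof
      assume x: "x \<in> \<Xi> l"
      have "z x = 0" using elim sub[OF x] by blast
      then show "c (l, 0) *\<^sub>R x + (\<chi> i. if i = 1 then c (l, 1) else if i = 2 then c (l, 2) else c (l, 3)) = 0"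
        using sum_xi_field[OF \<xi> lm(1) x, where c = c] lm(2) by (simp add: z_def)
    qed
  qed
  from affine_zero_AE[OF op ne this] have "c (l, 0) = 0" "c (l, 1) = 0" "c (l, 2) = 0" "c (l, 3) = 0"
    by (auto simp: vec_eq_iff forall_3)
  moreover have "j = 0 \<or> j = 1 \<or> j = 2 \<or> j = 3" using j by auto
  ultimately show ?thesis by auto
qed

lemma Dirichlet_field_combination:
  assumes \<Omega>: "open \<Omega>" "bounded \<Omega>" "continuous_boundary \<Omega>"
    and \<Xi>: "enumerates_components \<Omega> m \<Xi>" and \<xi>: "cutoff_functions m \<Xi> \<xi>" and T: "T \<in> Dirichlet_fields \<Omega>"
  shows "\<exists>c. T = (\<Sum>(l, j)\<in>{1..<m} \<times> {0..3}. c (l, j) *\<^sub>R devGrad \<Omega> (v_field \<Omega> \<xi> l j))"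
proof -
  let ?I = "{1..<m} \<times> {0..3::nat}" and ?E = "- closure \<Omega>"
  obtain R where R: "\<Omega> \<subseteq> cball 0 R" using \<Omega>(2) bounded_subset_cball_0 by blast
  have Ts: "T \<in> ker (symCurl_T0 \<Omega>)" and Td: "T \<in> ker (Div_T \<Omega>)" using T by (auto simp: Dirichlet_fields_def)
  obtain v w F where v: "\<And>n. test (cball 0 (R + 1)) (v n)"
    "\<And>n x. \<forall>y\<in>closure \<Omega>. inverse (real (Suc n)) \<le> dist x y \<Longrightarrow> dev (Grad (v n) x) = 0"
    and w: "sq_int w" "(\<lambda>n. abs_L2 (v n)) \<longlonglongrightarrow> abs_L2 w" "(abs_L2 w, F) \<in> H10 (cball 0 (R + 1))" "T = dev_L2 F"
    using ker_symCurl_potential[OF \<Omega>(1) R Ts] by blast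
  obtain W where W: "AE x in lebesgue. x \<notin> closure \<Omega> \<longrightarrow> w x = W x"
    "\<And>p. p \<notin> closure \<Omega> \<Longrightarrow> \<exists>\<rho>>0. \<exists>a b. \<forall>x\<in>ball p \<rho>. W x = a *\<^sub>R x + b" "\<And>x. \<forall>n. v n x = 0 \<Longrightarrow> W x = 0"
    using affine_limit[OF test_smooth[OF v(1)] test_sq_int[OF v(1)] w(1,2) closed_closure v(2)] by blast
  note comp = exterior_cover(2)[OF \<Xi>]
  have "\<exists>a b. \<forall>p\<in>\<Xi> k. \<exists>\<rho>>0. \<forall>x\<in>ball p \<rho>. W x = a *\<^sub>R x + b" if k: "k < m" for k
  proof (rule locally_affine_imp_affine)
    show "connected (\<Xi> k)" "\<Xi> k \<noteq> {}" using in_components_connected[OF comp[OF k]] in_components_nonempty[OF comp[OF k]] by auto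
    show "\<exists>\<rho>>0. \<exists>a b. \<forall>x\<in>ball p \<rho>. W x = a *\<^sub>R x + b" if "p \<in> \<Xi> k" for p
      using in_components_subset[OF comp[OF k]] that by (intro W(2)) blast
  qed
  then obtain a b where ab: "\<And>k p. k < m \<Longrightarrow> p \<in> \<Xi> k \<Longrightarrow> \<exists>\<rho>>0. \<forall>x\<in>ball p \<rho>. W x = a k *\<^sub>R x + b k" by metis
  have Wab: "W x = a k *\<^sub>R x + b k" if "k < m" "x \<in> \<Xi> k" for k x using ab[OF that] by auto
  \<comment> \<open>The unbounded component leaves the ball that supports all \<open>v n\<close>,
    and an affine map that vanishes on an open set there is zero.\<close>
  have ab0: "a 0 = 0 \<and> b 0 = 0" if m: "0 < m"
  proof -
    have "\<not> bounded (\<Xi> 0)" using \<Xi> by (simp add: enumerates_components_def)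
    then have "\<not> \<Xi> 0 \<subseteq> cball 0 (R + 1)" using bounded_subset bounded_cball by blast
    then obtain p where p: "p \<in> \<Xi> 0" "p \<notin> cball 0 (R + 1)" by blast
    obtain \<rho> where \<rho>: "\<rho> > 0" "\<And>x. x \<in> ball p \<rho> \<Longrightarrow> W x = a 0 *\<^sub>R x + b 0" using ab[OF m p(1)] by blast
    let ?U = "ball p \<rho> - cball 0 (R + 1)"
    have "p \<in> ?U" using p(2) \<rho>(1) by simp
    then have U: "open ?U" "?U \<noteq> {}" by (intro open_Diff open_ball closed_cball, blast)
    have "a 0 *\<^sub>R x + b 0 = 0" if "x \<in> ?U" for x
    proof -
      have "W x = 0" by (rule W(3)) (use that test_zero_outside[OF v(1)] in blast)
      then show ?thesis using \<rho>(2)[of x] that by simp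
    qed
    then have "AE x in lebesgue. x \<in> ?U \<longrightarrow> a 0 *\<^sub>R x + b 0 = 0" by auto
    from affine_zero_AE[OF U this] show ?thesis by simp
  qed
  \<comment> \<open>The entries of \<open>b l\<close> are taken at \<open>of_nat j\<close>, as in
    \<open>rhat\<close>, so that the combination reproduces a x + b on each bounded
    component.\<close>
  define c where "c = (\<lambda>(l, j). if j = 0 then a l else b l $ (of_nat j))"
  have cb: "c (k, 0) *\<^sub>R x + (\<chi> i. if i = 1 then c (k, 1) else if i = 2 then c (k, 2) else c (k, 3)) = a k *\<^sub>R x + b k" for k x
    by (simp add: c_def vec_eq_iff forall_3)
  define z where "z x = (\<Sum>(l, j)\<in>?I. c (l, j) *\<^sub>R xi_field \<xi> l j x)" for x
  define G where "G = (\<Sum>(l, j)\<in>?I. c (l, j) *\<^sub>R abs_L2 (Grad (xi_field \<xi> l j)))"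
  have t: "test UNIV (\<xi> l)" if "l \<in> {1..<m}" for l by (rule cutoff_functionsD(1)[OF \<xi> that])
  have sz: "sq_int z"
    unfolding z_def case_prod_unfold
    by (intro sq_int_sum sq_int_scaleR test_sq_int[of UNIV] test_xi_field[where \<xi> = \<xi>] t) auto
  have zG: "(abs_L2 z, G) \<in> H10 UNIV" using H10_sum_xi_field[OF t, where m = m and c = c] by (simp add: z_def[abs_def] G_def)
  have wz: "W x = z x" if xE: "x \<notin> closure \<Omega>" for x
  proof -
    have "x \<in> (\<Union>k\<in>{0..<m}. \<Xi> k)" using xE exterior_cover(1)[OF \<Xi>] by blast
    then obtain k where k: "k \<in> {0..<m}" "x \<in> \<Xi> k" by blast
    then have "k < m" by simp
    show ?thesis
      using sum_xi_field[OF \<xi> k, where c = c] Wab[OF \<open>k < m\<close> k(2)] ab0 \<open>k < m\<close> unfolding cb by (auto simp: z_def split: if_splits)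
  qed
  have "(abs_L2 w, F) \<in> H10 UNIV" using H10_mono[OF subset_UNIV] w(3) by blast
  from subspace_diff[OF subspace_H10 this zG] have "(abs_L2 (\<lambda>x. w x - z x), F - G) \<in> H10 UNIV"
    by (simp add: abs_L2_diff w(1) sz)
  then have h: "(abs_L2 (\<lambda>x. w x - z x), F - G) \<in> H10 \<Omega>"
  proof (rule H10_of_vanishing[OF \<Omega> sq_int_diff[OF w(1) sz]])
    show "AE x in lebesgue. x \<notin> closure \<Omega> \<longrightarrow> w x - z x = 0"
      using W(1) by eventually_elim (simp add: wz)
  qed
  let ?R = "dev_L2 ` Range (H10 \<Omega>)"
  define S where "S = (\<Sum>(l, j)\<in>?I. c (l, j) *\<^sub>R devGrad \<Omega> (v_field \<Omega> \<xi> l j))"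
  have sR: "subspace ?R" by (rule subspace_devGrad_range[OF R])
  have "dev_L2 (F - G) \<in> ?R" using h by blast
  moreover have "dev_L2 G - S = (\<Sum>(l, j)\<in>?I. c (l, j) *\<^sub>R (abs_L2 (\<lambda>x. dev (Grad (xi_field \<xi> l j) x)) - devGrad \<Omega> (v_field \<Omega> \<xi> l j)))"
    using dev_L2_sum_xi_field[OF t, where m = m and c = c] by (simp add: S_def G_def case_prod_unfold scaleR_diff_right sum_subtractf)
  moreover have "\<dots> \<in> ?R"
    by (rule subspace_sum[OF sR])
      (auto intro!: subspace_scale[OF sR] v_field_decomposition(3)[OF \<Omega>(1) R \<Omega>(3) \<Xi> \<xi>])
  ultimately have "dev_L2 (F - G) + (dev_L2 G - S) \<in> ?R" using subspace_add[OF sR] by simp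
  then have 1: "T - S \<in> ?R" by (simp add: w(4) linear_diff[OF bounded_linear.linear[OF bounded_linear_dev_L2]])
  have sN: "subspace (ker (Div_T \<Omega>))" by (rule subspace_ker_Div_T[OF R])
  have "S \<in> ker (Div_T \<Omega>)"
    unfolding S_def by (rule subspace_sum[OF sN])
      (auto intro!: subspace_scale[OF sN] v_field_decomposition(2)[OF \<Omega>(1) R \<Omega>(3) \<Xi> \<xi>])
  \<comment> \<open>\<open>T - S\<close> is now in the range of the deviatoric gradient and in its
    orthogonal complement, hence zero.\<close>
  then have "T - S \<in> ker (Div_T \<Omega>)" by (rule subspace_diff[OF sN Td])
  then have "(T - S) \<bullet> (T - S) = 0" using 1 unfolding ker_Div_T_iff[OF R] by blast
  then show ?thesis unfolding S_def by auto
qed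

lemma v_fields_basis:
  assumes \<Omega>: "open \<Omega>" "bounded \<Omega>" "continuous_boundary \<Omega>"
    and \<Xi>: "enumerates_components \<Omega> m \<Xi>" and \<xi>: "cutoff_functions m \<Xi> \<xi>"
  shows "inj_on (\<lambda>(l, j). devGrad \<Omega> (v_field \<Omega> \<xi> l j)) ({1..<m} \<times> {0..3})"
    and "independent {devGrad \<Omega> (v_field \<Omega> \<xi> l j) | l j. l \<in> {1..<m} \<and> j \<in> {0..3}}"
    and "span {devGrad \<Omega> (v_field \<Omega> \<xi> l j) | l j. l \<in> {1..<m} \<and> j \<in> {0..3}} = Dirichlet_fields \<Omega>"
proof -
  let ?f = "\<lambda>(l, j). devGrad \<Omega> (v_field \<Omega> \<xi> l j)" and ?I = "{1..<m} \<times> {0..3::nat}"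
  have im: "{devGrad \<Omega> (v_field \<Omega> \<xi> l j) | l j. l \<in> {1..<m} \<and> j \<in> {0..3}} = ?f ` ?I" by force
  have ind: "\<forall>i\<in>?I. c i = 0" if "(\<Sum>i\<in>?I. c i *\<^sub>R ?f i) = 0" for c
    using v_fields_combination_zero[OF \<Omega> \<Xi> \<xi>, of c] that by (auto simp: case_prod_unfold)
  show "inj_on ?f ?I" by (rule finite_family_independent(1)[OF _ ind]) auto
  show "independent {devGrad \<Omega> (v_field \<Omega> \<xi> l j) | l j. l \<in> {1..<m} \<and> j \<in> {0..3}}"
    unfolding im by (rule finite_family_independent(2)[OF _ ind]) auto
  obtain R where R: "\<Omega> \<subseteq> cball 0 R" using \<Omega>(2) bounded_subset_cball_0 by blast
  show "span {devGrad \<Omega> (v_field \<Omega> \<xi> l j) | l j. l \<in> {1..<m} \<and> j \<in> {0..3}} = Dirichlet_fields \<Omega>"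
    unfolding im
  proof
    show "span (?f ` ?I) \<subseteq> Dirichlet_fields \<Omega>"
      by (rule span_minimal[OF _ subspace_Dirichlet_fields[OF R]]) (auto intro!: v_field_in_Dirichlet_fields[OF \<Omega> \<Xi> \<xi>])
    show "Dirichlet_fields \<Omega> \<subseteq> span (?f ` ?I)"
    proof
      fix T assume "T \<in> Dirichlet_fields \<Omega>"
      from Dirichlet_field_combination[OF \<Omega> \<Xi> \<xi> this] obtain c where
        "T = (\<Sum>(l, j)\<in>?I. c (l, j) *\<^sub>R devGrad \<Omega> (v_field \<Omega> \<xi> l j))" by blast
      then have "T = (\<Sum>i\<in>?I. c i *\<^sub>R ?f i)" by (simp add: case_prod_unfold)
      moreover have "(\<Sum>i\<in>?I. c i *\<^sub>R ?f i) \<in> span (?f ` ?I)"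
        by (intro span_sum span_scale span_base imageI)
      ultimately show "T \<in> span (?f ` ?I)" by simp
    qed
  qed
qed

theorem theorem11p17:
  fixes \<Omega> :: "(real^3) set" and m :: nat
  assumes "open \<Omega>" and "bounded \<Omega>" and "continuous_boundary \<Omega>"
    and m: "m = card (components (- closure \<Omega>))"
  shows "finite (components (- closure \<Omega>)) \<and>
    (\<exists>B. finite B \<and> independent B \<and> span B = Dirichlet_fields \<Omega>) \<and>
    dim (Dirichlet_fields \<Omega>) = 4 * (m - 1) \<and>
    (\<forall>\<Xi> \<xi>. enumerates_components \<Omega> m \<Xi> \<and> cutoff_functions m \<Xi> \<xi> \<longrightarrow>
      (\<forall>l\<in>{1..<m}. \<forall>j\<in>{0..3}. v_field \<Omega> \<xi> l j \<in> H1 \<Omega>) \<and>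
      inj_on (\<lambda>(l, j). devGrad \<Omega> (v_field \<Omega> \<xi> l j)) ({1..<m} \<times> {0..3}) \<and>
      independent {devGrad \<Omega> (v_field \<Omega> \<xi> l j) | l j. l \<in> {1..<m} \<and> j \<in> {0..3}} \<and>
      span {devGrad \<Omega> (v_field \<Omega> \<xi> l j) | l j. l \<in> {1..<m} \<and> j \<in> {0..3}}
        = Dirichlet_fields \<Omega>)"
proof -
  note \<Omega> = assms(1-3)
  have fin: "finite (components (- closure \<Omega>))" by (rule finite_exterior_components[OF \<Omega>])
  obtain R where R: "\<Omega> \<subseteq> cball 0 R" using \<Omega>(2) bounded_subset_cball_0 by blast
  \<comment> \<open>The dimension does not refer to cutoffs, so an enumeration and a family of
    cutoffs are produced to evaluate it; the statement about bases is then shown for arbitrary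
    ones.\<close>
  obtain \<Xi> where \<Xi>: "enumerates_components \<Omega> m \<Xi>" using ex_enumeration[OF \<Omega>(2) fin m] by blast
  obtain \<xi> where \<xi>': "cutoff_functions m (\<lambda>k. closure (\<Xi> k)) \<xi>" using ex_strong_cutoffs[OF \<Omega> \<Xi>] by blast
  have \<xi>: "cutoff_functions m \<Xi> \<xi>"
    unfolding cutoff_functions_def
  proof (intro conjI ballI impI)
    fix l assume l: "l \<in> {1..<m}"
    show "test UNIV (\<xi> l)" by (rule cutoff_functionsD(1)[OF \<xi>' l])
    show "equals_near (\<xi> l) 1 (\<Xi> l)"
      using \<xi>' l by - (rule equals_near_mono[OF _ closure_subset], simp add: cutoff_functions_def)
    show "equals_near (\<xi> l) 0 (\<Xi> k)" if "k \<in> {0..<m} - {l}" for k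
      using \<xi>' l that by - (rule equals_near_mono[OF _ closure_subset], simp add: cutoff_functions_def)
    show "supp (\<xi> l) \<inter> supp (\<xi> k) = {}" if "k \<in> {1..<m}" "l \<noteq> k" for k
      using \<xi>' l that by (simp add: cutoff_functions_def)
  qed
  let ?f = "\<lambda>(l, j). devGrad \<Omega> (v_field \<Omega> \<xi> l j)" and ?I = "{1..<m} \<times> {0..3::nat}"
  let ?B = "{devGrad \<Omega> (v_field \<Omega> \<xi> l j) | l j. l \<in> {1..<m} \<and> j \<in> {0..3}}"
  note basis = v_fields_basis[OF \<Omega> \<Xi> \<xi>]
  have im: "?B = ?f ` ?I" by force
  have finB: "finite ?B" unfolding im by simp
  have "card ?B = 4 * (m - 1)" unfolding im card_image[OF basis(1)] by (simp add: card_cartesian_product)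
  moreover have "dim (Dirichlet_fields \<Omega>) = card ?B"
    unfolding basis(3)[symmetric] by (rule dim_span_eq_card_independent[OF basis(2)])
  ultimately have "dim (Dirichlet_fields \<Omega>) = 4 * (m - 1)" by simp
  \<comment> \<open>An infinite basis would also give \<open>dim\<close> the value 0, since infinite
    sets have cardinality 0; the finite basis excludes that reading when
    \<open>m = 1\<close>.\<close>
  moreover have "\<exists>B. finite B \<and> independent B \<and> span B = Dirichlet_fields \<Omega>"
    using finB basis(2,3) by (intro exI[of _ ?B] conjI)
  ultimately show ?thesis
  proof (intro conjI fin allI impI; (elim conjE)?)
    fix \<Xi> \<xi> assume a: "enumerates_components \<Omega> m \<Xi>" "cutoff_functions m \<Xi> \<xi>"
    show "\<forall>l\<in>{1..<m}. \<forall>j\<in>{0..3}. v_field \<Omega> \<xi> l j \<in> H1 \<Omega>"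
      using v_field_decomposition(1)[OF \<Omega>(1) R \<Omega>(3) a] by blast
    show "inj_on (\<lambda>(l, j). devGrad \<Omega> (v_field \<Omega> \<xi> l j)) ({1..<m} \<times> {0..3})"
      "independent {devGrad \<Omega> (v_field \<Omega> \<xi> l j) | l j. l \<in> {1..<m} \<and> j \<in> {0..3}}"
      "span {devGrad \<Omega> (v_field \<Omega> \<xi> l j) | l j. l \<in> {1..<m} \<and> j \<in> {0..3}} = Dirichlet_fields \<Omega>"
      by (rule v_fields_basis[OF \<Omega> a])+
  qed
qed

end
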